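(* Let $n$ be a positive integer and let $K^{(n)}$ be the simplicial $n$-complex defined in the context. For every (piecewise linear) embedding $f$ of $K^{(n)}$ into $\mathbb{R}^{2n+1}$, the following holds: $$\sum_{\lambda\in \Lambda^{n}(K^{(n)})}\mathrm{lk}_{2}(f(\lambda))\equiv 1\pmod{2}.$$
   Context: Everything is in the piecewise linear category; a finite simplicial complex is identified with its polyhedron. For a finite simplicial $n$-complex $K$, $\Lambda^{n}(K)$ denotes the set of all unordered pairs $(\gamma_1,\gamma_2)$ of mutually disjoint subcomplexes of $K$, each homeomorphic to an $n$-sphere; such a pair is identified with the disjoint union $\lambda=\gamma_1\sqcup\gamma_2$. For an embedding $f$ of $K$ into $\mathbb{R}^{2n+1}$, $f(\lambda)=f(\gamma_1)\sqcup f(\gamma_2)$ is a two-component link of $n$-spheres, and $\mathrm{lk}_2(f(\lambda))=\mathrm{lk}_2(f(\gamma_1),f(\gamma_2))\in\mathbb{Z}_2$ is its (symmetric) mod 2 linking number. Definition of $K^{(n)}$: take $n+1$ mutually disjoint sets $V^{i}=\{a_0^i,a_1^i,a_2^i\}$ ($i=0,1,\ldots,n$) of three $0$-simplices each, and a further $0$-simplex $b$ not in any $V^i$. Write $|c_0c_1\cdots c_m|$ for the simplex spanned by $c_0,\ldots,c_m$, and let a hat denote omission. $K^{(n)}$ is the abstract simplicial complex consisting of all faces of the following $n$-simplices: (Type I) all $|a_{j_0}^0a_{j_1}^1\cdots a_{j_n}^n|$ with $j_i\in\{0,1,2\}$; (Type II) all $|b\,a_{j_0}^0\cdots\hat{a}_{j_q}^q\cdots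 a_{j_n}^n|$ with $q\in\{0,1,\ldots,n\}$ and $j_i\in\{0,1,2\}$. (For $n=1$, $K^{(1)}$ is the complete tripartite graph $K_{3,3,1}$.) *)

theory Defs
  imports "HOL-Analysis.Analysis" "HOL-Number_Theory.Cong"
begin

section \<open>The abstract simplicial complex $K^{(n)}$\<close>

text \<open>\<open>A i j\<close> is the vertex $a^i_j$ and \<open>Apex\<close> is the vertex $b$; an abstract simplex is its set of
  vertices.\<close>

datatype vertex = A nat nat | Apex

definition type_I :: "nat \<Rightarrow> vertex set set" where
  "type_I n = {(\<lambda>i. A i (j i)) ` {0..n} | j :: nat \<Rightarrow> nat. \<forall>i\<in>{0..n}. j i \<in> {0, 1, 2}}"

definition type_II :: "nat \<Rightarrow> vertex set set" where
  "type_II n = {insert Apex ((\<lambda>i. A i (j i)) ` ({0..n} - {q})) | (j :: nat \<Rightarrow> nat) q.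
      q \<in> {0..n} \<and> (\<forall>i\<in>{0..n}. j i \<in> {0, 1, 2})}"

text \<open>The empty face is included, because the geometric complexes of
  \<^const>\<open>simplicial_complex\<close> contain it as well.\<close>

definition K_complex :: "nat \<Rightarrow> vertex set set" where
  "K_complex n = {s. \<exists>t \<in> type_I n \<union> type_II n. s \<subseteq> t}"

text \<open>A geometric simplicial complex \<open>K\<close> realizes an abstract one \<open>\<Sigma>\<close> via a placement \<open>p\<close> of the
  vertices. That two simplices meet exactly in their common face is part of
  \<^const>\<open>simplicial_complex\<close>. The polyhedron of \<open>K\<close> is \<open>\<Union>K\<close>.\<close>

definition realizes :: "'b::euclidean_space set set \<Rightarrow> 'v set set \<Rightarrow> bool" where
  "realizes K \<Sigma> \<longleftrightarrow> simplicial_complex K \<and>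
     (\<exists>p. inj_on p (\<Union>\<Sigma>) \<and> (\<forall>s\<in>\<Sigma>. \<not> affine_dependent (p ` s)) \<and>
          K = (\<lambda>s. convex hull (p ` s)) ` \<Sigma>)"

section \<open>Piecewise linear maps on compact polyhedra\<close>

definition affine_map_on :: "'a::real_vector set \<Rightarrow> ('a \<Rightarrow> 'b::real_vector) \<Rightarrow> bool" where
  "affine_map_on S f \<longleftrightarrow> (\<exists>g c. linear g \<and> (\<forall>x\<in>S. f x = g x + c))"

definition pl_map_on :: "'a::euclidean_space set \<Rightarrow> ('a \<Rightarrow> 'b::euclidean_space) \<Rightarrow> bool" where
  "pl_map_on P f \<longleftrightarrow> (\<exists>T. simplicial_complex T \<and> \<Union>T = P \<and> (\<forall>S\<in>T. affine_map_on S f))"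

text \<open>On a compact polyhedron an injective PL map is a topological embedding, and its inverse is
  again PL.\<close>

definition pl_embedding :: "'a::euclidean_space set \<Rightarrow> ('a \<Rightarrow> 'b::euclidean_space) \<Rightarrow> bool" where
  "pl_embedding P f \<longleftrightarrow> pl_map_on P f \<and> inj_on f P"

definition pl_homeomorphic :: "'a::euclidean_space set \<Rightarrow> 'b::euclidean_space set \<Rightarrow> bool" where
  "pl_homeomorphic P Q \<longleftrightarrow> (\<exists>h. pl_embedding P h \<and> h ` P = Q)"

text \<open>The model sphere may be taken in the space of \<open>P\<close>, since an $n$-sphere embeds only in
  spaces of dimension at least $n+1$, and these contain an $(n+1)$-simplex.\<close>

definition pl_sphere :: "nat \<Rightarrow> 'a::euclidean_space set \<Rightarrow> bool" where
  "pl_sphere n P \<longleftrightarrow>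
     (\<exists>\<Delta> :: 'a set. (int n + 1) simplex \<Delta> \<and> pl_homeomorphic P (rel_frontier \<Delta>))"

section \<open>Pairs of disjoint spheres in a complex\<close>

text \<open>Disjointness is that of the polyhedra: as families of simplices, two nonempty complexes
  always share the empty face.\<close>

definition Lambda :: "nat \<Rightarrow> 'b::euclidean_space set set \<Rightarrow> 'b set set set set" where
  "Lambda n K = {{\<gamma>\<^sub>1, \<gamma>\<^sub>2} | \<gamma>\<^sub>1 \<gamma>\<^sub>2.
     \<gamma>\<^sub>1 \<subseteq> K \<and> simplicial_complex \<gamma>\<^sub>1 \<and> pl_sphere n (\<Union>\<gamma>\<^sub>1) \<and>
     \<gamma>\<^sub>2 \<subseteq> K \<and> simplicial_complex \<gamma>\<^sub>2 \<and> pl_sphere n (\<Union>\<gamma>\<^sub>2) \<and>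
     \<Union>\<gamma>\<^sub>1 \<inter> \<Union>\<gamma>\<^sub>2 = {}}"

section \<open>The mod 2 linking number\<close>

text \<open>A finite set of geometric $(n+1)$-simplices is a PL chain with coefficients in $\mathbb{Z}_2$;
  different simplices of a chain may intersect arbitrarily.\<close>

definition mod2_boundary :: "nat \<Rightarrow> 'a::euclidean_space set set \<Rightarrow> 'a set set" where
  "mod2_boundary n C = {s. int n simplex s \<and> odd (card {c \<in> C. s face_of c})}"

definition spanning_chain :: "nat \<Rightarrow> 'a::euclidean_space set set \<Rightarrow> 'a set \<Rightarrow> bool" where
  "spanning_chain n C X \<longleftrightarrow> finite C \<and> (\<forall>c\<in>C. (int n + 1) simplex c) \<and>
     (\<exists>T. simplicial_complex T \<and> \<Union>T = X \<and> mod2_boundary n C = {s \<in> T. int n simplex s})"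

text \<open>In ambient dimension $2n+1$, these conditions make each $c \cap t$, with $t$ an $n$-simplex of
  $T$, empty or a single transverse crossing at an interior point of both.\<close>

definition general_position :: "nat \<Rightarrow> 'a::euclidean_space set set \<Rightarrow> 'a set \<Rightarrow> bool" where
  "general_position n C Y \<longleftrightarrow>
     (\<forall>c\<in>C. finite (c \<inter> Y) \<and> c \<inter> Y \<subseteq> rel_interior c) \<and>
     (\<exists>T. simplicial_complex T \<and> \<Union>T = Y \<and>
          (\<forall>c\<in>C. \<forall>t\<in>T. aff_dim t < int n \<longrightarrow> c \<inter> t = {}))"

text \<open>The linking number of disjoint $n$-spheres \<open>X\<close>, \<open>Y\<close> in $\mathbb{R}^{2n+1}$: the parity of the
  number of points in which a chain bounded by \<open>X\<close>, in general position to \<open>Y\<close>, meets \<open>Y\<close>. It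
  does not depend on the chain. The value is the representative in $\{0,1\}$ of the class.\<close>

definition lk2 :: "nat \<Rightarrow> 'a::euclidean_space set \<Rightarrow> 'a set \<Rightarrow> nat" where
  "lk2 n X Y = (THE r. \<exists>C. spanning_chain n C X \<and> general_position n C Y \<and>
                        r = (\<Sum>c\<in>C. card (c \<inter> Y)) mod 2)"

text \<open>A two-component link is the set of its two components; by symmetry of \<^const>\<open>lk2\<close> the
  value does not depend on their order.\<close>

definition lk2_link :: "nat \<Rightarrow> 'a::euclidean_space set set \<Rightarrow> nat" where
  "lk2_link n L = (THE r. \<exists>X Y. L = {X, Y} \<and> X \<noteq> Y \<and> r = lk2 n X Y)"

definition image_link :: "('b \<Rightarrow> 'a) \<Rightarrow> 'b set set set \<Rightarrow> 'a set set" where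
  "image_link f lam = (\<lambda>\<gamma>. f ` \<Union>\<gamma>) ` lam"

end

theory Submission imports Defs begin

text \<open>Let \<open>l 0, l 1, \<dots>\<close> be linear forms on \<open>2n+1\<close>-space, in general position with respect to the image
of \<open>f\<close>. A pair of points lies in \<open>fib l k\<close> if the first \<open>k\<close> forms vanish on the difference of the
two points, that is, if the points have the same image in \<open>k\<close>-space under these forms; \<open>ht l k\<close>
is the value of the next form on the difference. So \<open>meet l k X Y\<close> counts the crossings of \<open>X\<close>
and \<open>Y\<close> in the projection to \<open>k\<close>-space, and \<open>over l k X Y\<close> counts those where \<open>X\<close> passes over \<open>Y\<close>.

The counts for different \<open>k\<close> are tied together by one fact. If \<open>s\<close> and \<open>t\<close> are disjoint cells with
\<open>dim s + dim t = k + 1\<close>, then \<open>s \<times> t\<close> meets \<open>fib l k\<close> in segments. The ends of a segment lie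
over the facets of \<open>s\<close> or \<open>t\<close>, and the height \<open>ht l k\<close> vanishes once on the segment if it has
different signs at the two ends, and nowhere otherwise. Modulo 2, the coboundary of \<open>over l k\<close> is therefore
\<open>meet l (k+1)\<close> (\<open>crossings_boundary\<close>, \<open>meet_boundary\<close>). Moreover \<open>over\<close> and its transpose
add up to \<open>meet\<close>, since of two crossing points one is above the other.

For \<open>k = 2n\<close>, applied to a chain bounded by \<open>X\<close> and to \<open>Y\<close>, this fact shows that the linking number of
\<open>X\<close> and \<open>Y\<close> is the parity of the number of crossings where \<open>X\<close> passes over \<open>Y\<close> in a diagram
(\<open>lk2_crossings\<close>). Here every triangulation of an \<open>n\<close>-sphere must be a mod 2 cycle of
dimension \<open>n\<close>, which follows from invariance of domain (\<open>sphere_triangulation.bdry_empty\<close>).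

The pairs of disjoint spheres are explicit (\<open>Lambda_eq\<close>). Choose a vertex of every \<open>V\<^sup>i\<close>; one
sphere is the boundary of the simplex spanned by the chosen vertices and \<open>b\<close>, the other one is
the join of the pairs of vertices that remain. Summed over all choices and over all \<open>n\<close>-simplices of
both spheres, the crossings of a type II simplex over a type I simplex cancel: the omitted index \<open>q\<close>
admits two choices of the vertex that is missing. There remains the number of crossings of \<open>s\<close> over
\<open>t\<close>, summed over all ordered pairs of disjoint simplices of type I. It is the number of crossings
of unordered such pairs in \<open>2n\<close>-space, the van Kampen number of the join of \<open>n+1\<close> three-point sets.
It is odd: the relations between the counts for \<open>k = 2n, 2n - 1, 2n - 2\<close> reduce it to
the same number for \<open>n - 1\<close>, and finally to the number of pairs in a set of three points (\<open>odd_over_sum\<close>).\<close>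

section \<open>Fibres of the difference map\<close>

definition fib :: "(nat \<Rightarrow> 'a::euclidean_space) \<Rightarrow> nat \<Rightarrow> ('a \<times> 'a) set" where
  "fib l k = {z. \<forall>i<k. l i \<bullet> (fst z - snd z) = 0}"

definition ht :: "(nat \<Rightarrow> 'a::euclidean_space) \<Rightarrow> nat \<Rightarrow> 'a \<times> 'a \<Rightarrow> real" where
  "ht l k z = l k \<bullet> (fst z - snd z)"

lemma fib_0 [simp]: "fib l 0 = UNIV"
  by (simp add: fib_def)

lemma ht_inner: "ht l k z = (l k, - l k) \<bullet> z"
  by (cases z) (simp add: ht_def inner_diff_right)

lemma fib_Suc: "fib l (Suc k) = fib l k \<inter> {z. (l k, - l k) \<bullet> z = 0}"
  unfolding ht_inner[symmetric] by (auto simp: fib_def ht_def less_Suc_eq)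

lemma fib_Suc_ht: "z \<in> fib l (Suc k) \<longleftrightarrow> z \<in> fib l k \<and> ht l k z = 0"
  by (auto simp: fib_Suc ht_inner)

lemma affine_fib: "affine (fib l k)"
proof (induction k)
  case (Suc k)
  then show ?case unfolding fib_Suc by (intro affine_Int affine_hyperplane)
qed simp

lemma closed_fib: "closed (fib l k)"
proof (induction k)
  case (Suc k)
  then show ?case unfolding fib_Suc by (intro closed_Int closed_hyperplane)
qed simp

lemma aff_dim_Int_fib_ge:
  assumes "affine B" "B \<inter> fib l k \<noteq> {}"
  shows "aff_dim B - int k \<le> aff_dim (B \<inter> fib l k)"
  using assms(2)
proof (induction k)
  case (Suc k)
  let ?H = "{z. (l k, - l k) \<bullet> z = 0}"
  have ne: "(B \<inter> fib l k) \<inter> ?H \<noteq> {}"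
    using Suc.prems by (simp add: fib_Suc Int_assoc)
  have "affine (B \<inter> fib l k)" using assms(1) affine_fib by (rule affine_Int)
  then have "aff_dim ((B \<inter> fib l k) \<inter> ?H) \<ge> aff_dim (B \<inter> fib l k) - 1"
    using ne by (simp add: aff_dim_affine_Int_hyperplane)
  moreover have "aff_dim B - int k \<le> aff_dim (B \<inter> fib l k)"
    using Suc.IH ne by blast
  ultimately show ?case by (simp add: fib_Suc Int_assoc)
qed simp

lemma affine_line:
  assumes "affine B" "z \<in> B" "z + v \<in> B"
  shows "z + c *\<^sub>R v \<in> B"
proof -
  have "(1 - c) *\<^sub>R z + c *\<^sub>R (z + v) \<in> B"
    using assms by (intro mem_affine) auto
  then show ?thesis by (simp add: algebra_simps)
qed

lemma line_in_fib:
  assumes "affine B" "z \<in> B" "z \<in> fib l k" "aff_dim B > int k"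
  obtains v where "v \<noteq> 0" "\<And>c. z + c *\<^sub>R v \<in> B" "\<And>c. z + c *\<^sub>R v \<in> fib l k"
proof -
  let ?B = "B \<inter> fib l k"
  have B: "affine ?B" using assms(1) affine_fib by (rule affine_Int)
  have "aff_dim B - int k \<le> aff_dim ?B"
    using assms by (intro aff_dim_Int_fib_ge) auto
  then have "aff_dim ?B > 0" using assms(4) by linarith
  then have "\<not> ?B \<subseteq> {z}" by (metis aff_dim_sing aff_dim_subset not_less)
  then obtain w where w: "w \<in> ?B" "w \<noteq> z" by blast
  have "z + c *\<^sub>R (w - z) \<in> ?B" for c
    using B w assms by (intro affine_line) auto
  then show thesis using w that[of "w - z"] by auto
qed

lemma rel_interior_affine_hull: "z \<in> rel_interior S \<Longrightarrow> z \<in> affine hull S"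
  by (meson hull_inc rel_interior_subset subsetD)

lemma rel_interior_line:
  fixes S :: "'a::euclidean_space set"
  assumes "z \<in> rel_interior S" "z + v \<in> affine hull S"
  obtains e where "e > 0" "\<And>c. \<bar>c\<bar> \<le> e \<Longrightarrow> z + c *\<^sub>R v \<in> S"
proof -
  obtain r where r: "r > 0" "cball z r \<inter> affine hull S \<subseteq> S"
    using assms(1) unfolding mem_rel_interior_cball by blast
  have zS: "z \<in> affine hull S"
    using assms(1) by (rule rel_interior_affine_hull)
  have "z + c *\<^sub>R v \<in> S" if c: "\<bar>c\<bar> \<le> r / (norm v + 1)" for c
  proof -
    have "\<bar>c\<bar> * norm v \<le> (r / (norm v + 1)) * (norm v + 1)"
      using c by (intro mult_mono) (auto simp: r(1) less_imp_le)
    also have "\<dots> = r" by (simp add: add_nonneg_eq_0_iff)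
    finally have "z + c *\<^sub>R v \<in> cball z r" by (simp add: dist_norm)
    moreover have "z + c *\<^sub>R v \<in> affine hull S"
      using zS assms(2) by (intro affine_line) auto
    ultimately show ?thesis using r by blast
  qed
  then show thesis
    using r(1) by (intro that[of "r / (norm v + 1)"]) (auto intro!: divide_pos_pos add_nonneg_pos)
qed

text \<open>Starting at a point \<open>p\<close> inside a facet, a direction with positive component towards a point of \<open>Q\<close>
enters \<open>Q\<close>, whatever its component along the facet: the latter can be absorbed by moving \<open>p\<close>
within the facet.\<close>

lemma facet_inward:
  fixes Q :: "'a::euclidean_space set"
  assumes Q: "convex Q" "F \<subseteq> Q" and p: "p \<in> rel_interior F" and q: "q \<in> Q"
    and f: "p + f \<in> affine hull F" and k: "k > 0"
  obtains e where "e > 0" "\<And>c. 0 \<le> c \<Longrightarrow> c \<le> e \<Longrightarrow> p + c *\<^sub>R (k *\<^sub>R (q - p) + f) \<in> Q"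
proof -
  obtain d where d: "d > 0" "\<And>c. \<bar>c\<bar> \<le> d \<Longrightarrow> p + c *\<^sub>R f \<in> F"
    using rel_interior_line[OF p f] by blast
  \<comment> \<open>The bound \<open>1 / (2 * k)\<close> keeps the weight \<open>t = c * k\<close> of \<open>q\<close> at most 1/2, and \<open>d / 2\<close> keeps the rescaled step along the facet within \<open>d\<close>.\<close>
  define e where "e = min (1 / (2 * k)) (d / 2)"
  have e: "e > 0" using d k by (simp add: e_def)
  have "p + c *\<^sub>R (k *\<^sub>R (q - p) + f) \<in> Q" if c: "0 \<le> c" "c \<le> e" for c
  proof -
    define t where "t = c * k"
    have t: "0 \<le> t" "t \<le> 1/2"
      using c k by (auto simp: t_def e_def field_simps)
    have "c \<le> d * (1 - t)"
    proof -
      have "c \<le> d / 2" using c by (simp add: e_def)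
      also have "\<dots> \<le> d * (1 - t)" using d(1) t by (simp add: field_simps)
      finally show ?thesis .
    qed
    then have "\<bar>c / (1 - t)\<bar> \<le> d" using c t by (simp add: field_simps abs_if)
    then have "p + (c / (1 - t)) *\<^sub>R f \<in> Q" using d(2) Q(2) by blast
    then have "(1 - t) *\<^sub>R (p + (c / (1 - t)) *\<^sub>R f) + t *\<^sub>R q \<in> Q"
      using Q(1) q t by (intro convexD) auto
    also have "(1 - t) *\<^sub>R (p + (c / (1 - t)) *\<^sub>R f) = (1 - t) *\<^sub>R p + c *\<^sub>R f"
      using t by (simp add: scaleR_add_right)
    finally show ?thesis by (simp add: t_def algebra_simps)
  qed
  then show thesis using e that by blast
qed

lemma facet_direction:
  fixes Q :: "'a::euclidean_space set"
  assumes Q: "convex Q" "F facet_of Q" and p: "p \<in> affine hull F"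
    and q: "q \<in> Q" "q \<notin> affine hull F" and v: "p + v \<in> affine hull Q"
  obtains k f where "v = k *\<^sub>R (q - p) + f" "p + f \<in> affine hull F"
proof -
  have "insert q F \<subseteq> Q" using Q q facet_of_imp_subset by blast
  moreover have "aff_dim (insert q F) = aff_dim Q"
    using Q(2) q(2) by (simp add: aff_dim_insert facet_of_def)
  ultimately have eq: "affine hull (insert q F) = affine hull Q"
    using aff_dim_eq_full_gen by blast
  have pin: "p \<in> affine hull (insert q F)" using p by (meson hull_mono subset_insertI subsetD)
  have "v \<in> span ((\<lambda>x. x - p) ` insert q F)"
    using v unfolding eq[symmetric] affine_hull_span_gen[OF pin]
    by (auto simp: algebra_simps image_def)
  then obtain k where k: "v - k *\<^sub>R (q - p) \<in> span ((\<lambda>x. x - p) ` F)"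
    by (auto simp: span_breakdown_eq)
  then have "p + (v - k *\<^sub>R (q - p)) \<in> affine hull F"
    unfolding affine_hull_span_gen[OF p]
    by (intro imageI) (simp add: diff_conv_add_uminus add.commute del: add_uminus_conv_diff)
  then show thesis by (intro that[of k "v - k *\<^sub>R (q - p)"]) auto
qed

lemma facet_off_point:
  fixes Q :: "'a::euclidean_space set"
  assumes "convex Q" "F facet_of Q"
  obtains q where "q \<in> Q" "q \<notin> affine hull F"
proof -
  have "aff_dim F < aff_dim Q" using assms by (simp add: facet_of_def)
  then have "\<not> Q \<subseteq> affine hull F" by (metis aff_dim_affine_hull aff_dim_subset not_less)
  then show thesis using that by blast
qed

text \<open>A line through an interior point of a facet that is transverse to the facet enters the polytope on
one side; \<open>s\<close> is the sign of that side. With \<open>facet_not_both_sides\<close> this locates the two cells at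
an inner wall, and the ends of the segments below.\<close>

lemma facet_one_side:
  fixes Q :: "'a::euclidean_space set"
  assumes Q: "convex Q" "F facet_of Q" and p: "p \<in> rel_interior F"
    and v: "p + v \<in> affine hull Q" "p + v \<notin> affine hull F"
  obtains e s where "e > 0" "s = 1 \<or> s = -1" "\<And>c. 0 \<le> c \<Longrightarrow> c \<le> e \<Longrightarrow> p + (s * c) *\<^sub>R v \<in> Q"
proof -
  obtain q where q: "q \<in> Q" "q \<notin> affine hull F" using facet_off_point[OF Q] .
  have pF: "p \<in> affine hull F" using p by (rule rel_interior_affine_hull)
  obtain k f where kf: "v = k *\<^sub>R (q - p) + f" "p + f \<in> affine hull F"
    using facet_direction[OF Q pF q v(1)] .
  have FQ: "F \<subseteq> Q" using Q(2) by (rule facet_of_imp_subset)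
  have "k \<noteq> 0" using kf v(2) by auto
  then consider "k > 0" | "k < 0" by linarith
  then show thesis
  proof cases
    case 1
    obtain e where "e > 0" "\<And>c. 0 \<le> c \<Longrightarrow> c \<le> e \<Longrightarrow> p + c *\<^sub>R (k *\<^sub>R (q - p) + f) \<in> Q"
      using facet_inward[OF Q(1) FQ p q(1) kf(2) 1] by blast
    then show thesis using that[of e 1] kf(1) by simp
  next
    case 2
    have "p + (- 1) *\<^sub>R f \<in> affine hull F" using pF kf(2) by (intro affine_line) auto
    then obtain e where e: "e > 0" "\<And>c. 0 \<le> c \<Longrightarrow> c \<le> e \<Longrightarrow> p + c *\<^sub>R ((-k) *\<^sub>R (q - p) + (- f)) \<in> Q"
      using facet_inward[OF Q(1) FQ p q(1), of "- f" "- k"] 2 by auto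
    have eq: "(-k) *\<^sub>R (q - p) + (- f) = - v" using kf(1) by simp
    show thesis by (rule that[of e "-1"]) (use e(1) e(2)[unfolded eq] in auto)
  qed
qed

lemma facet_not_both_sides:
  fixes Q :: "'a::euclidean_space set"
  assumes "F face_of Q" "p \<in> F" "p + v \<notin> affine hull F" "a > 0" "b > 0"
    "p + a *\<^sub>R v \<in> Q" "p - b *\<^sub>R v \<in> Q"
  shows False
proof -
  have v: "v \<noteq> 0" using assms(2,3) hull_subset[of F affine] by auto
  have "p \<in> open_segment (p + a *\<^sub>R v) (p - b *\<^sub>R v)"
    unfolding in_segment
  proof (intro conjI exI[of _ "a / (a + b)"])
    show "p + a *\<^sub>R v \<noteq> p - b *\<^sub>R v"
    proof
      assume "p + a *\<^sub>R v = p - b *\<^sub>R v"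
      then have "(a + b) *\<^sub>R v = 0" by (simp add: scaleR_add_left algebra_simps eq_neg_iff_add_eq_0)
      then show False using v assms(4,5) by simp
    qed
    have "(1 - a / (a + b)) *\<^sub>R (p + a *\<^sub>R v) + (a / (a + b)) *\<^sub>R (p - b *\<^sub>R v)
        = p + ((1 - a / (a + b)) * a - (a / (a + b)) * b) *\<^sub>R v"
      by (simp add: algebra_simps)
    also have "(1 - a / (a + b)) * a - (a / (a + b)) * b = 0"
      using assms by (simp add: field_simps)
    finally show "p = (1 - a / (a + b)) *\<^sub>R (p + a *\<^sub>R v) + (a / (a + b)) *\<^sub>R (p - b *\<^sub>R v)"
      by simp
  qed (use assms in auto)
  then have pa: "p + a *\<^sub>R v \<in> F" using assms(1,2,6,7) unfolding face_of_def by blast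
  have "p + (1/a) *\<^sub>R (a *\<^sub>R v) \<in> affine hull F"
    by (rule affine_line) (use pa assms(2) in \<open>auto intro: hull_inc\<close>)
  then show False using assms by simp
qed

text \<open>Descend through facets until the point is no longer on the relative boundary.\<close>

lemma polytope_face_rel_interior:
  fixes Q :: "'a::euclidean_space set"
  assumes "polytope Q" "z \<in> Q"
  obtains F where "F face_of Q" "z \<in> rel_interior F"
proof -
  have "\<exists>F. F face_of Q \<and> z \<in> rel_interior F" using assms
  proof (induction "nat (aff_dim Q + 1)" arbitrary: Q rule: less_induct)
    case less
    show ?case
    proof (cases "z \<in> rel_interior Q")
      case True
      then show ?thesis using less.prems face_of_refl polytope_imp_convex by blast
    next
      case False
      then have "z \<in> \<Union> {F. F facet_of Q}"
        using rel_boundary_of_polyhedron[of Q] less.prems polytope_imp_polyhedron by blast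
      then obtain F where F: "F facet_of Q" "z \<in> F" by blast
      then have "nat (aff_dim F + 1) < nat (aff_dim Q + 1)"
        using aff_dim_geq[of F] by (auto simp: facet_of_def)
      moreover have "polytope F" using F less.prems face_of_polytope_polytope facet_of_imp_face_of by blast
      ultimately obtain G where "G face_of F" "z \<in> rel_interior G"
        using less.hyps F by blast
      then show ?thesis using F face_of_trans facet_of_imp_face_of by blast
    qed
  qed
  then show thesis using that by blast
qed

section \<open>Segments cut out of a polytope\<close>

text \<open>The position of a \<open>(k+1)\<close>-dimensional product cell \<open>Q\<close> relative to a generic projection to
\<open>k\<close>-space: the fibre cuts \<open>Q\<close> in dimension at most 1 and facets in dimension at most 0, misses
the faces of smaller dimension, and the next form separates the two points of every pair
found in a facet. If such a cell is met at all, it is cut in a segment that ends in two different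
facets.\<close>

locale crossing =
  fixes Q :: "('a::euclidean_space \<times> 'a) set" and l :: "nat \<Rightarrow> 'a" and k :: nat
  assumes poly: "polytope Q" and dimQ: "aff_dim Q = int k + 1"
    and one: "aff_dim (Q \<inter> fib l k) \<le> 1"
    and zero: "\<And>F. F facet_of Q \<Longrightarrow> aff_dim (F \<inter> fib l k) \<le> 0"
    and none: "\<And>F. F face_of Q \<Longrightarrow> aff_dim F < int k \<Longrightarrow> F \<inter> fib l k = {}"
    and level: "\<And>F z. F facet_of Q \<Longrightarrow> z \<in> F \<inter> fib l k \<Longrightarrow> ht l k z \<noteq> 0"
begin

abbreviation "P \<equiv> Q \<inter> fib l k"

lemma convQ: "convex Q" using poly polytope_imp_convex by blast

lemma finite_facets: "finite {F. F facet_of Q}"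
  using poly finite_polytope_facets by blast

lemma facet_unique:
  assumes "F facet_of Q" "G facet_of Q" "z \<in> F" "z \<in> G" "z \<in> fib l k"
  shows "F = G"
proof (rule ccontr)
  assume ne: "F \<noteq> G"
  have FG: "F face_of Q" "G face_of Q" using assms facet_of_imp_face_of by auto
  have "F \<inter> G \<noteq> F \<or> F \<inter> G \<noteq> G" using ne by blast
  moreover have "F \<inter> G face_of F" "F \<inter> G face_of G"
    using face_of_subset[OF face_of_Int[OF FG]] FG face_of_imp_subset by auto
  moreover have "convex F" "convex G" using FG face_of_imp_convex by auto
  ultimately have "aff_dim (F \<inter> G) < int k"
    using face_of_aff_dim_lt[of F "F \<inter> G"] face_of_aff_dim_lt[of G "F \<inter> G"] assms(1,2) dimQ
    by (auto simp: facet_of_def)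
  then show False using none[of "F \<inter> G"] FG face_of_Int assms by blast
qed

lemma single:
  assumes "F facet_of Q" "z \<in> F \<inter> fib l k" "w \<in> F \<inter> fib l k"
  shows "z = w"
proof -
  have "aff_dim (F \<inter> fib l k) \<le> 0" using zero assms by blast
  then have "aff_dim {z, w} \<le> 0" using assms by (meson aff_dim_subset empty_subsetI insert_subset order_trans)
  then show ?thesis by (auto simp: aff_dim_2 split: if_splits)
qed

lemma interior_line:
  assumes "z \<in> rel_interior Q" "z \<in> fib l k"
  obtains v where "v \<noteq> 0" "z + v \<in> P" "z - v \<in> P"
proof -
  have "z \<in> affine hull Q" using assms(1) by (rule rel_interior_affine_hull)
  moreover have "aff_dim (affine hull Q) > int k" using dimQ by (simp add: aff_dim_affine_hull)
  ultimately obtain v where v: "v \<noteq> 0" "\<And>c. z + c *\<^sub>R v \<in> affine hull Q" "\<And>c. z + c *\<^sub>R v \<in> fib l k"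
    using line_in_fib[of "affine hull Q" z l k] assms affine_affine_hull by blast
  obtain e where e: "e > 0" "\<And>c. \<bar>c\<bar> \<le> e \<Longrightarrow> z + c *\<^sub>R v \<in> Q"
    using rel_interior_line[OF assms(1), of v] v(2)[of 1] by (metis scaleR_one)
  have "z + (-e) *\<^sub>R v \<in> P" using v(3)[of "-e"] e(1) e(2)[of "-e"] by simp
  moreover have "z + e *\<^sub>R v \<in> P" using v(3) e(1) e(2)[of e] by simp
  ultimately show thesis using that[of "e *\<^sub>R v"] v(1) e(1) by simp
qed

text \<open>The codimension of the fibre is only \<open>k\<close>, so a line inside the fibre passes through each of its
points in \<open>Q\<close>. At a point interior to a facet one half of this line still runs inside \<open>Q\<close>, and
smaller faces are not met. Hence the intersection is never a single point.\<close>

lemma other_point: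
  assumes "z \<in> P" shows "\<exists>w\<in>P. w \<noteq> z"
proof (cases "z \<in> rel_interior Q")
  case True
  then show ?thesis using interior_line[of z] assms by (metis IntD2 add_cancel_left_right)
next
  case False
  then have "z \<in> \<Union> {F. F facet_of Q}"
    using rel_boundary_of_polyhedron[of Q] poly polytope_imp_polyhedron assms by blast
  then obtain F where F: "F facet_of Q" "z \<in> F" by blast
  have polyF: "polytope F" using F poly face_of_polytope_polytope facet_of_imp_face_of by blast
  obtain G where G: "G face_of F" "z \<in> rel_interior G"
    using polytope_face_rel_interior[OF polyF F(2)] .
  have "G = F"
  proof (rule ccontr)
    assume "G \<noteq> F"
    then have "aff_dim G < int k"
      using face_of_aff_dim_lt[of F G] G polyF polytope_imp_convex F(1) dimQ by (auto simp: facet_of_def)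
    moreover have "G face_of Q" using G F face_of_trans facet_of_imp_face_of by blast
    ultimately show False using none[of G] G(2) rel_interior_subset assms by blast
  qed
  then have zF: "z \<in> rel_interior F" using G by simp
  have "z \<in> affine hull Q" using assms by (simp add: hull_inc)
  moreover have "aff_dim (affine hull Q) > int k" using dimQ by (simp add: aff_dim_affine_hull)
  ultimately obtain v where v: "v \<noteq> 0" "\<And>c. z + c *\<^sub>R v \<in> affine hull Q" "\<And>c. z + c *\<^sub>R v \<in> fib l k"
    using line_in_fib[of "affine hull Q" z l k] assms affine_affine_hull by blast
  show ?thesis
  proof (cases "z + v \<in> affine hull F")
    case True
    obtain e where e: "e > 0" "\<And>c. \<bar>c\<bar> \<le> e \<Longrightarrow> z + c *\<^sub>R v \<in> F"
      using rel_interior_line[OF zF True] by blast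
    then have "z + e *\<^sub>R v \<in> F" by simp
    then have "z + e *\<^sub>R v \<in> Q" using F facet_of_imp_subset by blast
    then show ?thesis using v e by (intro bexI[of _ "z + e *\<^sub>R v"]) auto
  next
    case False
    obtain e s where es: "e > 0" "s = 1 \<or> s = -1" "\<And>c. 0 \<le> c \<Longrightarrow> c \<le> e \<Longrightarrow> z + (s * c) *\<^sub>R v \<in> Q"
      using facet_one_side[OF convQ F(1) zF _ False] v(2)[of 1] by (metis scaleR_one)
    then have "z + (s * e) *\<^sub>R v \<in> P" using v(3) es(3)[of e] by auto
    moreover have "z + (s * e) *\<^sub>R v \<noteq> z" using es v by auto
    ultimately show ?thesis by blast
  qed
qed

text \<open>An endpoint inside \<open>Q\<close> could be prolonged on both sides; an inner point of the segment that lies in a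
facet would pull both endpoints into that facet, which meets the fibre only once.\<close>

lemma segment:
  assumes "P \<noteq> {}"
  obtains p q where "p \<noteq> q" "P = closed_segment p q"
    "\<And>z. z \<in> P \<Longrightarrow> z \<in> {p, q} \<longleftrightarrow> (\<exists>F. F facet_of Q \<and> z \<in> F)"
proof -
  have "compact P" by (simp add: poly polytope_imp_compact closed_fib compact_Int_closed)
  moreover have convP: "convex P" by (simp add: convQ affine_fib affine_imp_convex convex_Int)
  moreover have "collinear P" using one by (simp add: collinear_aff_dim)
  ultimately obtain p q where pq: "P = closed_segment p q"
    using assms compact_convex_collinear_segment by metis
  then have pqP: "p \<in> P" "q \<in> P" by auto
  have ne: "p \<noteq> q" using other_point[OF pqP(1)] pq by auto
  have end1: "\<exists>F. F facet_of Q \<and> z \<in> F" if z: "z \<in> {p,q}" for z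
  proof (rule ccontr)
    assume "\<not> ?thesis"
    then have "z \<in> rel_interior Q"
      using rel_boundary_of_polyhedron[of Q] poly polytope_imp_polyhedron z pqP by blast
    then obtain v where v: "v \<noteq> 0" "z + v \<in> P" "z - v \<in> P" using interior_line z pqP by blast
    have "z = midpoint (z + v) (z - v)"
      by (simp add: midpoint_def algebra_simps flip: scaleR_2)
    moreover have "z + v \<noteq> z - v"
    proof
      assume "z + v = z - v" then have "v + v = 0" by (simp add: algebra_simps eq_neg_iff_add_eq_0)
      then show False using v by (simp flip: scaleR_2)
    qed
    ultimately have "z \<in> open_segment (z + v) (z - v)" by (metis midpoint_in_open_segment)
    then have "\<not> z extreme_point_of P" using v unfolding extreme_point_of_def by blast
    then show False using z ne unfolding pq by (auto simp: extreme_point_of_segment)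
  qed
  have end2: "z \<in> {p,q}" if z: "z \<in> P" "F facet_of Q" "z \<in> F" for z F
  proof (rule ccontr)
    assume "z \<notin> {p,q}"
    then have "z \<in> open_segment p q" using z pq by (auto simp: open_segment_def)
    then have "p \<in> F" "q \<in> F" using z pqP facet_of_imp_face_of[OF z(2)] unfolding face_of_def by blast+
    then show False using single[OF z(2), of p q] pqP ne by blast
  qed
  show thesis by (rule that[OF ne pq]) (use end1 end2 in blast)
qed

lemma facet_sum:
  assumes "P = closed_segment p q" "p \<noteq> q"
    "\<And>z. z \<in> P \<Longrightarrow> z \<in> {p, q} \<longleftrightarrow> (\<exists>F. F facet_of Q \<and> z \<in> F)"
  shows "(\<Sum>F | F facet_of Q. card {z \<in> F \<inter> fib l k. R z}) = card {z \<in> {p,q}. R z}"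
proof -
  let ?A = "\<lambda>F. {z \<in> F \<inter> fib l k. R z}"
  have sub: "?A F \<subseteq> {p,q}" if "F facet_of Q" for F
    using assms(3) that facet_of_imp_subset by fastforce
  have "(\<Sum>F | F facet_of Q. card (?A F)) = card (\<Union>F\<in>{F. F facet_of Q}. ?A F)"
  proof (rule card_UN_disjoint[symmetric])
    show "\<forall>F\<in>{F. F facet_of Q}. \<forall>G\<in>{F. F facet_of Q}. F \<noteq> G \<longrightarrow> ?A F \<inter> ?A G = {}"
      using facet_unique by blast
    show "\<forall>F\<in>{F. F facet_of Q}. finite (?A F)"
      using sub finite_subset[of _ "{p,q}"] by blast
  qed (rule finite_facets)
  also have "(\<Union>F\<in>{F. F facet_of Q}. ?A F) = {z \<in> {p,q}. R z}"
    using sub assms(1,3) by auto (use ends_in_segment in blast)+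
  finally show ?thesis .
qed

lemma even_ends: "even (\<Sum>F | F facet_of Q. card (F \<inter> fib l k))"
proof (cases "P = {}")
  case True
  then have "F \<inter> fib l k = {}" if "F facet_of Q" for F using that facet_of_imp_subset by blast
  then show ?thesis by simp
next
  case False
  then obtain p q where pq: "p \<noteq> q" "P = closed_segment p q"
    "\<And>z. z \<in> P \<Longrightarrow> z \<in> {p, q} \<longleftrightarrow> (\<exists>F. F facet_of Q \<and> z \<in> F)" using segment by blast
  have "(\<Sum>F | F facet_of Q. card {z \<in> F \<inter> fib l k. True}) = card {z \<in> {p,q}. True}"
    by (rule facet_sum) (use pq in auto)
  moreover have "{z \<in> {p,q}. True} = {p,q}" by blast
  moreover have "{z \<in> F \<inter> fib l k. True} = F \<inter> fib l k" for F by blast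
  ultimately show ?thesis using pq(1) by simp
qed

text \<open>The height is an affine function on the segment and does not vanish at the ends. It has a zero,
exactly one, iff the signs at the ends differ, iff the number of positive ends is odd.\<close>

lemma zeros_eq_positive_ends:
  "even (card {z \<in> P. ht l k z = 0} + (\<Sum>F | F facet_of Q. card {z \<in> F \<inter> fib l k. ht l k z > 0}))"
proof (cases "P = {}")
  case True
  then have "F \<inter> fib l k = {}" if "F facet_of Q" for F using that facet_of_imp_subset by blast
  then show ?thesis using True by simp
next
  case False
  then obtain p q where pq: "p \<noteq> q" "P = closed_segment p q"
    "\<And>z. z \<in> P \<Longrightarrow> z \<in> {p, q} \<longleftrightarrow> (\<exists>F. F facet_of Q \<and> z \<in> F)" using segment by blast
  have sum: "(\<Sum>F | F facet_of Q. card {z \<in> F \<inter> fib l k. ht l k z > 0}) = card {z \<in> {p,q}. ht l k z > 0}"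
    by (rule facet_sum) (use pq in auto)
  have pqP: "p \<in> P" "q \<in> P" using pq by auto
  let ?a = "ht l k p" and ?b = "ht l k q"
  have ab: "?a \<noteq> 0" "?b \<noteq> 0" using pq(3) pqP level by blast+
  have h: "ht l k ((1 - u) *\<^sub>R p + u *\<^sub>R q) = (1 - u) * ?a + u * ?b" for u
    by (simp add: ht_inner inner_add_right)
  have zs: "{z \<in> P. ht l k z = 0} = (\<lambda>u. (1 - u) *\<^sub>R p + u *\<^sub>R q) ` {u. 0 \<le> u \<and> u \<le> 1 \<and> (1 - u) * ?a + u * ?b = 0}"
    unfolding pq(2) by (auto simp: in_segment h image_iff)
  have set2: "{z \<in> {p,q}. ht l k z > 0} = (if ?a > 0 then {p} else {}) \<union> (if ?b > 0 then {q} else {})"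
    by auto
  show ?thesis
  proof (cases "(?a > 0) = (?b > 0)")
    case True
    have "{u. 0 \<le> u \<and> u \<le> 1 \<and> (1 - u) * ?a + u * ?b = 0} = {}"
    proof -
      have "(1 - u) * ?a + u * ?b \<noteq> 0" if u: "0 \<le> u" "u \<le> 1" for u
      proof (cases "?a > 0")
        case a: True
        then show ?thesis using True u
          by (smt (verit) mult_nonneg_nonneg mult_pos_pos)
      next
        case a: False
        then have "?a < 0" "?b < 0" using True ab by auto
        then show ?thesis using u
          by (smt (verit) mult_nonneg_nonpos mult_pos_neg)
      qed
      then show ?thesis by auto
    qed
    then have "{z \<in> P. ht l k z = 0} = {}" unfolding zs by simp
    then have "card {z \<in> P. ht l k z = 0} = 0" by (simp only: card.empty)
    then show ?thesis unfolding sum set2 using True pq(1) by auto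
  next
    case False
    then have ne: "?a - ?b \<noteq> 0" by auto
    have "{u. 0 \<le> u \<and> u \<le> 1 \<and> (1 - u) * ?a + u * ?b = 0} = {?a / (?a - ?b)}"
    proof (intro set_eqI iffI)
      fix u assume "u \<in> {u. 0 \<le> u \<and> u \<le> 1 \<and> (1 - u) * ?a + u * ?b = 0}"
      then show "u \<in> {?a / (?a - ?b)}" using ne by (auto simp: field_simps)
    next
      fix u assume "u \<in> {?a / (?a - ?b)}"
      then have u: "u = ?a / (?a - ?b)" by simp
      have "0 \<le> u" "u \<le> 1" unfolding u using False ab
        by (auto simp: divide_simps not_less split: if_splits)
      moreover have "(1 - u) * ?a + u * ?b = 0"
      proof -
        have "u * (?a - ?b) = ?a" using u ne by simp
        then show ?thesis by (simp add: algebra_simps)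
      qed
      ultimately show "u \<in> {u. 0 \<le> u \<and> u \<le> 1 \<and> (1 - u) * ?a + u * ?b = 0}" by simp
    qed
    then have "card {z \<in> P. ht l k z = 0} = 1" unfolding zs by simp
    then show ?thesis unfolding sum set2 using False by auto
  qed
qed

end

section \<open>Generic directions\<close>

lemma aff_dim_Times:
  fixes S :: "'a::euclidean_space set" and T :: "'b::euclidean_space set"
  assumes "S \<noteq> {}" "T \<noteq> {}"
  shows "aff_dim (S \<times> T) = aff_dim S + aff_dim T"
proof -
  obtain a b where ab: "a \<in> S" "b \<in> T" using assms by blast
  let ?S = "(+) (- a) ` S" and ?T = "(+) (- b) ` T"
  have 0: "0 \<in> ?S" "0 \<in> ?T" using ab by (auto simp: image_iff intro: bexI[of _ a] bexI[of _ b])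
  have eq: "(+) (- (a, b)) ` (S \<times> T) = ?S \<times> ?T" by (auto simp: image_iff)
  have "span (?S \<times> ?T) = span ?S \<times> span ?T"
  proof
    show "span (?S \<times> ?T) \<subseteq> span ?S \<times> span ?T"
      by (rule span_minimal) (auto intro: span_base subspace_Times)
    show "span ?S \<times> span ?T \<subseteq> span (?S \<times> ?T)"
    proof clarify
      fix x y assume x: "x \<in> span ?S" and y: "y \<in> span ?T"
      have "(x, 0) \<in> span (?S \<times> ?T)"
      proof -
        have "(\<lambda>x. (x, 0)) ` span ?S = span ((\<lambda>x. (x, 0)) ` ?S)"
          by (rule linear_span_image[symmetric]) (auto intro!: linearI)
        also have "\<dots> \<subseteq> span (?S \<times> ?T)" using 0 by (intro span_mono) auto
        finally show ?thesis using x by blast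
      qed
      moreover have "(0, y) \<in> span (?S \<times> ?T)"
      proof -
        have "Pair 0 ` span ?T = span (Pair 0 ` ?T)"
          by (rule linear_span_image[symmetric]) (auto intro!: linearI)
        also have "\<dots> \<subseteq> span (?S \<times> ?T)" using 0 by (intro span_mono) auto
        finally show ?thesis using y by blast
      qed
      ultimately have "(x, 0) + (0, y) \<in> span (?S \<times> ?T)" by (rule span_add)
      then show "(x, y) \<in> span (?S \<times> ?T)" by simp
    qed
  qed
  then have "dim (?S \<times> ?T) = dim (span ?S \<times> span ?T)" by (metis dim_span)
  also have "\<dots> = dim ?S + dim ?T" by (simp add: dim_Times)
  finally have d: "dim (?S \<times> ?T) = dim ?S + dim ?T" .
  have "aff_dim (S \<times> T) = aff_dim (?S \<times> ?T)"
    by (metis aff_dim_translation_eq eq)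
  also have "\<dots> = int (dim (?S \<times> ?T))"
  proof (rule aff_dim_zero)
    have "(0, 0) \<in> ?S \<times> ?T" using 0 by blast
    then show "0 \<in> affine hull (?S \<times> ?T)" by (simp only: zero_prod_def hull_inc)
  qed
  also have "\<dots> = int (dim ?S) + int (dim ?T)" using d by simp
  also have "int (dim ?S) = aff_dim ?S" by (rule aff_dim_zero[symmetric]) (use 0 in \<open>auto intro: hull_inc\<close>)
  also have "int (dim ?T) = aff_dim ?T" by (rule aff_dim_zero[symmetric]) (use 0 in \<open>auto intro: hull_inc\<close>)
  also have "aff_dim ?S = aff_dim S" by (rule aff_dim_translation_eq)
  also have "aff_dim ?T = aff_dim T" by (rule aff_dim_translation_eq)
  finally show ?thesis .
qed

definition cuts_down :: "(nat \<Rightarrow> 'a::euclidean_space) \<Rightarrow> ('a \<times> 'a) set \<Rightarrow> bool" where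
  "cuts_down l Q \<longleftrightarrow>
     (\<forall>k\<le>DIM('a). Q \<inter> fib l k \<noteq> {} \<longrightarrow> aff_dim (Q \<inter> fib l k) \<le> aff_dim Q - int k)"

text \<open>The first conjunct says that all forms together separate points, so that the full fibre is the
diagonal.\<close>

definition generic :: "(nat \<Rightarrow> 'a::euclidean_space) \<Rightarrow> ('a \<times> 'a) set set \<Rightarrow> bool" where
  "generic l \<Q> \<longleftrightarrow> (\<forall>x. (\<forall>i<DIM('a). l i \<bullet> x = 0) \<longrightarrow> x = 0) \<and> (\<forall>Q\<in>\<Q>. cuts_down l Q)"

text \<open>The diagonal lies in every fibre, so no choice of the forms can cut down a set whose part in a
fibre is contained in the diagonal. \<open>admissible\<close> excludes this. It is the only obstruction, as
\<open>cuts_down_exists\<close> shows.\<close>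

definition admissible :: "('a::euclidean_space \<times> 'a) set \<Rightarrow> bool" where
  "admissible Q \<longleftrightarrow>
     (\<forall>l k. k < DIM('a) \<longrightarrow> Q \<inter> fib l k \<noteq> {} \<longrightarrow> (\<exists>z\<in>Q \<inter> fib l k. fst z \<noteq> snd z))"

lemma admissible_disjoint: "X \<inter> Y = {} \<Longrightarrow> admissible (X \<times> Y)"
  unfolding admissible_def by (metis IntE disjoint_iff ex_in_conv mem_Times_iff)

lemma generic_Un: "generic l (\<Q> \<union> \<R>) \<longleftrightarrow> generic l \<Q> \<and> generic l \<R>"
  by (auto simp: generic_def)

lemma avoid_hyperplanes:
  fixes W :: "'a::euclidean_space set"
  assumes "finite W" "0 \<notin> W"
  obtains v where "\<And>w. w \<in> W \<Longrightarrow> v \<bullet> w \<noteq> 0"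
proof -
  have "negligible (\<Union>w\<in>W. {v. w \<bullet> v = 0})"
    using assms by (intro negligible_Union) (auto intro!: negligible_hyperplane)
  then have "(\<Union>w\<in>W. {v. w \<bullet> v = 0}) \<noteq> UNIV"
    using non_negligible_UNIV by metis
  then obtain v where "\<forall>w\<in>W. w \<bullet> v \<noteq> 0" by blast
  then show thesis using that by (metis inner_commute)
qed

lemma aff_dim_Int_hyperplane_less:
  fixes S :: "'b::euclidean_space set"
  assumes "z \<in> S" "a \<bullet> z \<noteq> b"
  shows "aff_dim (S \<inter> {x. a \<bullet> x = b}) < aff_dim S"
proof (rule aff_dim_psubset)
  have "affine hull (S \<inter> {x. a \<bullet> x = b}) \<subseteq> {x. a \<bullet> x = b}"
    by (intro hull_minimal affine_hyperplane) auto
  then have "z \<notin> affine hull (S \<inter> {x. a \<bullet> x = b})" using assms by blast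
  moreover have "z \<in> affine hull S" using assms by (simp add: hull_inc)
  ultimately show "affine hull (S \<inter> {x. a \<bullet> x = b}) \<subset> affine hull S"
    by (metis Int_lower1 hull_mono psubsetI)
qed

text \<open>The forms are chosen one after the other. In every set that still meets the fibre, admissibility
provides a pair of different points; the next form is taken off the finitely many hyperplanes of forms
that vanish on one of their differences. Then no set stays inside the new hyperplane.\<close>

lemma cuts_down_exists:
  fixes \<Q> :: "('a::euclidean_space \<times> 'a) set set"
  assumes "finite \<Q>" and "\<And>Q. Q \<in> \<Q> \<Longrightarrow> admissible Q"
  shows "\<exists>l. \<forall>Q\<in>\<Q>. cuts_down l Q"
proof -
  have "\<exists>l. \<forall>Q\<in>\<Q>. \<forall>k\<le>m. Q \<inter> fib l k \<noteq> {} \<longrightarrow> aff_dim (Q \<inter> fib l k) \<le> aff_dim Q - int k"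
    if "m \<le> DIM('a)" for m using that
  proof (induction m)
    case 0
    then show ?case by simp
  next
    case (Suc m)
    then have "\<exists>l. \<forall>Q\<in>\<Q>. \<forall>k\<le>m. Q \<inter> fib l k \<noteq> {} \<longrightarrow> aff_dim (Q \<inter> fib l k) \<le> aff_dim Q - int k"
      by simp
    then obtain l where l0: "\<forall>Q\<in>\<Q>. \<forall>k\<le>m. Q \<inter> fib l k \<noteq> {} \<longrightarrow> aff_dim (Q \<inter> fib l k) \<le> aff_dim Q - int k"
      by (rule exE)
    have l: "aff_dim (Q \<inter> fib l k) \<le> aff_dim Q - int k" if "Q \<in> \<Q>" "k \<le> m" "Q \<inter> fib l k \<noteq> {}" for Q k
      using l0 that by blast
    define \<R> where "\<R> = {Q\<in>\<Q>. Q \<inter> fib l m \<noteq> {}}"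
    have "\<forall>Q\<in>\<R>. \<exists>z\<in>Q \<inter> fib l m. fst z \<noteq> snd z"
      using assms(2) Suc.prems by (auto simp: \<R>_def admissible_def)
    then obtain w where w: "\<And>Q. Q \<in> \<R> \<Longrightarrow> w Q \<in> Q \<inter> fib l m \<and> fst (w Q) \<noteq> snd (w Q)"
      by metis
    let ?W = "(\<lambda>Q. fst (w Q) - snd (w Q)) ` \<R>"
    have "finite ?W" using assms(1) by (simp add: \<R>_def)
    moreover have "0 \<notin> ?W" using w by force
    ultimately obtain v where v: "\<And>x. x \<in> ?W \<Longrightarrow> v \<bullet> x \<noteq> 0" using avoid_hyperplanes by blast
    let ?l = "l(m := v)"
    have fibeq: "fib ?l k = fib l k" if "k \<le> m" for k using that by (auto simp: fib_def)
    have "aff_dim (Q \<inter> fib ?l k) \<le> aff_dim Q - int k"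
      if Q: "Q \<in> \<Q>" "k \<le> Suc m" "Q \<inter> fib ?l k \<noteq> {}" for Q k
    proof (cases "k \<le> m")
      case True
      then show ?thesis using l Q fibeq by simp
    next
      case False
      then have k: "k = Suc m" using Q by simp
      have Qm: "Q \<inter> fib ?l k = (Q \<inter> fib l m) \<inter> {z. (v, -v) \<bullet> z = 0}"
        unfolding k fib_Suc using fibeq[of m] by auto
      then have QR: "Q \<in> \<R>" using Q by (auto simp: \<R>_def)
      have "v \<bullet> (fst (w Q) - snd (w Q)) \<noteq> 0" using v QR by blast
      then have "(v, -v) \<bullet> w Q \<noteq> 0" by (cases "w Q") (simp add: inner_diff_right)
      then have "aff_dim (Q \<inter> fib ?l k) < aff_dim (Q \<inter> fib l m)"
        unfolding Qm using w[OF QR] by (intro aff_dim_Int_hyperplane_less) auto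
      also have "\<dots> \<le> aff_dim Q - int m" using l[of Q m] QR by (auto simp: \<R>_def)
      finally show ?thesis using k by simp
    qed
    then show ?case by blast
  qed
  from this[of "DIM('a)"] show ?thesis by (simp add: cuts_down_def)
qed

text \<open>Separation of points is again a matter of cutting down: it amounts to the statement that the space
\<open>UNIV \<times> {0}\<close>, which represents all differences, is cut down to dimension 0.\<close>

lemma generic_exists:
  fixes \<Q> :: "('a::euclidean_space \<times> 'a) set set"
  assumes "finite \<Q>" and "\<And>Q. Q \<in> \<Q> \<Longrightarrow> admissible Q"
  obtains l where "generic l \<Q>"
proof -
  let ?Z = "UNIV \<times> {0} :: ('a \<times> 'a) set"
  have dimZ: "aff_dim ?Z = int DIM('a)" by (simp add: aff_dim_Times)
  \<comment> \<open>The part of \<open>?Z\<close> on the diagonal is the origin, and its part in a fibre with \<open>k < DIM\<close> is larger.\<close>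
  have "admissible ?Z"
    unfolding admissible_def
  proof (intro allI impI)
    fix l :: "nat \<Rightarrow> 'a" and k assume k: "k < DIM('a)"
    have "affine ?Z" by (auto simp: affine_def)
    moreover have "0 \<in> ?Z" "0 \<in> fib l k" by (auto simp: fib_def zero_prod_def)
    ultimately obtain v where v: "v \<noteq> 0" "\<And>c. 0 + c *\<^sub>R v \<in> ?Z" "\<And>c. 0 + c *\<^sub>R v \<in> fib l k"
      using line_in_fib[of ?Z 0 l k] dimZ k by (metis of_nat_less_iff)
    have "v \<in> ?Z \<inter> fib l k" using v(2)[of 1] v(3)[of 1] by simp
    moreover from this have "fst v \<noteq> snd v" using v(1) by (cases v) (auto simp: zero_prod_def)
    ultimately show "\<exists>z\<in>?Z \<inter> fib l k. fst z \<noteq> snd z" by blast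
  qed
  then obtain l where l: "\<forall>Q\<in>insert ?Z \<Q>. cuts_down l Q"
    using cuts_down_exists[of "insert ?Z \<Q>"] assms by auto
  have "x = 0" if x: "\<forall>i<DIM('a). l i \<bullet> x = 0" for x
  proof -
    have mem: "{(0,0), (x,0)} \<subseteq> ?Z \<inter> fib l DIM('a)" using x by (auto simp: fib_def)
    then have "aff_dim (?Z \<inter> fib l DIM('a)) \<le> 0"
    proof -
      have "cuts_down l ?Z" using l by blast
      moreover have "?Z \<inter> fib l DIM('a) \<noteq> {}" using mem by blast
      ultimately have "aff_dim (?Z \<inter> fib l DIM('a)) \<le> aff_dim ?Z - int DIM('a)"
        unfolding cuts_down_def by blast
      then show ?thesis unfolding dimZ by linarith
    qed
    then have "aff_dim {(0::'a,0::'a), (x,0)} \<le> 0" using aff_dim_subset[OF mem] by linarith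
    then show ?thesis by (auto simp: aff_dim_2 split: if_splits)
  qed
  then show thesis using that[of l] l by (simp add: generic_def)
qed

section \<open>Crossing counts of chains\<close>

text \<open>Crossings are pairs of points, one in each set, with the same image under the first \<open>k\<close> forms. The
trivial condition gives \<open>meet\<close> and \<open>over\<close> the same form, so that counting lemmas with an arbitrary
predicate serve both.\<close>

definition meet :: "(nat \<Rightarrow> 'a::euclidean_space) \<Rightarrow> nat \<Rightarrow> 'a set \<Rightarrow> 'a set \<Rightarrow> nat" where
  "meet l k X Y = card {z \<in> X \<times> Y \<inter> fib l k. True}"

definition over :: "(nat \<Rightarrow> 'a::euclidean_space) \<Rightarrow> nat \<Rightarrow> 'a set \<Rightarrow> 'a set \<Rightarrow> nat" where
  "over l k X Y = card {z \<in> X \<times> Y \<inter> fib l k. ht l k z > 0}"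

definition bdry :: "'a::euclidean_space set set \<Rightarrow> 'a set set" where
  "bdry S = {r. odd (card {s \<in> S. r facet_of s})}"

text \<open>The forms must be in general position also to the products of proper faces, so that crossings avoid
the faces of small dimension.\<close>

definition cells :: "'a::euclidean_space set set \<Rightarrow> 'a set set \<Rightarrow> ('a \<times> 'a) set set" where
  "cells S T = {s' \<times> t' |s' t' s t. s \<in> S \<and> t \<in> T \<and> s' face_of s \<and> t' face_of t}"

lemma facet_of_Times:
  fixes s :: "'a::euclidean_space set" and t :: "'b::euclidean_space set"
  assumes "convex s" "convex t" "s \<noteq> {}" "t \<noteq> {}"
  shows "F facet_of (s \<times> t) \<longleftrightarrow> (\<exists>r. r facet_of s \<and> F = r \<times> t) \<or> (\<exists>r. r facet_of t \<and> F = s \<times> r)"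
proof
  assume "F facet_of (s \<times> t)"
  then obtain f g where fg: "f face_of s" "g face_of t" "F = f \<times> g" "F \<noteq> {}"
    "aff_dim F = aff_dim (s \<times> t) - 1"
    unfolding facet_of_def face_of_Times_decomp by blast
  then have ne: "f \<noteq> {}" "g \<noteq> {}" by auto
  have d: "aff_dim f + aff_dim g = aff_dim s + aff_dim t - 1"
    using fg ne assms by (simp add: aff_dim_Times)
  have "aff_dim f \<le> aff_dim s" "aff_dim g \<le> aff_dim t"
    using fg face_of_imp_subset aff_dim_subset by blast+
  then consider "aff_dim f = aff_dim s" | "aff_dim g = aff_dim t" using d by linarith
  then show "(\<exists>r. r facet_of s \<and> F = r \<times> t) \<or> (\<exists>r. r facet_of t \<and> F = s \<times> r)"
  proof cases
    case 1
    then have "f = s" using face_of_aff_dim_lt[of s f] assms fg by force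
    then show ?thesis using fg d ne by (auto simp: facet_of_def)
  next
    case 2
    then have "g = t" using face_of_aff_dim_lt[of t g] assms fg by force
    then show ?thesis using fg d ne by (auto simp: facet_of_def)
  qed
next
  assume "(\<exists>r. r facet_of s \<and> F = r \<times> t) \<or> (\<exists>r. r facet_of t \<and> F = s \<times> r)"
  then show "F facet_of (s \<times> t)"
  proof (elim disjE exE conjE)
    fix r assume r: "r facet_of s" "F = r \<times> t"
    then have "aff_dim F = aff_dim r + aff_dim t" using assms by (simp add: aff_dim_Times facet_of_def)
    then show ?thesis using r assms by (simp add: facet_of_def face_of_Times face_of_refl aff_dim_Times)
  next
    fix r assume r: "r facet_of t" "F = s \<times> r"
    then have "aff_dim F = aff_dim s + aff_dim r" using assms by (simp add: aff_dim_Times facet_of_def)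
    then show ?thesis using r assms by (simp add: facet_of_def face_of_Times face_of_refl aff_dim_Times)
  qed
qed

lemma finite_cells:
  assumes "finite S" "finite T" "\<And>s. s \<in> S \<Longrightarrow> polytope s" "\<And>t. t \<in> T \<Longrightarrow> polytope t"
  shows "finite (cells S T)"
proof -
  have "cells S T \<subseteq> (\<lambda>(a, b). a \<times> b) ` ((\<Union>s\<in>S. {f. f face_of s}) \<times> (\<Union>t\<in>T. {f. f face_of t}))"
    unfolding cells_def by auto
  moreover have "finite (\<Union>s\<in>S. {f. f face_of s})" "finite (\<Union>t\<in>T. {f. f face_of t})"
    using assms finite_polytope_faces by auto
  ultimately show ?thesis by (meson finite_SigmaI finite_imageI finite_subset)
qed

text \<open>Summing a function over the facets of all cells counts each facet as often as it has cells, which modulo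
2 leaves the facets in the boundary.\<close>

lemma sum_facets_mod2:
  fixes G :: "'a::euclidean_space set \<Rightarrow> nat"
  assumes "finite S" "\<And>s. s \<in> S \<Longrightarrow> polytope s"
  shows "even ((\<Sum>s\<in>S. \<Sum>r | r facet_of s. G r) + (\<Sum>r\<in>bdry S. G r))"
proof -
  define R where "R = (\<Union>s\<in>S. {r. r facet_of s})"
  have fin: "finite R" using assms finite_polytope_facets by (auto simp: R_def)
  have sub: "bdry S \<subseteq> R"
  proof
    fix r assume "r \<in> bdry S"
    then have "card {s \<in> S. r facet_of s} \<noteq> 0" unfolding bdry_def by (metis even_zero mem_Collect_eq)
    then have "{s \<in> S. r facet_of s} \<noteq> {}" by (metis card.empty)
    then show "r \<in> R" by (auto simp: R_def)
  qed
  have "(\<Sum>s\<in>S. \<Sum>r | r facet_of s. G r) = (\<Sum>s\<in>S. \<Sum>r\<in>R. if r facet_of s then G r else 0)"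
  proof (rule sum.cong[OF refl])
    fix s assume "s \<in> S"
    then have "{r. r facet_of s} = {r \<in> R. r facet_of s}" by (auto simp: R_def)
    then show "(\<Sum>r | r facet_of s. G r) = (\<Sum>r\<in>R. if r facet_of s then G r else 0)"
      using fin by (simp add: sum.inter_filter)
  qed
  also have "\<dots> = (\<Sum>r\<in>R. \<Sum>s\<in>S. if r facet_of s then G r else 0)" by (rule sum.swap)
  also have "\<dots> = (\<Sum>r\<in>R. card {s\<in>S. r facet_of s} * G r)"
    using assms(1) by (simp flip: sum.inter_filter)
  finally have 1: "(\<Sum>s\<in>S. \<Sum>r | r facet_of s. G r) = (\<Sum>r\<in>R. card {s\<in>S. r facet_of s} * G r)" .
  have 2: "(\<Sum>r\<in>bdry S. G r) = (\<Sum>r\<in>R. if r \<in> bdry S then G r else 0)"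
    using fin sub by (simp add: sum.inter_restrict[symmetric] Int_absorb1)
  show ?thesis unfolding 1 2 sum.distrib[symmetric]
    by (intro dvd_sum) (auto simp: bdry_def)
qed

lemma crossing_Times:
  fixes s t :: "'a::euclidean_space set"
  assumes s: "polytope s" "s \<noteq> {}" and t: "polytope t" "t \<noteq> {}"
    and dim: "aff_dim s + aff_dim t = int k + 1" and k: "k < DIM('a)"
    and cd: "\<And>f g. f face_of s \<Longrightarrow> g face_of t \<Longrightarrow> cuts_down l (f \<times> g)"
  shows "crossing (s \<times> t) l k"
proof
  show poly: "polytope (s \<times> t)" using s t by (simp add: polytope_Times)
  show d: "aff_dim (s \<times> t) = int k + 1" using s t dim by (simp add: aff_dim_Times)
  have cd': "cuts_down l F" if "F face_of s \<times> t" for F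
    using that cd unfolding face_of_Times_decomp by blast
  have cut: "aff_dim (F \<inter> fib l j) \<le> aff_dim F - int j \<or> F \<inter> fib l j = {}"
    if "F face_of s \<times> t" "j \<le> DIM('a)" for F j
    using cd'[OF that(1)] that(2) unfolding cuts_down_def by blast
  have "s \<times> t face_of s \<times> t" using poly polytope_imp_convex face_of_refl by blast
  from cut[OF this, of k] show "aff_dim (s \<times> t \<inter> fib l k) \<le> 1" using k d by auto
  show "aff_dim (F \<inter> fib l k) \<le> 0" if "F facet_of s \<times> t" for F
    using cut[of F k] that k d by (auto simp: facet_of_def)
  show "F \<inter> fib l k = {}" if F: "F face_of s \<times> t" "aff_dim F < int k" for F
  proof -
    have "F \<inter> fib l k = {}" if "aff_dim (F \<inter> fib l k) \<le> aff_dim F - int k"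
    proof -
      have "aff_dim (F \<inter> fib l k) < 0" using that F by linarith
      then show ?thesis by (meson aff_dim_negative_iff)
    qed
    then show ?thesis using cut[OF F(1), of k] k by auto
  qed
  show "ht l k z \<noteq> 0" if F: "F facet_of s \<times> t" "z \<in> F \<inter> fib l k" for F z
  proof
    assume "ht l k z = 0"
    then have z: "z \<in> F \<inter> fib l (Suc k)" using F by (simp add: fib_Suc_ht)
    then have "aff_dim (F \<inter> fib l (Suc k)) \<le> aff_dim F - int (Suc k)"
      using cut[OF facet_of_imp_face_of[OF F(1)] Suc_leI[OF k]] by blast
    moreover have "aff_dim F = int k" using F d by (simp add: facet_of_def)
    ultimately have "aff_dim (F \<inter> fib l (Suc k)) < 0" by linarith
    then show False using z by (metis aff_dim_negative_iff empty_iff)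
  qed
qed

lemma sum_facets_Times:
  fixes s t :: "'a::euclidean_space set"
  assumes "polytope s" "s \<noteq> {}" "polytope t" "t \<noteq> {}"
  shows "(\<Sum>F | F facet_of (s \<times> t). (G F :: nat)) =
     (\<Sum>r | r facet_of s. G (r \<times> t)) + (\<Sum>r | r facet_of t. G (s \<times> r))"
proof -
  let ?f = "\<lambda>r. r \<times> t" and ?g = "\<lambda>r. s \<times> r"
  have conv: "convex s" "convex t" using assms polytope_imp_convex by auto
  have eq: "{F. F facet_of (s \<times> t)} = ?f ` {r. r facet_of s} \<union> ?g ` {r. r facet_of t}"
    using facet_of_Times[OF conv assms(2,4)] by auto
  have "?f r \<noteq> ?g r'" if "r facet_of s" "r' facet_of t" for r r'
  proof
    assume "?f r = ?g r'"
    moreover have "r \<noteq> {}" using that by (simp add: facet_of_def)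
    ultimately have "r = s" using assms by (metis times_eq_iff)
    then show False using that by simp
  qed
  then have disj: "?f ` {r. r facet_of s} \<inter> ?g ` {r. r facet_of t} = {}" by blast
  have inj: "inj_on ?f {r. r facet_of s}" "inj_on ?g {r. r facet_of t}"
    using assms by (auto simp: inj_on_def times_eq_iff facet_of_def)
  show ?thesis unfolding eq
    using disj assms by (subst sum.union_disjoint) (auto simp: finite_polytope_facets sum.reindex[OF inj(1)] sum.reindex[OF inj(2)])
qed

text \<open>The coboundary formula for chains. A facet of \<open>s \<times> t\<close> is a facet of \<open>s\<close> times \<open>t\<close> or \<open>s\<close> times
a facet of \<open>t\<close>. Counting the positive ends of all segments by facets gives the two sums of \<open>over\<close>, and
counting the zeros of the height gives \<open>meet\<close> for \<open>k + 1\<close>. The second statement says that the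
number of all ends is even.\<close>

theorem crossings_boundary:
  fixes S T :: "'a::euclidean_space set set"
  assumes S: "finite S" "\<And>s. s \<in> S \<Longrightarrow> polytope s \<and> aff_dim s = i"
    and T: "finite T" "\<And>t. t \<in> T \<Longrightarrow> polytope t \<and> aff_dim t = j"
    and dim: "0 \<le> i" "0 \<le> j" "i + j = int k + 1" and k: "k < DIM('a)"
    and cd: "\<And>Q. Q \<in> cells S T \<Longrightarrow> cuts_down l Q"
  shows "even ((\<Sum>s\<in>S. \<Sum>t\<in>T. meet l (Suc k) s t) +
      ((\<Sum>r\<in>bdry S. \<Sum>t\<in>T. over l k r t) + (\<Sum>s\<in>S. \<Sum>r\<in>bdry T. over l k s r)))"
    and "even ((\<Sum>r\<in>bdry S. \<Sum>t\<in>T. meet l k r t) + (\<Sum>s\<in>S. \<Sum>r\<in>bdry T. meet l k s r))"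
proof -
  have cr: "crossing (s \<times> t) l k" if "s \<in> S" "t \<in> T" for s t
  proof (rule crossing_Times)
    show "s \<noteq> {}" "t \<noteq> {}" using S(2)[OF that(1)] T(2)[OF that(2)] dim by auto
    show "cuts_down l (f \<times> g)" if "f face_of s" "g face_of t" for f g
      using that \<open>s \<in> S\<close> \<open>t \<in> T\<close> by (intro cd) (auto simp: cells_def)
  qed (use S(2)[OF that(1)] T(2)[OF that(2)] dim k in auto)
  have ne: "s \<noteq> {}" "t \<noteq> {}" if "s \<in> S" "t \<in> T" for s t
    using S(2)[OF that(1)] T(2)[OF that(2)] dim by auto
  have fac: "(\<Sum>s\<in>S. \<Sum>t\<in>T. \<Sum>F | F facet_of (s \<times> t). card {z \<in> F \<inter> fib l k. R z}) =
     (\<Sum>s\<in>S. \<Sum>r | r facet_of s. \<Sum>t\<in>T. card {z \<in> r \<times> t \<inter> fib l k. R z}) +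
     (\<Sum>s\<in>S. \<Sum>t\<in>T. \<Sum>r | r facet_of t. card {z \<in> s \<times> r \<inter> fib l k. R z})" for R
  proof -
    have "(\<Sum>t\<in>T. \<Sum>r | r facet_of s. card {z \<in> r \<times> t \<inter> fib l k. R z}) =
      (\<Sum>r | r facet_of s. \<Sum>t\<in>T. card {z \<in> r \<times> t \<inter> fib l k. R z})" for s :: "'a set"
      by (rule sum.swap)
    moreover have "(\<Sum>s\<in>S. \<Sum>t\<in>T. \<Sum>F | F facet_of (s \<times> t). card {z \<in> F \<inter> fib l k. R z}) =
     (\<Sum>s\<in>S. \<Sum>t\<in>T. (\<Sum>r | r facet_of s. card {z \<in> r \<times> t \<inter> fib l k. R z}) +
        (\<Sum>r | r facet_of t. card {z \<in> s \<times> r \<inter> fib l k. R z}))"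
      by (intro sum.cong refl sum_facets_Times) (use S T ne in auto)
    ultimately show ?thesis by (simp add: sum.distrib)
  qed
  have par: "even ((\<Sum>s\<in>S. \<Sum>t\<in>T. \<Sum>F | F facet_of (s \<times> t). card {z \<in> F \<inter> fib l k. R z}) +
     ((\<Sum>r\<in>bdry S. \<Sum>t\<in>T. card {z \<in> r \<times> t \<inter> fib l k. R z}) +
      (\<Sum>s\<in>S. \<Sum>r\<in>bdry T. card {z \<in> s \<times> r \<inter> fib l k. R z})))" for R
  proof -
    have 1: "even ((\<Sum>s\<in>S. \<Sum>r | r facet_of s. \<Sum>t\<in>T. card {z \<in> r \<times> t \<inter> fib l k. R z}) +
       (\<Sum>r\<in>bdry S. \<Sum>t\<in>T. card {z \<in> r \<times> t \<inter> fib l k. R z}))"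
      by (rule sum_facets_mod2) (use S in auto)
    have "even (\<Sum>s\<in>S. (\<Sum>t\<in>T. \<Sum>r | r facet_of t. card {z \<in> s \<times> r \<inter> fib l k. R z}) +
       (\<Sum>r\<in>bdry T. card {z \<in> s \<times> r \<inter> fib l k. R z}))"
      by (intro dvd_sum sum_facets_mod2) (use T in auto)
    then have 2: "even ((\<Sum>s\<in>S. \<Sum>t\<in>T. \<Sum>r | r facet_of t. card {z \<in> s \<times> r \<inter> fib l k. R z}) +
       (\<Sum>s\<in>S. \<Sum>r\<in>bdry T. card {z \<in> s \<times> r \<inter> fib l k. R z}))"
      by (simp add: sum.distrib)
    show ?thesis unfolding fac using 1 2 by presburger
  qed
  have "even (\<Sum>s\<in>S. \<Sum>t\<in>T. meet l (Suc k) s t +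
      (\<Sum>F | F facet_of (s \<times> t). card {z \<in> F \<inter> fib l k. ht l k z > 0}))"
  proof (intro dvd_sum)
    fix s t assume "s \<in> S" "t \<in> T"
    moreover have "{z \<in> s \<times> t \<inter> fib l (Suc k). True} = {z \<in> s \<times> t \<inter> fib l k. ht l k z = 0}"
      by (auto simp: fib_Suc_ht)
    ultimately show "even (meet l (Suc k) s t +
      (\<Sum>F | F facet_of (s \<times> t). card {z \<in> F \<inter> fib l k. ht l k z > 0}))"
      using crossing.zeros_eq_positive_ends[OF cr] unfolding meet_def by presburger
  qed
  then show "even ((\<Sum>s\<in>S. \<Sum>t\<in>T. meet l (Suc k) s t) +
      ((\<Sum>r\<in>bdry S. \<Sum>t\<in>T. over l k r t) + (\<Sum>s\<in>S. \<Sum>r\<in>bdry T. over l k s r)))"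
    using par[of "\<lambda>z. ht l k z > 0"] unfolding sum.distrib over_def by presburger
  have "even (\<Sum>s\<in>S. \<Sum>t\<in>T. \<Sum>F | F facet_of (s \<times> t). card {z \<in> F \<inter> fib l k. True})"
  proof (intro dvd_sum[of S] dvd_sum[of T])
    fix s t assume "s \<in> S" "t \<in> T"
    moreover have "{z \<in> F \<inter> fib l k. True} = F \<inter> fib l k" for F by blast
    ultimately show "even (\<Sum>F | F facet_of (s \<times> t). card {z \<in> F \<inter> fib l k. True})"
      using crossing.even_ends[OF cr] by simp
  qed
  then show "even ((\<Sum>r\<in>bdry S. \<Sum>t\<in>T. meet l k r t) + (\<Sum>s\<in>S. \<Sum>r\<in>bdry T. meet l k s r))"
    using par[of "\<lambda>z. True"] unfolding meet_def by presburger
qed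

definition top_cells :: "int \<Rightarrow> 'a::euclidean_space set set \<Rightarrow> 'a set set" where
  "top_cells i T = {t \<in> T. aff_dim t = i}"

lemma complex_Int:
  assumes "simplicial_complex T" "s \<in> T" "t \<in> T"
  shows "s \<inter> t \<in> T" "s \<inter> t face_of s" "s \<inter> t face_of t"
proof -
  have f: "x \<inter> y face_of x" if "x \<in> T" "y \<in> T" for x y
    using assms(1) that unfolding simplicial_complex_def by blast
  show 1: "s \<inter> t face_of s" using f assms by blast
  show "s \<inter> t face_of t" using f[of t s] assms by (simp add: Int_commute)
  show "s \<inter> t \<in> T" using 1 assms unfolding simplicial_complex_def by blast
qed

lemma complex_convex: "simplicial_complex T \<Longrightarrow> s \<in> T \<Longrightarrow> convex s"
  unfolding simplicial_complex_def using convex_simplex by blast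

text \<open>Crossings of two polyhedra are crossings of their top-dimensional cells: a product of two cells of
smaller total dimension misses the fibre, so a crossing point lies in the interior of unique cells.\<close>

lemma card_Union_crossings:
  fixes S T :: "'a::euclidean_space set set"
  assumes S: "simplicial_complex S" "\<And>s. s \<in> S \<Longrightarrow> aff_dim s \<le> i"
    and T: "simplicial_complex T" "\<And>t. t \<in> T \<Longrightarrow> aff_dim t \<le> j"
    and k: "i + j = int k" "k \<le> DIM('a)"
    and cd: "\<And>s t. s \<in> S \<Longrightarrow> t \<in> T \<Longrightarrow> cuts_down l (s \<times> t)"
  shows "finite (\<Union>S \<times> \<Union>T \<inter> fib l k)"
    and "card {z \<in> \<Union>S \<times> \<Union>T \<inter> fib l k. R z} =
      (\<Sum>s\<in>top_cells i S. \<Sum>t\<in>top_cells j T. card {z \<in> s \<times> t \<inter> fib l k. R z})"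
proof -
  have low: "s \<times> t \<inter> fib l k = {}" if "s \<in> S" "t \<in> T" "aff_dim s + aff_dim t < int k" for s t
  proof (rule ccontr)
    assume ne: "s \<times> t \<inter> fib l k \<noteq> {}"
    then have "aff_dim (s \<times> t \<inter> fib l k) \<le> aff_dim (s \<times> t) - int k"
      using cd[OF that(1,2)] k by (auto simp: cuts_down_def)
    also have "aff_dim (s \<times> t) = aff_dim s + aff_dim t" using ne by (intro aff_dim_Times) auto
    finally have "aff_dim (s \<times> t \<inter> fib l k) < 0" using that by linarith
    then show False using ne by (meson aff_dim_negative_iff)
  qed
  have fin: "finite (s \<times> t \<inter> fib l k)" if "s \<in> S" "t \<in> T" for s t
  proof (cases "s \<times> t \<inter> fib l k = {}")
    case False
    then have "aff_dim (s \<times> t \<inter> fib l k) \<le> aff_dim (s \<times> t) - int k"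
      using cd[OF that(1,2)] k by (auto simp: cuts_down_def)
    also have "aff_dim (s \<times> t) = aff_dim s + aff_dim t" using False by (intro aff_dim_Times) auto
    also have "\<dots> - int k \<le> 0" using S(2)[OF that(1)] T(2)[OF that(2)] k by linarith
    finally have "aff_dim (s \<times> t \<inter> fib l k) = 0 \<or> aff_dim (s \<times> t \<inter> fib l k) = -1"
      using aff_dim_geq[of "s \<times> t \<inter> fib l k"] by linarith
    then show ?thesis by (auto simp: aff_dim_eq_0 aff_dim_empty[symmetric])
  qed auto
  have finST: "finite S" "finite T" using S T by (auto simp: simplicial_complex_def)
  have eq: "\<Union>S \<times> \<Union>T \<inter> fib l k = (\<Union>(s,t)\<in>top_cells i S \<times> top_cells j T. s \<times> t \<inter> fib l k)"
  proof (intro equalityI subsetI)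
    fix z assume z: "z \<in> \<Union>S \<times> \<Union>T \<inter> fib l k"
    then obtain s t where st: "s \<in> S" "t \<in> T" "z \<in> s \<times> t \<inter> fib l k" by auto
    then have "\<not> aff_dim s + aff_dim t < int k" using low by blast
    then have "aff_dim s = i" "aff_dim t = j" using S(2)[OF st(1)] T(2)[OF st(2)] k by linarith+
    then show "z \<in> (\<Union>(s,t)\<in>top_cells i S \<times> top_cells j T. s \<times> t \<inter> fib l k)"
      using st by (auto simp: top_cells_def)
  qed (auto simp: top_cells_def)
  have fintop: "finite (top_cells i S)" "finite (top_cells j T)" using finST by (auto simp: top_cells_def)
  show "finite (\<Union>S \<times> \<Union>T \<inter> fib l k)" unfolding eq
    using fintop fin by (auto simp: top_cells_def)
  have disj: "(s \<times> t \<inter> fib l k) \<inter> (s' \<times> t' \<inter> fib l k) = {}"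
    if st: "s \<in> top_cells i S" "t \<in> top_cells j T" "s' \<in> top_cells i S" "t' \<in> top_cells j T" "(s, t) \<noteq> (s', t')"
    for s t s' t'
  proof -
    have mem: "s \<inter> s' \<in> S" "t \<inter> t' \<in> T" and
      fc: "s \<inter> s' face_of s" "s \<inter> s' face_of s'" "t \<inter> t' face_of t" "t \<inter> t' face_of t'"
      using st complex_Int[OF S(1), of s s'] complex_Int[OF T(1), of t t'] by (auto simp: top_cells_def)
    have cv: "convex s" "convex s'" "convex t" "convex t'"
      using st complex_convex[OF S(1)] complex_convex[OF T(1)] by (auto simp: top_cells_def)
    have d: "aff_dim s = i" "aff_dim s' = i" "aff_dim t = j" "aff_dim t' = j"
      using st by (auto simp: top_cells_def)
    have le: "aff_dim (s \<inter> s') \<le> i" "aff_dim (t \<inter> t') \<le> j" using S T mem by auto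
    have "aff_dim (s \<inter> s') + aff_dim (t \<inter> t') < int k"
    proof (cases "s = s'")
      case True
      then have "t \<inter> t' \<noteq> t \<or> t \<inter> t' \<noteq> t'" using st by auto
      then have "aff_dim (t \<inter> t') < j" using face_of_aff_dim_lt fc cv d by metis
      then show ?thesis using k le by linarith
    next
      case False
      then have "s \<inter> s' \<noteq> s \<or> s \<inter> s' \<noteq> s'" by auto
      then have "aff_dim (s \<inter> s') < i" using face_of_aff_dim_lt fc cv d by metis
      then show ?thesis using k le by linarith
    qed
    from low[OF mem this] show ?thesis by blast
  qed
  have "{z \<in> \<Union>S \<times> \<Union>T \<inter> fib l k. R z} =
      (\<Union>p\<in>top_cells i S \<times> top_cells j T. {z \<in> fst p \<times> snd p \<inter> fib l k. R z})"
    unfolding eq by auto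
  also have "card \<dots> = (\<Sum>p\<in>top_cells i S \<times> top_cells j T. card {z \<in> fst p \<times> snd p \<inter> fib l k. R z})"
  proof (rule card_UN_disjoint)
    show "\<forall>p\<in>top_cells i S \<times> top_cells j T. finite {z \<in> fst p \<times> snd p \<inter> fib l k. R z}"
    proof
      fix p assume "p \<in> top_cells i S \<times> top_cells j T"
      then have "finite (fst p \<times> snd p \<inter> fib l k)"
        by (intro fin) (auto simp: top_cells_def)
      then show "finite {z \<in> fst p \<times> snd p \<inter> fib l k. R z}" by (rule rev_finite_subset) blast
    qed
    show "\<forall>p\<in>top_cells i S \<times> top_cells j T. \<forall>q\<in>top_cells i S \<times> top_cells j T. p \<noteq> q \<longrightarrow>
       {z \<in> fst p \<times> snd p \<inter> fib l k. R z} \<inter> {z \<in> fst q \<times> snd q \<inter> fib l k. R z} = {}"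
    proof (intro ballI impI)
      fix p q assume "p \<in> top_cells i S \<times> top_cells j T" "q \<in> top_cells i S \<times> top_cells j T" "p \<noteq> q"
      then have "(fst p \<times> snd p \<inter> fib l k) \<inter> (fst q \<times> snd q \<inter> fib l k) = {}"
        by (intro disj) auto
      then show "{z \<in> fst p \<times> snd p \<inter> fib l k. R z} \<inter> {z \<in> fst q \<times> snd q \<inter> fib l k. R z} = {}" by blast
    qed
  qed (use fintop in simp)
  also have "\<dots> = (\<Sum>s\<in>top_cells i S. \<Sum>t\<in>top_cells j T. card {z \<in> s \<times> t \<inter> fib l k. R z})"
    by (simp add: sum.cartesian_product case_prod_unfold)
  finally show "card {z \<in> \<Union>S \<times> \<Union>T \<inter> fib l k. R z} =
      (\<Sum>s\<in>top_cells i S. \<Sum>t\<in>top_cells j T. card {z \<in> s \<times> t \<inter> fib l k. R z})" .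
qed

section \<open>Local structure of triangulations\<close>

lemma simplicial_complexD:
  assumes "simplicial_complex T"
  shows "finite T" "t \<in> T \<Longrightarrow> \<exists>i. i simplex t" "t \<in> T \<Longrightarrow> f face_of t \<Longrightarrow> f \<in> T"
    "t \<in> T \<Longrightarrow> polytope t" "t \<in> T \<Longrightarrow> closed t"
  using assms simplex_imp_polytope closed_simplex unfolding simplicial_complex_def by blast+

lemma complex_subset_face:
  assumes "simplicial_complex T" "r \<in> T" "t \<in> T" "r \<subseteq> t"
  shows "r face_of t"
  using complex_Int(3)[OF assms(1-3)] assms(4) by (simp add: Int_absorb2)

lemma complex_rel_interior_subset:
  assumes "simplicial_complex T" "s \<in> T" "t \<in> T" "x \<in> rel_interior s" "x \<in> t"
  shows "s \<subseteq> t"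
proof -
  have "x \<in> s" using assms(4) rel_interior_subset by blast
  then have "s \<subseteq> s \<inter> t"
    using subset_of_face_of[OF complex_Int(2)[OF assms(1-3)], of s] assms by blast
  then show ?thesis by blast
qed

lemma complex_eq_if_common_point:
  assumes T: "simplicial_complex T" "s \<in> T" "t \<in> T" and r: "r facet_of s" "r facet_of t"
    and y: "y \<in> s" "y \<in> t" "y \<notin> affine hull r"
  shows "s = t"
proof -
  have sub: "r \<subseteq> s \<inter> t" using r facet_of_imp_subset by blast
  then have "insert y r \<subseteq> s \<inter> t" using y by blast
  then have "aff_dim (insert y r) \<le> aff_dim (s \<inter> t)" by (rule aff_dim_subset)
  then have d: "aff_dim s \<le> aff_dim (s \<inter> t)" "aff_dim t \<le> aff_dim (s \<inter> t)"
    using y r by (auto simp: aff_dim_insert facet_of_def)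
  have "s \<inter> t = s"
    using face_of_aff_dim_lt[OF complex_convex[OF T(1,2)] complex_Int(2)[OF T]] d by force
  moreover have "s \<inter> t = t"
    using face_of_aff_dim_lt[OF complex_convex[OF T(1,3)] complex_Int(3)[OF T]] d by force
  ultimately show ?thesis by blast
qed

lemma facet_Int_eq:
  assumes T: "simplicial_complex T" "s \<in> T" "t \<in> T" and r: "r facet_of s" "r facet_of t"
    and "s \<noteq> t" "y \<in> s" "y \<in> t"
  shows "y \<in> r"
proof (rule ccontr)
  assume "y \<notin> r"
  moreover have "s \<inter> affine hull r = r"
    using face_of_imp_eq_affine_Int[OF complex_convex[OF T(1,2)] facet_of_imp_face_of[OF r(1)]] by blast
  ultimately have "y \<notin> affine hull r" using assms by blast
  then show False using complex_eq_if_common_point[OF T r] assms by blast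
qed

text \<open>The open star: the points of the polyhedron all of whose cells contain \<open>r\<close>.\<close>

definition star :: "'a::euclidean_space set set \<Rightarrow> 'a set \<Rightarrow> 'a set" where
  "star T r = \<Union>T - \<Union>{t \<in> T. \<not> r \<subseteq> t}"

lemma star_open:
  assumes "simplicial_complex T"
  shows "openin (top_of_set (\<Union>T)) (star T r)"
proof -
  have "closed (\<Union>{t \<in> T. \<not> r \<subseteq> t})"
    using simplicial_complexD[OF assms] by (intro closed_Union) auto
  then show ?thesis unfolding star_def by (simp add: openin_diff closedin_closed_Int
    openin_open Diff_eq) (metis open_Compl)
qed

lemma star_sub: "star T r \<subseteq> \<Union>{t \<in> T. r \<subseteq> t}"
  by (auto simp: star_def)

lemma rel_interior_sub_star:
  assumes "simplicial_complex T" "t \<in> T" "r \<subseteq> t"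
  shows "rel_interior t \<subseteq> star T r"
  using complex_rel_interior_subset[OF assms(1,2)] assms rel_interior_subset
  unfolding star_def by blast

section \<open>Subdivisions of a convex polytope\<close>

lemma rel_interior_ne:
  fixes S :: "'a::euclidean_space set"
  assumes "convex S" "S \<noteq> {}" obtains x where "x \<in> rel_interior S"
  using assms rel_interior_eq_empty by blast

text \<open>Take a line through an interior point of a wall \<open>r\<close> that is transverse to \<open>r\<close>. Each cell at \<open>r\<close> is
entered by exactly one half of the line, and each half that starts inside \<open>Q\<close> enters exactly one
cell. Both halves do so if \<open>r\<close> is an inner wall, and just one if \<open>r\<close> lies in the boundary of \<open>Q\<close>.\<close>

theorem bdry_subdivision:
  fixes Q :: "'a::euclidean_space set"
  assumes Q: "polytope Q" "aff_dim Q = i" and T: "simplicial_complex T" "\<Union>T = Q"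
  shows "bdry (top_cells i T) = {r \<in> T. r \<noteq> {} \<and> aff_dim r = i - 1 \<and> r \<subseteq> rel_frontier Q}"
proof -
  have convQ: "convex Q" using Q polytope_imp_convex by blast
  let ?S = "\<lambda>r. {s \<in> top_cells i T. r facet_of s}"
  have main: "(r \<subseteq> rel_frontier Q \<longrightarrow> card (?S r) = 1) \<and> (\<not> r \<subseteq> rel_frontier Q \<longrightarrow> card (?S r) = 2)"
    if r: "r \<in> T" "r \<noteq> {}" "aff_dim r = i - 1" for r
  proof -
    have convr: "convex r" using complex_convex[OF T(1) r(1)] .
    obtain x where x: "x \<in> rel_interior r" using rel_interior_ne[OF convr r(2)] .
    then have xr: "x \<in> r" using rel_interior_subset by blast
    have rQ: "r \<subseteq> Q" using r T by blast
    have "aff_dim r < aff_dim Q" using r Q by simp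
    then have "\<not> Q \<subseteq> affine hull r" by (metis aff_dim_affine_hull aff_dim_subset not_less)
    then obtain q where q: "q \<in> Q" "q \<notin> affine hull r" by blast
    define v where "v = q - x"
    have off: "x + c *\<^sub>R v \<notin> affine hull r" if "c \<noteq> 0" for c
    proof
      assume "x + c *\<^sub>R v \<in> affine hull r"
      moreover have "x \<in> affine hull r" using xr by (simp add: hull_inc)
      ultimately have "x + (1/c) *\<^sub>R (c *\<^sub>R v) \<in> affine hull r"
        using affine_line[OF affine_affine_hull] by blast
      then show False using that q by (simp add: v_def)
    qed
    \<comment> \<open>The cells at \<open>r\<close> on the side \<open>\<sigma> = 1\<close> or \<open>\<sigma> = -1\<close> of the line.\<close>
    define N where "N \<sigma> = {s \<in> ?S r. \<exists>c>0. x + (\<sigma> * c) *\<^sub>R v \<in> s}" for \<sigma> :: real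
    have aff: "affine hull s = affine hull Q" if "s \<in> top_cells i T" for s
      using that T Q by (metis (mono_tags, lifting) Union_upper aff_dim_eq_full_gen mem_Collect_eq top_cells_def)
    have side: "s \<in> N 1 \<or> s \<in> N (-1)" and "\<not> (s \<in> N 1 \<and> s \<in> N (-1))" if s: "s \<in> ?S r" for s
    proof -
      have convs: "convex s" using s complex_convex[OF T(1)] by (auto simp: top_cells_def)
      have fs: "r facet_of s" using s by blast
      have "x + v \<in> affine hull s" using q aff s by (auto simp: v_def hull_inc)
      then obtain e \<sigma> where e: "e > 0" "\<sigma> = 1 \<or> \<sigma> = -1" "\<And>c. 0 \<le> c \<Longrightarrow> c \<le> e \<Longrightarrow> x + (\<sigma> * c) *\<^sub>R v \<in> s"
        using facet_one_side[OF convs fs x _ ] off[of 1] by (metis scaleR_one zero_neq_one)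
      then have "x + (\<sigma> * e) *\<^sub>R v \<in> s" by simp
      then have "s \<in> N \<sigma>" using e(1) s unfolding N_def by blast
      then show "s \<in> N 1 \<or> s \<in> N (-1)" using e(2) by blast
      show "\<not> (s \<in> N 1 \<and> s \<in> N (-1))"
      proof
        assume "s \<in> N 1 \<and> s \<in> N (-1)"
        then obtain a b where "a > 0" "b > 0" "x + a *\<^sub>R v \<in> s" "x - b *\<^sub>R v \<in> s"
          unfolding N_def by auto
        then show False
          using facet_not_both_sides[OF facet_of_imp_face_of[OF fs] xr, of v a b] off[of 1] by simp
      qed
    qed
    have uniq: "s = t" if stN: "s \<in> N \<sigma>" "t \<in> N \<sigma>" and "\<sigma> = 1 \<or> \<sigma> = -1" for s t \<sigma>
    proof -
      have st: "s \<in> T" "t \<in> T" "r facet_of s" "r facet_of t" using that by (auto simp: N_def top_cells_def)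
      obtain a b where a: "a > 0" "x + (\<sigma> * a) *\<^sub>R v \<in> s" and b: "b > 0" "x + (\<sigma> * b) *\<^sub>R v \<in> t"
        using stN unfolding N_def by blast
      have sh: "x + (\<sigma> * c) *\<^sub>R v \<in> u" if "u \<in> T" "r \<subseteq> u" "0 < c" "c \<le> d" "x + (\<sigma> * d) *\<^sub>R v \<in> u" for u c d
      proof -
        have "(1 - c/d) *\<^sub>R x + (c/d) *\<^sub>R (x + (\<sigma> * d) *\<^sub>R v) \<in> u"
          using that complex_convex[OF T(1), of u] xr by (intro convexD) auto
        then show ?thesis using that by (simp add: algebra_simps)
      qed
      have m: "min a b > 0" using a b by simp
      have "x + (\<sigma> * min a b) *\<^sub>R v \<in> s" "x + (\<sigma> * min a b) *\<^sub>R v \<in> t"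
        using sh[of s "min a b" a] sh[of t "min a b" b] a b st facet_of_imp_subset by auto
      moreover have "\<sigma> * min a b \<noteq> 0" using m that by auto
      ultimately show ?thesis using complex_eq_if_common_point[OF T(1) st] off by blast
    qed
    have ex: "\<exists>s. s \<in> N \<sigma>" if \<sigma>: "\<sigma> = 1 \<or> \<sigma> = -1" and "d > 0" and inQ: "\<And>c. 0 \<le> c \<Longrightarrow> c \<le> d \<Longrightarrow> x + (\<sigma> * c) *\<^sub>R v \<in> Q" for \<sigma> d
    proof -
      \<comment> \<open>Near \<open>x\<close> the line runs inside the open star, so the cell that contains it has \<open>r\<close> as a facet.\<close>
      have "x \<in> star T r" using rel_interior_sub_star[OF T(1) r(1)] x by blast
      then obtain \<epsilon> where \<epsilon>: "\<epsilon> > 0" "ball x \<epsilon> \<inter> Q \<subseteq> star T r"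
        using star_open[OF T(1), of r] unfolding T(2) openin_contains_ball by blast
      define c where "c = min d (\<epsilon> / (2 * (norm v + 1)))"
      have c: "0 < c" "c \<le> d" using \<epsilon> \<open>d > 0\<close> by (auto simp: c_def intro!: divide_pos_pos add_nonneg_pos)
      have "c * norm v \<le> \<epsilon> / (2 * (norm v + 1)) * (norm v + 1)"
        by (intro mult_mono) (use \<epsilon> in \<open>auto simp: c_def\<close>)
      also have "\<dots> = \<epsilon> / 2" by (simp add: field_simps add_nonneg_eq_0_iff)
      finally have "c * norm v < \<epsilon>" using \<epsilon> by linarith
      then have "x + (\<sigma> * c) *\<^sub>R v \<in> ball x \<epsilon>" using \<sigma> c by (auto simp: dist_norm)
      then have "x + (\<sigma> * c) *\<^sub>R v \<in> star T r" using \<epsilon>(2) inQ[of c] c by auto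
      then obtain t where t: "t \<in> T" "r \<subseteq> t" "x + (\<sigma> * c) *\<^sub>R v \<in> t" using star_sub by blast
      have "insert (x + (\<sigma> * c) *\<^sub>R v) r \<subseteq> t" using t by blast
      then have "aff_dim (insert (x + (\<sigma> * c) *\<^sub>R v) r) \<le> aff_dim t" by (rule aff_dim_subset)
      moreover have "\<sigma> * c \<noteq> 0" using \<sigma> c(1) by auto
      then have "x + (\<sigma> * c) *\<^sub>R v \<notin> affine hull r" by (rule off)
      ultimately have "i \<le> aff_dim t" using r by (simp add: aff_dim_insert)
      moreover have "aff_dim t \<le> i" using t T Q by (metis Union_upper aff_dim_subset)
      ultimately have "t \<in> top_cells i T" using t by (simp add: top_cells_def)
      moreover from this have "r facet_of t"
        using complex_subset_face[OF T(1) r(1) t(1,2)] r by (simp add: facet_of_def top_cells_def)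
      ultimately show ?thesis using t c unfolding N_def by blast
    qed
    have S: "?S r = N 1 \<union> N (-1)" using side by (auto simp: N_def)
    have disj: "N 1 \<inter> N (-1) = {}" using \<open>\<And>s. s \<in> ?S r \<Longrightarrow> \<not> (s \<in> N 1 \<and> s \<in> N (-1))\<close> by (auto simp: N_def)
    have inward: "x + (1 * c) *\<^sub>R v \<in> Q" if "0 \<le> c" "c \<le> 1" for c
    proof -
      have "(1 - c) *\<^sub>R x + c *\<^sub>R q \<in> Q" using convQ xr rQ q that by (intro convexD) auto
      then show ?thesis by (simp add: v_def algebra_simps)
    qed
    obtain s1 where s1: "N 1 = {s1}" using ex[of 1 1, OF _ _ inward] uniq[of _ 1] by auto
    show ?thesis
    proof (cases "r \<subseteq> rel_frontier Q")
      case True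
      then have "x \<in> \<Union>{F. F facet_of Q}" using xr rel_frontier_of_polyhedron Q polytope_imp_polyhedron by blast
      then obtain F where F: "F facet_of Q" "x \<in> F" by blast
      have "r \<subseteq> F" using subset_of_face_of[OF facet_of_imp_face_of[OF F(1)] rQ] F x by blast
      then have affF: "affine hull r = affine hull F" using aff_dim_eq_full_gen[of r F] F Q r by (simp add: facet_of_def)
      have "N (-1) = {}"
      proof (rule ccontr)
        assume "N (-1) \<noteq> {}"
        then obtain s c where s: "s \<in> T" "c > 0" "x - c *\<^sub>R v \<in> s" by (auto simp: N_def top_cells_def)
        then have "x - c *\<^sub>R v \<in> Q" using T by blast
        moreover have "x + 1 *\<^sub>R v \<in> Q" using q by (simp add: v_def)
        moreover have "x + v \<notin> affine hull F" using off[of 1] affF by simp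
        ultimately show False
          using facet_not_both_sides[OF facet_of_imp_face_of[OF F(1)] F(2), of v 1 c] s by simp
      qed
      then show ?thesis using True S s1 by simp
    next
      case False
      have "x \<in> rel_interior Q"
      proof (rule ccontr)
        assume "x \<notin> rel_interior Q"
        then have "x \<in> \<Union>{F. F facet_of Q}"
          using xr rQ rel_boundary_of_polyhedron[of Q] Q polytope_imp_polyhedron by blast
        then obtain F where F: "F facet_of Q" "x \<in> F" by blast
        have "r \<subseteq> F" using subset_of_face_of[OF facet_of_imp_face_of[OF F(1)] rQ] F x by blast
        then show False using False F rel_frontier_of_polyhedron[of Q] Q polytope_imp_polyhedron by blast
      qed
      moreover have "x + v \<in> affine hull Q" using q by (simp add: v_def hull_inc)
      ultimately obtain e where e: "e > 0" "\<And>c. \<bar>c\<bar> \<le> e \<Longrightarrow> x + c *\<^sub>R v \<in> Q" using rel_interior_line by blast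
      have "x + (-1 * c) *\<^sub>R v \<in> Q" if "0 \<le> c" "c \<le> e" for c
        by (rule e(2)) (use that in simp)
      then have "\<exists>s. s \<in> N (-1)" using ex[of "-1" e] e(1) by blast
      then obtain s2 where s2: "N (-1) = {s2}" using uniq[of _ "-1"] by blast
      then have "s1 \<noteq> s2" using disj s1 by blast
      then show ?thesis using False S s1 s2 by (simp add: insert_commute)
    qed
  qed
  show ?thesis
  proof (intro set_eqI iffI)
    fix r assume r: "r \<in> bdry (top_cells i T)"
    then have "card (?S r) \<noteq> 0" unfolding bdry_def by (metis (mono_tags, lifting) even_zero mem_Collect_eq)
    then have "?S r \<noteq> {}" by (metis card.empty)
    then obtain s where s: "s \<in> T" "aff_dim s = i" "r facet_of s" by (auto simp: top_cells_def)
    then have "r \<in> T" "r \<noteq> {}" "aff_dim r = i - 1"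
      using simplicial_complexD(3)[OF T(1)] by (auto simp: facet_of_def)
    moreover from this have "r \<subseteq> rel_frontier Q" using main[of r] r by (auto simp: bdry_def)
    ultimately show "r \<in> {r \<in> T. r \<noteq> {} \<and> aff_dim r = i - 1 \<and> r \<subseteq> rel_frontier Q}" by blast
  next
    fix r assume "r \<in> {r \<in> T. r \<noteq> {} \<and> aff_dim r = i - 1 \<and> r \<subseteq> rel_frontier Q}"
    then show "r \<in> bdry (top_cells i T)" using main[of r] by (simp add: bdry_def)
  qed
qed

section \<open>Triangulations of spheres\<close>

lemma facet_coordinate:
  fixes r :: "'a::euclidean_space set"
  assumes "x \<in> affine hull r" "p \<notin> affine hull r"
  obtains a where "a \<bullet> (p - x) = 1" "\<And>f. x + f \<in> affine hull r \<Longrightarrow> a \<bullet> f = 0"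
proof -
  let ?D = "{f. x + f \<in> affine hull r}"
  have "?D = (+) (- x) ` (affine hull r)" by (force simp: image_iff)
  then have "subspace ?D" using assms(1) affine_affine_hull
    by (metis affine_diffs_subspace)
  then have spanD: "span ?D = ?D" by simp
  obtain y z where yz: "y \<in> span ?D" "\<And>w. w \<in> span ?D \<Longrightarrow> orthogonal z w" "p - x = y + z"
    using orthogonal_subspace_decomp_exists by metis
  have "z \<noteq> 0" using yz assms spanD by auto
  have "z \<bullet> (p - x) = z \<bullet> z" using yz by (simp add: inner_add_right orthogonal_def)
  then have "(z /\<^sub>R (z \<bullet> z)) \<bullet> (p - x) = 1" using \<open>z \<noteq> 0\<close> by simp
  moreover have "(z /\<^sub>R (z \<bullet> z)) \<bullet> f = 0" if "x + f \<in> affine hull r" for f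
    using yz(2)[of f] that spanD by (simp add: orthogonal_def)
  ultimately show thesis using that by blast
qed

text \<open>The convex hull of \<open>p\<close> and a disc around \<open>x\<close> in the facet contains a uniform neighbourhood of \<open>x\<close> on
the side of \<open>p\<close>.\<close>

lemma facet_corner:
  fixes s :: "'a::euclidean_space set"
  assumes s: "convex s" "r \<subseteq> s" and x: "cball x \<rho> \<inter> affine hull r \<subseteq> r" "x \<in> affine hull r" and p: "p \<in> s"
    and k: "0 \<le> k" "k \<le> 1/2" and f: "norm f \<le> \<rho> / 2" "x + f \<in> affine hull r"
  shows "x + k *\<^sub>R (p - x) + f \<in> s"
proof -
  have "norm f \<le> \<rho> * (1 - k)"
  proof -
    have "0 \<le> \<rho>" using f(1) norm_ge_zero[of f] by linarith
    then have "\<rho> * (1/2) \<le> \<rho> * (1 - k)" by (rule mult_left_mono[rotated]) (use k in simp)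
    then show ?thesis using f(1) by linarith
  qed
  then have "norm ((1 / (1 - k)) *\<^sub>R f) \<le> \<rho>" using k by (simp add: field_simps)
  then have "x + (1 / (1 - k)) *\<^sub>R f \<in> cball x \<rho>" by (simp add: dist_norm)
  moreover have "x + (1 / (1 - k)) *\<^sub>R f \<in> affine hull r" using x f by (intro affine_line) auto
  ultimately have "x + (1 / (1 - k)) *\<^sub>R f \<in> s" using x s by blast
  then have "(1 - k) *\<^sub>R (x + (1 / (1 - k)) *\<^sub>R f) + k *\<^sub>R p \<in> s"
    using s p k by (intro convexD) auto
  moreover have "(1 - k) *\<^sub>R (x + (1 / (1 - k)) *\<^sub>R f) = (1 - k) *\<^sub>R x + f" using k by (simp add: scaleR_add_right)
  ultimately show ?thesis by (simp add: algebra_simps)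
qed

lemma affine_Times:
  fixes S :: "'a::real_vector set" and T :: "'b::real_vector set"
  shows "affine S \<Longrightarrow> affine T \<Longrightarrow> affine (S \<times> T)"
  by (auto simp: affine_def)

lemma homeomorphism_inj: "homeomorphism S T h g \<Longrightarrow> inj_on h S"
  by (rule inj_on_inverseI[of S g h]) (rule homeomorphism_apply1)

text \<open>\<open>T\<close> is any triangulation of a topological \<open>n\<close>-sphere, with the relative frontier of a bounded convex
set of dimension \<open>n+1\<close> as model. The definition of the linking number refers to arbitrary
triangulations, so their homological properties are derived from the topology alone.\<close>

locale sphere_triangulation =
  fixes T :: "'a::euclidean_space set set" and \<Delta> :: "'b::euclidean_space set" and n :: nat
  assumes T: "simplicial_complex T" and hom: "\<Union>T homeomorphic rel_frontier \<Delta>"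
    and \<Delta>: "convex \<Delta>" "bounded \<Delta>" "aff_dim \<Delta> = int n + 1"
begin

text \<open>The frontier of \<open>\<Delta>\<close> has codimension 1, so it contains no open subset of the hull.\<close>

lemma no_open_in_hull:
  assumes "openin (top_of_set (affine hull \<Delta>)) W" "W \<subseteq> rel_frontier \<Delta>"
  shows "W = {}"
proof -
  have "W \<subseteq> closure \<Delta>" using assms(2) by (auto simp: rel_frontier_def)
  moreover have "affine hull closure \<Delta> = affine hull \<Delta>" by simp
  ultimately have "W \<subseteq> rel_interior (closure \<Delta>)" using assms(1) rel_interior_maximal by metis
  also have "\<dots> = rel_interior \<Delta>" using \<Delta> by (simp add: convex_rel_interior_closure)
  finally show ?thesis using assms(2) by (auto simp: rel_frontier_def)
qed

lemma Union_ne: "\<Union>T \<noteq> {}"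
proof
  assume "\<Union>T = {}"
  then have "rel_frontier \<Delta> = {}" using hom by (metis homeomorphic_empty)
  then have "affine \<Delta>" using rel_frontier_eq_empty by blast
  then have "\<Delta> = {} \<or> (\<exists>a. \<Delta> = {a})" using \<Delta>(2) affine_bounded_eq_trivial by blast
  then show False using \<Delta>(3) by auto
qed

text \<open>By invariance of domain, the image of the interior of a simplex of larger dimension would be open in
the hull of \<open>\<Delta>\<close>.\<close>

lemma dim_le: assumes "t \<in> T" shows "aff_dim t \<le> int n"
proof (rule ccontr)
  assume "\<not> ?thesis"
  then have d: "aff_dim (affine hull \<Delta>) \<le> aff_dim (affine hull t)" using \<Delta> by simp
  obtain h g where hg: "homeomorphism (\<Union>T) (rel_frontier \<Delta>) h g" using hom homeomorphic_def by blast
  have sub: "rel_interior t \<subseteq> \<Union>T" using assms rel_interior_subset by blast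
  have "openin (top_of_set (affine hull \<Delta>)) (h ` rel_interior t)"
  proof (rule invariance_of_domain_affine_sets[OF openin_rel_interior _ _ d])
    show "continuous_on (rel_interior t) h" using hg sub continuous_on_subset homeomorphism_cont1 by blast
    have "h ` rel_interior t \<subseteq> rel_frontier \<Delta>" using hg sub homeomorphism_image1 by blast
    also have "\<dots> \<subseteq> closure \<Delta>" by (auto simp: rel_frontier_def)
    also have "\<dots> \<subseteq> affine hull \<Delta>" by (rule closure_affine_hull)
    finally show "h \<in> rel_interior t \<rightarrow> affine hull \<Delta>" by blast
    show "inj_on h (rel_interior t)" by (rule inj_on_subset[OF homeomorphism_inj[OF hg] sub])
  qed auto
  moreover have "h ` rel_interior t \<subseteq> rel_frontier \<Delta>" using hg sub homeomorphism_image1 by blast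
  ultimately have "rel_interior t = {}" using no_open_in_hull by blast
  then have "t = {}" using complex_convex[OF T assms] rel_interior_eq_empty by blast
  then show False using \<open>\<not> aff_dim t \<le> int n\<close> by simp
qed

text \<open>A nonempty open set of the sphere cannot be mapped injectively to a flat of dimension less than \<open>n\<close>.
Invariance of domain is applied to the product of the flat with a line: the image would be open
there, though it has no extent in the direction of the line.\<close>

lemma star_open_in_affine:
  assumes "star T r \<subseteq> affine hull s" "aff_dim s < int n"
  shows "star T r = {}"
proof (rule ccontr)
  assume ne: "star T r \<noteq> {}"
  obtain h g where hg: "homeomorphism (\<Union>T) (rel_frontier \<Delta>) h g" using hom homeomorphic_def by blast
  let ?U = "star T r" and ?V = "(affine hull s) \<times> (UNIV :: real set)"
  have UT: "?U \<subseteq> \<Union>T" by (auto simp: star_def)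
  have op: "openin (top_of_set (rel_frontier \<Delta>)) (h ` ?U)"
    using homeomorphism_imp_open_map[OF hg star_open[OF T]] .
  have gh: "g (h x) = x" if "x \<in> ?U" for x using hg UT that by (meson homeomorphism_apply1 subsetD)
  let ?f = "\<lambda>y. (g y, 0::real)"
  have "affine hull s \<noteq> {}" using ne assms by blast
  then have "aff_dim ?V = aff_dim s + 1" by (simp add: aff_dim_Times)
  then have dV: "aff_dim ?V < aff_dim \<Delta>" using assms \<Delta> by simp
  have affV: "affine ?V"
    by (intro affine_Times affine_affine_hull affine_UNIV)
  have "openin (top_of_set ?V) (?f ` h ` ?U)"
  proof (rule invariance_of_domain_sphere_affine_set_gen[OF _ _ _ \<Delta>(2,1) affV dV op])
    have "h ` ?U \<subseteq> rel_frontier \<Delta>" using op openin_imp_subset by blast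
    then have "continuous_on (h ` ?U) g" using hg homeomorphism_cont2 continuous_on_subset by blast
    then show "continuous_on (h ` ?U) ?f" by (intro continuous_intros)
    show "inj_on ?f (h ` ?U)"
    proof (rule inj_onI)
      fix y z assume "y \<in> h ` ?U" "z \<in> h ` ?U" and eq: "?f y = ?f z"
      then obtain a b where "a \<in> ?U" "y = h a" "b \<in> ?U" "z = h b" by blast
      then show "y = z" using gh eq by simp
    qed
    show "?f \<in> h ` ?U \<rightarrow> ?V"
    proof
      fix y assume "y \<in> h ` ?U"
      then obtain x where x: "x \<in> ?U" "y = h x" by blast
      have "x \<in> affine hull s" using assms(1) x(1) by (rule subsetD)
      moreover have "g y = x" unfolding x(2) by (rule gh[OF x(1)])
      ultimately have "g y \<in> affine hull s" by (simp only:)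
      then show "?f y \<in> ?V" by (simp add: mem_Times_iff)
    qed
  qed
  moreover have "?f ` h ` ?U = ?U \<times> {0}"
  proof -
    have "?f ` h ` ?U = (\<lambda>x. (x, 0)) ` ?U" unfolding image_image by (rule image_cong) (simp_all add: gh)
    then show ?thesis by blast
  qed
  ultimately have opU: "openin (top_of_set ?V) (?U \<times> {0})" by simp
  obtain x where x: "x \<in> ?U" using ne by blast
  then obtain e where e: "e > 0" "ball (x, 0::real) e \<inter> ?V \<subseteq> ?U \<times> {0}"
    using opU unfolding openin_contains_ball by blast
  have "(x, e/2) \<in> ball (x, 0::real) e" using e by (simp add: dist_Pair_Pair)
  moreover have "(x, e/2) \<in> ?V" using x assms(1) by blast
  ultimately show False using e by auto
qed

text \<open>The open star of a maximal simplex is contained in this simplex, and it is open in the sphere.\<close>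

lemma pure:
  assumes "t \<in> T"
  obtains s where "s \<in> T" "t \<subseteq> s" "aff_dim s = int n"
proof -
  have exmax: "\<exists>s\<in>T. t \<subseteq> s \<and> s \<noteq> {} \<and> (\<forall>u\<in>T. s \<subseteq> u \<longrightarrow> u = s)"
  proof -
    have finT: "finite T" using simplicial_complexD(1)[OF T] .
    obtain m where m: "m \<in> T" "t \<subseteq> m" "\<forall>u\<in>T. m \<subseteq> u \<longrightarrow> u = m"
      using finite_has_maximal2[OF finT assms] by metis
    show ?thesis
    proof (cases "m = {}")
      case True
      then show ?thesis using m Union_ne by blast
    qed (use m in blast)
  qed
  then obtain s where s: "s \<in> T" "t \<subseteq> s" "s \<noteq> {}" "\<And>u. u \<in> T \<Longrightarrow> s \<subseteq> u \<Longrightarrow> u = s" by blast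
  have "star T s \<subseteq> s" using star_sub[of T s] s by blast
  then have sub: "star T s \<subseteq> affine hull s" using hull_subset by (metis order_trans)
  have "rel_interior s \<noteq> {}" using s complex_convex[OF T] rel_interior_eq_empty by blast
  then have "star T s \<noteq> {}" using rel_interior_sub_star[OF T s(1), of s] by auto
  then have "\<not> aff_dim s < int n" using star_open_in_affine[OF sub] by blast
  then have "aff_dim s = int n" using dim_le[OF s(1)] by simp
  then show thesis using that s by blast
qed

text \<open>If \<open>s\<close> were the only cell at its facet \<open>r\<close>, the open star of \<open>r\<close> would be a subset of \<open>s\<close>. By invariance of
domain it would be open in the hull of \<open>s\<close>, but it contains boundary points of \<open>s\<close>.\<close>

lemma second_cell:
  assumes s: "s \<in> T" "aff_dim s = int n" and r: "r facet_of s"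
  shows "\<exists>s'\<in>T. s' \<noteq> s \<and> aff_dim s' = int n \<and> r facet_of s'"
proof (rule ccontr)
  assume none: "\<not> ?thesis"
  obtain h g where hg: "homeomorphism (\<Union>T) (rel_frontier \<Delta>) h g" using hom homeomorphic_def by blast
  have rT: "r \<in> T" using simplicial_complexD(3)[OF T s(1)] r facet_of_imp_face_of by blast
  let ?U = "star T r"
  have "t \<subseteq> s" if t: "t \<in> T" "r \<subseteq> t" for t
  proof -
    have f: "r face_of t" using complex_subset_face[OF T rT t] .
    show ?thesis
    proof (cases "t = r")
      case False
      then have "aff_dim r < aff_dim t" using face_of_aff_dim_lt[OF complex_convex[OF T t(1)] f] by simp
      then have "aff_dim t = int n" using dim_le[OF t(1)] r s by (simp add: facet_of_def)
      moreover from this have "r facet_of t" using f r s by (simp add: facet_of_def)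
      ultimately show ?thesis using none t by blast
    qed (use r facet_of_imp_subset in blast)
  qed
  then have Us: "?U \<subseteq> s" using star_sub[of T r] by blast
  have UT: "?U \<subseteq> \<Union>T" by (auto simp: star_def)
  have op: "openin (top_of_set (rel_frontier \<Delta>)) (h ` ?U)"
    using homeomorphism_imp_open_map[OF hg star_open[OF T]] .
  have gh: "g (h x) = x" if "x \<in> ?U" for x using hg UT that by (meson homeomorphism_apply1 subsetD)
  have dV: "aff_dim (affine hull s) < aff_dim \<Delta>" using s \<Delta> by simp
  have "openin (top_of_set (affine hull s)) (g ` h ` ?U)"
  proof (rule invariance_of_domain_sphere_affine_set_gen[OF _ _ _ \<Delta>(2,1) affine_affine_hull dV op])
    have "h ` ?U \<subseteq> rel_frontier \<Delta>" using op openin_imp_subset by blast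
    then show "continuous_on (h ` ?U) g" using hg homeomorphism_cont2 continuous_on_subset by blast
    show "inj_on g (h ` ?U)" by (auto simp: inj_on_def gh)
    show "g \<in> h ` ?U \<rightarrow> affine hull s" using Us by (auto simp: gh hull_inc)
  qed
  moreover have "g ` h ` ?U = ?U" using gh by (force simp: image_iff)
  ultimately have "?U \<subseteq> rel_interior s" using Us by (simp add: rel_interior_maximal)
  moreover have "rel_interior r \<subseteq> ?U" using rel_interior_sub_star[OF T rT] by blast
  moreover have "r \<inter> rel_interior s = {}"
    using r s face_of_disjoint_rel_interior[of r s] facet_of_imp_face_of by (metis facet_of_irrefl)
  ultimately have "rel_interior r = {}" using rel_interior_subset by blast
  then show False using complex_convex[OF T rT] r rel_interior_eq_empty by (auto simp: facet_of_def)
qed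

text \<open>Two cells \<open>s1\<close> and \<open>s2\<close> at \<open>r\<close> contain an \<open>n\<close>-ball around an interior point \<open>x\<close> of \<open>r\<close>, obtained by
bending a ball in the hull of \<open>s1\<close> along \<open>r\<close> into \<open>s2\<close>. By invariance of domain this ball is open in the
sphere, so points of a third cell near \<open>x\<close> would have to lie in \<open>s1\<close> or \<open>s2\<close>.\<close>

lemma no_third_cell:
  assumes s1: "s1 \<in> T" "aff_dim s1 = int n" "r facet_of s1"
    and s2: "s2 \<in> T" "aff_dim s2 = int n" "r facet_of s2"
    and s3: "s3 \<in> T" "aff_dim s3 = int n" "r facet_of s3"
    and ne: "s1 \<noteq> s2" "s1 \<noteq> s3" "s2 \<noteq> s3"
  shows False
proof -
  obtain h g where hg: "homeomorphism (\<Union>T) (rel_frontier \<Delta>) h g" using hom homeomorphic_def by blast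
  have rT: "r \<in> T" using simplicial_complexD(3)[OF T s1(1)] s1 facet_of_imp_face_of by blast
  have cv: "convex s1" "convex s2" "convex s3" "convex r" using complex_convex[OF T] s1 s2 s3 rT by auto
  have rs: "r \<subseteq> s1" "r \<subseteq> s2" "r \<subseteq> s3" using s1 s2 s3 facet_of_imp_subset by auto
  obtain x where x: "x \<in> rel_interior r"
    using rel_interior_ne[OF cv(4)] s1 by (auto simp: facet_of_def)
  then obtain \<rho> where \<rho>: "\<rho> > 0" "cball x \<rho> \<inter> affine hull r \<subseteq> r"
    unfolding mem_rel_interior_cball by blast
  have xr: "x \<in> r" "x \<in> affine hull r" using x rel_interior_subset rel_interior_affine_hull by blast+
  obtain p1 where p1: "p1 \<in> s1" "p1 \<notin> affine hull r" using facet_off_point[OF cv(1) s1(3)] .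
  obtain p2 where p2: "p2 \<in> s2" "p2 \<notin> affine hull r" using facet_off_point[OF cv(2) s2(3)] .
  obtain a where a: "a \<bullet> (p1 - x) = 1" "\<And>f. x + f \<in> affine hull r \<Longrightarrow> a \<bullet> f = 0"
    using facet_coordinate[OF xr(2) p1(2)] by blast
  \<comment> \<open>\<open>\<phi>\<close> is the coordinate transverse to \<open>r\<close>, with value 1 at \<open>p1\<close>; \<open>rest\<close> is the component along \<open>r\<close>. \<open>G\<close> is the identity where \<open>\<phi> \<ge> 0\<close> and replaces \<open>- (p1 - x)\<close> by \<open>p2 - x\<close> where \<open>\<phi> < 0\<close>, which bends the ball \<open>B\<close> into \<open>s1\<close> and \<open>s2\<close>.\<close>
  define \<phi> where "\<phi> y = a \<bullet> (y - x)" for y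
  define rest where "rest y = (y - x) - \<phi> y *\<^sub>R (p1 - x)" for y
  define G where "G y = y + max 0 (- \<phi> y) *\<^sub>R ((p1 - x) + (p2 - x))" for y
  define B where "B = affine hull s1 \<inter> {y. \<bar>\<phi> y\<bar> < 1/2 \<and> norm (rest y) < \<rho> / 2}"
  have cont\<phi>: "continuous_on UNIV \<phi>" unfolding \<phi>_def by (intro continuous_intros)
  then have contr: "continuous_on UNIV rest" and contG: "continuous_on UNIV G"
    unfolding rest_def G_def by (auto intro!: continuous_intros)
  have "open {y. \<bar>\<phi> y\<bar> < 1/2 \<and> norm (rest y) < \<rho> / 2}"
    by (intro open_Collect_conj open_Collect_less continuous_intros cont\<phi> contr)
  then have opB: "openin (top_of_set (affine hull s1)) B" unfolding B_def by (auto simp: openin_open)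
  have rest: "x + rest y \<in> affine hull r" if y: "y \<in> affine hull s1" for y
  proof -
    have y': "x + (y - x) \<in> affine hull s1" using y by simp
    obtain k f where kf: "y - x = k *\<^sub>R (p1 - x) + f" "x + f \<in> affine hull r"
      using facet_direction[OF cv(1) s1(3) xr(2) p1 y'] by blast
    have "\<phi> y = k" unfolding \<phi>_def kf(1) using a(1) a(2)[OF kf(2)] by (simp add: inner_add_right)
    then have "rest y = f" unfolding rest_def kf(1) by simp
    then show ?thesis using kf by simp
  qed
  have Gpos: "G y = y" if "\<phi> y \<ge> 0" for y using that by (simp add: G_def max_def)
  have Gneg: "G y = x + (- \<phi> y) *\<^sub>R (p2 - x) + rest y" if "\<phi> y < 0" for y
    using that by (simp add: G_def rest_def algebra_simps)
  have ydec: "y = x + \<phi> y *\<^sub>R (p1 - x) + rest y" for y by (simp add: rest_def)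
  have BD: "y \<in> affine hull s1" "\<bar>\<phi> y\<bar> < 1/2" "norm (rest y) < \<rho> / 2" if "y \<in> B" for y
    using that by (auto simp: B_def)
  have G1: "G y \<in> s1" if "y \<in> B" "\<phi> y \<ge> 0" for y
  proof -
    have "x + \<phi> y *\<^sub>R (p1 - x) + rest y \<in> s1"
      by (rule facet_corner[OF cv(1) rs(1) \<rho>(2) xr(2) p1(1)]) (use that rest[OF BD(1)] BD[of y] in auto)
    then show ?thesis using Gpos that ydec by metis
  qed
  have G2: "G y \<in> s2" if "y \<in> B" "\<phi> y < 0" for y
  proof -
    have "x + (- \<phi> y) *\<^sub>R (p2 - x) + rest y \<in> s2"
      by (rule facet_corner[OF cv(2) rs(2) \<rho>(2) xr(2) p2(1)]) (use that rest[OF BD(1)] BD[of y] in auto)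
    then show ?thesis using Gneg that by metis
  qed
  obtain b where b: "b \<bullet> (p2 - x) = 1" "\<And>f. x + f \<in> affine hull r \<Longrightarrow> b \<bullet> f = 0"
    using facet_coordinate[OF xr(2) p2(2)] by blast
  have Gb: "b \<bullet> (G y - x) = - \<phi> y" if "y \<in> B" "\<phi> y < 0" for y
    using Gneg[OF that(2)] b(1) b(2)[OF rest[OF BD(1)[OF that(1)]]]
    by (simp add: inner_add_right inner_diff_right del: add_diff_eq)
  have mixed: "G y \<noteq> G y'" if "y \<in> B" "y' \<in> B" "\<phi> y \<ge> 0" "\<phi> y' < 0" for y y'
  proof
    assume eq: "G y = G y'"
    then have "G y' \<in> s1" "G y' \<in> s2" using G1[OF that(1,3)] G2[OF that(2,4)] by auto
    then have "G y' \<in> r" using facet_Int_eq[OF T s1(1) s2(1) s1(3) s2(3) ne(1)] by blast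
    then have "b \<bullet> (G y' - x) = 0" using b(2)[of "G y' - x"] by (simp add: hull_inc)
    then show False using Gb that by simp
  qed
  have injG: "inj_on G B"
  proof (rule inj_onI)
    fix y y' assume yy: "y \<in> B" "y' \<in> B" "G y = G y'"
    consider "\<phi> y \<ge> 0" "\<phi> y' \<ge> 0" | "\<phi> y < 0" "\<phi> y' < 0" | "\<phi> y \<ge> 0" "\<phi> y' < 0" | "\<phi> y < 0" "\<phi> y' \<ge> 0" by linarith
    then show "y = y'"
    proof cases
      case 1 then show ?thesis using Gpos yy by metis
    next
      case 2
      then have "\<phi> y = \<phi> y'" using Gb yy by (metis neg_equal_iff_equal)
      moreover from this have "rest y = rest y'" using Gneg 2 yy by (metis add_left_cancel)
      ultimately show ?thesis using ydec by metis
    next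
      case 3 then show ?thesis using mixed yy by metis
    next
      case 4 then show ?thesis using mixed yy by metis
    qed
  qed
  have GT: "G ` B \<subseteq> s1 \<union> s2" using G1 G2 by (metis Un_iff image_subsetI not_le)
  then have GT': "G ` B \<subseteq> \<Union>T" using s1 s2 by blast
  obtain q where q: "q \<in> rel_interior s3" using rel_interior_ne[OF cv(3)] s3 rs xr by blast
  have ri3: "rel_interior s3 \<inter> (s1 \<union> s2) = {}"
  proof -
    have "s3 \<subseteq> s1 \<or> s3 \<subseteq> s2" if "y \<in> rel_interior s3" "y \<in> s1 \<union> s2" for y
      using complex_rel_interior_subset[OF T s3(1)] s1(1) s2(1) that by blast
    moreover have "\<not> s3 \<subseteq> s1" "\<not> s3 \<subseteq> s2"
      using face_of_aff_dim_lt[OF cv(1) complex_subset_face[OF T s3(1) s1(1)]]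
        face_of_aff_dim_lt[OF cv(2) complex_subset_face[OF T s3(1) s2(1)]] s1 s2 s3 ne by auto
    ultimately show ?thesis by blast
  qed
  have qT: "q \<in> \<Union>T" using q rel_interior_subset s3 by blast
  have hq: "h q \<in> rel_frontier \<Delta>" using hg qT homeomorphism_image1 by blast
  have "\<Delta> \<noteq> {}" using \<Delta> by auto
  \<comment> \<open>Without the point \<open>h q\<close> the sphere is an \<open>n\<close>-dimensional flat, where invariance of domain applies.\<close>
  obtain V :: "'b set" where V: "affine V" "aff_dim V = int n"
  proof -
    obtain V :: "'b set" where "affine V" "V \<subseteq> UNIV" "aff_dim V = int n"
      using choose_affine_subset[of "UNIV :: 'b set" "int n"] \<Delta> aff_dim_subset[of \<Delta> UNIV] by auto
    then show thesis using that by blast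
  qed
  have "rel_frontier \<Delta> - {h q} homeomorphic V"
    by (rule homeomorphic_punctured_sphere_affine_gen[OF \<Delta>(1,2) hq V(1)]) (use \<Delta> V in simp)
  then obtain \<theta> \<psi> where \<theta>: "homeomorphism (rel_frontier \<Delta> - {h q}) V \<theta> \<psi>" using homeomorphic_def by blast
  have injh: "inj_on h (\<Union>T)" using hg by (rule homeomorphism_inj)
  have hGsub: "h ` G ` B \<subseteq> rel_frontier \<Delta> - {h q}"
  proof
    fix y assume "y \<in> h ` G ` B"
    then obtain w where w: "w \<in> G ` B" "y = h w" by blast
    then have "w \<noteq> q" using GT ri3 q by blast
    then have "h w \<noteq> h q" using injh w GT' qT by (metis inj_onD subsetD)
    moreover have "h w \<in> rel_frontier \<Delta>" using hg w GT' homeomorphism_image1 by blast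
    ultimately show "y \<in> rel_frontier \<Delta> - {h q}" unfolding w(2) by simp
  qed
  have opV: "openin (top_of_set V) ((\<theta> \<circ> h \<circ> G) ` B)"
  proof (rule invariance_of_domain_affine_sets[OF opB affine_affine_hull V(1)])
    show "aff_dim V \<le> aff_dim (affine hull s1)" using V s1 by simp
    show "continuous_on B (\<theta> \<circ> h \<circ> G)"
    proof (intro continuous_on_compose)
      show "continuous_on B G" using contG continuous_on_subset by blast
      show "continuous_on (G ` B) h" using hg GT' continuous_on_subset homeomorphism_cont1 by blast
      show "continuous_on (h ` G ` B) \<theta>" by (rule continuous_on_subset[OF homeomorphism_cont1[OF \<theta>] hGsub])
    qed
    show "\<theta> \<circ> h \<circ> G \<in> B \<rightarrow> V"
    proof
      fix y assume "y \<in> B"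
      then have "h (G y) \<in> rel_frontier \<Delta> - {h q}" using hGsub by blast
      then show "(\<theta> \<circ> h \<circ> G) y \<in> V" using homeomorphism_image1[OF \<theta>] by auto
    qed
    have inj\<theta>: "inj_on \<theta> (h ` G ` B)" by (rule inj_on_subset[OF homeomorphism_inj[OF \<theta>] hGsub])
    have "inj_on (h \<circ> G) B" by (rule comp_inj_on[OF injG inj_on_subset[OF injh GT']])
    then have "inj_on (\<theta> \<circ> (h \<circ> G)) B" by (rule comp_inj_on) (use inj\<theta> in \<open>simp add: image_comp\<close>)
    then show "inj_on (\<theta> \<circ> h \<circ> G) B" by (simp add: comp_assoc)
  qed
  have "\<psi> ` (\<theta> \<circ> h \<circ> G) ` B = h ` G ` B"
  proof -
    have "\<psi> (\<theta> y) = y" if "y \<in> h ` G ` B" for y using \<theta> hGsub that by (meson homeomorphism_apply1 subsetD)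
    then have "(\<lambda>y. \<psi> (\<theta> y)) ` h ` G ` B = (\<lambda>y. y) ` h ` G ` B" by (rule image_cong[OF refl])
    then show ?thesis by (simp add: image_image)
  qed
  moreover have "openin (top_of_set (rel_frontier \<Delta> - {h q})) (\<psi> ` (\<theta> \<circ> h \<circ> G) ` B)"
    using homeomorphism_imp_open_map[OF _ opV, of "rel_frontier \<Delta> - {h q}" \<psi> \<theta>] \<theta> homeomorphism_symD by blast
  ultimately have "openin (top_of_set (rel_frontier \<Delta> - {h q})) (h ` G ` B)" by simp
  moreover have "openin (top_of_set (rel_frontier \<Delta>)) (rel_frontier \<Delta> - {h q})" by (simp add: openin_delete)
  ultimately have "openin (top_of_set (rel_frontier \<Delta>)) (h ` G ` B)" using openin_trans by blast
  then have "openin (top_of_set (\<Union>T)) (g ` h ` G ` B)"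
    using homeomorphism_imp_open_map[of "rel_frontier \<Delta>" "\<Union>T" g h] hg homeomorphism_symD by blast
  moreover have "g ` h ` G ` B = G ` B"
  proof -
    have "g (h y) = y" if "y \<in> G ` B" for y using hg GT' that by (meson homeomorphism_apply1 subsetD)
    then have "(\<lambda>y. g (h y)) ` G ` B = (\<lambda>y. y) ` G ` B" by (rule image_cong[OF refl])
    then show ?thesis by (simp add: image_image)
  qed
  ultimately have opGB: "openin (top_of_set (\<Union>T)) (G ` B)" by simp
  have "x \<in> G ` B"
  proof -
    have "x \<in> affine hull s1" using xr rs by (meson hull_inc subsetD)
    then have "x \<in> B" using \<rho> by (simp add: B_def \<phi>_def rest_def)
    moreover have "G x = x" by (intro Gpos) (simp add: \<phi>_def)
    ultimately show ?thesis by (metis image_eqI)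
  qed
  then obtain e where e: "e > 0" "ball x e \<inter> \<Union>T \<subseteq> G ` B"
    using opGB unfolding openin_contains_ball by blast
  \<comment> \<open>A point of \<open>s3\<close> on the segment from \<open>x\<close> to \<open>q\<close>, so close to \<open>x\<close> that it should lie in the ball.\<close>
  define c where "c = min (1::real) (e / (2 * (norm (q - x) + 1)))"
  have c: "0 < c" "c \<le> 1" using e by (auto simp: c_def intro!: divide_pos_pos add_nonneg_pos)
  have "c * norm (q - x) \<le> e / (2 * (norm (q - x) + 1)) * (norm (q - x) + 1)"
    by (intro mult_mono) (use e in \<open>auto simp: c_def\<close>)
  also have "\<dots> = e / 2" by (simp add: field_simps add_nonneg_eq_0_iff)
  finally have "c * norm (q - x) < e" using e by linarith
  then have "x + c *\<^sub>R (q - x) \<in> ball x e" using c by (simp add: dist_norm)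
  moreover have ri: "x + c *\<^sub>R (q - x) \<in> rel_interior s3"
  proof -
    have "x - c *\<^sub>R (x - q) \<in> rel_interior s3"
      by (rule rel_interior_convex_shrink[OF cv(3) q]) (use xr rs c in auto)
    then show ?thesis by (simp add: algebra_simps)
  qed
  ultimately have "x + c *\<^sub>R (q - x) \<in> G ` B" using e s3 rel_interior_subset by blast
  then show False using GT ri ri3 by blast
qed

lemma cells_at_facet:
  assumes "s \<in> T" "aff_dim s = int n" "r facet_of s"
  shows "card {s \<in> top_cells n T. r facet_of s} = 2"
proof -
  obtain s' where s': "s' \<in> T" "s' \<noteq> s" "aff_dim s' = int n" "r facet_of s'"
    using second_cell[OF assms] by blast
  have "{s \<in> top_cells n T. r facet_of s} = {s, s'}"
    using assms s' no_third_cell[OF assms s'(1,3,4)] by (auto simp: top_cells_def)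
  then show ?thesis using s' by simp
qed

lemma bdry_empty: "bdry (top_cells n T) = {}"
proof (rule ccontr)
  assume "bdry (top_cells n T) \<noteq> {}"
  then obtain r where r: "odd (card {s \<in> top_cells n T. r facet_of s})" by (auto simp: bdry_def)
  then have "{s \<in> top_cells n T. r facet_of s} \<noteq> {}" by (metis card.empty even_zero)
  then obtain s where "s \<in> T" "aff_dim s = int n" "r facet_of s" by (auto simp: top_cells_def)
  then show False using cells_at_facet r by simp
qed

end

section \<open>Linking numbers as crossing numbers\<close>

lemma even_add_mod2: "even (a + b) \<longleftrightarrow> a mod 2 = b mod (2::nat)"
  by presburger

text \<open>The properties of \<open>n\<close>-spheres that the linking number needs, for all triangulations at once
because the chains in \<open>lk2\<close> may be bounded by any triangulation.\<close>

definition cycle_set :: "nat \<Rightarrow> 'a::euclidean_space set \<Rightarrow> bool" where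
  "cycle_set n Y \<longleftrightarrow> (\<exists>T. simplicial_complex T \<and> \<Union>T = Y) \<and>
     (\<forall>T. simplicial_complex T \<longrightarrow> \<Union>T = Y \<longrightarrow> (\<forall>t\<in>T. aff_dim t \<le> int n) \<and> bdry (top_cells n T) = {})"

lemma cycle_setD:
  assumes "cycle_set n (\<Union>T)" "simplicial_complex T"
  shows "t \<in> T \<Longrightarrow> aff_dim t \<le> int n" "bdry (top_cells n T) = {}"
  using assms unfolding cycle_set_def by blast+

lemma face_of_simplex:
  assumes "i simplex c" "f face_of c" shows "aff_dim f simplex f"
proof -
  obtain V where V: "\<not> affine_dependent V" "c = convex hull V" using assms(1) by (auto simp: simplex)
  then obtain W where W: "W \<subseteq> V" "f = convex hull W"
    using assms(2) by (auto simp: face_of_convex_hull_affine_independent)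
  then have "\<not> affine_dependent W" using V affine_independent_subset by blast
  moreover from this have "int (card W) = aff_dim f + 1"
    using W by (simp add: aff_dim_convex_hull affine_independent_iff_card)
  ultimately show ?thesis using W unfolding simplex_def by blast
qed

lemma complex_simplex: "simplicial_complex T \<Longrightarrow> t \<in> T \<Longrightarrow> aff_dim t simplex t"
  by (metis simplicial_complexD(2) aff_dim_simplex)

lemma mod2_boundary_eq_bdry:
  assumes "\<And>c. c \<in> C \<Longrightarrow> (int n + 1) simplex c"
  shows "mod2_boundary n C = bdry C"
proof -
  have eq: "{c \<in> C. s face_of c} = {c \<in> C. s facet_of c}" if s: "int n simplex s" for s
  proof -
    have "s face_of c \<longleftrightarrow> s facet_of c" if "c \<in> C" for c
      using aff_dim_simplex[OF s] aff_dim_simplex[OF assms[OF that]] by (auto simp: facet_of_def)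
    then show ?thesis by blast
  qed
  show ?thesis
  proof (intro set_eqI iffI)
    fix s assume "s \<in> mod2_boundary n C"
    then have "int n simplex s" "odd (card {c \<in> C. s face_of c})" by (auto simp: mod2_boundary_def)
    then show "s \<in> bdry C" unfolding bdry_def by (simp only: eq mem_Collect_eq not_False_eq_True)
  next
    fix s assume s: "s \<in> bdry C"
    then have "card {c \<in> C. s facet_of c} \<noteq> 0" unfolding bdry_def by (metis (mono_tags, lifting) even_zero mem_Collect_eq)
    then have "{c \<in> C. s facet_of c} \<noteq> {}" by (metis card.empty)
    then obtain c where c: "c \<in> C" "s facet_of c" by blast
    then have "aff_dim s simplex s" using face_of_simplex[OF assms] facet_of_imp_face_of by blast
    moreover have "aff_dim s = int n" using c aff_dim_simplex[OF assms[OF c(1)]] by (simp add: facet_of_def)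
    ultimately have "int n simplex s" by simp
    then show "s \<in> mod2_boundary n C" using s eq by (simp add: mod2_boundary_def bdry_def)
  qed
qed

lemma simplices_top: "simplicial_complex T \<Longrightarrow> {s \<in> T. int n simplex s} = top_cells n T"
  using complex_simplex aff_dim_simplex unfolding top_cells_def by fastforce

lemma finite_convex_single:
  fixes S :: "'a::euclidean_space set"
  assumes "finite S" "convex S" "x \<in> S" "y \<in> S"
  shows "x = y"
proof (rule ccontr)
  assume "x \<noteq> y"
  then have "uncountable (closed_segment x y)" by (rule uncountable_closed_segment)
  moreover have "closed_segment x y \<subseteq> S" using assms closed_segment_subset by blast
  ultimately show False using assms(1) countable_finite countable_subset by blast
qed

text \<open>Cells \<open>c\<close>, \<open>t\<close> of complementary dimension may meet, as long as they cross transversely: an interior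
common point moves inside the fibre along a line, which leaves the diagonal because \<open>c\<close> and \<open>t\<close> have no
segment in common.\<close>

lemma admissible_transverse:
  fixes c t :: "'a::euclidean_space set"
  assumes c: "convex c" and t: "convex t" and d: "aff_dim c + aff_dim t = int DIM('a)"
    and fin: "finite (c \<inter> t)" and ri: "c \<inter> t \<subseteq> rel_interior c" "c \<inter> t \<subseteq> rel_interior t"
  shows "admissible (c \<times> t)"
  unfolding admissible_def
proof (intro allI impI)
  fix l :: "nat \<Rightarrow> 'a" and k assume k: "k < DIM('a)" and ne: "c \<times> t \<inter> fib l k \<noteq> {}"
  show "\<exists>z\<in>c \<times> t \<inter> fib l k. fst z \<noteq> snd z"
  proof (rule ccontr)
    assume "\<not> ?thesis"
    then have diag: "fst z = snd z" if "z \<in> c \<times> t \<inter> fib l k" for z using that by blast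
    obtain z where z: "z \<in> c \<times> t" "z \<in> fib l k" using ne by blast
    then have eqz: "fst z = snd z" by (intro diag IntI)
    have y: "fst z = snd z" "fst z \<in> c \<inter> t" using z eqz by (auto simp: mem_Times_iff)
    then have "z \<in> rel_interior (c \<times> t)"
      using ri c t z by (auto simp: rel_interior_Times mem_Times_iff)
    then have z': "z \<in> affine hull (c \<times> t)" by (rule rel_interior_affine_hull)
    have "c \<noteq> {}" "t \<noteq> {}" using z by auto
    then have "aff_dim (affine hull (c \<times> t)) > int k" using d k by (simp add: aff_dim_Times)
    then obtain v where v: "v \<noteq> 0" "\<And>c'. z + c' *\<^sub>R v \<in> affine hull (c \<times> t)" "\<And>c. z + c *\<^sub>R v \<in> fib l k"
      using line_in_fib[OF affine_affine_hull z' z(2)] by blast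
    have "z + v \<in> affine hull (c \<times> t)" using v(2)[of 1] by simp
    then obtain e where e: "e > 0" "\<And>a. \<bar>a\<bar> \<le> e \<Longrightarrow> z + a *\<^sub>R v \<in> c \<times> t"
      using rel_interior_line \<open>z \<in> rel_interior (c \<times> t)\<close> by blast
    have w: "z + e *\<^sub>R v \<in> c \<times> t" using e by simp
    then have y2: "fst (z + e *\<^sub>R v) = snd (z + e *\<^sub>R v)"
      using v(3)[of e] by (intro diag IntI)
    have "fst (z + e *\<^sub>R v) \<in> c" "snd (z + e *\<^sub>R v) \<in> t"
      using w unfolding mem_Times_iff by (rule conjunct1, rule conjunct2)
    then have y3: "fst (z + e *\<^sub>R v) \<in> c \<inter> t" unfolding y2 by (rule IntI)
    have "convex (c \<inter> t)" using c t convex_Int by blast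
    then have "fst z = fst (z + e *\<^sub>R v)" using finite_convex_single[OF fin] y(2) y3 by blast
    then have "z = z + e *\<^sub>R v" using y(1) y2 by (metis prod_eqI)
    then show False using v e by simp
  qed
qed

lemma fib_full:
  fixes l :: "nat \<Rightarrow> 'a::euclidean_space"
  assumes "generic l \<Q>" shows "fib l DIM('a) = {z. fst z = snd z}"
proof -
  have "fst z = snd z" if "z \<in> fib l DIM('a)" for z
  proof -
    have "\<forall>i<DIM('a). l i \<bullet> (fst z - snd z) = 0" using that by (simp add: fib_def)
    then have "fst z - snd z = 0" using assms unfolding generic_def by blast
    then show ?thesis by simp
  qed
  then show ?thesis by (auto simp: fib_def)
qed

text \<open>Exchanging the two points of a crossing reverses the sign of the height.\<close>

lemma over_add_swap:
  assumes "finite (X \<times> Y \<inter> fib l k)" "\<And>z. z \<in> X \<times> Y \<inter> fib l k \<Longrightarrow> ht l k z \<noteq> 0"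
  shows "over l k X Y + over l k Y X = meet l k X Y"
proof -
  have neg: "ht l k (b, a) = - ht l k (a, b)" "(b, a) \<in> fib l k \<longleftrightarrow> (a, b) \<in> fib l k" for a b
    by (auto simp: ht_def fib_def inner_diff_right)
  have "{z \<in> Y \<times> X \<inter> fib l k. ht l k z > 0} = prod.swap ` {z \<in> X \<times> Y \<inter> fib l k. ht l k z < 0}"
  proof (intro set_eqI iffI)
    fix z assume "z \<in> {z \<in> Y \<times> X \<inter> fib l k. ht l k z > 0}"
    moreover obtain b a where "z = (b, a)" by (cases z)
    ultimately show "z \<in> prod.swap ` {z \<in> X \<times> Y \<inter> fib l k. ht l k z < 0}"
      using neg[of b a] by (intro image_eqI[of _ _ "(a, b)"]) simp_all
  next
    fix z assume "z \<in> prod.swap ` {z \<in> X \<times> Y \<inter> fib l k. ht l k z < 0}"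
    then obtain a b where "z = (b, a)" "a \<in> X" "b \<in> Y" "(a, b) \<in> fib l k" "ht l k (a, b) < 0" by auto
    then show "z \<in> {z \<in> Y \<times> X \<inter> fib l k. ht l k z > 0}" using neg[of b a] by simp
  qed
  moreover have "inj_on prod.swap {z \<in> X \<times> Y \<inter> fib l k. ht l k z < 0}" by (auto simp: inj_on_def)
  ultimately have "over l k Y X = card {z \<in> X \<times> Y \<inter> fib l k. ht l k z < 0}"
    by (simp add: over_def card_image)
  moreover have "{z \<in> X \<times> Y \<inter> fib l k. True} =
      {z \<in> X \<times> Y \<inter> fib l k. ht l k z > 0} \<union> {z \<in> X \<times> Y \<inter> fib l k. ht l k z < 0}"
    using assms(2) by fastforce
  moreover have "card ({z \<in> X \<times> Y \<inter> fib l k. ht l k z > 0} \<union> {z \<in> X \<times> Y \<inter> fib l k. ht l k z < 0}) =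
     card {z \<in> X \<times> Y \<inter> fib l k. ht l k z > 0} + card {z \<in> X \<times> Y \<inter> fib l k. ht l k z < 0}"
    using assms(1) by (intro card_Un_disjoint) (auto intro: rev_finite_subset)
  ultimately show ?thesis unfolding over_def[of l k X Y] meet_def by presburger
qed

text \<open>Apply the coboundary formula for \<open>k = 2n\<close> to the chain \<open>C\<close> and the \<open>n\<close>-cells of \<open>Y\<close>. The full fibre is the
diagonal, so \<open>meet\<close> for \<open>2n + 1\<close> counts the common points of \<open>C\<close> and \<open>Y\<close>; the boundary of \<open>C\<close> is \<open>X\<close>
and \<open>Y\<close> has no boundary. Hence the number of common points has the parity of the number of crossings of
\<open>X\<close> over \<open>Y\<close>. The last statement amounts to the symmetry of the linking number.\<close>

theorem spanning_chain_crossings: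
  fixes X Y :: "'a::euclidean_space set"
  assumes dim: "DIM('a) = 2 * n + 1" and span: "spanning_chain n C X" and gp: "general_position n C Y"
    and X: "cycle_set n X" and Y: "cycle_set n Y" and disj: "X \<inter> Y = {}"
  obtains \<Q> where "finite \<Q>" "\<And>Q. Q \<in> \<Q> \<Longrightarrow> admissible Q"
    "\<And>l. generic l \<Q> \<Longrightarrow> even ((\<Sum>c\<in>C. card (c \<inter> Y)) + over l (2*n) X Y)"
    "\<And>l. generic l \<Q> \<Longrightarrow> even (over l (2*n) X Y + over l (2*n) Y X)"
proof -
  have C: "finite C" "\<And>c. c \<in> C \<Longrightarrow> (int n + 1) simplex c" using span by (auto simp: spanning_chain_def)
  obtain T where T: "simplicial_complex T" "\<Union>T = X" "mod2_boundary n C = {s \<in> T. int n simplex s}"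
    using span by (auto simp: spanning_chain_def)
  have bC: "bdry C = top_cells n T"
    using T mod2_boundary_eq_bdry[of C n] C simplices_top by metis
  have g1: "\<And>c. c \<in> C \<Longrightarrow> finite (c \<inter> Y)" "\<And>c. c \<in> C \<Longrightarrow> c \<inter> Y \<subseteq> rel_interior c"
    using gp by (auto simp: general_position_def)
  obtain U where U: "simplicial_complex U" "\<Union>U = Y"
    and low: "\<And>c t. c \<in> C \<Longrightarrow> t \<in> U \<Longrightarrow> aff_dim t < int n \<Longrightarrow> c \<inter> t = {}"
    using gp unfolding general_position_def by metis
  let ?U = "top_cells n U"
  have UD: "aff_dim t \<le> int n" if "t \<in> U" for t using cycle_setD(1)[of n U] Y U that by simp
  have bU: "bdry ?U = {}" using cycle_setD(2)[of n U] Y U by simp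
  have TD: "aff_dim t \<le> int n" if "t \<in> T" for t using cycle_setD(1)[of n T] X T that by simp
  have Ut: "t \<in> U" "aff_dim t = int n" "polytope t" "convex t" if "t \<in> ?U" for t
    using that simplicial_complexD(4)[OF U(1)] complex_convex[OF U(1)] by (auto simp: top_cells_def)
  have Ct: "polytope c" "aff_dim c = int n + 1" "convex c" if "c \<in> C" for c
    using C(2)[OF that] simplex_imp_polytope aff_dim_simplex convex_simplex by auto
  have finU: "finite U" "finite ?U" using simplicial_complexD(1)[OF U(1)] by (auto simp: top_cells_def)
  have riU: "c \<inter> t \<subseteq> rel_interior t" if "c \<in> C" "t \<in> ?U" for c t
  proof
    fix y assume y: "y \<in> c \<inter> t"
    show "y \<in> rel_interior t"
    proof (rule ccontr)
      assume "y \<notin> rel_interior t"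
      then have "y \<in> \<Union>{F. F facet_of t}"
        using y rel_boundary_of_polyhedron[of t] polytope_imp_polyhedron[OF Ut(3)[OF that(2)]] by blast
      then obtain F where F: "F facet_of t" "y \<in> F" by blast
      then have "F \<in> U" using simplicial_complexD(3)[OF U(1) Ut(1)[OF that(2)]] facet_of_imp_face_of by blast
      moreover have "aff_dim F < int n" using F Ut(2)[OF that(2)] by (simp add: facet_of_def)
      ultimately show False using low[OF that(1)] F y by blast
    qed
  qed
  define \<Q> where "\<Q> = cells C ?U \<union> cells T U"
  have "finite T" using simplicial_complexD(1)[OF T(1)] .
  then have fin: "finite \<Q>"
    using C finU Ct Ut simplicial_complexD(4)[OF T(1)] simplicial_complexD(4)[OF U(1)]
    by (auto simp: \<Q>_def intro!: finite_cells)
  have adm: "admissible Q" if "Q \<in> \<Q>" for Q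
  proof -
    from that consider "Q \<in> cells C ?U" | "Q \<in> cells T U" unfolding \<Q>_def by blast
    then show ?thesis
    proof cases
      case 1
      then obtain f g c t where Q: "Q = f \<times> g" "c \<in> C" "t \<in> ?U" "f face_of c" "g face_of t"
        by (auto simp: cells_def)
      show ?thesis
      proof (cases "f \<inter> g = {}")
        case True then show ?thesis unfolding Q(1) by (rule admissible_disjoint)
      next
        case False
        then obtain y where y: "y \<in> f" "y \<in> g" by blast
        have gU: "g \<in> U" using simplicial_complexD(3)[OF U(1) Ut(1)[OF Q(3)] Q(5)] .
        have fc: "f \<subseteq> c" "g \<subseteq> t" using Q face_of_imp_subset by auto
        have "y \<in> rel_interior c" using g1(2)[OF Q(2)] y fc Ut(1)[OF Q(3)] U(2) by blast
        then have "f = c" using face_of_disjoint_rel_interior[OF Q(4)] y by blast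
        have "\<not> aff_dim g < int n" using low[OF Q(2) gU] y fc by blast
        then have "g = t" using face_of_aff_dim_lt[OF Ut(4)[OF Q(3)] Q(5)] Ut(2)[OF Q(3)] by force
        have "admissible (c \<times> t)"
        proof (rule admissible_transverse)
          show "finite (c \<inter> t)" using g1(1)[OF Q(2)] Ut(1)[OF Q(3)] U(2) by (blast intro: rev_finite_subset)
          show "c \<inter> t \<subseteq> rel_interior c" using g1(2)[OF Q(2)] Ut(1)[OF Q(3)] U(2) by blast
          show "c \<inter> t \<subseteq> rel_interior t" using riU Q by blast
          show "aff_dim c + aff_dim t = int DIM('a)" using dim Ct(2)[OF Q(2)] Ut(2)[OF Q(3)] by simp
        qed (use Ct Ut Q in auto)
        then show ?thesis using Q \<open>f = c\<close> \<open>g = t\<close> by simp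
      qed
    next
      case 2
      then obtain f g s t where Q: "Q = f \<times> g" "s \<in> T" "t \<in> U" "f face_of s" "g face_of t"
        by (auto simp: cells_def)
      then have "f \<inter> g \<subseteq> X \<inter> Y" using T U face_of_imp_subset by blast
      then show ?thesis unfolding Q(1) using disj by (intro admissible_disjoint) blast
    qed
  qed
  have main: "even ((\<Sum>c\<in>C. card (c \<inter> Y)) + over l (2*n) X Y) \<and> even (over l (2*n) X Y + over l (2*n) Y X)"
    if gen: "generic l \<Q>" for l
  proof -
    have cd: "cuts_down l Q" if "Q \<in> \<Q>" for Q using gen that by (simp add: generic_def)
    have b1: "even ((\<Sum>s\<in>C. \<Sum>t\<in>?U. meet l (Suc (2*n)) s t) +
      ((\<Sum>r\<in>bdry C. \<Sum>t\<in>?U. over l (2*n) r t) + (\<Sum>s\<in>C. \<Sum>r\<in>bdry ?U. over l (2*n) s r)))"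
      and b2: "even ((\<Sum>r\<in>bdry C. \<Sum>t\<in>?U. meet l (2*n) r t) + (\<Sum>s\<in>C. \<Sum>r\<in>bdry ?U. meet l (2*n) s r))"
      by (rule crossings_boundary[of C "int n + 1" ?U "int n" "2*n" l];
          use C finU Ct Ut dim cd in \<open>simp add: \<Q>_def\<close>)+
    have cdTU: "cuts_down l (s \<times> t)" if "s \<in> T" "t \<in> U" for s t
    proof (rule cd)
      have "s face_of s" "t face_of t" using that complex_convex[OF T(1)] complex_convex[OF U(1)] face_of_refl by auto
      then show "s \<times> t \<in> \<Q>" using that unfolding \<Q>_def cells_def by blast
    qed
    have k2: "int n + int n = int (2*n)" "2 * n \<le> DIM('a)" using dim by auto
    note cU = card_Union_crossings[OF T(1) TD U(1) UD k2 cdTU, unfolded T(2) U(2)]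
    have o: "over l (2*n) X Y = (\<Sum>r\<in>top_cells n T. \<Sum>t\<in>?U. over l (2*n) r t)"
      unfolding over_def by (rule cU(2))
    have m: "meet l (2*n) X Y = (\<Sum>r\<in>top_cells n T. \<Sum>t\<in>?U. meet l (2*n) r t)"
      unfolding meet_def by (rule cU(2))
    have full: "fib l (Suc (2*n)) = {z. fst z = snd z}" using fib_full[OF gen] dim by simp
    have pt: "meet l (Suc (2*n)) c t = card (c \<inter> t)" for c t
    proof -
      have "{z \<in> c \<times> t \<inter> fib l (Suc (2*n)). True} = (\<lambda>y. (y, y)) ` (c \<inter> t)" unfolding full by auto
      then show ?thesis unfolding meet_def by (simp add: card_image inj_on_def)
    qed
    have cc: "(\<Sum>t\<in>?U. card (c \<inter> t)) = card (c \<inter> Y)" if c: "c \<in> C" for c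
    proof -
      have "c \<inter> Y = (\<Union>t\<in>?U. c \<inter> t)"
      proof
        show "c \<inter> Y \<subseteq> (\<Union>t\<in>?U. c \<inter> t)"
        proof
          fix y assume y: "y \<in> c \<inter> Y"
          then obtain t where t: "t \<in> U" "y \<in> t" using U by blast
          then have "\<not> aff_dim t < int n" using low[OF c] y by blast
          then have "t \<in> ?U" using UD t by (force simp: top_cells_def)
          then show "y \<in> (\<Union>t\<in>?U. c \<inter> t)" using y t by blast
        qed
      qed (use Ut U in blast)
      moreover have "card (\<Union>t\<in>?U. c \<inter> t) = (\<Sum>t\<in>?U. card (c \<inter> t))"
      proof (rule card_UN_disjoint[OF finU(2)])
        show "\<forall>t\<in>?U. finite (c \<inter> t)" using g1(1)[OF c] Ut(1) U(2) by (blast intro: rev_finite_subset)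
        show "\<forall>t\<in>?U. \<forall>u\<in>?U. t \<noteq> u \<longrightarrow> (c \<inter> t) \<inter> (c \<inter> u) = {}"
        proof (intro ballI impI)
          fix t u assume tu: "t \<in> ?U" "u \<in> ?U" "t \<noteq> u"
          have I: "t \<inter> u \<in> U" "t \<inter> u face_of t" "t \<inter> u face_of u"
            using complex_Int[OF U(1)] Ut tu by auto
          have "t \<inter> u \<noteq> t \<or> t \<inter> u \<noteq> u" using tu by blast
          then have "aff_dim (t \<inter> u) < int n"
            using face_of_aff_dim_lt[OF Ut(4)[OF tu(1)] I(2)] face_of_aff_dim_lt[OF Ut(4)[OF tu(2)] I(3)]
              Ut(2)[OF tu(1)] Ut(2)[OF tu(2)] by metis
          then show "(c \<inter> t) \<inter> (c \<inter> u) = {}" using low[OF c I(1)] by blast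
        qed
      qed
      ultimately show ?thesis by simp
    qed
    have e1: "even ((\<Sum>c\<in>C. card (c \<inter> Y)) + over l (2*n) X Y)"
      using b1 unfolding bU bC pt o by (simp add: cc)
    have em: "even (meet l (2*n) X Y)" using b2 unfolding bU bC m by simp
    have "over l (2*n) X Y + over l (2*n) Y X = meet l (2*n) X Y"
    proof (rule over_add_swap[OF cU(1)])
      fix z assume z: "z \<in> X \<times> Y \<inter> fib l (2*n)"
      show "ht l (2*n) z \<noteq> 0"
      proof
        assume "ht l (2*n) z = 0"
        then have "z \<in> fib l (Suc (2*n))" using z by (simp add: fib_Suc_ht)
        then have "fst z = snd z" unfolding full by (rule CollectD)
        moreover have "fst z \<in> X" "snd z \<in> Y" using z by (auto simp: mem_Times_iff)
        ultimately show False using disj by (metis IntI empty_iff)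
      qed
    qed
    then show ?thesis using e1 em by simp
  qed
  show thesis by (rule that[OF fin adm]) (use main in auto)
qed

section \<open>Cones\<close>

definition cone :: "'a::euclidean_space \<Rightarrow> 'a set \<Rightarrow> 'a set" where
  "cone p s = convex hull (insert p s)"

lemma cone_hull: "cone p (convex hull V) = convex hull (insert p V)"
  unfolding cone_def by (metis hull_insert)

lemma cone_vertices:
  assumes "i simplex s" "p \<notin> affine hull s"
  obtains V where "s = convex hull V" "\<not> affine_dependent V" "int (card V) = i + 1" "finite V"
    "\<not> affine_dependent (insert p V)" "p \<notin> V" "cone p s = convex hull (insert p V)"
proof -
  obtain V where V: "finite V" "\<not> affine_dependent V" "int (card V) = i + 1" "s = convex hull V"
    using assms(1) by (auto simp: simplex)
  have "affine hull s = affine hull V" using V by (simp add: affine_hull_convex_hull)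
  then have pV: "p \<notin> affine hull V" using assms by simp
  then have "p \<notin> V" by (meson hull_inc)
  then show thesis
    using that[OF V(4,2,3,1) affine_independent_insert[OF V(2) pV]] cone_hull[of p V] V(4) by blast
qed

lemma cone_inj:
  assumes "i simplex s" "p \<notin> affine hull s" "j simplex t" "p \<notin> affine hull t" "cone p s = cone p t"
  shows "s = t"
proof -
  obtain V where V: "s = convex hull V" "\<not> affine_dependent V" "int (card V) = i + 1" "finite V"
    "\<not> affine_dependent (insert p V)" "p \<notin> V" "cone p s = convex hull (insert p V)"
    by (rule cone_vertices[OF assms(1,2)])
  obtain W where W: "t = convex hull W" "\<not> affine_dependent W" "int (card W) = j + 1" "finite W"
    "\<not> affine_dependent (insert p W)" "p \<notin> W" "cone p t = convex hull (insert p W)"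
    by (rule cone_vertices[OF assms(3,4)])
  have "insert p V = insert p W"
  proof (rule set_eqI)
    fix x
    have "x \<in> insert p V \<longleftrightarrow> x extreme_point_of cone p s"
      unfolding V(7) by (rule extreme_point_of_convex_hull_affine_independent[OF V(5), symmetric])
    also have "\<dots> \<longleftrightarrow> x \<in> insert p W"
      unfolding assms(5) W(7) by (rule extreme_point_of_convex_hull_affine_independent[OF W(5)])
    finally show "x \<in> insert p V \<longleftrightarrow> x \<in> insert p W" .
  qed
  then have "V = W" using V(6) W(6) by (metis insert_ident)
  then show ?thesis using V(1) W(1) by simp
qed

lemma facet_of_cone:
  assumes s: "int n simplex s" "n \<ge> 1" "p \<notin> affine hull s"
  shows "r facet_of cone p s \<longleftrightarrow> r = s \<or> (\<exists>f. f facet_of s \<and> r = cone p f)"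
proof -
  obtain V where V: "s = convex hull V" "\<not> affine_dependent V" "int (card V) = int n + 1" "finite V"
    "\<not> affine_dependent (insert p V)" "p \<notin> V" "cone p s = convex hull (insert p V)"
    by (rule cone_vertices[OF s(1,3)])
  have card: "2 \<le> card V" "2 \<le> card (insert p V)" using V s by auto
  have fs: "f facet_of s \<longleftrightarrow> (\<exists>u\<in>V. f = convex hull (V - {u}))" for f
    unfolding V(1) facet_of_convex_hull_affine_independent_alt[OF V(2)] using card by blast
  have "r facet_of cone p s \<longleftrightarrow> (\<exists>u\<in>insert p V. r = convex hull (insert p V - {u}))"
    unfolding V(7) facet_of_convex_hull_affine_independent_alt[OF V(5)] using card by blast
  also have "\<dots> \<longleftrightarrow> r = convex hull V \<or> (\<exists>u\<in>V. r = convex hull (insert p (V - {u})))"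
  proof -
    have "insert p V - {u} = insert p (V - {u})" if "u \<in> V" for u using that V(6) by auto
    moreover have "insert p V - {p} = V" using V(6) by auto
    ultimately show ?thesis by auto
  qed
  also have "\<dots> \<longleftrightarrow> r = s \<or> (\<exists>f. f facet_of s \<and> r = cone p f)"
    unfolding fs V(1)[symmetric] by (auto simp: cone_hull)
  finally show ?thesis .
qed

lemma aff_dim_Un_complex:
  fixes s t :: "'a::euclidean_space set"
  assumes "i simplex s" "j simplex t"
  shows "aff_dim (s \<union> t) \<le> i + j + 1"
proof -
  obtain V W where V: "finite V" "int (card V) = i + 1" "s = convex hull V"
    and W: "finite W" "int (card W) = j + 1" "t = convex hull W"
    using assms by (auto simp: simplex)
  have "s \<union> t \<subseteq> affine hull (V \<union> W)"
    unfolding V W using convex_hull_subset_affine_hull[of V] convex_hull_subset_affine_hull[of W]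
      hull_mono[of V "V \<union> W" affine] hull_mono[of W "V \<union> W" affine] by blast
  then have "aff_dim (s \<union> t) \<le> aff_dim (V \<union> W)" by (metis aff_dim_affine_hull aff_dim_subset)
  also have "\<dots> \<le> int (card (V \<union> W)) - 1"
    by (rule aff_dim_le_card) (use V(1) W(1) in simp)
  also have "\<dots> \<le> int (card V + card W) - 1" using card_Un_le[of V W] by linarith
  finally show ?thesis using V W by simp
qed

text \<open>Finitely many proper flats do not fill the space.\<close>

lemma avoid_flats:
  fixes F :: "'a::euclidean_space set set"
  assumes "finite F" "\<And>S. S \<in> F \<Longrightarrow> aff_dim S < int DIM('a)"
  obtains p where "\<And>S. S \<in> F \<Longrightarrow> p \<notin> affine hull S"
proof -
  have "negligible (affine hull S)" if "S \<in> F" for S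
  proof -
    have "interior (affine hull S) = {}"
      using aff_dim_nonempty_interior[of "affine hull S"] assms(2)[OF that] by auto
    moreover have "convex (affine hull S)" by (simp add: affine_imp_convex)
    ultimately show ?thesis using negligible_convex_interior by blast
  qed
  then have "negligible (\<Union>S\<in>F. affine hull S)" using assms(1) by (intro negligible_Union) auto
  then have "(\<Union>S\<in>F. affine hull S) \<noteq> UNIV" using non_negligible_UNIV by metis
  then show thesis using that by blast
qed

text \<open>The chain is the cone over \<open>X\<close> from a point \<open>p\<close>. Its boundary is \<open>X\<close>, since every facet of \<open>X\<close> belongs to
an even number of cells. If \<open>p\<close> avoids the flats spanned by a cell of \<open>X\<close> and a cell of \<open>Y\<close> that are not the
whole space, a cone over a cell of \<open>X\<close> meets a cell of \<open>Y\<close> only if both have dimension \<open>n\<close>, and then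
in inner points.\<close>

theorem chain_exists:
  fixes X Y :: "'a::euclidean_space set"
  assumes dim: "DIM('a) = 2 * n + 1" and n: "n \<ge> 1"
    and X: "cycle_set n X" and Y: "cycle_set n Y" and disj: "X \<inter> Y = {}"
  obtains C where "spanning_chain n C X" "general_position n C Y"
proof -
  obtain T where T: "simplicial_complex T" "\<Union>T = X" using X by (auto simp: cycle_set_def)
  obtain U where U: "simplicial_complex U" "\<Union>U = Y" using Y by (auto simp: cycle_set_def)
  have TD: "aff_dim t \<le> int n" if "t \<in> T" for t using cycle_setD(1)[of n T] X T that by simp
  have UD: "aff_dim t \<le> int n" if "t \<in> U" for t using cycle_setD(1)[of n U] Y U that by simp
  have bT: "bdry (top_cells n T) = {}" using cycle_setD(2)[of n T] X T by simp
  have fin: "finite T" "finite U" using simplicial_complexD(1) T U by auto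
  \<comment> \<open>The empty set is added so that \<open>p\<close> also avoids the hulls of the single cells.\<close>
  let ?F = "{s \<union> t |s t. s \<in> insert {} T \<and> t \<in> insert {} U \<and> aff_dim (s \<union> t) < int DIM('a)}"
  have "?F \<subseteq> (\<lambda>(s,t). s \<union> t) ` (insert {} T \<times> insert {} U)" by auto
  then have "finite ?F" using fin by (meson finite_SigmaI finite.insertI finite_imageI finite_subset)
  then obtain p where p: "\<And>S. S \<in> ?F \<Longrightarrow> p \<notin> affine hull S"
    using avoid_flats[of ?F] by blast
  have pst: "p \<notin> affine hull (s \<union> t)" if "s \<in> insert {} T" "t \<in> insert {} U" "aff_dim (s \<union> t) < int DIM('a)" for s t
    by (rule p) (use that in blast)
  have ps: "p \<notin> affine hull s" if "s \<in> T" for s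
    using pst[of s "{}"] that TD[OF that] dim by simp
  have pt: "p \<notin> affine hull t" if "t \<in> U" for t
    using pst[of "{}" t] that UD[OF that] dim by simp
  have avoid: "cone p s \<inter> t = {}" if st: "s \<in> T" "t \<in> U" "aff_dim s + aff_dim t < 2 * int n" for s t
  proof (rule ccontr)
    assume "cone p s \<inter> t \<noteq> {}"
    then obtain y where y: "y \<in> cone p s" "y \<in> t" by blast
    have "aff_dim (s \<union> t) \<le> aff_dim s + aff_dim t + 1"
      using aff_dim_Un_complex complex_simplex T U st by blast
    then have pn: "p \<notin> affine hull (s \<union> t)" using st dim by (intro pst) auto
    show False
    proof (cases "s = {}")
      case True
      then have "y = p" using y by (simp add: cone_def)
      then show False using pt[OF st(2)] y by (simp add: hull_inc)
    next
      case False
      have "convex hull s = s" using complex_convex[OF T(1) st(1)] by (simp add: hull_same)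
      then obtain u v x where uv: "0 \<le> u" "0 \<le> v" "u + v = 1" "x \<in> s" "y = u *\<^sub>R p + v *\<^sub>R x"
        using y(1) unfolding cone_def convex_hull_insert[OF False] by auto
      show False
      proof (cases "u = 0")
        case True
        then have "y \<in> X \<inter> Y" using uv st y T U by auto
        then show False using disj by blast
      next
        case u: False
        have "y \<in> affine hull (s \<union> t)" "x \<in> affine hull (s \<union> t)" using y uv by (auto intro!: hull_inc)
        then have "(1/u) *\<^sub>R y + (- v / u) *\<^sub>R x \<in> affine hull (s \<union> t)"
          using uv u by (intro mem_affine[OF affine_affine_hull]) (auto simp: field_simps)
        moreover have "(1/u) *\<^sub>R y + (- v / u) *\<^sub>R x = p" unfolding uv(5) using u by (simp add: scaleR_add_right)
        ultimately show False using pn by simp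
      qed
    qed
  qed
  let ?T = "top_cells n T"
  have Tt: "s \<in> T" "int n simplex s" "aff_dim s = int n" if "s \<in> ?T" for s
    using that complex_simplex[OF T(1)] by (auto simp: top_cells_def) (metis)
  define C where "C = cone p ` ?T"
  have finC: "finite C" using fin by (simp add: C_def top_cells_def)
  have Cs: "(int n + 1) simplex cone p s" if "s \<in> ?T" for s
    unfolding cone_def using simplex_insert_dimplus1[OF Tt(2)[OF that] ps[OF Tt(1)[OF that]]] .
  have inj: "s = t" if "s \<in> T" "t \<in> T" "cone p s = cone p t" for s t
    using cone_inj[OF complex_simplex[OF T(1) that(1)] ps[OF that(1)] complex_simplex[OF T(1) that(2)] ps[OF that(2)] that(3)] .
  have fc: "r facet_of cone p s \<longleftrightarrow> r = s \<or> (\<exists>f. f facet_of s \<and> r = cone p f)" if "s \<in> ?T" for r s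
    using facet_of_cone[OF Tt(2)[OF that] n ps[OF Tt(1)[OF that]]] .
  have pin: "p \<in> cone p f" for f by (simp add: cone_def hull_inc)
  have pnot: "p \<notin> s" if "s \<in> T" for s using ps[OF that] by (meson hull_inc)
  have injon: "inj_on (cone p) S" if "S \<subseteq> T" for S using inj that by (meson inj_onI subsetD)
  have bC: "bdry C = ?T"
  proof (rule set_eqI)
    fix r
    have cnt: "card {c \<in> C. r facet_of c} = card {s \<in> ?T. r facet_of cone p s}"
    proof -
      have "{c \<in> C. r facet_of c} = cone p ` {s \<in> ?T. r facet_of cone p s}" by (auto simp: C_def)
      moreover have "inj_on (cone p) {s \<in> ?T. r facet_of cone p s}" by (rule injon) (use Tt in blast)
      ultimately show ?thesis by (simp add: card_image)
    qed
    show "r \<in> bdry C \<longleftrightarrow> r \<in> ?T"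
    proof (cases "p \<in> r")
      case False
      then have "{s \<in> ?T. r facet_of cone p s} = (if r \<in> ?T then {r} else {})"
        using fc pin by auto
      then show ?thesis unfolding bdry_def by (simp add: cnt)
    next
      case True
      have "even (card {s \<in> ?T. r facet_of cone p s})"
      proof (cases "\<exists>f s. s \<in> ?T \<and> f facet_of s \<and> r = cone p f")
        case True
        then obtain f s0 where f: "s0 \<in> ?T" "f facet_of s0" "r = cone p f" by blast
        have fT: "f' \<in> T" if "s \<in> ?T" "f' facet_of s" for f' s
          using simplicial_complexD(3)[OF T(1) Tt(1)[OF that(1)]] facet_of_imp_face_of[OF that(2)] by blast
        have "{s \<in> ?T. r facet_of cone p s} = {s \<in> ?T. f facet_of s}"
        proof (intro Collect_cong conj_cong refl)
          fix s assume s: "s \<in> ?T"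
          have "r \<noteq> s" using \<open>p \<in> r\<close> pnot Tt(1)[OF s] by blast
          then show "r facet_of cone p s \<longleftrightarrow> f facet_of s"
            unfolding fc[OF s] using f(3) inj[OF fT[OF f(1,2)] fT[OF s]] by metis
        qed
        moreover have "f \<notin> bdry ?T" unfolding bT by simp
        then have "even (card {s \<in> ?T. f facet_of s})" by (simp add: bdry_def)
        ultimately show ?thesis by (simp only:)
      next
        case False
        have "\<not> r facet_of cone p s" if s: "s \<in> ?T" for s
          unfolding fc[OF s] using False s \<open>p \<in> r\<close> pnot Tt(1)[OF s] by blast
        then have "{s \<in> ?T. r facet_of cone p s} = {}" by blast
        then show ?thesis by (simp only: card.empty even_zero)
      qed
      moreover have "r \<notin> ?T" using True pnot Tt(1) by blast
      ultimately show ?thesis unfolding bdry_def by (simp add: cnt)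
    qed
  qed
  have Csimp: "(int n + 1) simplex c" if "c \<in> C" for c using that Cs by (auto simp: C_def)
  have "mod2_boundary n C = {s \<in> T. int n simplex s}"
    using mod2_boundary_eq_bdry[OF Csimp] bC simplices_top[OF T(1)] by simp
  then have "spanning_chain n C X" unfolding spanning_chain_def using finC Csimp T by blast
  moreover have "general_position n C Y"
    unfolding general_position_def
  proof (intro conjI ballI exI[of _ U] impI)
    fix c assume "c \<in> C"
    then obtain s where s: "s \<in> ?T" "c = cone p s" by (auto simp: C_def)
    have cc: "convex c" "polytope c" "compact c" using Cs[OF s(1)] s(2) convex_simplex simplex_imp_polytope compact_simplex by auto
    have low: "c \<inter> t = {}" if "t \<in> U" "aff_dim t < int n" for t
      using avoid[OF Tt(1)[OF s(1)] that(1)] Tt(3)[OF s(1)] that(2) s(2) by simp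
    then show "c \<inter> t = {}" if "t \<in> U" "aff_dim t < int n" for t using that by blast
    have ri: "c \<inter> t \<subseteq> rel_interior c" if t: "t \<in> U" for t
    proof
      fix y assume y: "y \<in> c \<inter> t"
      show "y \<in> rel_interior c"
      proof (rule ccontr)
        assume "y \<notin> rel_interior c"
        then have "y \<in> \<Union>{F. F facet_of c}"
          using y rel_boundary_of_polyhedron[of c] polytope_imp_polyhedron[OF cc(2)] by blast
        then obtain r where r: "r facet_of cone p s" "y \<in> r" using s by blast
        then consider "r = s" | f where "f facet_of s" "r = cone p f" using fc[OF s(1)] by blast
        then show False
        proof cases
          case 1
          then have "y \<in> X \<inter> Y" using r y t Tt(1)[OF s(1)] T U by blast
          then show False using disj by blast
        next
          case 2
          have "f \<in> T" using simplicial_complexD(3)[OF T(1) Tt(1)[OF s(1)]] facet_of_imp_face_of[OF 2(1)] by blast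
          moreover have "aff_dim f + aff_dim t < 2 * int n" using 2(1) Tt(3)[OF s(1)] UD[OF t] by (simp add: facet_of_def)
          ultimately show False using avoid[of f t] t r y 2 by blast
        qed
      qed
    qed
    then show "c \<inter> Y \<subseteq> rel_interior c" using U(2) by blast
    have "finite (c \<inter> t)" if t: "t \<in> U" for t
    proof (cases "c \<inter> t = {}")
      case False
      have ct: "convex t" "polytope t" "compact t"
        using complex_convex[OF U(1) t] simplicial_complexD(4)[OF U(1) t] polytope_imp_compact by auto
      have rit: "c \<inter> t \<subseteq> rel_interior t"
      proof
        fix y assume y: "y \<in> c \<inter> t"
        show "y \<in> rel_interior t"
        proof (rule ccontr)
          assume "y \<notin> rel_interior t"
          then have "y \<in> \<Union>{F. F facet_of t}"
            using y rel_boundary_of_polyhedron[of t] polytope_imp_polyhedron[OF ct(2)] by blast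
          then obtain F where F: "F facet_of t" "y \<in> F" by blast
          then have "F \<in> U" using simplicial_complexD(3)[OF U(1) t] facet_of_imp_face_of by blast
          moreover have "aff_dim F < int n" using F UD[OF t] by (simp add: facet_of_def)
          ultimately show False using low F y by blast
        qed
      qed
      have "rel_interior c \<inter> rel_interior t \<noteq> {}" using False ri[OF t] rit by blast
      then have "rel_interior (c \<inter> t) = rel_interior c \<inter> rel_interior t"
        using convex_rel_interior_inter_two[OF cc(1) ct(1)] by blast
      then have "c \<inter> t \<subseteq> rel_interior (c \<inter> t)" using ri[OF t] rit by blast
      moreover have comp: "compact (c \<inter> t)" using cc ct compact_Int by blast
      then have "closure (c \<inter> t) = c \<inter> t" by (simp add: compact_imp_closed)
      ultimately have "rel_frontier (c \<inter> t) = {}" by (auto simp: rel_frontier_def)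
      then have "affine (c \<inter> t)" using rel_frontier_eq_empty by blast
      then have "c \<inter> t = {} \<or> (\<exists>a. c \<inter> t = {a})"
        using affine_bounded_eq_trivial comp compact_imp_bounded by blast
      then show ?thesis by auto
    qed simp
    then have "finite (\<Union>t\<in>U. c \<inter> t)" using fin(2) by blast
    moreover have "c \<inter> Y = (\<Union>t\<in>U. c \<inter> t)" using U(2) by blast
    ultimately show "finite (c \<inter> Y)" by (simp only:)
  qed (use U in auto)
  ultimately show thesis using that by blast
qed

text \<open>Two chains give the same parity, because they can be compared with the crossings for a
common family of generic forms.\<close>

theorem lk2_crossings:
  fixes X Y :: "'a::euclidean_space set"
  assumes dim: "DIM('a) = 2 * n + 1" and n: "n \<ge> 1"
    and X: "cycle_set n X" and Y: "cycle_set n Y" and disj: "X \<inter> Y = {}"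
  obtains \<Q> where "finite \<Q>" "\<And>Q. Q \<in> \<Q> \<Longrightarrow> admissible Q"
    "\<And>l. generic l \<Q> \<Longrightarrow> lk2 n X Y = over l (2*n) X Y mod 2"
    "\<And>l. generic l \<Q> \<Longrightarrow> even (over l (2*n) X Y + over l (2*n) Y X)"
proof -
  obtain C where C: "spanning_chain n C X" "general_position n C Y"
    using chain_exists[OF dim n X Y disj] by blast
  obtain \<Q> where Q: "finite \<Q>" "\<And>Q. Q \<in> \<Q> \<Longrightarrow> admissible Q"
    "\<And>l. generic l \<Q> \<Longrightarrow> even ((\<Sum>c\<in>C. card (c \<inter> Y)) + over l (2*n) X Y)"
    "\<And>l. generic l \<Q> \<Longrightarrow> even (over l (2*n) X Y + over l (2*n) Y X)"
    using spanning_chain_crossings[OF dim C X Y disj] by blast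
  have uniq: "(\<Sum>c\<in>D. card (c \<inter> Y)) mod 2 = (\<Sum>c\<in>C. card (c \<inter> Y)) mod 2"
    if D: "spanning_chain n D X" "general_position n D Y" for D
  proof -
    obtain \<R> where R: "finite \<R>" "\<And>Q. Q \<in> \<R> \<Longrightarrow> admissible Q"
      "\<And>l. generic l \<R> \<Longrightarrow> even ((\<Sum>c\<in>D. card (c \<inter> Y)) + over l (2*n) X Y)"
      "\<And>l. generic l \<R> \<Longrightarrow> even (over l (2*n) X Y + over l (2*n) Y X)"
      using spanning_chain_crossings[OF dim D X Y disj] by blast
    obtain l where "generic l (\<Q> \<union> \<R>)" using generic_exists[of "\<Q> \<union> \<R>"] Q R by blast
    then have "generic l \<Q>" "generic l \<R>" by (auto simp: generic_Un)
    then have "even ((\<Sum>c\<in>C. card (c \<inter> Y)) + over l (2*n) X Y)" "even ((\<Sum>c\<in>D. card (c \<inter> Y)) + over l (2*n) X Y)"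
      using Q(3) R(3) by blast+
    then show ?thesis by presburger
  qed
  have "lk2 n X Y = (\<Sum>c\<in>C. card (c \<inter> Y)) mod 2"
    unfolding lk2_def
  proof (rule the_equality)
    show "\<exists>D. spanning_chain n D X \<and> general_position n D Y \<and>
        (\<Sum>c\<in>C. card (c \<inter> Y)) mod 2 = (\<Sum>c\<in>D. card (c \<inter> Y)) mod 2"
      using C by blast
    fix r assume "\<exists>D. spanning_chain n D X \<and> general_position n D Y \<and> r = (\<Sum>c\<in>D. card (c \<inter> Y)) mod 2"
    then obtain D where "spanning_chain n D X" "general_position n D Y" "r = (\<Sum>c\<in>D. card (c \<inter> Y)) mod 2"
      by blast
    then show "r = (\<Sum>c\<in>C. card (c \<inter> Y)) mod 2" using uniq by simp
  qed
  moreover have "(\<Sum>c\<in>C. card (c \<inter> Y)) mod 2 = over l (2*n) X Y mod 2" if "generic l \<Q>" for l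
    using Q(3)[OF that] by (simp only: even_add_mod2)
  ultimately have "lk2 n X Y = over l (2*n) X Y mod 2" if "generic l \<Q>" for l
    using that by simp
  then show thesis using that[OF Q(1,2) _ Q(4)] by blast
qed

section \<open>Piecewise linear images\<close>

lemma affine_map_on_subset: "affine_map_on S f \<Longrightarrow> R \<subseteq> S \<Longrightarrow> affine_map_on R f"
  unfolding affine_map_on_def by blast

lemma affine_image_hull:
  fixes f :: "'a::euclidean_space \<Rightarrow> 'b::euclidean_space"
  assumes "affine_map_on (convex hull V) f" "W \<subseteq> V"
  shows "f ` (convex hull W) = convex hull (f ` W)"
proof -
  obtain g c where g: "linear g" "\<And>x. x \<in> convex hull V \<Longrightarrow> f x = g x + c"
    using assms(1) unfolding affine_map_on_def by blast
  have sub: "convex hull W \<subseteq> convex hull V" "W \<subseteq> convex hull V"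
    using assms(2) hull_mono hull_subset by (metis, metis order_trans)
  have im: "f ` X = (+) c ` g ` X" if "X \<subseteq> convex hull V" for X
    unfolding image_image by (rule image_cong[OF refl]) (use g(2) that in \<open>auto simp: add.commute\<close>)
  have "f ` (convex hull W) = (+) c ` g ` (convex hull W)" using im sub by blast
  also have "\<dots> = convex hull ((+) c ` g ` W)"
    by (simp only: convex_hull_linear_image[OF g(1)] convex_hull_translation)
  also have "\<dots> = convex hull (f ` W)" using im[OF sub(2)] by simp
  finally show ?thesis .
qed

lemma affine_image_independent:
  fixes f :: "'a::euclidean_space \<Rightarrow> 'b::euclidean_space"
  assumes V: "\<not> affine_dependent V" and f: "affine_map_on (convex hull V) f" and inj: "inj_on f (convex hull V)"
  shows "\<not> affine_dependent (f ` V)"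
proof
  assume dep: "affine_dependent (f ` V)"
  have fin: "finite V" using V aff_independent_finite by blast
  obtain g c where g: "linear g" "\<And>x. x \<in> convex hull V \<Longrightarrow> f x = g x + c"
    using f unfolding affine_map_on_def by blast
  have VV: "V \<subseteq> convex hull V" by (rule hull_subset)
  have injV: "inj_on f V" using inj VV by (rule inj_on_subset)
  have "finite (f ` V)" using fin by simp
  from dep[unfolded affine_dependent_explicit_finite[OF this]]
  obtain U where U: "sum U (f ` V) = 0" "\<exists>v\<in>f ` V. U v \<noteq> 0" "(\<Sum>v\<in>f ` V. U v *\<^sub>R v) = 0" by blast
  define u where "u v = U (f v)" for v
  have u0: "sum u V = 0" using U(1) by (simp add: sum.reindex[OF injV] u_def)
  have une: "\<exists>v\<in>V. u v \<noteq> 0" using U(2) by (auto simp: u_def)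
  have "0 = (\<Sum>v\<in>V. u v *\<^sub>R f v)" using U(3) by (simp add: sum.reindex[OF injV] u_def)
  also have "\<dots> = (\<Sum>v\<in>V. u v *\<^sub>R (g v + c))" by (rule sum.cong[OF refl]) (use g VV in auto)
  also have "\<dots> = (\<Sum>v\<in>V. u v *\<^sub>R g v) + sum u V *\<^sub>R c"
    by (simp add: scaleR_add_right sum.distrib scaleR_left.sum)
  also have "\<dots> = g (\<Sum>v\<in>V. u v *\<^sub>R v)"
    using u0 g(1) by (simp add: linear_sum linear_cmul)
  finally have gw: "g (\<Sum>v\<in>V. u v *\<^sub>R v) = 0" by simp
  define m where "m = real (card V)"
  have "V \<noteq> {}" using une by blast
  then have m: "m > 0" using fin by (simp add: m_def card_gt_0_iff)
  define M where "M = 1 + (\<Sum>v\<in>V. \<bar>u v\<bar>)"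
  have M: "M > 0" "\<bar>u v\<bar> \<le> M" if "v \<in> V" for v
  proof -
    show "M > 0" by (simp add: M_def add_pos_nonneg sum_nonneg)
    have "\<bar>u v\<bar> \<le> (\<Sum>v\<in>V. \<bar>u v\<bar>)" using fin that by (intro member_le_sum) auto
    then show "\<bar>u v\<bar> \<le> M" by (simp add: M_def)
  qed
  have M0: "M > 0" using M(1) \<open>V \<noteq> {}\<close> by blast
  define e where "e = 1 / (m * M)"
  have e: "e > 0" using m M0 by (simp add: e_def)
  define x y where "x = (\<Sum>v\<in>V. (1/m) *\<^sub>R v)" and "y = (\<Sum>v\<in>V. (1/m + e * u v) *\<^sub>R v)"
  have ge: "0 \<le> 1/m + e * u v" if "v \<in> V" for v
  proof -
    have "e * \<bar>u v\<bar> \<le> e * M" using M(2)[OF that] e by (intro mult_left_mono) auto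
    also have "\<dots> = 1 / m" using m M0 by (simp add: e_def field_simps)
    finally have "e * \<bar>u v\<bar> \<le> 1 / m" .
    moreover have "- (e * u v) \<le> e * \<bar>u v\<bar>" using e by (simp add: abs_if mult_le_0_iff)
    ultimately show ?thesis by linarith
  qed
  have "sum (\<lambda>v. 1/m) V = 1" using m by (simp add: m_def)
  then have xin: "x \<in> convex hull V"
    unfolding x_def convex_hull_finite[OF fin] using m by (intro CollectI exI[of _ "\<lambda>v. 1/m"]) auto
  have "sum (\<lambda>v. 1/m + e * u v) V = 1"
    using \<open>sum (\<lambda>v. 1/m) V = 1\<close> u0 by (simp add: sum.distrib sum_distrib_left[symmetric])
  then have yin: "y \<in> convex hull V"
    unfolding y_def convex_hull_finite[OF fin] using ge by (intro CollectI exI[of _ "\<lambda>v. 1/m + e * u v"]) auto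
  have yx: "y = x + e *\<^sub>R (\<Sum>v\<in>V. u v *\<^sub>R v)"
    by (simp add: x_def y_def scaleR_add_left sum.distrib scaleR_sum_right)
  have "f y = f x" using g xin yin gw by (simp add: yx linear_add linear_cmul)
  then have "y = x" using inj xin yin by (meson inj_onD)
  then have "(\<Sum>v\<in>V. u v *\<^sub>R v) = 0" using yx e by simp
  then have "affine_dependent V" using affine_dependent_explicit_finite[OF fin] u0 une by blast
  then show False using V by blast
qed

lemma simplex_vertices:
  assumes "i simplex s" obtains V where "finite V" "\<not> affine_dependent V" "int (card V) = i + 1" "s = convex hull V"
  using assms by (auto simp: simplex)

lemma simplex_image:
  fixes f :: "'a::euclidean_space \<Rightarrow> 'b::euclidean_space"
  assumes "i simplex s" "affine_map_on s f" "inj_on f s"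
  shows "i simplex (f ` s)"
proof -
  obtain V where V: "finite V" "\<not> affine_dependent V" "int (card V) = i + 1" "s = convex hull V"
    by (rule simplex_vertices[OF assms(1)])
  have "\<not> affine_dependent (f ` V)" using affine_image_independent[OF V(2)] assms V by simp
  moreover have "card (f ` V) = card V"
    by (rule card_image) (rule inj_on_subset[OF assms(3)], simp add: V(4) hull_subset)
  moreover have "f ` s = convex hull (f ` V)" using affine_image_hull[of V f V] assms V by simp
  ultimately show ?thesis using V unfolding simplex_def by (intro exI[of _ "f ` V"]) simp
qed

lemma face_of_image:
  fixes f :: "'a::euclidean_space \<Rightarrow> 'b::euclidean_space"
  assumes "i simplex s" "affine_map_on s f" "inj_on f s"
  shows "r face_of (f ` s) \<longleftrightarrow> (\<exists>q. q face_of s \<and> r = f ` q)"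
proof -
  obtain V where V: "finite V" "\<not> affine_dependent V" "int (card V) = i + 1" "s = convex hull V"
    by (rule simplex_vertices[OF assms(1)])
  have ind: "\<not> affine_dependent (f ` V)" using affine_image_independent[OF V(2)] assms V by simp
  have im: "f ` (convex hull W) = convex hull (f ` W)" if "W \<subseteq> V" for W
    using affine_image_hull[of V f W] assms V that by simp
  have "r face_of (f ` s) \<longleftrightarrow> (\<exists>W'\<subseteq>f ` V. r = convex hull W')"
    unfolding V(4) im[OF order_refl] face_of_convex_hull_affine_independent[OF ind] by blast
  also have "\<dots> \<longleftrightarrow> (\<exists>W\<subseteq>V. r = convex hull (f ` W))" by (auto simp: subset_image_iff)
  also have "\<dots> \<longleftrightarrow> (\<exists>W\<subseteq>V. r = f ` (convex hull W))" using im by metis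
  also have "\<dots> \<longleftrightarrow> (\<exists>q. q face_of s \<and> r = f ` q)"
    unfolding V(4) face_of_convex_hull_affine_independent[OF V(2)] by blast
  finally show ?thesis .
qed

lemma aff_dim_image:
  fixes f :: "'a::euclidean_space \<Rightarrow> 'b::euclidean_space"
  assumes "i simplex s" "affine_map_on s f" "inj_on f s" "q face_of s"
  shows "aff_dim (f ` q) = aff_dim q"
proof -
  have "q \<subseteq> s" using assms(4) face_of_imp_subset by blast
  then have "aff_dim q simplex (f ` q)"
    using simplex_image[OF face_of_simplex[OF assms(1,4)]] assms affine_map_on_subset inj_on_subset by blast
  then show ?thesis by (rule aff_dim_simplex)
qed

lemma facet_of_image:
  fixes f :: "'a::euclidean_space \<Rightarrow> 'b::euclidean_space"
  assumes "i simplex s" "affine_map_on s f" "inj_on f s"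
  shows "r facet_of (f ` s) \<longleftrightarrow> (\<exists>q. q facet_of s \<and> r = f ` q)"
proof -
  have "s face_of s" using assms(1) convex_simplex face_of_refl by blast
  then show ?thesis
    unfolding facet_of_def face_of_image[OF assms] using aff_dim_image[OF assms] by auto
qed

text \<open>An embedding that is affine on each simplex of \<open>T\<close> carries simplices, faces and boundaries of \<open>T\<close>
to those of a complex in the target.\<close>

locale simplexwise_embedding =
  fixes T :: "'b::euclidean_space set set" and f :: "'b \<Rightarrow> 'a::euclidean_space"
  assumes T: "simplicial_complex T" and aff: "\<And>t. t \<in> T \<Longrightarrow> affine_map_on t f"
    and inj: "inj_on f (\<Union>T)"
begin

lemma inj': "t \<in> T \<Longrightarrow> inj_on f t" using inj inj_on_subset by blast

lemma image_eq: "x \<subseteq> \<Union>T \<Longrightarrow> y \<subseteq> \<Union>T \<Longrightarrow> f ` x = f ` y \<longleftrightarrow> x = y"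
  using inj by (rule inj_on_image_eq_iff)

lemma dim_image: "t \<in> T \<Longrightarrow> aff_dim (f ` t) = aff_dim t"
  using aff_dim_image[OF complex_simplex[OF T] aff inj'] face_of_refl complex_convex[OF T] by blast

lemma facet_image: "t \<in> T \<Longrightarrow> r facet_of (f ` t) \<longleftrightarrow> (\<exists>q. q facet_of t \<and> r = f ` q)"
  using facet_of_image[OF complex_simplex[OF T] aff inj'] by blast

lemma complex_image:
  assumes S: "S \<subseteq> T" "simplicial_complex S"
  shows "simplicial_complex ((`) f ` S)"
  unfolding simplicial_complex_def
proof (intro conjI allI impI ballI)
  show "finite ((`) f ` S)" using simplicial_complexD(1)[OF S(2)] by blast
  show "\<exists>n. n simplex X" if "X \<in> (`) f ` S" for X
    using that simplex_image[OF complex_simplex[OF T] aff inj'] S by blast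
  show "F \<in> (`) f ` S" if XF: "X \<in> (`) f ` S \<and> F face_of X" for F X
  proof -
    obtain s where s: "s \<in> S" "F face_of f ` s" using XF by blast
    then obtain q where q: "q face_of s" "F = f ` q"
      using face_of_image[OF complex_simplex[OF T] aff inj'] S by blast
    then show ?thesis using simplicial_complexD(3)[OF S(2) s(1)] by blast
  qed
  show "X \<inter> Y face_of X" if XY: "X \<in> (`) f ` S \<and> Y \<in> (`) f ` S" for X Y
  proof -
    obtain s t where st: "s \<in> S" "t \<in> S" "X = f ` s" "Y = f ` t" using XY by blast
    then have sT: "s \<in> T" "t \<in> T" using S by auto
    have "f ` s \<inter> f ` t = f ` (s \<inter> t)"
      by (rule inj_on_image_Int[OF inj, symmetric]) (use sT in auto)
    then show ?thesis
      unfolding st(3,4) face_of_image[OF complex_simplex[OF T sT(1)] aff[OF sT(1)] inj'[OF sT(1)]]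
      using complex_Int(2)[OF T sT] by blast
  qed
qed

lemma top_cells_image: "S \<subseteq> T \<Longrightarrow> top_cells i ((`) f ` S) = (`) f ` top_cells i S"
  using dim_image unfolding top_cells_def by auto

lemma bdry_image:
  assumes S: "S \<subseteq> T" shows "bdry ((`) f ` S) = (`) f ` bdry S"
proof -
  have sub: "q \<subseteq> \<Union>T" if "q facet_of s" "s \<in> S" for q s
    using that S facet_of_imp_subset by blast
  have cnt: "card {c \<in> (`) f ` S. f ` q facet_of c} = card {s \<in> S. q facet_of s}" if q: "q \<subseteq> \<Union>T" for q
  proof -
    have "f ` q facet_of f ` s \<longleftrightarrow> q facet_of s" if "s \<in> S" for s
    proof -
      have "s \<in> T" using that S by blast
      then show ?thesis using facet_image[of s "f ` q"] image_eq[OF q sub[OF _ that]] by metis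
    qed
    then have "{c \<in> (`) f ` S. f ` q facet_of c} = (`) f ` {s \<in> S. q facet_of s}" by blast
    moreover have "inj_on ((`) f) {s \<in> S. q facet_of s}"
    proof (rule inj_onI)
      fix x y assume "x \<in> {s \<in> S. q facet_of s}" "y \<in> {s \<in> S. q facet_of s}" "f ` x = f ` y"
      then show "x = y" using image_eq[of x y] S by (simp add: Union_upper subsetD)
    qed
    ultimately show ?thesis by (simp add: card_image)
  qed
  have nonz: "\<exists>c\<in>X. r facet_of c" if "r \<in> bdry X" for r and X :: "'c::euclidean_space set set"
  proof -
    have "card {s \<in> X. r facet_of s} \<noteq> 0" using that unfolding bdry_def by (metis (mono_tags, lifting) even_zero mem_Collect_eq)
    then have "{s \<in> X. r facet_of s} \<noteq> {}" by (metis card.empty)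
    then show ?thesis by blast
  qed
  show ?thesis
  proof (intro set_eqI iffI)
    fix r assume r: "r \<in> bdry ((`) f ` S)"
    then obtain s where s: "s \<in> S" "r facet_of f ` s" using nonz by blast
    then obtain q where q: "q facet_of s" "r = f ` q" using facet_image S by blast
    then have "q \<in> bdry S" using r cnt[OF sub[OF q(1) s(1)]] by (simp add: bdry_def)
    then show "r \<in> (`) f ` bdry S" using q by blast
  next
    fix r assume "r \<in> (`) f ` bdry S"
    then obtain q where q: "q \<in> bdry S" "r = f ` q" by blast
    then obtain s where "s \<in> S" "q facet_of s" using nonz by blast
    then show "r \<in> bdry ((`) f ` S)" using q cnt[OF sub] by (simp add: bdry_def)
  qed
qed

end

lemma subcomplex_within:
  assumes "simplicial_complex T"
  shows "simplicial_complex {t \<in> T. t \<subseteq> Q}"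
  using assms face_of_imp_subset unfolding simplicial_complex_def by (simp add: finite_subset) blast

lemma pl_map_continuous:
  assumes "pl_map_on P f" shows "continuous_on P f"
proof -
  obtain T where T: "simplicial_complex T" "\<Union>T = P" "\<And>t. t \<in> T \<Longrightarrow> affine_map_on t f"
    using assms unfolding pl_map_on_def by blast
  have "continuous_on (\<Union>t\<in>T. t) f"
  proof (rule continuous_on_closed_Union)
    fix t assume t: "t \<in> T"
    obtain g c where g: "linear g" "\<And>x. x \<in> t \<Longrightarrow> f x = g x + c"
      using T(3)[OF t] unfolding affine_map_on_def by blast
    have "continuous_on t (\<lambda>x. g x + c)" using g(1) by (intro continuous_intros linear_continuous_on) (simp add: linear_conv_bounded_linear)
    then show "continuous_on t f" using g(2) by (simp cong: continuous_on_cong)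
  qed (use simplicial_complexD[OF T(1)] in auto)
  then show ?thesis using T(2) by simp
qed

text \<open>Intersect the simplices of \<open>K\<close> with those of a triangulation on whose simplices the map is affine, and
triangulate the resulting cell complex.\<close>

lemma common_refinement:
  fixes K :: "'b::euclidean_space set set"
  assumes K: "simplicial_complex K" and f: "pl_map_on (\<Union>K) f"
  obtains T where "simplicial_complex T" "\<Union>T = \<Union>K" "\<And>t. t \<in> T \<Longrightarrow> affine_map_on t f"
    "\<And>s. s \<in> K \<Longrightarrow> \<Union>{t \<in> T. t \<subseteq> s} = s"
proof -
  obtain U where U: "simplicial_complex U" "\<Union>U = \<Union>K" "\<And>t. t \<in> U \<Longrightarrow> affine_map_on t f"
    using f unfolding pl_map_on_def by blast
  define M where "M = (\<lambda>(s, t). s \<inter> t) ` (K \<times> U)"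
  have fin: "finite M" using simplicial_complexD(1)[OF K] simplicial_complexD(1)[OF U(1)] by (simp add: M_def)
  have poly: "polytope C" if "C \<in> M" for C
    using that simplicial_complexD(4)[OF K] simplicial_complexD(4)[OF U(1)] polytope_Int by (auto simp: M_def)
  have face: "C \<inter> D face_of C" if CD: "C \<in> M" "D \<in> M" for C D
  proof -
    obtain s t where st: "s \<in> K" "t \<in> U" "C = s \<inter> t" using CD(1) by (auto simp: M_def)
    obtain s' t' where st': "s' \<in> K" "t' \<in> U" "D = s' \<inter> t'" using CD(2) by (auto simp: M_def)
    have "(s \<inter> s') \<inter> (t \<inter> t') face_of s \<inter> t"
      using face_of_Int_Int[OF complex_Int(2)[OF K st(1) st'(1)] complex_Int(2)[OF U(1) st(2) st'(2)]] .
    moreover have "(s \<inter> s') \<inter> (t \<inter> t') = C \<inter> D" using st st' by blast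
    ultimately show ?thesis using st by simp
  qed
  obtain T where T: "simplicial_complex T" "\<Union>T = \<Union>M"
    "\<And>C. C \<in> M \<Longrightarrow> \<exists>F. finite F \<and> F \<subseteq> T \<and> C = \<Union>F" "\<And>k. k \<in> T \<Longrightarrow> \<exists>C. C \<in> M \<and> k \<subseteq> C"
    using simplicial_subdivision_of_cell_complex[OF fin poly face] by blast
  have UM: "\<Union>M = \<Union>K"
  proof
    show "\<Union>M \<subseteq> \<Union>K" by (auto simp: M_def)
    show "\<Union>K \<subseteq> \<Union>M"
    proof
      fix x assume x: "x \<in> \<Union>K"
      then obtain s t where "s \<in> K" "t \<in> U" "x \<in> s \<inter> t" using U(2) by blast
      then show "x \<in> \<Union>M" unfolding M_def by force
    qed
  qed
  show thesis
  proof (rule that[OF T(1)])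
    show "\<Union>T = \<Union>K" using T UM by simp
    show "affine_map_on t f" if t: "t \<in> T" for t
    proof -
      obtain C where C: "C \<in> M" "t \<subseteq> C" using T(4)[OF t] by blast
      then obtain u where "u \<in> U" "t \<subseteq> u" by (auto simp: M_def)
      then show ?thesis using U(3) affine_map_on_subset by blast
    qed
    show "\<Union>{t \<in> T. t \<subseteq> s} = s" if s: "s \<in> K" for s
    proof
      show "s \<subseteq> \<Union>{t \<in> T. t \<subseteq> s}"
      proof
        fix x assume x: "x \<in> s"
        then obtain u where u: "u \<in> U" "x \<in> u" using U(2) s by blast
        then have "s \<inter> u \<in> M" using s by (force simp: M_def)
        then obtain F where F: "F \<subseteq> T" "s \<inter> u = \<Union>F" using T(3) by blast
        then obtain t where t: "t \<in> F" "x \<in> t" using x u by blast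
        then have "t \<subseteq> s" using F by blast
        then show "x \<in> \<Union>{t \<in> T. t \<subseteq> s}" using t F by blast
      qed
    qed blast
  qed
qed

section \<open>Crossing counts of the cells of a complex\<close>

text \<open>The simplices of \<open>K\<close> are mapped to curved cells, subdivided by the images of the simplices of \<open>T\<close>.
Crossing counts of these cells obey the same coboundary formula as those of straight cells.\<close>

locale refined_embedding = simplexwise_embedding T f
  for T :: "'b::euclidean_space set set" and f :: "'b \<Rightarrow> 'a::euclidean_space" +
  fixes K :: "'b set set"
  assumes K: "simplicial_complex K" and refine: "\<And>s. s \<in> K \<Longrightarrow> \<Union>{t \<in> T. t \<subseteq> s} = s"
begin

definition img :: "'b set \<Rightarrow> 'a set set" where "img s = (`) f ` {t \<in> T. t \<subseteq> s}"

text \<open>The product cells to which the linear forms must be in general position.\<close>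

definition \<Q> :: "('a \<times> 'a) set set" where "\<Q> = {f ` s \<times> f ` t |s t. s \<in> T \<and> t \<in> T \<and> s \<inter> t = {}}"

lemma finite_\<Q>: "finite \<Q>"
proof -
  have "\<Q> \<subseteq> (\<lambda>(s, t). f ` s \<times> f ` t) ` (T \<times> T)" by (auto simp: \<Q>_def)
  then show ?thesis using simplicial_complexD(1)[OF T] by (meson finite_SigmaI finite_imageI finite_subset)
qed

lemma admissible_\<Q>: assumes "Q \<in> \<Q>" shows "admissible Q"
proof -
  obtain s t where st: "Q = f ` s \<times> f ` t" "s \<in> T" "t \<in> T" "s \<inter> t = {}" using assms by (auto simp: \<Q>_def)
  have "f ` s \<inter> f ` t = f ` (s \<inter> t)"
    by (rule inj_on_image_Int[OF inj, symmetric]) (use st in auto)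
  then show ?thesis unfolding st(1) using st(4) by (intro admissible_disjoint) simp
qed

lemma img_complex: "simplicial_complex (img s)"
  unfolding img_def by (rule complex_image[OF _ subcomplex_within[OF T]]) blast

lemma img_Union: "s \<in> K \<Longrightarrow> \<Union>(img s) = f ` s"
  unfolding img_def using refine[of s] by (metis image_Union)

lemma img_dim: assumes "s \<in> K" "x \<in> img s" shows "aff_dim x \<le> aff_dim s"
proof -
  obtain t where t: "x = f ` t" "t \<in> T" "t \<subseteq> s" using assms by (auto simp: img_def)
  then show ?thesis using dim_image aff_dim_subset by metis
qed

lemma img_cuts:
  assumes "generic l \<Q>" "s \<inter> t = {}" "x \<in> img s" "y \<in> img t"
  shows "cuts_down l (x \<times> y)"
proof -
  obtain u where "x = f ` u" "u \<in> T" "u \<subseteq> s" using assms(3) unfolding img_def by blast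
  moreover obtain v where "y = f ` v" "v \<in> T" "v \<subseteq> t" using assms(4) unfolding img_def by blast
  ultimately have "x \<times> y \<in> \<Q>" using assms(2) unfolding \<Q>_def by blast
  then show ?thesis using assms(1) by (simp add: generic_def)
qed

lemma img_counts:
  assumes "generic l \<Q>" "s \<in> K" "t \<in> K" "s \<inter> t = {}" "aff_dim s + aff_dim t = int k" "k \<le> DIM('a)"
  shows "finite (f ` s \<times> f ` t \<inter> fib l k)"
    and "card {z \<in> f ` s \<times> f ` t \<inter> fib l k. R z} =
      (\<Sum>x\<in>top_cells (aff_dim s) (img s). \<Sum>y\<in>top_cells (aff_dim t) (img t). card {z \<in> x \<times> y \<inter> fib l k. R z})"
proof -
  have ds: "aff_dim x \<le> aff_dim s" if "x \<in> img s" for x by (rule img_dim[OF assms(2) that])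
  have dt: "aff_dim x \<le> aff_dim t" if "x \<in> img t" for x by (rule img_dim[OF assms(3) that])
  have cd: "cuts_down l (x \<times> y)" if "x \<in> img s" "y \<in> img t" for x y by (rule img_cuts[OF assms(1,4) that])
  note c = card_Union_crossings[OF img_complex ds img_complex dt assms(5,6) cd]
  have "finite (\<Union>(img s) \<times> \<Union>(img t) \<inter> fib l k)" by (rule c(1))
  then show "finite (f ` s \<times> f ` t \<inter> fib l k)" by (simp only: img_Union[OF assms(2)] img_Union[OF assms(3)])
  have "card {z \<in> \<Union>(img s) \<times> \<Union>(img t) \<inter> fib l k. R z} =
      (\<Sum>x\<in>top_cells (aff_dim s) (img s). \<Sum>y\<in>top_cells (aff_dim t) (img t). card {z \<in> x \<times> y \<inter> fib l k. R z})"
    by (rule c(2))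
  then show "card {z \<in> f ` s \<times> f ` t \<inter> fib l k. R z} =
      (\<Sum>x\<in>top_cells (aff_dim s) (img s). \<Sum>y\<in>top_cells (aff_dim t) (img t). card {z \<in> x \<times> y \<inter> fib l k. R z})"
    by (simp only: img_Union[OF assms(2)] img_Union[OF assms(3)])
qed

text \<open>Only the walls in the facets of \<open>s\<close> survive modulo 2, by \<open>bdry_subdivision\<close>.\<close>

lemma bdry_img:
  assumes s: "s \<in> K"
  shows "bdry (top_cells (aff_dim s) (img s)) = (\<Union>r\<in>{r. r facet_of s}. top_cells (aff_dim s - 1) (img r))"
proof -
  let ?W = "{t \<in> T. t \<subseteq> s}" and ?i = "aff_dim s"
  have poly: "polytope s" using simplicial_complexD(4)[OF K s] .
  have tW: "top_cells i {t \<in> T. t \<subseteq> r} \<subseteq> T" for i r by (auto simp: top_cells_def)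
  have "bdry (top_cells ?i ?W) = {r \<in> ?W. r \<noteq> {} \<and> aff_dim r = ?i - 1 \<and> r \<subseteq> rel_frontier s}"
    by (rule bdry_subdivision[OF poly refl subcomplex_within[OF T] refine[OF s]])
  also have "\<dots> = (\<Union>r\<in>{r. r facet_of s}. top_cells (?i - 1) {t \<in> T. t \<subseteq> r})"
  proof (intro set_eqI iffI)
    fix x assume x: "x \<in> {r \<in> ?W. r \<noteq> {} \<and> aff_dim r = ?i - 1 \<and> r \<subseteq> rel_frontier s}"
    then have "convex x" using complex_convex[OF T] by blast
    then obtain y where y: "y \<in> rel_interior x" using rel_interior_ne x by blast
    then have "y \<in> \<Union>{F. F facet_of s}"
      using x rel_interior_subset rel_frontier_of_polyhedron[OF polytope_imp_polyhedron[OF poly]] by blast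
    then obtain F where F: "F facet_of s" "y \<in> F" by blast
    have "x \<subseteq> F" using subset_of_face_of[OF facet_of_imp_face_of[OF F(1)], of x] x y F by blast
    then show "x \<in> (\<Union>r\<in>{r. r facet_of s}. top_cells (?i - 1) {t \<in> T. t \<subseteq> r})"
      using F x by (auto simp: top_cells_def)
  next
    fix x assume "x \<in> (\<Union>r\<in>{r. r facet_of s}. top_cells (?i - 1) {t \<in> T. t \<subseteq> r})"
    then obtain r where r: "r facet_of s" "x \<in> T" "x \<subseteq> r" "aff_dim x = ?i - 1" by (auto simp: top_cells_def)
    have "r \<noteq> {}" "aff_dim r = ?i - 1" using r by (auto simp: facet_of_def)
    then have "x \<noteq> {}" using r(4) by (metis aff_dim_empty)
    moreover have "r \<subseteq> rel_frontier s" using r rel_frontier_of_polyhedron[OF polytope_imp_polyhedron[OF poly]] by blast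
    moreover have "r \<subseteq> s" using r facet_of_imp_subset by blast
    ultimately show "x \<in> {r \<in> ?W. r \<noteq> {} \<and> aff_dim r = ?i - 1 \<and> r \<subseteq> rel_frontier s}" using r by blast
  qed
  finally have eq: "bdry (top_cells ?i ?W) = (\<Union>r\<in>{r. r facet_of s}. top_cells (?i - 1) {t \<in> T. t \<subseteq> r})" .
  have "bdry (top_cells ?i (img s)) = (`) f ` bdry (top_cells ?i ?W)"
  proof -
    have "top_cells ?i (img s) = (`) f ` top_cells ?i ?W" unfolding img_def by (rule top_cells_image) blast
    then show ?thesis using bdry_image[OF tW] by simp
  qed
  also have "\<dots> = (\<Union>r\<in>{r. r facet_of s}. (`) f ` top_cells (?i - 1) {t \<in> T. t \<subseteq> r})"
    unfolding eq by (rule image_UN)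
  also have "\<dots> = (\<Union>r\<in>{r. r facet_of s}. top_cells (?i - 1) (img r))"
    unfolding img_def by (intro SUP_cong refl top_cells_image[symmetric]) blast
  finally show ?thesis .
qed

lemma sum_bdry_img:
  fixes G :: "'a set \<Rightarrow> nat"
  assumes s: "s \<in> K"
  shows "sum G (bdry (top_cells (aff_dim s) (img s))) = (\<Sum>r | r facet_of s. sum G (top_cells (aff_dim s - 1) (img r)))"
  unfolding bdry_img[OF s]
proof (rule sum.UNION_disjoint)
  have poly: "polytope s" using simplicial_complexD(4)[OF K s] .
  then show "finite {r. r facet_of s}" by (rule finite_polytope_facets)
  show "\<forall>r\<in>{r. r facet_of s}. finite (top_cells (aff_dim s - 1) (img r))"
    using simplicial_complexD(1)[OF img_complex] by (auto simp: top_cells_def)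
  show "\<forall>r\<in>{r. r facet_of s}. \<forall>q\<in>{r. r facet_of s}. r \<noteq> q \<longrightarrow>
      top_cells (aff_dim s - 1) (img r) \<inter> top_cells (aff_dim s - 1) (img q) = {}"
  proof (intro ballI impI)
    fix r q assume rq: "r \<in> {r. r facet_of s}" "q \<in> {r. r facet_of s}" "r \<noteq> q"
    then have f: "r facet_of s" "q facet_of s" by auto
    then have KK: "r \<in> K" "q \<in> K" using simplicial_complexD(3)[OF K s] facet_of_imp_face_of by blast+
    have "r \<inter> q \<noteq> r \<or> r \<inter> q \<noteq> q" using rq by blast
    then have lt: "aff_dim (r \<inter> q) < aff_dim s - 1"
      using face_of_aff_dim_lt[OF complex_convex[OF K KK(1)] complex_Int(2)[OF K KK]]
        face_of_aff_dim_lt[OF complex_convex[OF K KK(2)] complex_Int(3)[OF K KK]] f by (auto simp: facet_of_def)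
    show "top_cells (aff_dim s - 1) (img r) \<inter> top_cells (aff_dim s - 1) (img q) = {}"
    proof (rule ccontr)
      assume "\<not> ?thesis"
      then obtain x where x: "x \<in> img r" "x \<in> img q" "aff_dim x = aff_dim s - 1" by (auto simp: top_cells_def)
      obtain u where u: "x = f ` u" "u \<in> T" "u \<subseteq> r" using x(1) unfolding img_def by blast
      obtain v where v: "x = f ` v" "v \<in> T" "v \<subseteq> q" using x(2) unfolding img_def by blast
      note uv = u v
      then have "u = v" using image_eq[of u v] by blast
      then have "aff_dim u \<le> aff_dim (r \<inter> q)" using uv by (intro aff_dim_subset) blast
      then show False using lt x(3) dim_image[OF uv(2)] uv(1) by simp
    qed
  qed
qed

text \<open>The coboundary formula for the pieces of \<open>f(s)\<close> and \<open>f(t)\<close>; the pieces in the interior of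
\<open>s\<close> and \<open>t\<close> contribute no boundary.\<close>

theorem meet_boundary:
  assumes gen: "generic l \<Q>" and s: "s \<in> K" and t: "t \<in> K" and disj: "s \<inter> t = {}" and ne: "s \<noteq> {}" "t \<noteq> {}"
    and d: "aff_dim s + aff_dim t = int k + 1" and k: "k < DIM('a)"
  shows "even (meet l (Suc k) (f ` s) (f ` t) +
    ((\<Sum>r | r facet_of s. over l k (f ` r) (f ` t)) + (\<Sum>r | r facet_of t. over l k (f ` s) (f ` r))))"
proof -
  let ?S = "top_cells (aff_dim s) (img s)" and ?T = "top_cells (aff_dim t) (img t)"
  have fin: "finite ?S" "finite ?T" using simplicial_complexD(1)[OF img_complex] by (auto simp: top_cells_def)
  have nn: "0 \<le> aff_dim s" "0 \<le> aff_dim t" using ne by (meson aff_dim_negative_iff not_less)+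
  have cS: "polytope x \<and> aff_dim x = aff_dim s" if "x \<in> ?S" for x
    using that simplicial_complexD(4)[OF img_complex] by (auto simp: top_cells_def)
  have cT: "polytope x \<and> aff_dim x = aff_dim t" if "x \<in> ?T" for x
    using that simplicial_complexD(4)[OF img_complex] by (auto simp: top_cells_def)
  have cd: "cuts_down l Q" if QQ: "Q \<in> cells ?S ?T" for Q
  proof -
    obtain x y u v where Q: "Q = x \<times> y" "u \<in> ?S" "v \<in> ?T" "x face_of u" "y face_of v" using QQ by (auto simp: cells_def)
    then have "x \<in> img s" "y \<in> img t"
      using simplicial_complexD(3)[OF img_complex] by (auto simp: top_cells_def)
    then show ?thesis unfolding Q(1) by (rule img_cuts[OF gen disj])
  qed
  have main: "even ((\<Sum>x\<in>?S. \<Sum>y\<in>?T. meet l (Suc k) x y) +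
      ((\<Sum>r\<in>bdry ?S. \<Sum>y\<in>?T. over l k r y) + (\<Sum>x\<in>?S. \<Sum>r\<in>bdry ?T. over l k x r)))"
    by (rule crossings_boundary(1)[OF fin(1) cS fin(2) cT nn d k cd])
  have m: "meet l (Suc k) (f ` s) (f ` t) = (\<Sum>x\<in>?S. \<Sum>y\<in>?T. meet l (Suc k) x y)"
    unfolding meet_def by (rule img_counts(2)[OF gen s t disj]) (use d k in auto)
  have facK: "r \<in> K" "r \<subseteq> u" "aff_dim r = aff_dim u - 1" if "u \<in> K" "r facet_of u" for r u
  proof -
    show "r \<in> K" by (rule simplicial_complexD(3)[OF K that(1) facet_of_imp_face_of[OF that(2)]])
    show "r \<subseteq> u" by (rule facet_of_imp_subset[OF that(2)])
    show "aff_dim r = aff_dim u - 1" using that(2) by (simp add: facet_of_def)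
  qed
  have o1: "(\<Sum>r\<in>bdry ?S. \<Sum>y\<in>?T. over l k r y) = (\<Sum>r | r facet_of s. over l k (f ` r) (f ` t))"
    unfolding sum_bdry_img[OF s]
  proof (rule sum.cong[OF refl])
    fix r assume "r \<in> {r. r facet_of s}"
    then have r: "r \<in> K" "r \<subseteq> s" "aff_dim r = aff_dim s - 1" using facK[OF s, of r] by blast+
    have rt: "r \<inter> t = {}" "aff_dim r + aff_dim t = int k" "k \<le> DIM('a)" using r disj d k by auto
    have "over l k (f ` r) (f ` t) = (\<Sum>x\<in>top_cells (aff_dim r) (img r). \<Sum>y\<in>?T. over l k x y)"
      unfolding over_def by (rule img_counts(2)[OF gen r(1) t rt])
    then show "(\<Sum>x\<in>top_cells (aff_dim s - 1) (img r). \<Sum>y\<in>?T. over l k x y) = over l k (f ` r) (f ` t)"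
      using r by simp
  qed
  have o2: "(\<Sum>x\<in>?S. \<Sum>r\<in>bdry ?T. over l k x r) = (\<Sum>r | r facet_of t. over l k (f ` s) (f ` r))"
  proof -
    have "(\<Sum>x\<in>?S. \<Sum>r\<in>bdry ?T. over l k x r) = (\<Sum>r\<in>bdry ?T. \<Sum>x\<in>?S. over l k x r)" by (rule sum.swap)
    also have "\<dots> = (\<Sum>r | r facet_of t. over l k (f ` s) (f ` r))"
      unfolding sum_bdry_img[OF t]
    proof (rule sum.cong[OF refl])
      fix r assume "r \<in> {r. r facet_of t}"
      then have r: "r \<in> K" "r \<subseteq> t" "aff_dim r = aff_dim t - 1" using facK[OF t, of r] by blast+
      have rt: "s \<inter> r = {}" "aff_dim s + aff_dim r = int k" "k \<le> DIM('a)" using r disj d k by auto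
      have "over l k (f ` s) (f ` r) = (\<Sum>x\<in>?S. \<Sum>y\<in>top_cells (aff_dim r) (img r). over l k x y)"
        unfolding over_def by (rule img_counts(2)[OF gen s r(1) rt])
      also have "\<dots> = (\<Sum>y\<in>top_cells (aff_dim r) (img r). \<Sum>x\<in>?S. over l k x y)" by (rule sum.swap)
      finally show "(\<Sum>y\<in>top_cells (aff_dim t - 1) (img r). \<Sum>x\<in>?S. over l k x y) = over l k (f ` s) (f ` r)"
        using r by simp
    qed
    finally show ?thesis .
  qed
  show ?thesis using main unfolding m o1 o2 .
qed

text \<open>By genericity the dimension of the intersection would be negative.\<close>

lemma no_crossing:
  assumes gen: "generic l \<Q>" and st: "s \<in> K" "t \<in> K" "s \<inter> t = {}"
    and d: "aff_dim s + aff_dim t < int k" and k: "k \<le> DIM('a)"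
  shows "f ` s \<times> f ` t \<inter> fib l k = {}"
proof (rule ccontr)
  assume "\<not> ?thesis"
  then obtain z where z: "z \<in> f ` s \<times> f ` t" "z \<in> fib l k" by blast
  have "z \<in> \<Union>(img s) \<times> \<Union>(img t)" using z img_Union st by auto
  then obtain x y where xy: "x \<in> img s" "y \<in> img t" "z \<in> x \<times> y" by (auto simp: mem_Times_iff)
  then have ne: "x \<times> y \<inter> fib l k \<noteq> {}" "x \<noteq> {}" "y \<noteq> {}" using z by auto
  have "aff_dim (x \<times> y \<inter> fib l k) \<le> aff_dim (x \<times> y) - int k"
    using img_cuts[OF gen st(3) xy(1,2)] ne(1) k unfolding cuts_down_def by blast
  also have "aff_dim (x \<times> y) = aff_dim x + aff_dim y" using ne by (intro aff_dim_Times)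
  also have "\<dots> - int k < 0" using img_dim[OF st(1) xy(1)] img_dim[OF st(2) xy(2)] d by simp
  finally show False using ne(1) by (metis aff_dim_negative_iff)
qed

lemma over_add_swap_cells:
  assumes gen: "generic l \<Q>" and st: "s \<in> K" "t \<in> K" "s \<inter> t = {}"
    and d: "aff_dim s + aff_dim t = int k" and k: "k < DIM('a)"
  shows "over l k (f ` s) (f ` t) + over l k (f ` t) (f ` s) = meet l k (f ` s) (f ` t)"
proof (rule over_add_swap)
  show "finite (f ` s \<times> f ` t \<inter> fib l k)" using img_counts(1)[OF gen st d] k by simp
  have empty: "f ` s \<times> f ` t \<inter> fib l (Suc k) = {}"
    by (rule no_crossing[OF gen st]) (use d k in auto)
  fix z assume z: "z \<in> f ` s \<times> f ` t \<inter> fib l k"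
  show "ht l k z \<noteq> 0"
  proof
    assume "ht l k z = 0"
    then have "z \<in> fib l (Suc k)" using z by (simp add: fib_Suc_ht)
    then show False using z empty by blast
  qed
qed

end

section \<open>The van Kampen recursion\<close>

lemma even_sum_involution:
  fixes F :: "'c \<Rightarrow> nat"
  assumes "finite S" "\<And>x. x \<in> S \<Longrightarrow> \<iota> x \<in> S" "\<And>x. x \<in> S \<Longrightarrow> \<iota> x \<noteq> x" "\<And>x. x \<in> S \<Longrightarrow> \<iota> (\<iota> x) = x"
    "\<And>x. x \<in> S \<Longrightarrow> F (\<iota> x) = F x"
  shows "even (sum F S)"
  using assms
proof (induction "card S" arbitrary: S rule: less_induct)
  case less
  show ?case
  proof (cases "S = {}")
    case False
    then obtain x where x: "x \<in> S" by blast
    let ?R = "S - {x, \<iota> x}"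
    have ix: "\<iota> x \<in> S" "\<iota> x \<noteq> x" using less.prems x by auto
    have "?R \<subset> S" using x by blast
    then have "card ?R < card S" using less.prems(1) psubset_card_mono by blast
    then have "even (sum F ?R)"
    proof (rule less.hyps)
      fix y assume y: "y \<in> ?R"
      then have "\<iota> y \<noteq> x" "\<iota> y \<noteq> \<iota> x" using less.prems(4) x by (metis DiffD1 DiffD2 insertCI)+
      then show "\<iota> y \<in> ?R" using less.prems(2) y by blast
    qed (use less.prems in auto)
    moreover have "sum F S = F x + (F (\<iota> x) + sum F ?R)"
    proof -
      have "sum F S = F x + sum F (S - {x})" using less.prems(1) x by (rule sum.remove)
      also have "sum F (S - {x}) = F (\<iota> x) + sum F (S - {x} - {\<iota> x})"
        using less.prems(1) ix by (intro sum.remove) auto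
      also have "S - {x} - {\<iota> x} = ?R" by blast
      finally show ?thesis .
    qed
    ultimately show ?thesis using less.prems(5)[OF x] by simp
  qed simp
qed

text \<open>The simplex with the vertices \<open>h 0, \<dots>, h (i-1)\<close> in the first \<open>i\<close> of the sets \<open>V\<^sup>j\<close>. A function in
\<open>choices i\<close> is such a simplex, and a pair in \<open>opposite i\<close> is an ordered pair of disjoint ones.\<close>

definition part :: "nat \<Rightarrow> (nat \<Rightarrow> nat) \<Rightarrow> vertex set" where
  "part i h = (\<lambda>j. A j (h j)) ` {..<i}"

definition choices :: "nat \<Rightarrow> (nat \<Rightarrow> nat) set" where
  "choices i = {..<i} \<rightarrow>\<^sub>E {0, 1, 2}"

definition opposite :: "nat \<Rightarrow> ((nat \<Rightarrow> nat) \<times> (nat \<Rightarrow> nat)) set" where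
  "opposite i = {(h, h'). h \<in> choices i \<and> h' \<in> choices i \<and> (\<forall>j<i. h j \<noteq> h' j)}"

lemma finite_choices: "finite (choices i)"
  by (simp add: choices_def finite_PiE)

lemma finite_opposite: "finite (opposite i)"
  by (rule finite_subset[of _ "choices i \<times> choices i"]) (auto simp: opposite_def finite_choices)

lemma choicesD:
  assumes "h \<in> choices i" "j < i" shows "h j \<in> {0,1,2}"
  by (rule PiE_mem[OF assms(1)[unfolded choices_def]]) (use assms(2) in simp)

lemma opposite_swap: "(h, h') \<in> opposite i \<longleftrightarrow> (h', h) \<in> opposite i"
  unfolding opposite_def mem_Collect_eq prod.case by metis

lemma sum_opposite_swap: "(\<Sum>(h, h')\<in>opposite i. G h h') = (\<Sum>(h, h')\<in>opposite i. G h' h)"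
  by (rule sum.reindex_bij_witness[of _ prod.swap prod.swap]) (auto simp: opposite_swap)

text \<open>The term depends on \<open>h j\<close> only through the condition \<open>h j \<noteq> h' j\<close>. So it stays the same when \<open>h j\<close>
is exchanged with the third vertex of \<open>V\<^sup>j\<close>, which is \<open>3 - h j - h' j\<close>, and this is an involution
without fixed points.\<close>

lemma even_removed_vertex:
  fixes G :: "vertex set \<Rightarrow> vertex set \<Rightarrow> nat"
  assumes "j < i"
  shows "even (\<Sum>(h, h')\<in>opposite i. G (part i h - {A j (h j)}) (part i h'))"
proof -
  define \<iota> where "\<iota> = (\<lambda>(h, h'). (h(j := 3 - h j - h' j), h' :: nat \<Rightarrow> nat))"
  have third: "3 - a - b \<in> {0,1,2} \<and> 3 - a - b \<noteq> a \<and> 3 - a - b \<noteq> b \<and> 3 - (3 - a - b) - b = a"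
    if "a \<in> {0,1,2}" "b \<in> {0,1,2}" "a \<noteq> b" for a b :: nat using that by auto
  have p: "part i (h(j := c)) - {A j c} = part i h - {A j (h j)}" for h c
    unfolding part_def by auto
  show ?thesis
  proof (rule even_sum_involution[of _ \<iota>, OF finite_opposite])
    fix x assume x: "x \<in> opposite i"
    then obtain h h' where hh: "x = (h, h')" "h \<in> choices i" "h' \<in> choices i" "\<forall>j<i. h j \<noteq> h' j"
      by (auto simp: opposite_def)
    note t = third[OF choicesD[OF hh(2) assms] choicesD[OF hh(3) assms]]
    have ne: "h j \<noteq> h' j" using hh assms by blast
    have "h(j := 3 - h j - h' j) \<in> choices i"
      using hh(2) assms t[OF ne] by (auto simp: choices_def PiE_iff extensional_def)
    then show "\<iota> x \<in> opposite i" using hh t[OF ne] by (auto simp: \<iota>_def opposite_def)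
    show "\<iota> x \<noteq> x" using t[OF ne] by (auto simp: \<iota>_def hh(1) fun_eq_iff)
    show "\<iota> (\<iota> x) = x" using t[OF ne] by (simp add: \<iota>_def hh(1))
    show "(case \<iota> x of (h, h') \<Rightarrow> G (part i h - {A j (h j)}) (part i h')) =
        (case x of (h, h') \<Rightarrow> G (part i h - {A j (h j)}) (part i h'))"
      using p[of h "3 - h j - h' j"] by (simp add: \<iota>_def hh(1))
  qed
qed

lemma even_removed_vertex':
  fixes G :: "vertex set \<Rightarrow> vertex set \<Rightarrow> nat"
  assumes "j < i"
  shows "even (\<Sum>(h, h')\<in>opposite i. G (part i h) (part i h' - {A j (h' j)}))"
  unfolding sum_opposite_swap[of "\<lambda>h h'. G (part i h) (part i h' - {A j (h' j)})"]
  using even_removed_vertex[OF assms, of "\<lambda>x y. G y x"] .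

lemma card_part [simp]: "card (part i h) = i" and finite_part [simp]: "finite (part i h)"
  unfolding part_def by (auto simp: card_image inj_on_def)

lemma part_not_mem [simp]: "i \<le> j \<Longrightarrow> A j a \<notin> part i h"
  by (auto simp: part_def)

lemma part_subset_type_I:
  assumes "h \<in> choices i" "i \<le> n" "a \<in> {0,1,2}"
  shows "\<exists>t\<in>type_I n. insert (A i a) (part i h) \<subseteq> t"
proof -
  let ?g = "\<lambda>j. if j < i then h j else a"
  have "(\<lambda>j. A j (?g j)) ` {0..n} \<in> type_I n"
    unfolding type_I_def using choicesD[OF assms(1)] assms(3) by (intro CollectI exI[of _ ?g]) auto
  moreover have "insert (A i a) (part i h) \<subseteq> (\<lambda>j. A j (?g j)) ` {0..n}"
    using assms(2) by (auto simp: part_def image_iff intro: bexI[of _ i])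
  ultimately show ?thesis by blast
qed

lemma K_complex_part:
  assumes "h \<in> choices i" "i \<le> n" "a \<in> {0,1,2}"
  shows "insert (A i a) (part i h) \<in> K_complex n" "part i h \<in> K_complex n"
  using part_subset_type_I[OF assms] unfolding K_complex_def by blast+

text \<open>The combinatorial properties of the crossing counts of the simplices of \<open>K\<^sup>(\<^sup>n\<^sup>)\<close> from which parity is
deduced. Two simplices with \<open>k + 2\<close> vertices together have total dimension \<open>k\<close>.\<close>

locale crossing_cochains =
  fixes n :: nat and over meet :: "nat \<Rightarrow> vertex set \<Rightarrow> vertex set \<Rightarrow> nat"
  assumes points: "\<And>v w. {v} \<in> K_complex n \<Longrightarrow> {w} \<in> K_complex n \<Longrightarrow> v \<noteq> w \<Longrightarrow> odd (meet 0 {v} {w})"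
    and symm: "\<And>k s t. s \<in> K_complex n \<Longrightarrow> t \<in> K_complex n \<Longrightarrow> s \<inter> t = {} \<Longrightarrow> s \<noteq> {} \<Longrightarrow> t \<noteq> {} \<Longrightarrow>
        card s + card t = k + 2 \<Longrightarrow> k \<le> 2 * n \<Longrightarrow> even (over k s t + over k t s + meet k s t)"
    and coboundary: "\<And>k s t. s \<in> K_complex n \<Longrightarrow> t \<in> K_complex n \<Longrightarrow> s \<inter> t = {} \<Longrightarrow> s \<noteq> {} \<Longrightarrow> t \<noteq> {} \<Longrightarrow>
        card s + card t = k + 3 \<Longrightarrow> k \<le> 2 * n \<Longrightarrow>
        even (meet (Suc k) s t + ((\<Sum>v\<in>s. over k (s - {v}) t) + (\<Sum>v\<in>t. over k s (t - {v}))))"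
begin

abbreviation ext :: "nat \<Rightarrow> (nat \<Rightarrow> nat) \<Rightarrow> nat \<Rightarrow> vertex set" where
  "ext i h a \<equiv> insert (A i a) (part i h)"

lemma sum_part: "(\<Sum>v\<in>part i h. G v) = (\<Sum>j<i. (G (A j (h j)) :: nat))"
  unfolding part_def by (subst sum.reindex) (auto simp: inj_on_def)

lemma sum_ext: "(\<Sum>v\<in>ext i h a. (G (ext i h a - {v}) :: nat)) =
   G (part i h) + (\<Sum>j<i. G (insert (A i a) (part i h - {A j (h j)})))"
proof -
  have "(\<Sum>v\<in>ext i h a. G (ext i h a - {v})) = G (ext i h a - {A i a}) + (\<Sum>v\<in>part i h. G (ext i h a - {v}))"
    by (rule sum.insert) auto
  also have "ext i h a - {A i a} = part i h" by (simp add: insert_Diff_if)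
  also have "(\<Sum>v\<in>part i h. G (ext i h a - {v})) = (\<Sum>j<i. G (ext i h a - {A j (h j)}))" by (rule sum_part)
  also have "\<dots> = (\<Sum>j<i. G (insert (A i a) (part i h - {A j (h j)})))"
    by (intro sum.cong refl arg_cong[of _ _ G]) auto
  finally show ?thesis .
qed

lemma disjoint_parts:
  assumes "(h, h') \<in> opposite i"
  shows "part i h \<inter> part i h' = {}" "a \<noteq> b \<Longrightarrow> ext i h a \<inter> ext i h' b = {}" "ext i h a \<inter> part i h' = {}"
  using assms by (auto simp: opposite_def part_def)

text \<open>One of the two orders of each pair of different vertices in \<open>{0, 1, 2}\<close>. The orientation
\<open>0 \<rightarrow> 1 \<leftarrow> 2 \<rightarrow> 0\<close> makes the vertex 1 occur twice in the second position and 2 twice in the first,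
so that in \<open>van_kampen_mixed\<close> only terms with the vertex 0 remain.\<close>

definition pair_reps :: "(nat \<times> nat) set" where "pair_reps = {(0, 1), (2, 1), (2, 0)}"

text \<open>Crossings of \<open>(i-1)\<close>-simplices of the join of \<open>i\<close> sets in \<open>(2i-2)\<close>-space, over all ordered pairs.\<close>

definition over_sum :: "nat \<Rightarrow> nat" where
  "over_sum i = (\<Sum>(h, h')\<in>opposite i. over (2 * i - 2) (part i h) (part i h'))"

text \<open>The van Kampen number of the join of \<open>i + 1\<close> three-point sets: the crossings of \<open>i\<close>-simplices in \<open>2i\<close>-space
over all unordered disjoint pairs. Each unordered pair has one order with
\<open>(a, b) \<in> pair_reps\<close>.\<close>

definition van_kampen :: "nat \<Rightarrow> nat" where
  "van_kampen i = (\<Sum>(h, h')\<in>opposite i. \<Sum>(a, b)\<in>pair_reps. meet (2 * i) (ext i h a) (ext i h' b))"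

text \<open>The intermediate step between \<open>van_kampen i\<close> and \<open>over_sum i\<close>: crossings of \<open>i\<close>-simplices containing
the vertex 0 of the last set with \<open>(i-1)\<close>-simplices of the join of the first \<open>i\<close> sets.\<close>

definition mixed_sum :: "nat \<Rightarrow> nat" where
  "mixed_sum i = (\<Sum>(h, h')\<in>opposite i. meet (2 * i - 1) (ext i h 0) (part i h'))"

text \<open>Coboundary formula for \<open>k = 2i - 2\<close>. The facets that lack a vertex in one of the first \<open>i\<close> sets cancel by
\<open>even_removed_vertex\<close>; the facet that lacks the last vertex gives \<open>over_sum i\<close>.\<close>

lemma mixed_over:
  assumes "1 \<le> i" "i \<le> n"
  shows "even (mixed_sum i + over_sum i)"
proof -
  let ?k = "2 * i - 2"
  have "even (\<Sum>(h, h')\<in>opposite i. meet (2 * i - 1) (ext i h 0) (part i h') +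
     ((over ?k (part i h) (part i h') + (\<Sum>j<i. over ?k (insert (A i 0) (part i h - {A j (h j)})) (part i h')))
     + (\<Sum>j<i. over ?k (ext i h 0) (part i h' - {A j (h' j)}))))"
  proof (rule dvd_sum, clarify)
    fix h h' assume hh: "(h, h') \<in> opposite i"
    then have ch: "h \<in> choices i" "h' \<in> choices i" by (auto simp: opposite_def)
    have "part i h' \<noteq> {}" using assms card_part[of i h'] by (metis card.empty not_one_le_zero)
    moreover have "Suc ?k = 2 * i - 1" using assms by simp
    ultimately show "even (meet (2 * i - 1) (ext i h 0) (part i h') +
     ((over ?k (part i h) (part i h') + (\<Sum>j<i. over ?k (insert (A i 0) (part i h - {A j (h j)})) (part i h')))
     + (\<Sum>j<i. over ?k (ext i h 0) (part i h' - {A j (h' j)}))))"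
      using coboundary[of "ext i h 0" "part i h'" ?k] disjoint_parts(3)[OF hh] assms
        K_complex_part(1)[OF ch(1) assms(2), of 0] K_complex_part(2)[OF ch(2) assms(2), of 0]
        sum_ext[of "\<lambda>s. over ?k s (part i h')" i 0 h] sum_part[of "\<lambda>v. over ?k (ext i h 0) (part i h' - {v})" i h']
      by simp
  qed
  then have "even (mixed_sum i + (over_sum i + (\<Sum>(h, h')\<in>opposite i. \<Sum>j<i. over ?k (insert (A i 0) (part i h - {A j (h j)})) (part i h'))
     + (\<Sum>(h, h')\<in>opposite i. \<Sum>j<i. over ?k (ext i h 0) (part i h' - {A j (h' j)}))))"
    by (simp add: mixed_sum_def over_sum_def case_prod_unfold sum.distrib)
  moreover have "even (\<Sum>(h, h')\<in>opposite i. \<Sum>j<i. over ?k (insert (A i 0) (part i h - {A j (h j)})) (part i h'))"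
    unfolding case_prod_unfold
    by (subst sum.swap, rule dvd_sum)
      (use even_removed_vertex[of _ i "\<lambda>s. over ?k (insert (A i 0) s)"] in \<open>simp add: case_prod_unfold\<close>)
  moreover have "even (\<Sum>(h, h')\<in>opposite i. \<Sum>j<i. over ?k (ext i h 0) (part i h' - {A j (h' j)}))"
    unfolding case_prod_unfold
    by (subst sum.swap, rule dvd_sum)
      (use even_removed_vertex'[of _ i "\<lambda>s. over ?k (insert (A i 0) s)"] in \<open>simp add: case_prod_unfold\<close>)
  ultimately show ?thesis by simp
qed

text \<open>Coboundary formula for \<open>k = 2i - 1\<close>. After cancellation each pair \<open>(a, b)\<close> leaves a term that depends only
on \<open>a\<close> and a term that depends only on \<open>b\<close>. Summed over \<open>pair_reps\<close>, those for the vertices 1 and 2 cancel,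
and the two for the vertex 0 are transposes of each other and add up to \<open>mixed_sum i\<close>.\<close>

lemma van_kampen_mixed:
  assumes "1 \<le> i" "i \<le> n"
  shows "even (van_kampen i + mixed_sum i)"
proof -
  let ?k = "2 * i - 1"
  let ?P = "\<lambda>h h' a b. \<Sum>j<i. over ?k (insert (A i a) (part i h - {A j (h j)})) (ext i h' b)"
  let ?R = "\<lambda>h h' a b. \<Sum>j<i. over ?k (ext i h a) (insert (A i b) (part i h' - {A j (h' j)}))"
  have step: "even (meet (2 * i) (ext i h a) (ext i h' b) +
      ((over ?k (part i h) (ext i h' b) + ?P h h' a b) + (over ?k (ext i h a) (part i h') + ?R h h' a b)))"
    if hh: "(h, h') \<in> opposite i" and ab: "a \<in> {0,1,2}" "b \<in> {0,1,2}" "a \<noteq> b" for h h' a b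
  proof -
    have ch: "h \<in> choices i" "h' \<in> choices i" using hh by (auto simp: opposite_def)
    have k: "Suc ?k = 2 * i" "i + 1 + (i + 1) = ?k + 3" "?k \<le> 2 * n" using assms by auto
    have "card (ext i h a) + card (ext i h' b) = ?k + 3" using k(2) by simp
    from coboundary[OF K_complex_part(1)[OF ch(1) assms(2) ab(1)] K_complex_part(1)[OF ch(2) assms(2) ab(2)]
        disjoint_parts(2)[OF hh ab(3)] _ _ this k(3)]
    show ?thesis
      unfolding k(1) sum_ext[of "\<lambda>s. over ?k s (ext i h' b)" i a h] sum_ext[of "\<lambda>s. over ?k (ext i h a) s" i b h'] by simp
  qed
  have evP: "even (\<Sum>(h, h')\<in>opposite i. ?P h h' a b)" for a b
    unfolding case_prod_unfold
    by (subst sum.swap, rule dvd_sum)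
      (use even_removed_vertex[of _ i "\<lambda>s t. over ?k (insert (A i a) s) (insert (A i b) t)"] in \<open>simp add: case_prod_unfold\<close>)
  have evR: "even (\<Sum>(h, h')\<in>opposite i. ?R h h' a b)" for a b
    unfolding case_prod_unfold
    by (subst sum.swap, rule dvd_sum)
      (use even_removed_vertex'[of _ i "\<lambda>s t. over ?k (insert (A i a) s) (insert (A i b) t)"] in \<open>simp add: case_prod_unfold\<close>)
  let ?M = "\<lambda>a b. \<Sum>(h, h')\<in>opposite i. meet (2 * i) (ext i h a) (ext i h' b)"
  let ?L = "\<lambda>b. \<Sum>(h, h')\<in>opposite i. over ?k (part i h) (ext i h' b)"
  let ?U = "\<lambda>a. \<Sum>(h, h')\<in>opposite i. over ?k (ext i h a) (part i h')"
  have M: "even (?M a b + (?L b + ?U a))" if ab: "a \<in> {0,1,2}" "b \<in> {0,1,2}" "a \<noteq> b" for a b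
  proof -
    have "even (\<Sum>(h, h')\<in>opposite i. meet (2 * i) (ext i h a) (ext i h' b) +
      ((over ?k (part i h) (ext i h' b) + ?P h h' a b) + (over ?k (ext i h a) (part i h') + ?R h h' a b)))"
      by (rule dvd_sum, clarify) (rule step[OF _ ab])
    then show ?thesis using evP[of a b] evR[of a b] by (simp add: case_prod_unfold sum.distrib)
  qed
  have van_kampen: "van_kampen i = ?M 0 1 + ?M 2 1 + ?M 2 0"
    by (simp add: van_kampen_def pair_reps_def case_prod_unfold sum.distrib)
  have e1: "even (van_kampen i + (?L 0 + ?U 0))"
  proof -
    \<comment> \<open>Over the pairs (0,1), (2,1), (2,0) the terms \<open>l1\<close> and \<open>u2\<close> occur twice.\<close>
    have par: "even (m1 + m2 + m3 + (l0 + u0))"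
      if "even (m1 + (l1 + u0))" "even (m2 + (l1 + u2))" "even (m3 + (l0 + u2))" for m1 m2 m3 l0 l1 u0 u2 :: nat
      using that by presburger
    show ?thesis unfolding van_kampen by (rule par[OF M M M]) simp_all
  qed
  have "?L 0 = (\<Sum>(h, h')\<in>opposite i. over ?k (part i h') (ext i h 0))" by (rule sum_opposite_swap)
  moreover have "even (\<Sum>(h, h')\<in>opposite i. over ?k (ext i h 0) (part i h') + over ?k (part i h') (ext i h 0)
      + meet ?k (ext i h 0) (part i h'))"
  proof (rule dvd_sum, clarify)
    fix h h' assume hh: "(h, h') \<in> opposite i"
    then have ch: "h \<in> choices i" "h' \<in> choices i" by (auto simp: opposite_def)
    have "part i h' \<noteq> {}" using assms card_part[of i h'] by (metis card.empty not_one_le_zero)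
    then show "even (over ?k (ext i h 0) (part i h') + over ?k (part i h') (ext i h 0) + meet ?k (ext i h 0) (part i h'))"
      using symm[of "ext i h 0" "part i h'" ?k] disjoint_parts(3)[OF hh] assms
        K_complex_part(1)[OF ch(1) assms(2), of 0] K_complex_part(2)[OF ch(2) assms(2), of 0] by simp
  qed
  ultimately have e2: "even (?U 0 + ?L 0 + mixed_sum i)"
    by (simp add: mixed_sum_def case_prod_unfold sum.distrib)
  show ?thesis using e1 e2 by presburger
qed

lemma opposite_Suc:
  "(\<Sum>(h, h')\<in>opposite (Suc i). (G (part (Suc i) h) (part (Suc i) h') :: nat)) =
   (\<Sum>(h, h')\<in>opposite i. \<Sum>(a, b)\<in>{(a, b). a \<in> {0,1,2} \<and> b \<in> {0,1,2} \<and> a \<noteq> b}. G (ext i h a) (ext i h' b))"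
proof -
  let ?B = "{(a, b). a \<in> {0,1,2::nat} \<and> b \<in> {0,1,2::nat} \<and> a \<noteq> b}"
  have part_upd: "part (Suc i) (h(i := a)) = ext i h a" for h a
    unfolding part_def lessThan_Suc by auto
  have finB: "finite ?B" by (rule finite_subset[of _ "{0,1,2} \<times> {0,1,2}"]) auto
  define I where "I = (\<lambda>((h, h'), (a, b)). (h(i := a), h'(i := b)) :: (nat \<Rightarrow> nat) \<times> (nat \<Rightarrow> nat))"
  define J where "J = (\<lambda>(h, h'). ((h(i := undefined), h'(i := undefined)), (h i, h' i)) :: ((nat \<Rightarrow> nat) \<times> (nat \<Rightarrow> nat)) \<times> (nat \<times> nat))"
  define H where "H = (\<lambda>((h, h'), (a, b)). G (ext i h a) (ext i h' b))"
  define H' where "H' = (\<lambda>(h, h'). G (part (Suc i) h) (part (Suc i) h'))"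
  have "sum H' (opposite (Suc i)) = sum H (opposite i \<times> ?B)"
  proof (rule sum.reindex_bij_witness[of _ I J])
    fix x assume "x \<in> opposite (Suc i)"
    then obtain h h' where x: "x = (h, h')" "h \<in> choices (Suc i)" "h' \<in> choices (Suc i)" "\<forall>j<Suc i. h j \<noteq> h' j"
      by (auto simp: opposite_def)
    show "I (J x) = x" by (simp add: x(1) I_def J_def)
    have "h(i := undefined) \<in> choices i" "h'(i := undefined) \<in> choices i"
      using x(2,3) by (auto simp: choices_def PiE_iff extensional_def less_Suc_eq)
    moreover have "h i \<in> {0,1,2}" "h' i \<in> {0,1,2}" using choicesD[OF x(2), of i] choicesD[OF x(3), of i] by auto
    ultimately show "J x \<in> opposite i \<times> ?B"
      using x(4) by (auto simp: x(1) opposite_def J_def)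
    have "ext i (g(i := undefined)) (g i) = part (Suc i) g" for g
      using part_upd[of "g(i := undefined)" "g i"] by simp
    then show "H (J x) = H' x" by (simp add: x(1) J_def H_def H'_def)
  next
    fix y assume y: "y \<in> opposite i \<times> ?B"
    then obtain h h' a b where yy: "y = ((h, h'), (a, b))" "h \<in> choices i" "h' \<in> choices i" "\<forall>j<i. h j \<noteq> h' j"
      "a \<in> {0,1,2}" "b \<in> {0,1,2}" "a \<noteq> b" by (auto simp: opposite_def)
    have und: "h i = undefined" "h' i = undefined" using yy(2,3) by (auto simp: choices_def PiE_iff extensional_def)
    have "h(i := undefined) = h" "h'(i := undefined) = h'" using und by (auto simp: fun_eq_iff)
    then show "J (I y) = y" by (simp add: yy(1) I_def J_def)
    have "h(i := a) \<in> choices (Suc i)"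
      unfolding choices_def lessThan_Suc by (rule PiE_fun_upd[OF yy(5) yy(2)[unfolded choices_def]])
    moreover have "h'(i := b) \<in> choices (Suc i)"
      unfolding choices_def lessThan_Suc by (rule PiE_fun_upd[OF yy(6) yy(3)[unfolded choices_def]])
    moreover have "\<forall>j<Suc i. (h(i := a)) j \<noteq> (h'(i := b)) j"
      using yy(4,7) by (auto simp: less_Suc_eq)
    ultimately show "I y \<in> opposite (Suc i)" unfolding yy(1) I_def opposite_def by simp
  qed
  also have "\<dots> = (\<Sum>(h, h')\<in>opposite i. \<Sum>(a, b)\<in>?B. G (ext i h a) (ext i h' b))"
    by (simp add: sum.cartesian_product case_prod_unfold H_def)
  finally show ?thesis by (simp add: H'_def)
qed

text \<open>The two orders of an unordered pair contribute \<open>over\<close> and its transpose, together \<open>meet\<close>.\<close>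

lemma over_van_kampen:
  assumes "i \<le> n"
  shows "even (over_sum (Suc i) + van_kampen i)"
proof -
  let ?B = "{(a, b). a \<in> {0,1,2::nat} \<and> b \<in> {0,1,2::nat} \<and> a \<noteq> b}"
  let ?G = "\<lambda>a b. \<Sum>(h, h')\<in>opposite i. over (2 * i) (ext i h a) (ext i h' b)"
  let ?M = "\<lambda>a b. \<Sum>(h, h')\<in>opposite i. meet (2 * i) (ext i h a) (ext i h' b)"
  have B: "?B = {(0,1),(0,2),(1,0),(1,2),(2,0),(2,1)}" by auto
  have "over_sum (Suc i) = (\<Sum>(h, h')\<in>opposite i. \<Sum>(a, b)\<in>?B. over (2 * i) (ext i h a) (ext i h' b))"
    unfolding over_sum_def using opposite_Suc[of "over (2 * i)" i] by simp
  also have "\<dots> = ?G 0 1 + ?G 0 2 + ?G 1 0 + ?G 1 2 + ?G 2 0 + ?G 2 1"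
    unfolding B by (simp add: case_prod_unfold sum.distrib)
  finally have lev: "over_sum (Suc i) = ?G 0 1 + ?G 0 2 + ?G 1 0 + ?G 1 2 + ?G 2 0 + ?G 2 1" .
  have van_kampen: "van_kampen i = ?M 0 1 + ?M 2 1 + ?M 2 0"
    by (simp add: van_kampen_def pair_reps_def case_prod_unfold sum.distrib)
  have pair: "even (?G a b + ?G b a + ?M a b)" if ab: "a \<in> {0,1,2}" "b \<in> {0,1,2}" "a \<noteq> b" for a b
  proof -
    have "?G b a = (\<Sum>(h, h')\<in>opposite i. over (2 * i) (ext i h' b) (ext i h a))"
      by (rule sum_opposite_swap)
    moreover have "even (\<Sum>(h, h')\<in>opposite i. over (2 * i) (ext i h a) (ext i h' b) +
        over (2 * i) (ext i h' b) (ext i h a) + meet (2 * i) (ext i h a) (ext i h' b))"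
    proof (rule dvd_sum, clarify)
      fix h h' assume hh: "(h, h') \<in> opposite i"
      then have ch: "h \<in> choices i" "h' \<in> choices i" by (auto simp: opposite_def)
      show "even (over (2 * i) (ext i h a) (ext i h' b) +
        over (2 * i) (ext i h' b) (ext i h a) + meet (2 * i) (ext i h a) (ext i h' b))"
        by (rule symm[OF K_complex_part(1)[OF ch(1) assms ab(1)] K_complex_part(1)[OF ch(2) assms ab(2)]
          disjoint_parts(2)[OF hh ab(3)]]) (use assms in auto)
    qed
    ultimately show ?thesis by (simp add: case_prod_unfold sum.distrib)
  qed
  show ?thesis unfolding lev van_kampen using pair[of 0 1] pair[of 2 1] pair[of 2 0] by simp presburger
qed

lemma opposite_0: "opposite 0 = {(\<lambda>_. undefined, \<lambda>_. undefined)}"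
  by (auto simp: opposite_def choices_def)

lemma odd_van_kampen_0: "odd (van_kampen 0)"
proof -
  have "odd (meet 0 {A 0 a} {A 0 b})" if "a \<in> {0,1,2}" "b \<in> {0,1,2}" "a \<noteq> b" for a b
    using points[of "A 0 a" "A 0 b"] K_complex_part(1)[of "\<lambda>_. undefined" 0 n a]
      K_complex_part(1)[of "\<lambda>_. undefined" 0 n b] that by (simp add: choices_def part_def)
  from this[of 0 1] this[of 2 1] this[of 2 0] show ?thesis
    by (simp add: van_kampen_def opposite_0 pair_reps_def part_def)
qed

text \<open>The base case counts the three pairs of points in a three-point set.\<close>

theorem odd_over_sum: "i \<le> n \<Longrightarrow> odd (over_sum (Suc i))"
proof (induction i)
  case 0
  then show ?case using over_van_kampen[of 0] odd_van_kampen_0 by simp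
next
  case (Suc i)
  then have "odd (over_sum (Suc i))" by simp
  moreover have "even (mixed_sum (Suc i) + over_sum (Suc i))" "even (van_kampen (Suc i) + mixed_sum (Suc i))" "even (over_sum (Suc (Suc i)) + van_kampen (Suc i))"
    using mixed_over[of "Suc i"] van_kampen_mixed[of "Suc i"] over_van_kampen[of "Suc i"] Suc by auto
  ultimately show ?case by presburger
qed

text \<open>The terms with \<open>b\<close> have a vertex removed, so they cancel by \<open>even_removed_vertex\<close>.\<close>

theorem odd_total:
  "odd (\<Sum>(c, t)\<in>opposite (Suc n). over (2 * n) (part (Suc n) c) (part (Suc n) t) +
     (\<Sum>q<Suc n. over (2 * n) (insert Apex (part (Suc n) c - {A q (c q)})) (part (Suc n) t)))"
proof -
  have "even (\<Sum>(c, t)\<in>opposite (Suc n). \<Sum>q<Suc n. over (2 * n) (insert Apex (part (Suc n) c - {A q (c q)})) (part (Suc n) t))"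
    unfolding case_prod_unfold
    by (subst sum.swap, rule dvd_sum)
      (use even_removed_vertex[of _ "Suc n" "\<lambda>s. over (2 * n) (insert Apex s)"] in \<open>simp add: case_prod_unfold\<close>)
  moreover have "odd (\<Sum>(c, t)\<in>opposite (Suc n). over (2 * n) (part (Suc n) c) (part (Suc n) t))"
    using odd_over_sum[of n] unfolding over_sum_def by simp
  ultimately show ?thesis by (simp add: case_prod_unfold sum.distrib)
qed

end

section \<open>Realizations and barycentric coordinates\<close>

lemma affine_independent_unique:
  fixes d :: "'i \<Rightarrow> 'b::euclidean_space"
  assumes I: "finite I" "inj_on d I" "\<not> affine_dependent (d ` I)"
    and eq: "sum u I = sum u' I" "(\<Sum>k\<in>I. u k *\<^sub>R d k) = (\<Sum>k\<in>I. u' k *\<^sub>R d k)" and k: "k \<in> I"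
  shows "u k = u' k"
proof (rule ccontr)
  assume ne: "u k \<noteq> u' k"
  define U where "U x = u (the_inv_into I d x) - u' (the_inv_into I d x)" for x
  have Ud: "U (d i) = u i - u' i" if "i \<in> I" for i
    using that by (simp add: U_def the_inv_into_f_f[OF I(2)])
  have "sum U (d ` I) = (\<Sum>i\<in>I. u i - u' i)" by (simp add: sum.reindex[OF I(2)] Ud)
  then have "sum U (d ` I) = 0" using eq(1) by (simp add: sum_subtractf)
  moreover have "(\<Sum>v\<in>d ` I. U v *\<^sub>R v) = (\<Sum>i\<in>I. (u i - u' i) *\<^sub>R d i)"
    by (simp add: sum.reindex[OF I(2)] Ud)
  then have "(\<Sum>v\<in>d ` I. U v *\<^sub>R v) = 0" using eq(2) by (simp add: scaleR_diff_left sum_subtractf)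
  moreover have "\<exists>v\<in>d ` I. U v \<noteq> 0" using k ne Ud by (intro bexI[of _ "d k"]) auto
  ultimately have "affine_dependent (d ` I)"
    using I(1) affine_dependent_explicit_finite[of "d ` I"] by blast
  then show False using I(3) by blast
qed

lemma convex_hull_image_weights:
  fixes d :: "'i \<Rightarrow> 'b::euclidean_space"
  assumes I: "finite I" "inj_on d I"
  shows "x \<in> convex hull (d ` I) \<longleftrightarrow> (\<exists>u. (\<forall>k\<in>I. 0 \<le> u k) \<and> sum u I = 1 \<and> x = (\<Sum>k\<in>I. u k *\<^sub>R d k))"
proof
  assume "x \<in> convex hull (d ` I)"
  then obtain U where U: "\<forall>y\<in>d ` I. 0 \<le> U y" "sum U (d ` I) = 1" "(\<Sum>y\<in>d ` I. U y *\<^sub>R y) = x"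
    using I(1) by (auto simp: convex_hull_finite)
  then show "\<exists>u. (\<forall>k\<in>I. 0 \<le> u k) \<and> sum u I = 1 \<and> x = (\<Sum>k\<in>I. u k *\<^sub>R d k)"
    by (intro exI[of _ "U \<circ> d"]) (auto simp: sum.reindex[OF I(2)])
next
  assume "\<exists>u. (\<forall>k\<in>I. 0 \<le> u k) \<and> sum u I = 1 \<and> x = (\<Sum>k\<in>I. u k *\<^sub>R d k)"
  then obtain u where u: "\<forall>k\<in>I. 0 \<le> u k" "sum u I = 1" "x = (\<Sum>k\<in>I. u k *\<^sub>R d k)" by blast
  show "x \<in> convex hull (d ` I)" unfolding u(3)
    by (rule convex_sum[OF I(1) convex_convex_hull u(2)]) (use u(1) in \<open>auto intro: hull_inc\<close>)
qed

lemma affine_independent_hull_inj: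
  fixes V W :: "'b::euclidean_space set"
  assumes "\<not> affine_dependent V" "\<not> affine_dependent W" "convex hull V = convex hull W"
  shows "V = W"
proof (rule set_eqI)
  fix x
  have "x \<in> V \<longleftrightarrow> x extreme_point_of (convex hull V)"
    using extreme_point_of_convex_hull_affine_independent[OF assms(1)] by blast
  also have "\<dots> \<longleftrightarrow> x \<in> W"
    unfolding assms(3) using extreme_point_of_convex_hull_affine_independent[OF assms(2)] by blast
  finally show "x \<in> V \<longleftrightarrow> x \<in> W" .
qed

text \<open>A geometric realization of \<open>K\<^sup>(\<^sup>n\<^sup>)\<close>. The map \<open>cell\<close> is an isomorphism from the abstract simplices to
those of \<open>K\<close>, compatible with intersections and faces.\<close>

locale realization =
  fixes n :: nat and K :: "'b::euclidean_space set set" and p :: "vertex \<Rightarrow> 'b"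
  assumes n: "n \<ge> 1" and K: "simplicial_complex K" and pinj: "inj_on p (\<Union>(K_complex n))"
    and indep: "\<And>s. s \<in> K_complex n \<Longrightarrow> \<not> affine_dependent (p ` s)"
    and Keq: "K = (\<lambda>s. convex hull (p ` s)) ` K_complex n"
begin

abbreviation "\<Sigma> \<equiv> K_complex n"

definition cell :: "vertex set \<Rightarrow> 'b set" where "cell s = convex hull (p ` s)"

lemma K_cell: "K = cell ` \<Sigma>" using Keq by (simp add: cell_def)

lemma down: "s \<in> \<Sigma> \<Longrightarrow> t \<subseteq> s \<Longrightarrow> t \<in> \<Sigma>"
  unfolding K_complex_def by blast

lemma finite_VV: "finite (\<Union>\<Sigma>)"
proof -
  have "\<Union>\<Sigma> \<subseteq> insert Apex ((\<lambda>(i, k). A i k) ` ({0..n} \<times> {0,1,2}))"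
    unfolding K_complex_def type_I_def type_II_def by force
  then show ?thesis by (rule finite_subset) simp
qed

lemma sub_VV: "s \<in> \<Sigma> \<Longrightarrow> s \<subseteq> \<Union>\<Sigma>" by blast

lemma finite_simplex: "s \<in> \<Sigma> \<Longrightarrow> finite s"
  using finite_VV sub_VV finite_subset by blast

lemma pinj_on: "s \<in> \<Sigma> \<Longrightarrow> inj_on p s" using pinj sub_VV inj_on_subset by blast

lemma card_image_p: "s \<in> \<Sigma> \<Longrightarrow> card (p ` s) = card s" using pinj_on card_image by blast

lemma image_p_eq: "s \<in> \<Sigma> \<Longrightarrow> t \<in> \<Sigma> \<Longrightarrow> p ` s = p ` t \<longleftrightarrow> s = t"
  by (rule inj_on_image_eq_iff[OF pinj sub_VV sub_VV])

lemma cell_inj: assumes "s \<in> \<Sigma>" "t \<in> \<Sigma>" "cell s = cell t" shows "s = t"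
proof -
  have "p ` s = p ` t"
    by (rule affine_independent_hull_inj[OF indep[OF assms(1)] indep[OF assms(2)] assms(3)[unfolded cell_def]])
  then show ?thesis using image_p_eq[OF assms(1,2)] by simp
qed

lemma cell_mono: "s \<subseteq> t \<Longrightarrow> cell s \<subseteq> cell t"
  unfolding cell_def by (intro hull_mono image_mono)

lemma face_of_cell:
  assumes "s \<in> \<Sigma>" shows "F face_of cell s \<longleftrightarrow> (\<exists>u\<subseteq>s. F = cell u)"
proof -
  have "F face_of cell s \<longleftrightarrow> (\<exists>c\<subseteq>p ` s. F = convex hull c)"
    unfolding cell_def face_of_convex_hull_affine_independent[OF indep[OF assms]] by blast
  also have "\<dots> \<longleftrightarrow> (\<exists>u\<subseteq>s. F = cell u)" unfolding cell_def by (auto simp: subset_image_iff)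
  finally show ?thesis .
qed

lemma cell_Int:
  assumes s: "s \<in> \<Sigma>" and t: "t \<in> \<Sigma>" shows "cell s \<inter> cell t = cell (s \<inter> t)"
proof
  have m: "cell s \<in> K" "cell t \<in> K" using s t K_cell by auto
  obtain u where u: "u \<subseteq> s" "cell s \<inter> cell t = cell u"
    using complex_Int(2)[OF K m] face_of_cell[OF s] by blast
  obtain v where v: "v \<subseteq> t" "cell s \<inter> cell t = cell v"
    using complex_Int(3)[OF K m] face_of_cell[OF t] by blast
  have "u = v" using cell_inj[OF down[OF s u(1)] down[OF t v(1)]] u v by simp
  then have "u \<subseteq> s \<inter> t" using u v by blast
  then show "cell s \<inter> cell t \<subseteq> cell (s \<inter> t)" unfolding u(2) by (rule cell_mono)
  show "cell (s \<inter> t) \<subseteq> cell s \<inter> cell t" by (intro Int_greatest cell_mono) auto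
qed

lemma cell_subset: assumes "s \<in> \<Sigma>" "t \<in> \<Sigma>" shows "cell s \<subseteq> cell t \<longleftrightarrow> s \<subseteq> t"
proof
  assume "cell s \<subseteq> cell t"
  then have "cell s \<inter> cell t = cell s" by (rule Int_absorb2)
  then have "cell (s \<inter> t) = cell s" using cell_Int[OF assms] by simp
  then have "s \<inter> t = s" by (rule cell_inj[OF down[OF assms(1) Int_lower1] assms(1)])
  then show "s \<subseteq> t" by blast
qed (rule cell_mono)

lemma aff_dim_cell: assumes "s \<in> \<Sigma>" shows "aff_dim (cell s) = int (card s) - 1"
  using indep[OF assms] card_image_p[OF assms] unfolding cell_def aff_dim_convex_hull
  by (simp add: affine_independent_iff_card)

lemma cell_empty [simp]: "cell {} = {}" by (simp add: cell_def)

lemma cell_eq_empty: "cell s = {} \<longleftrightarrow> s = {}" by (simp add: cell_def)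

lemma facet_of_cell:
  assumes "s \<in> \<Sigma>" shows "F facet_of cell s \<longleftrightarrow> 2 \<le> card s \<and> (\<exists>v\<in>s. F = cell (s - {v}))"
proof -
  have "p ` s - {p v} = p ` (s - {v})" if "v \<in> s" for v
    using inj_on_image_set_diff[OF pinj_on[OF assms], of s "{v}"] that by auto
  then have "(\<exists>u. u \<in> p ` s \<and> F = convex hull (p ` s - {u})) \<longleftrightarrow> (\<exists>v\<in>s. F = cell (s - {v}))"
    unfolding cell_def by (metis (no_types, lifting) image_iff)
  then show ?thesis
    using facet_of_convex_hull_affine_independent_alt[OF indep[OF assms], of F] card_image_p[OF assms]
    by (simp only: cell_def)
qed

definition subcx :: "vertex set set \<Rightarrow> bool" where
  "subcx S \<longleftrightarrow> S \<subseteq> \<Sigma> \<and> (\<forall>s\<in>S. \<forall>t\<subseteq>s. t \<in> S)"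

lemma subcx_complex: assumes "subcx S" shows "simplicial_complex (cell ` S)"
  unfolding simplicial_complex_def
proof (intro conjI allI impI ballI)
  have sub: "cell ` S \<subseteq> K" using assms K_cell by (auto simp: subcx_def)
  then show "finite (cell ` S)" using simplicial_complexD(1)[OF K] finite_subset by blast
  show "\<exists>n. n simplex x" if "x \<in> cell ` S" for x using that sub simplicial_complexD(2)[OF K] by blast
  show "F \<in> cell ` S" if FX: "X \<in> cell ` S \<and> F face_of X" for F X
  proof -
    obtain s where s: "s \<in> S" "F face_of cell s" using FX by blast
    then have "s \<in> \<Sigma>" using assms unfolding subcx_def by blast
    then obtain u where u: "u \<subseteq> s" "F = cell u" using s(2) face_of_cell by blast
    then have "u \<in> S" using s(1) assms unfolding subcx_def by blast
    then show ?thesis using u(2) by blast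
  qed
  show "X \<inter> Y face_of X" if "X \<in> cell ` S \<and> Y \<in> cell ` S" for X Y
    using complex_Int(2)[OF K] that sub by blast
qed

lemma complex_subcx:
  assumes "\<gamma> \<subseteq> K" "simplicial_complex \<gamma>"
  obtains S where "subcx S" "\<gamma> = cell ` S"
proof -
  let ?S = "{s \<in> \<Sigma>. cell s \<in> \<gamma>}"
  have "\<gamma> = cell ` ?S" using assms(1) K_cell by blast
  moreover have "subcx ?S" unfolding subcx_def
  proof (intro conjI ballI allI impI)
    fix s t assume st: "s \<in> ?S" "t \<subseteq> s"
    then have "cell t face_of cell s" using face_of_cell by blast
    then have "cell t \<in> \<gamma>" using simplicial_complexD(3)[OF assms(2)] st by blast
    then show "t \<in> ?S" using down st by blast
  qed blast
  ultimately show thesis using that by blast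
qed

lemma cells_disjoint:
  assumes "subcx S" "subcx T"
  shows "\<Union>(cell ` S) \<inter> \<Union>(cell ` T) = {} \<longleftrightarrow> \<Union>S \<inter> \<Union>T = {}"
proof
  assume d: "\<Union>(cell ` S) \<inter> \<Union>(cell ` T) = {}"
  show "\<Union>S \<inter> \<Union>T = {}"
  proof (rule ccontr)
    assume "\<Union>S \<inter> \<Union>T \<noteq> {}"
    then obtain v where v: "v \<in> \<Union>S" "v \<in> \<Union>T" by blast
    have "{v} \<in> S" "{v} \<in> T" using v assms unfolding subcx_def by (meson UnionE empty_subsetI insert_subset)+
    then have "cell {v} \<subseteq> \<Union>(cell ` S) \<inter> \<Union>(cell ` T)" by blast
    then show False using d cell_eq_empty[of "{v}"] by blast
  qed
next
  assume d: "\<Union>S \<inter> \<Union>T = {}"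
  have "cell s \<inter> cell t = {}" if "s \<in> S" "t \<in> T" for s t
  proof -
    have "s \<inter> t = {}" using d that by blast
    then show ?thesis using cell_Int[of s t] that assms by (auto simp: subcx_def)
  qed
  then show "\<Union>(cell ` S) \<inter> \<Union>(cell ` T) = {}" by blast
qed

text \<open>Barycentric coordinates of the points of a subcomplex, extended by 0 to all vertices.\<close>

definition wts :: "vertex set set \<Rightarrow> (vertex \<Rightarrow> real) set" where
  "wts S = {w. (\<forall>v. 0 \<le> w v) \<and> (\<exists>s\<in>S. (\<forall>v. v \<notin> s \<longrightarrow> w v = 0) \<and> sum w s = 1)}"

text \<open>The point with given weights when the vertices are placed by \<open>q\<close>. For \<open>q = p\<close> this parametrizes \<open>K\<close>;
for other \<open>q\<close> it describes the simplicial map with vertex images \<open>q\<close>.\<close>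

definition pt :: "(vertex \<Rightarrow> 'c::euclidean_space) \<Rightarrow> (vertex \<Rightarrow> real) \<Rightarrow> 'c" where
  "pt q w = (\<Sum>v\<in>\<Union>\<Sigma>. w v *\<^sub>R q v)"

lemma pt_on: assumes "s \<subseteq> \<Union>\<Sigma>" "\<And>v. v \<notin> s \<Longrightarrow> w v = 0" shows "pt q w = (\<Sum>v\<in>s. w v *\<^sub>R q v)"
  unfolding pt_def
proof (rule sum.mono_neutral_right[OF finite_VV assms(1)], rule ballI)
  fix v assume "v \<in> \<Union>\<Sigma> - s"
  then have "w v = 0" using assms(2) by blast
  then show "w v *\<^sub>R q v = 0" by simp
qed

lemma pt_cell:
  assumes "s \<in> \<Sigma>"
  shows "x \<in> cell s \<longleftrightarrow> (\<exists>w. (\<forall>v. 0 \<le> w v) \<and> (\<forall>v. v \<notin> s \<longrightarrow> w v = 0) \<and> sum w s = 1 \<and> x = pt p w)"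
proof
  assume "x \<in> cell s"
  then have "\<exists>u. (\<forall>k\<in>s. 0 \<le> u k) \<and> sum u s = 1 \<and> x = (\<Sum>k\<in>s. u k *\<^sub>R p k)"
    unfolding cell_def by (rule iffD1[OF convex_hull_image_weights[OF finite_simplex[OF assms] pinj_on[OF assms]]])
  then obtain u where u: "\<forall>v\<in>s. 0 \<le> u v" "sum u s = 1" "x = (\<Sum>v\<in>s. u v *\<^sub>R p v)"
    by (elim exE conjE)
  let ?w = "\<lambda>v. if v \<in> s then u v else 0"
  have "pt p ?w = (\<Sum>v\<in>s. ?w v *\<^sub>R p v)" by (rule pt_on[OF sub_VV[OF assms]]) simp
  then have "x = pt p ?w" using u(3) by simp
  moreover have "sum ?w s = 1" using u(2) by simp
  ultimately show "\<exists>w. (\<forall>v. 0 \<le> w v) \<and> (\<forall>v. v \<notin> s \<longrightarrow> w v = 0) \<and> sum w s = 1 \<and> x = pt p w"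
    using u(1) by (intro exI[of _ ?w] conjI) simp_all
next
  assume "\<exists>w. (\<forall>v. 0 \<le> w v) \<and> (\<forall>v. v \<notin> s \<longrightarrow> w v = 0) \<and> sum w s = 1 \<and> x = pt p w"
  then obtain w where w: "\<forall>v. 0 \<le> w v" "\<forall>v. v \<notin> s \<longrightarrow> w v = 0" "sum w s = 1" "x = pt p w"
    by (elim exE conjE)
  have "pt p w = (\<Sum>v\<in>s. w v *\<^sub>R p v)" by (rule pt_on[OF sub_VV[OF assms]]) (use w(2) in simp)
  then show "x \<in> cell s" unfolding cell_def
    using w(1,3,4) by (intro iffD2[OF convex_hull_image_weights[OF finite_simplex[OF assms] pinj_on[OF assms]]] exI[of _ w]) simp
qed

lemma pt_image: assumes "S \<subseteq> \<Sigma>" shows "pt p ` wts S = \<Union>(cell ` S)"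
proof (intro set_eqI iffI)
  fix x assume "x \<in> pt p ` wts S"
  then obtain w s where "s \<in> S" "\<forall>v. 0 \<le> w v" "\<forall>v. v \<notin> s \<longrightarrow> w v = 0" "sum w s = 1" "x = pt p w" by (auto simp: wts_def)
  then have "x \<in> cell s" using pt_cell[of s] assms by blast
  then show "x \<in> \<Union>(cell ` S)" using \<open>s \<in> S\<close> by blast
next
  fix x assume "x \<in> \<Union>(cell ` S)"
  then obtain s where s: "s \<in> S" "x \<in> cell s" by blast
  then obtain w where "\<forall>v. 0 \<le> w v" "\<forall>v. v \<notin> s \<longrightarrow> w v = 0" "sum w s = 1" "x = pt p w"
    using pt_cell[of s] assms by blast
  then show "x \<in> pt p ` wts S" using s(1) by (auto simp: wts_def)
qed

lemma pt_unique_in: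
  assumes s: "s \<in> \<Sigma>" and w: "\<And>v. v \<notin> s \<Longrightarrow> w v = 0" "sum w s = 1" and u: "\<And>v. v \<notin> s \<Longrightarrow> u v = 0" "sum u s = 1"
    and eq: "pt p w = pt p u"
  shows "w = u"
proof
  fix v
  show "w v = u v"
  proof (cases "v \<in> s")
    case True
    have "sum w s = sum u s" using w u by simp
    moreover have "(\<Sum>v\<in>s. w v *\<^sub>R p v) = (\<Sum>v\<in>s. u v *\<^sub>R p v)"
      using pt_on[OF sub_VV[OF s] w(1), where q=p] pt_on[OF sub_VV[OF s] u(1), where q=p] eq by simp
    ultimately show ?thesis
      using affine_independent_unique[OF finite_simplex[OF s] pinj_on[OF s] indep[OF s] _ _ True] by blast
  qed (use w u in simp)
qed

lemma pt_inj: "inj_on (pt p) (wts \<Sigma>)"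
proof (rule inj_onI)
  fix w u assume wu: "w \<in> wts \<Sigma>" "u \<in> wts \<Sigma>" "pt p w = pt p u"
  obtain s where s: "s \<in> \<Sigma>" "\<forall>v. 0 \<le> w v" "\<And>v. v \<notin> s \<Longrightarrow> w v = 0" "sum w s = 1" using wu(1) unfolding wts_def by blast
  obtain t where t: "t \<in> \<Sigma>" "\<forall>v. 0 \<le> u v" "\<And>v. v \<notin> t \<Longrightarrow> u v = 0" "sum u t = 1" using wu(2) unfolding wts_def by blast
  have "pt p w \<in> cell s" using pt_cell[OF s(1)] s by blast
  moreover have "pt p w \<in> cell t" unfolding wu(3) using pt_cell[OF t(1)] t by blast
  ultimately have "pt p w \<in> cell (s \<inter> t)" using cell_Int[OF s(1) t(1)] by blast
  then obtain z where z: "\<forall>v. v \<notin> s \<inter> t \<longrightarrow> z v = 0" "sum z (s \<inter> t) = 1" "pt p w = pt p z"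
    using pt_cell[OF down[OF s(1)], of "s \<inter> t"] by blast
  have zs: "sum z s = 1"
  proof -
    have "sum z s = sum z (s \<inter> t)" by (rule sum.mono_neutral_right) (use finite_simplex[OF s(1)] z(1) in auto)
    then show ?thesis using z by simp
  qed
  have zt: "sum z t = 1"
  proof -
    have "sum z t = sum z (s \<inter> t)" by (rule sum.mono_neutral_right) (use finite_simplex[OF t(1)] z(1) in auto)
    then show ?thesis using z by simp
  qed
  have "w = z" by (rule pt_unique_in[OF s(1,3,4) _ zs z(3)]) (use z(1) in auto)
  moreover have "u = z" by (rule pt_unique_in[OF t(1,3,4) _ zt]) (use z wu(3) in auto)
  ultimately show "w = u" by simp
qed

lemma affine_extension:
  fixes q :: "vertex \<Rightarrow> 'c::euclidean_space"
  assumes s: "s \<in> \<Sigma>"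
  obtains g c where "linear g" "\<And>v. v \<in> s \<Longrightarrow> q v = g (p v) + c"
proof (cases "s = {}")
  case True
  show thesis by (rule that[of "\<lambda>x. 0" 0]) (use True in \<open>auto intro: linearI\<close>)
next
  case False
  then obtain v0 where v0: "v0 \<in> s" by blast
  let ?B = "(\<lambda>x. x - p v0) ` (p ` s - {p v0})"
  have B: "?B = (\<lambda>x. - p v0 + x) ` (p ` s - {p v0})" by (rule image_cong) simp_all
  have "p v0 \<in> p ` s" using v0 by (rule imageI)
  from affine_dependent_iff_dependent2[OF this] have indB: "independent ?B"
    unfolding B using indep[OF s] by blast
  from linear_independent_extend[OF indB, of "\<lambda>x. q (the_inv_into s p (x + p v0)) - q v0"]
  obtain g where g: "linear g" "\<forall>x\<in>?B. g x = q (the_inv_into s p (x + p v0)) - q v0"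
    by (elim exE conjE)
  have "q v = g (p v) + (q v0 - g (p v0))" if v: "v \<in> s" for v
  proof (cases "v = v0")
    case False
    then have "p v \<noteq> p v0" using pinj_on[OF s] v v0 by (meson inj_onD)
    then have "p v - p v0 \<in> ?B" using v by blast
    then have "g (p v - p v0) = q (the_inv_into s p (p v - p v0 + p v0)) - q v0" using g(2) by blast
    also have "the_inv_into s p (p v - p v0 + p v0) = v" using the_inv_into_f_f[OF pinj_on[OF s] v] by simp
    finally have "g (p v) - g (p v0) = q v - q v0" using g(1) by (simp add: linear_diff)
    then show ?thesis by (simp add: algebra_simps)
  qed simp
  then show thesis using that g(1) by blast
qed

text \<open>The homeomorphism is the simplicial map \<open>p v \<mapsto> q v\<close>; to find it one only has to check in terms of
weights that it is injective.\<close>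

lemma simplicial_pl_map:
  fixes q :: "vertex \<Rightarrow> 'c::euclidean_space"
  assumes S: "subcx S" and inj: "inj_on (pt q) (wts S)"
  shows "pl_homeomorphic (\<Union>(cell ` S)) (pt q ` wts S)"
proof -
  have SS: "S \<subseteq> \<Sigma>" using S by (simp add: subcx_def)
  have injp: "inj_on (pt p) (wts S)" using pt_inj by (rule inj_on_subset) (use SS in \<open>auto simp: wts_def\<close>)
  define h where "h x = pt q (the_inv_into (wts S) (pt p) x)" for x
  have hp: "h (pt p w) = pt q w" if "w \<in> wts S" for w
    unfolding h_def using the_inv_into_f_f[OF injp that] by simp
  have im: "\<Union>(cell ` S) = pt p ` wts S" using pt_image[OF SS] by simp
  have "inj_on h (\<Union>(cell ` S))"
    unfolding im using hp inj by (auto simp: inj_on_def)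
  moreover have "h ` \<Union>(cell ` S) = pt q ` wts S" unfolding im image_image by (rule image_cong[OF refl hp])
  moreover have "pl_map_on (\<Union>(cell ` S)) h"
    unfolding pl_map_on_def
  proof (intro exI[of _ "cell ` S"] conjI ballI refl subcx_complex[OF S])
    fix C assume "C \<in> cell ` S"
    then obtain s where s: "s \<in> S" "C = cell s" by blast
    then have sS: "s \<in> \<Sigma>" using SS by blast
    obtain g c where g: "linear g" "\<And>v. v \<in> s \<Longrightarrow> q v = g (p v) + c" using affine_extension[OF sS] by blast
    have "h x = g x + c" if x: "x \<in> cell s" for x
    proof -
      obtain w where w: "\<forall>v. 0 \<le> w v" "\<And>v. v \<notin> s \<Longrightarrow> w v = 0" "sum w s = 1" "x = pt p w"
        using x pt_cell[OF sS] by blast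
      then have "w \<in> wts S" using s(1) by (auto simp: wts_def)
      then have "h x = pt q w" using hp w(4) by simp
      also have "\<dots> = (\<Sum>v\<in>s. w v *\<^sub>R q v)" by (rule pt_on[OF sub_VV[OF sS] w(2)])
      also have "\<dots> = (\<Sum>v\<in>s. w v *\<^sub>R (g (p v) + c))" using g(2) by simp
      also have "\<dots> = (\<Sum>v\<in>s. w v *\<^sub>R g (p v)) + sum w s *\<^sub>R c"
        by (simp add: scaleR_add_right sum.distrib scaleR_left.sum)
      also have "\<dots> = g (\<Sum>v\<in>s. w v *\<^sub>R p v) + c" using w(3) g(1) by (simp add: linear_sum linear_cmul)
      also have "(\<Sum>v\<in>s. w v *\<^sub>R p v) = x" using pt_on[OF sub_VV[OF sS] w(2), where q=p] w(4) by simp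
      finally show ?thesis .
    qed
    then show "affine_map_on C h" unfolding affine_map_on_def s(2) using g(1) by blast
  qed
  ultimately show ?thesis unfolding pl_homeomorphic_def pl_embedding_def by blast
qed

end

lemma compact_complex: "simplicial_complex T \<Longrightarrow> compact (\<Union>T)"
  using simplicial_complexD(1,4) polytope_imp_compact by (intro compact_Union) blast+

lemma pl_sphere_triangulation:
  fixes T :: "'a::euclidean_space set set"
  assumes T: "simplicial_complex T" and S: "pl_sphere n (\<Union>T)"
  obtains \<Delta> :: "'a set" where "sphere_triangulation T \<Delta> n"
proof -
  obtain \<Delta> :: "'a set" where \<Delta>: "(int n + 1) simplex \<Delta>" "pl_homeomorphic (\<Union>T) (rel_frontier \<Delta>)"
    using S unfolding pl_sphere_def by blast
  then obtain h where h: "pl_map_on (\<Union>T) h" "inj_on h (\<Union>T)" "h ` \<Union>T = rel_frontier \<Delta>"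
    unfolding pl_homeomorphic_def pl_embedding_def by blast
  have "\<Union>T homeomorphic rel_frontier \<Delta>"
    by (rule homeomorphic_compact[OF compact_complex[OF T] pl_map_continuous[OF h(1)] h(3,2)])
  moreover have "bounded \<Delta>" using \<Delta>(1) compact_simplex compact_imp_bounded by blast
  ultimately have "sphere_triangulation T \<Delta> n"
    using T \<Delta>(1) convex_simplex aff_dim_simplex by unfold_locales auto
  then show thesis by (rule that)
qed

section \<open>Standard spheres\<close>

context realization begin

text \<open>A set of vertices is a simplex iff it has at most one vertex in each \<open>V\<^sup>i\<close> and, if it contains \<open>b\<close>, none
in some \<open>V\<^sup>q\<close>.\<close>

lemma Sigma_iff:
  "s \<in> \<Sigma> \<longleftrightarrow> (\<forall>x\<in>s. x = Apex \<or> (\<exists>i\<le>n. \<exists>k\<in>{0,1,2}. x = A i k)) \<and>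
     (\<forall>i k k'. A i k \<in> s \<longrightarrow> A i k' \<in> s \<longrightarrow> k = k') \<and> (Apex \<in> s \<longrightarrow> (\<exists>q\<le>n. \<forall>k. A q k \<notin> s))"
proof
  assume "s \<in> \<Sigma>"
  then obtain t where t: "t \<in> type_I n \<union> type_II n" "s \<subseteq> t" unfolding K_complex_def by blast
  from t(1) consider j where "t = (\<lambda>i. A i (j i)) ` {0..n}" "\<forall>i\<in>{0..n}. j i \<in> {0,1,2}"
    | j q where "t = insert Apex ((\<lambda>i. A i (j i)) ` ({0..n} - {q}))" "q \<in> {0..n}" "\<forall>i\<in>{0..n}. j i \<in> {0,1,2}"
    unfolding type_I_def type_II_def by blast
  then show "(\<forall>x\<in>s. x = Apex \<or> (\<exists>i\<le>n. \<exists>k\<in>{0,1,2}. x = A i k)) \<and>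
     (\<forall>i k k'. A i k \<in> s \<longrightarrow> A i k' \<in> s \<longrightarrow> k = k') \<and> (Apex \<in> s \<longrightarrow> (\<exists>q\<le>n. \<forall>k. A q k \<notin> s))"
  proof cases
    case (1 j)
    have "x \<in> (\<lambda>i. A i (j i)) ` {0..n}" if "x \<in> s" for x using that t(2) 1(1) by blast
    then have x: "\<exists>i\<le>n. x = A i (j i)" if "x \<in> s" for x using that by fastforce
    show ?thesis
    proof (intro conjI ballI allI impI)
      fix y assume "y \<in> s"
      then show "y = Apex \<or> (\<exists>i\<le>n. \<exists>k\<in>{0,1,2}. y = A i k)" using x[of y] 1(2) by (metis atLeastAtMost_iff zero_le)
    next
      fix i k k' assume "A i k \<in> s" "A i k' \<in> s"
      then show "k = k'" using x[of "A i k"] x[of "A i k'"] by auto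
    next
      assume "Apex \<in> s" then show "\<exists>q\<le>n. \<forall>k. A q k \<notin> s" using x[of Apex] by auto
    qed
  next
    case (2 j q)
    have "x \<in> insert Apex ((\<lambda>i. A i (j i)) ` ({0..n} - {q}))" if "x \<in> s" for x using that t(2) 2(1) by blast
    then have x: "x = Apex \<or> (\<exists>i\<le>n. i \<noteq> q \<and> x = A i (j i))" if "x \<in> s" for x using that by fastforce
    show ?thesis
    proof (intro conjI ballI allI impI)
      fix y assume "y \<in> s"
      then show "y = Apex \<or> (\<exists>i\<le>n. \<exists>k\<in>{0,1,2}. y = A i k)" using x[of y] 2(3) by (metis atLeastAtMost_iff zero_le)
    next
      fix i k k' assume "A i k \<in> s" "A i k' \<in> s"
      then show "k = k'" using x[of "A i k"] x[of "A i k'"] by auto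
    next
      assume "Apex \<in> s"
      have "A q k \<notin> s" for k using x[of "A q k"] by auto
      then show "\<exists>q\<le>n. \<forall>k. A q k \<notin> s" using 2(2) by auto
    qed
  qed
next
  assume a: "(\<forall>x\<in>s. x = Apex \<or> (\<exists>i\<le>n. \<exists>k\<in>{0,1,2}. x = A i k)) \<and>
     (\<forall>i k k'. A i k \<in> s \<longrightarrow> A i k' \<in> s \<longrightarrow> k = k') \<and> (Apex \<in> s \<longrightarrow> (\<exists>q\<le>n. \<forall>k. A q k \<notin> s))"
  have a1: "x = Apex \<or> (\<exists>i\<le>n. \<exists>k\<in>{0,1,2}. x = A i k)" if "x \<in> s" for x
    by (rule bspec[OF conjunct1[OF a] that])
  have a2: "k = k'" if "A i k \<in> s" "A i k' \<in> s" for i k k'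
    using conjunct1[OF conjunct2[OF a]] that by blast
  have a3: "\<exists>q\<le>n. \<forall>k. A q k \<notin> s" if "Apex \<in> s"
    by (rule mp[OF conjunct2[OF conjunct2[OF a]] that])
  define j where "j i = (if \<exists>k. A i k \<in> s then SOME k. A i k \<in> s else 0)" for i
  have j: "k = j i" if k: "A i k \<in> s" for i k
  proof -
    have "A i (SOME k. A i k \<in> s) \<in> s" using k by (rule someI)
    moreover have "j i = (SOME k. A i k \<in> s)" unfolding j_def using k by auto
    ultimately have "A i (j i) \<in> s" by simp
    with k show ?thesis by (rule a2)
  qed
  have jr: "j i \<in> {0,1,2}" for i
  proof (cases "\<exists>k. A i k \<in> s")
    case True
    then obtain k where k: "A i k \<in> s" by blast
    have "k \<in> {0,1,2}" using a1[OF k] by auto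
    then show ?thesis using j[OF k] by simp
  qed (simp add: j_def)
  have el: "x = Apex \<or> (\<exists>i\<le>n. x = A i (j i))" if x: "x \<in> s" for x
  proof -
    consider "x = Apex" | i k where "i \<le> n" "x = A i k" using a1[OF x] by blast
    then show ?thesis
    proof cases
      case (2 i k)
      then show ?thesis using j[of i k] x by blast
    qed simp
  qed
  show "s \<in> \<Sigma>"
  proof (cases "Apex \<in> s")
    case False
    have "(\<lambda>i. A i (j i)) ` {0..n} \<in> type_I n"
      unfolding type_I_def by (intro CollectI exI[of _ j] conjI refl ballI jr)
    moreover have "s \<subseteq> (\<lambda>i. A i (j i)) ` {0..n}"
    proof
      fix x assume x: "x \<in> s"
      then obtain i where "i \<le> n" "x = A i (j i)" using el[OF x] False by blast
      then show "x \<in> (\<lambda>i. A i (j i)) ` {0..n}" by auto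
    qed
    ultimately show ?thesis unfolding K_complex_def by blast
  next
    case True
    then obtain q where q: "q \<le> n" "\<forall>k. A q k \<notin> s" using a3 by blast
    have "insert Apex ((\<lambda>i. A i (j i)) ` ({0..n} - {q})) \<in> type_II n"
      unfolding type_II_def
    proof (intro CollectI exI conjI)
      show "q \<in> {0..n}" using q(1) by simp
      show "\<forall>i\<in>{0..n}. j i \<in> {0,1,2}" using jr by blast
    qed (rule refl)
    moreover have "s \<subseteq> insert Apex ((\<lambda>i. A i (j i)) ` ({0..n} - {q}))"
    proof
      fix x assume x: "x \<in> s"
      show "x \<in> insert Apex ((\<lambda>i. A i (j i)) ` ({0..n} - {q}))"
      proof (cases "x = Apex")
        case False
        then obtain i where i: "i \<le> n" "x = A i (j i)" using el[OF x] by blast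
        then have "i \<noteq> q" using q(2) x by blast
        then show ?thesis using i by auto
      qed simp
    qed
    ultimately show ?thesis unfolding K_complex_def by blast
  qed
qed

abbreviation "tr c \<equiv> part (Suc n) c"

text \<open>The boundary of the \<open>(n+1)\<close>-simplex spanned by \<open>b\<close> and the vertices chosen by \<open>c\<close>. That simplex
does not belong to \<open>K\<^sup>(\<^sup>n\<^sup>)\<close>, but its proper faces do.\<close>

definition bd :: "(nat \<Rightarrow> nat) \<Rightarrow> vertex set set" where
  "bd c = {s. s \<subset> insert Apex (tr c)}"

text \<open>The full subcomplex on the vertices that \<open>bd c\<close> leaves over, the join of \<open>n+1\<close> pairs of points.\<close>

definition away :: "(nat \<Rightarrow> nat) \<Rightarrow> vertex set set" where
  "away c = {s \<in> \<Sigma>. s \<inter> insert Apex (tr c) = {}}"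

lemma mem_tr: "A i k \<in> tr c \<longleftrightarrow> i \<le> n \<and> k = c i"
  unfolding part_def by auto

lemma Apex_notin_tr: "Apex \<notin> tr c" unfolding part_def by auto

lemma tr_cases: "x \<in> tr c \<Longrightarrow> \<exists>i\<le>n. x = A i (c i)"
  unfolding part_def by auto

lemma subcx_bd: assumes c: "c \<in> choices (Suc n)" shows "subcx (bd c)"
proof -
  have "s \<in> \<Sigma>" if s: "s \<subset> insert Apex (tr c)" for s
    unfolding Sigma_iff
  proof (intro conjI ballI allI impI)
    fix x assume "x \<in> s"
    then have "x = Apex \<or> x \<in> tr c" using s by blast
    then show "x = Apex \<or> (\<exists>i\<le>n. \<exists>k\<in>{0,1,2}. x = A i k)"
      using tr_cases choicesD[OF c] le_imp_less_Suc by blast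
  next
    fix i k k' assume "A i k \<in> s" "A i k' \<in> s"
    then have "A i k \<in> tr c" "A i k' \<in> tr c" using s by blast+
    then show "k = k'" by (simp add: mem_tr)
  next
    assume "Apex \<in> s"
    then obtain x where "x \<in> tr c" "x \<notin> s" using s by blast
    then obtain q where q: "q \<le> n" "A q (c q) \<notin> s" using tr_cases by blast
    have "A q k \<notin> s" for k
    proof
      assume k: "A q k \<in> s"
      then have "A q k \<in> tr c" using s by blast
      then show False using q k by (simp add: mem_tr)
    qed
    then show "\<exists>q\<le>n. \<forall>k. A q k \<notin> s" using q(1) by blast
  qed
  then show ?thesis unfolding subcx_def bd_def by blast
qed

lemma subcx_away: "subcx (away c)"
  unfolding subcx_def away_def using down by blast

text \<open>In \<open>n\<close>-space at most two \<open>n\<close>-simplices can share a facet without overlapping, but in \<open>K\<^sup>(\<^sup>n\<^sup>)\<close> the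
simplices of type I that differ only in the last vertex are three with a common facet. So the space of \<open>K\<close> contains an \<open>(n+1)\<close>-simplex that
serves as the model.\<close>

lemma dim_ambient: "DIM('b) \<ge> n + 1"
proof (rule ccontr)
  assume small: "\<not> DIM('b) \<ge> n + 1"
  define h :: "nat \<Rightarrow> nat" where "h = (\<lambda>i\<in>{..<n}. 0)"
  have h: "h \<in> choices n" unfolding choices_def h_def by auto
  let ?r = "cell (part n h)" and ?s = "\<lambda>k. insert (A n k) (part n h)"
  have sS: "?s k \<in> \<Sigma>" if "k \<in> {0,1,2}" for k using K_complex_part(1)[OF h order_refl that] .
  have cs: "card (?s k) = n + 1" for k by simp
  have ne: "?s k \<noteq> ?s k'" if "k \<noteq> k'" for k k' using that by (metis insertE insertI1 part_not_mem order_refl vertex.inject)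
  have dims: "aff_dim (cell (?s k)) = int n" if "k \<in> {0,1,2}" for k using aff_dim_cell[OF sS[OF that]] cs by simp
  have D: "int DIM('b) = int n" using dims[of 0] aff_dim_le_DIM[of "cell (?s 0)"] small by simp
  have full: "affine hull (cell (?s k)) = UNIV" if "k \<in> {0,1,2}" for k
    using dims[OF that] D aff_dim_eq_full by metis
  have facet: "?r facet_of cell (?s k)" if "k \<in> {0,1,2}" for k
  proof -
    have "?s k - {A n k} = part n h" by simp
    then show ?thesis unfolding facet_of_cell[OF sS[OF that]] using n cs[of k] by (intro conjI bexI[of _ "A n k"]) simp_all
  qed
  have cK: "cell (?s k) \<in> K" if "k \<in> {0,1,2}" for k using sS[OF that] K_cell by blast
  have conv: "convex (cell s)" for s unfolding cell_def by (rule convex_convex_hull)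
  have "?r \<noteq> {}" using facet[of 0] by (simp add: facet_of_def)
  then obtain x where x: "x \<in> rel_interior ?r" using rel_interior_ne[OF conv] by blast
  obtain q0 where q0: "q0 \<notin> affine hull ?r" using facet_off_point[OF conv facet[of 0]] by blast
  define v where "v = q0 - x"
  have xa: "x \<in> affine hull ?r" using x by (rule rel_interior_affine_hull)
  have off: "x + a *\<^sub>R v \<notin> affine hull ?r" if "a \<noteq> 0" for a
  proof
    assume "x + a *\<^sub>R v \<in> affine hull ?r"
    then have "x + (1/a) *\<^sub>R (a *\<^sub>R v) \<in> affine hull ?r" using affine_line[OF affine_affine_hull xa] by blast
    then show False using that q0 by (simp add: v_def)
  qed
  have off1: "x + v \<notin> affine hull ?r" using off[of 1] by simp
  have side: "\<exists>\<sigma> e. e > 0 \<and> (\<sigma> = 1 \<or> \<sigma> = -1) \<and> (\<forall>a. 0 \<le> a \<longrightarrow> a \<le> e \<longrightarrow> x + (\<sigma> * a) *\<^sub>R v \<in> cell (?s k))"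
    if "k \<in> {0,1,2}" for k
  proof -
    have "x + v \<in> affine hull (cell (?s k))" using full[OF that] by simp
    from facet_one_side[OF conv facet[OF that] x this off1] show ?thesis by metis
  qed
  \<comment> \<open>On two half lines there is no room for three simplices.\<close>
  define good where "good \<sigma> k \<longleftrightarrow> (\<exists>e>0. \<forall>a. 0 \<le> a \<longrightarrow> a \<le> e \<longrightarrow> x + (\<sigma> * a) *\<^sub>R v \<in> cell (?s k))" for \<sigma> :: real and k
  have g: "good 1 k \<or> good (-1) k" if "k \<in> {0,1,2}" for k using side[OF that] unfolding good_def by blast
  have uniq: "False" if kk: "k \<in> {0,1,2}" "k' \<in> {0,1,2}" "k \<noteq> k'" and gg: "good \<sigma> k" "good \<sigma> k'" and "\<sigma> = 1 \<or> \<sigma> = -1" for \<sigma> k k'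
  proof -
    obtain e where e: "e > 0" "\<And>a. 0 \<le> a \<Longrightarrow> a \<le> e \<Longrightarrow> x + (\<sigma> * a) *\<^sub>R v \<in> cell (?s k)" using gg(1) unfolding good_def by blast
    obtain e' where e': "e' > 0" "\<And>a. 0 \<le> a \<Longrightarrow> a \<le> e' \<Longrightarrow> x + (\<sigma> * a) *\<^sub>R v \<in> cell (?s k')" using gg(2) unfolding good_def by blast
    let ?y = "x + (\<sigma> * min e e') *\<^sub>R v"
    have "?y \<in> cell (?s k)" "?y \<in> cell (?s k')" using e e' by auto
    moreover have "\<sigma> * min e e' \<noteq> 0" using that(6) e e' by auto
    then have "?y \<notin> affine hull ?r" by (rule off)
    ultimately have "cell (?s k) = cell (?s k')"
      by (rule complex_eq_if_common_point[OF K cK[OF kk(1)] cK[OF kk(2)] facet[OF kk(1)] facet[OF kk(2)]])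
    then have "?s k = ?s k'" by (rule cell_inj[OF sS[OF kk(1)] sS[OF kk(2)]])
    then show False using ne kk(3) by blast
  qed
  have u01: "\<not> (good \<sigma> 0 \<and> good \<sigma> 1)" "\<not> (good \<sigma> 0 \<and> good \<sigma> 2)" "\<not> (good \<sigma> 1 \<and> good \<sigma> 2)" if "\<sigma> = 1 \<or> \<sigma> = -1" for \<sigma>
    using uniq[of 0 1 \<sigma>] uniq[of 0 2 \<sigma>] uniq[of 1 2 \<sigma>] that by auto
  show False using g[of 0] g[of 1] g[of 2] u01[of 1] u01[of "-1"] by auto
qed

lemma model_simplex:
  obtains d :: "nat \<Rightarrow> 'b" where "inj_on d {..n+1}" "\<not> affine_dependent (d ` {..n+1})"
proof -
  obtain B :: "'b set" where B: "\<not> affine_dependent B" "affine hull B = affine hull UNIV"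
    using affine_basis_exists[of "UNIV :: 'b set"] by blast
  have "int (card B) = int DIM('b) + 1"
    using B aff_dim_affine_independent[OF B(1)] aff_dim_affine_hull[of B] by (simp add: aff_dim_UNIV)
  then have "n + 2 \<le> card B" using dim_ambient by simp
  then obtain B' where B': "B' \<subseteq> B" "card B' = n + 2" "finite B'" by (rule obtain_subset_with_card_n)
  obtain d where d: "bij_betw d {0..<card B'} B'" using ex_bij_betw_nat_finite[OF B'(3)] by blast
  have I: "{0..<card B'} = {..n+1}" using B'(2) by auto
  have "inj_on d {..n+1}" "d ` {..n+1} = B'" using d unfolding I bij_betw_def by auto
  moreover have "\<not> affine_dependent B'" using B(1) B'(1) affine_independent_subset by blast
  ultimately show thesis using that by simp
qed

text \<open>In barycentric coordinates the frontier of a simplex is given by the vanishing of one coordinate.\<close>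

lemma frontier_weights:
  fixes d :: "nat \<Rightarrow> 'b"
  assumes d: "inj_on d {..n+1}" "\<not> affine_dependent (d ` {..n+1})"
  shows "x \<in> rel_frontier (convex hull (d ` {..n+1})) \<longleftrightarrow>
    (\<exists>u. (\<forall>k. 0 \<le> u k) \<and> (\<Sum>k\<le>n+1. u k) = 1 \<and> (\<exists>k\<le>n+1. u k = 0) \<and> x = (\<Sum>k\<le>n+1. u k *\<^sub>R d k))"
proof -
  let ?I = "{..n+1}"
  have im: "d ` ?I - {d k} = d ` (?I - {k})" if "k \<in> ?I" for k
    using inj_on_image_set_diff[OF d(1), of ?I "{k}"] that by simp
  have inj: "inj_on d (?I - {k})" for k using d(1) by (rule inj_on_subset) blast
  have "closed (convex hull (d ` ?I))" by (intro compact_imp_closed compact_convex_hull finite_imp_compact) simp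
  then have "rel_frontier (convex hull (d ` ?I)) = convex hull (d ` ?I) - rel_interior (convex hull (d ` ?I))"
    by (simp add: rel_frontier_def)
  also have "\<dots> = (\<Union>a\<in>d ` ?I. convex hull (d ` ?I - {a}))" by (rule rel_boundary_of_convex_hull[OF d(2)])
  also have "\<dots> = (\<Union>k\<in>?I. convex hull (d ` (?I - {k})))" using im by simp
  finally have fr: "rel_frontier (convex hull (d ` ?I)) = (\<Union>k\<in>?I. convex hull (d ` (?I - {k})))" .
  show ?thesis
  proof
    assume "x \<in> rel_frontier (convex hull (d ` ?I))"
    then obtain k where k: "k \<in> ?I" "x \<in> convex hull (d ` (?I - {k}))" unfolding fr by blast
    have "finite (?I - {k})" by simp
    from iffD1[OF convex_hull_image_weights[OF this inj] k(2)]
    obtain u where u: "\<forall>m\<in>?I - {k}. 0 \<le> u m" "sum u (?I - {k}) = 1" "x = (\<Sum>m\<in>?I - {k}. u m *\<^sub>R d m)"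
      by (elim exE conjE)
    let ?u = "\<lambda>m. if m \<in> ?I - {k} then u m else 0"
    have "(\<Sum>m\<le>n+1. ?u m) = sum ?u (?I - {k})" by (rule sum.mono_neutral_right) auto
    also have "\<dots> = 1" using u(2) by simp
    finally have 1: "(\<Sum>m\<le>n+1. ?u m) = 1" .
    have "(\<Sum>m\<le>n+1. ?u m *\<^sub>R d m) = (\<Sum>m\<in>?I - {k}. ?u m *\<^sub>R d m)" by (rule sum.mono_neutral_right) auto
    also have "\<dots> = x" using u(3) by simp
    finally have 2: "x = (\<Sum>m\<le>n+1. ?u m *\<^sub>R d m)" by simp
    have "\<forall>m. 0 \<le> ?u m" using u(1) by simp
    moreover have "\<exists>m\<le>n+1. ?u m = 0" using k(1) by (intro exI[of _ k]) simp
    ultimately show "\<exists>u. (\<forall>k. 0 \<le> u k) \<and> (\<Sum>k\<le>n+1. u k) = 1 \<and> (\<exists>k\<le>n+1. u k = 0) \<and> x = (\<Sum>k\<le>n+1. u k *\<^sub>R d k)"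
      using 1 2 by (intro exI[of _ ?u] conjI)
  next
    assume "\<exists>u. (\<forall>k. 0 \<le> u k) \<and> (\<Sum>k\<le>n+1. u k) = 1 \<and> (\<exists>k\<le>n+1. u k = 0) \<and> x = (\<Sum>k\<le>n+1. u k *\<^sub>R d k)"
    then obtain u k where u: "\<forall>k. 0 \<le> u k" "(\<Sum>k\<le>n+1. u k) = 1" "k \<le> n+1" "u k = (0::real)" "x = (\<Sum>k\<le>n+1. u k *\<^sub>R d k)"
      by (elim exE conjE)
    have "sum u ?I = sum u (?I - {k})" by (rule sum.mono_neutral_right) (use u(4) in auto)
    moreover have "(\<Sum>m\<le>n+1. u m *\<^sub>R d m) = (\<Sum>m\<in>?I - {k}. u m *\<^sub>R d m)" by (rule sum.mono_neutral_right) (use u(4) in auto)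
    ultimately have "x \<in> convex hull (d ` (?I - {k}))"
      using u by (intro iffD2[OF convex_hull_image_weights[OF _ inj]] exI[of _ u]) simp_all
    then show "x \<in> rel_frontier (convex hull (d ` ?I))" unfolding fr using u(3) by blast
  qed
qed

lemma pl_sphereI:
  fixes d :: "nat \<Rightarrow> 'b" and q :: "vertex \<Rightarrow> 'b"
  assumes d: "inj_on d {..n+1}" "\<not> affine_dependent (d ` {..n+1})" and S: "subcx S"
    and inj: "inj_on (pt q) (wts S)" and im: "pt q ` wts S = rel_frontier (convex hull (d ` {..n+1}))"
  shows "pl_sphere n (\<Union>(cell ` S))"
proof -
  have "card (d ` {..n+1}) = n + 2" using card_image[OF d(1)] by simp
  then have "(int n + 1) simplex (convex hull (d ` {..n+1}))" using d(2) by (intro simplex_convex_hull) simp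
  then show ?thesis unfolding pl_sphere_def using simplicial_pl_map[OF S inj] im by auto
qed

lemma sphere_bd: assumes c: "c \<in> choices (Suc n)" shows "pl_sphere n (\<Union>(cell ` bd c))"
proof -
  obtain d :: "nat \<Rightarrow> 'b" where d: "inj_on d {..n+1}" "\<not> affine_dependent (d ` {..n+1})" by (rule model_simplex)
  define q where "q v = (case v of Apex \<Rightarrow> d (n+1) | A i k \<Rightarrow> d i)" for v
  define e where "e k = (if k \<le> n then A k (c k) else Apex)" for k
  let ?I = "{..n+1}" and ?V = "insert Apex (tr c)"
  have eI: "inj_on e ?I" unfolding e_def by (auto simp: inj_on_def split: if_splits)
  have eV: "e ` ?I = ?V"
  proof
    show "e ` ?I \<subseteq> ?V" by (auto simp: e_def mem_tr)
    show "?V \<subseteq> e ` ?I"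
    proof
      fix v assume "v \<in> ?V"
      then consider "v = Apex" | i where "i \<le> n" "v = A i (c i)" using tr_cases by blast
      then show "v \<in> e ` ?I" by cases (auto simp: e_def image_iff intro: bexI[of _ "n+1"])
    qed
  qed
  have qe: "q (e k) = d k" if "k \<in> ?I" for k using that by (auto simp: q_def e_def le_Suc_eq)
  have VV: "?V \<subseteq> \<Union>\<Sigma>"
  proof
    fix v assume v: "v \<in> ?V"
    have "card ?V = n + 2" using Apex_notin_tr by simp
    then have "card ?V \<noteq> card {v}" by simp
    then have "?V \<noteq> {v}" by metis
    then have "{v} \<in> bd c" using v unfolding bd_def by blast
    then show "v \<in> \<Union>\<Sigma>" using subcx_bd[OF c] unfolding subcx_def by blast
  qed
  have W: "(\<forall>v. v \<notin> ?V \<longrightarrow> w v = 0) \<and> (\<forall>v. 0 \<le> w v) \<and> (\<Sum>k\<le>n+1. w (e k)) = 1 \<and> (\<exists>k\<le>n+1. w (e k) = 0)"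
    if w: "w \<in> wts (bd c)" for w
  proof -
    obtain s where s: "s \<in> bd c" "\<And>v. v \<notin> s \<Longrightarrow> w v = 0" "sum w s = 1" "\<And>v. 0 \<le> w v" using w unfolding wts_def by blast
    have sV: "s \<subset> ?V" using s(1) by (simp add: bd_def)
    have "sum w ?V = sum w s" by (rule sum.mono_neutral_right) (use sV s(2) in auto)
    moreover have "sum w ?V = (\<Sum>k\<in>?I. w (e k))" by (rule sum.reindex_cong[OF eI eV[symmetric] refl])
    moreover obtain v where "v \<in> ?V" "v \<notin> s" using sV by blast
    then have "\<exists>k\<in>?I. w (e k) = 0" using eV s(2) by (metis imageE)
    ultimately show ?thesis using s sV by auto
  qed
  have ptq: "pt q w = (\<Sum>k\<le>n+1. w (e k) *\<^sub>R d k)" if w: "w \<in> wts (bd c)" for w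
  proof -
    have "pt q w = (\<Sum>v\<in>?V. w v *\<^sub>R q v)" by (rule pt_on[OF VV]) (use W[OF w] in blast)
    also have "\<dots> = (\<Sum>k\<in>?I. w (e k) *\<^sub>R d k)"
      by (rule sum.reindex_cong[OF eI eV[symmetric]]) (simp only: qe)
    finally show ?thesis .
  qed
  show ?thesis
  proof (rule pl_sphereI[OF d subcx_bd[OF c]])
    show "inj_on (pt q) (wts (bd c))"
    proof (rule inj_onI)
      fix w u assume w: "w \<in> wts (bd c)" and u: "u \<in> wts (bd c)" and eq: "pt q w = pt q u"
      have "w (e k) = u (e k)" if "k \<in> ?I" for k
        by (rule affine_independent_unique[OF _ d(1,2), of "\<lambda>k. w (e k)" "\<lambda>k. u (e k)"])
          (use W[OF w] W[OF u] ptq[OF w] ptq[OF u] eq that in simp_all)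
      then have "w v = u v" if "v \<in> ?V" for v using that eV by (metis imageE)
      moreover have "w v = u v" if "v \<notin> ?V" for v using W[OF w] W[OF u] that by metis
      ultimately show "w = u" by blast
    qed
    show "pt q ` wts (bd c) = rel_frontier (convex hull (d ` {..n+1}))"
    proof (intro set_eqI iffI)
      fix x assume "x \<in> pt q ` wts (bd c)"
      then obtain w where w: "w \<in> wts (bd c)" "x = pt q w" by blast
      show "x \<in> rel_frontier (convex hull (d ` {..n+1}))"
        unfolding frontier_weights[OF d] using W[OF w(1)] ptq[OF w(1)] w(2) by (intro exI[of _ "\<lambda>k. w (e k)"]) simp
    next
      fix x assume "x \<in> rel_frontier (convex hull (d ` {..n+1}))"
      then obtain u k where u: "\<forall>k. 0 \<le> u k" "(\<Sum>k\<le>n+1. u k) = 1" "k \<le> n+1" "u k = (0::real)" "x = (\<Sum>k\<le>n+1. u k *\<^sub>R d k)"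
        unfolding frontier_weights[OF d] by (elim exE conjE)
      define w where "w v = (if v \<in> e ` (?I - {k}) then u (the_inv_into ?I e v) else 0)" for v
      have we: "w (e m) = u m" if "m \<in> ?I" for m
      proof (cases "m = k")
        case True
        then have "e m \<notin> e ` (?I - {k})" using eI that by (auto simp: inj_on_def)
        then show ?thesis using True u(4) by (simp add: w_def)
      next
        case False
        then show ?thesis using that the_inv_into_f_f[OF eI that] by (auto simp: w_def)
      qed
      let ?s = "e ` (?I - {k})"
      have "k \<in> ?I" using u(3) by simp
      then have "e k \<notin> ?s" "e k \<in> ?V" using eI eV by (auto simp: inj_on_def)
      then have "?s \<in> bd c" unfolding bd_def using eV by blast
      moreover have "sum w ?s = 1"
      proof -
        have "sum w ?s = (\<Sum>m\<in>?I - {k}. w (e m))" by (rule sum.reindex_cong[OF inj_on_subset[OF eI] refl refl]) blast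
        also have "\<dots> = (\<Sum>m\<in>?I - {k}. u m)" by (rule sum.cong) (use we in auto)
        also have "\<dots> = sum u ?I" by (rule sum.mono_neutral_left) (use u(4) in auto)
        finally show ?thesis using u(2) by simp
      qed
      moreover have "\<forall>v. 0 \<le> w v" using u(1) by (simp add: w_def)
      moreover have "\<forall>v. v \<notin> ?s \<longrightarrow> w v = 0" by (simp add: w_def)
      ultimately have w: "w \<in> wts (bd c)" unfolding wts_def by blast
      have "x = pt q w" unfolding ptq[OF w] u(5) using we by simp
      then show "x \<in> pt q ` wts (bd c)" using w by blast
    qed
  qed
qed

end

section \<open>The join of the remaining pairs is a sphere\<close>

text \<open>Collects the coefficients of \<open>d k\<close> when the barycentres of \<open>d 0, \<dots>, d i\<close> are expanded.\<close>

lemma shifted_sum: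
  fixes d :: "nat \<Rightarrow> 'c::real_vector" and a s :: "nat \<Rightarrow> real" and n :: nat
  defines "R \<equiv> \<lambda>k. \<Sum>i\<in>{k..n}. a i"
  shows "(\<Sum>i\<le>n. s i *\<^sub>R d (Suc i) + a i *\<^sub>R (\<Sum>m\<le>i. d m)) =
     R 0 *\<^sub>R d 0 + (\<Sum>k\<le>n. (s k + R (Suc k)) *\<^sub>R d (Suc k))"
proof -
  have "(\<Sum>i\<le>n. a i *\<^sub>R (\<Sum>m\<le>i. d m)) = (\<Sum>i\<le>n. \<Sum>m\<le>n. if m \<le> i then a i *\<^sub>R d m else 0)"
  proof (rule sum.cong[OF refl])
    fix i assume "i \<in> {..n}"
    then have "{..i} = {m \<in> {..n}. m \<le> i}" by auto
    then show "a i *\<^sub>R (\<Sum>m\<le>i. d m) = (\<Sum>m\<le>n. if m \<le> i then a i *\<^sub>R d m else 0)"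
      by (simp only: scaleR_sum_right sum.inter_filter[OF finite_atMost], intro sum.cong refl) simp
  qed
  also have "\<dots> = (\<Sum>m\<le>n. \<Sum>i\<le>n. if m \<le> i then a i *\<^sub>R d m else 0)" by (rule sum.swap)
  also have "\<dots> = (\<Sum>m\<le>n. R m *\<^sub>R d m)"
  proof (rule sum.cong[OF refl])
    fix m assume "m \<in> {..n}"
    have "{i \<in> {..n}. m \<le> i} = {m..n}" by auto
    then have "(\<Sum>i\<le>n. if m \<le> i then a i *\<^sub>R d m else 0) = (\<Sum>i\<in>{m..n}. a i *\<^sub>R d m)"
      by (simp only: sum.inter_filter[OF finite_atMost, symmetric])
    then show "(\<Sum>i\<le>n. if m \<le> i then a i *\<^sub>R d m else 0) = R m *\<^sub>R d m"
      by (simp add: R_def scaleR_left.sum)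
  qed
  also have "\<dots> = R 0 *\<^sub>R d 0 + (\<Sum>k\<le>n. R (Suc k) *\<^sub>R d (Suc k))"
  proof -
    have "(\<Sum>m\<le>Suc n. R m *\<^sub>R d m) = R 0 *\<^sub>R d 0 + (\<Sum>k\<le>n. R (Suc k) *\<^sub>R d (Suc k))"
      by (rule sum.atMost_Suc_shift)
    moreover have "R (Suc n) = 0" by (simp add: R_def)
    ultimately show ?thesis by simp
  qed
  finally show ?thesis by (simp add: sum.distrib scaleR_add_left)
qed

text \<open>These minima invert the coordinate change in \<open>sphere_away\<close>.\<close>

fun running_min :: "(nat \<Rightarrow> real) \<Rightarrow> nat \<Rightarrow> real" where
  "running_min u 0 = u 0"
| "running_min u (Suc i) = min (running_min u i) (u (Suc i))"

lemma running_min_le: "k \<le> i \<Longrightarrow> running_min u i \<le> u k"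
  by (induction i) (auto simp: le_Suc_eq intro: order_trans[OF min.cobounded1])

lemma running_min_attained: "\<exists>k\<le>i. running_min u i = u k"
proof (induction i)
  case (Suc i)
  then obtain k where "k \<le> i" "running_min u i = u k" by blast
  then show ?case by (cases "running_min u i \<le> u (Suc i)") (auto simp: min_def intro: exI[of _ k])
qed simp

lemma running_min_cong: "(\<And>k. k \<le> i \<Longrightarrow> u k = v k) \<Longrightarrow> running_min u i = running_min v i"
  by (induction i) auto

context realization begin

lemma Sigma_vertex: "s \<in> \<Sigma> \<Longrightarrow> v \<in> s \<Longrightarrow> v = Apex \<or> (\<exists>i\<le>n. \<exists>k\<in>{0,1,2}. v = A i k)"
  by (rule bspec[OF conjunct1[OF iffD1[OF Sigma_iff]]])

lemma Sigma_unique: "s \<in> \<Sigma> \<Longrightarrow> A i k \<in> s \<Longrightarrow> A i k' \<in> s \<Longrightarrow> k = k'"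
  using conjunct1[OF conjunct2[OF iffD1[OF Sigma_iff]]] by blast

lemma Sigma_gap: "s \<in> \<Sigma> \<Longrightarrow> Apex \<in> s \<Longrightarrow> \<exists>q\<le>n. \<forall>k. A q k \<notin> s"
  by (rule mp[OF conjunct2[OF conjunct2[OF iffD1[OF Sigma_iff]]]])

text \<open>The two vertices of \<open>V\<^sup>i\<close> other than \<open>c i\<close>.\<close>

definition lo :: "(nat \<Rightarrow> nat) \<Rightarrow> nat \<Rightarrow> nat" where "lo c i = (if c i = 0 then 1 else 0)"
definition hi :: "(nat \<Rightarrow> nat) \<Rightarrow> nat \<Rightarrow> nat" where "hi c i = (if c i = 2 then 1 else 2)"

lemma lo_hi:
  assumes "c \<in> choices (Suc n)" "i \<le> n"
  shows "lo c i \<in> {0,1,2}" "hi c i \<in> {0,1,2}" "lo c i \<noteq> hi c i" "lo c i \<noteq> c i" "hi c i \<noteq> c i"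
    "k \<in> {0,1,2} \<Longrightarrow> k \<noteq> c i \<Longrightarrow> k = lo c i \<or> k = hi c i"
proof -
  have "c i \<in> {0,1,2}" using choicesD[OF assms(1)] assms(2) by simp
  then show "lo c i \<in> {0,1,2}" "hi c i \<in> {0,1,2}" "lo c i \<noteq> hi c i" "lo c i \<noteq> c i" "hi c i \<noteq> c i"
    "k \<in> {0,1,2} \<Longrightarrow> k \<noteq> c i \<Longrightarrow> k = lo c i \<or> k = hi c i"
    unfolding lo_def hi_def by auto
qed

lemma away_memD:
  assumes "c \<in> choices (Suc n)" "s \<in> away c" "v \<in> s"
  shows "\<exists>i\<le>n. v = A i (lo c i) \<or> v = A i (hi c i)"
proof -
  have s: "s \<in> \<Sigma>" "v \<noteq> Apex" "v \<notin> tr c" using assms(2,3) unfolding away_def by blast+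
  then obtain i k where ik: "i \<le> n" "k \<in> {0,1,2}" "v = A i k" using Sigma_vertex[OF s(1) assms(3)] by blast
  then have "k \<noteq> c i" using s(3) by (simp add: mem_tr)
  then show ?thesis using lo_hi(6)[OF assms(1) ik(1,2)] ik by blast
qed

text \<open>The join of \<open>n+1\<close> pairs of points is obtained from the boundary of the simplex \<open>d 0, \<dots>, d (n+1)\<close> by
stellar subdivisions: of the two vertices in position \<open>i\<close>, one becomes \<open>d (i+1)\<close> and the other the
barycentre of \<open>d 0, \<dots>, d i\<close>. If \<open>u\<close> are the barycentric coordinates in the simplex, then the
minimum of \<open>u 0, \<dots>, u i\<close> is the sum of the normalized weights of the barycentres
from position \<open>i\<close> on. So the weights are recovered from \<open>u\<close>, and
they exist for every \<open>u\<close> with minimum 0, that is, on the whole frontier.\<close>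

lemma sphere_away: assumes c: "c \<in> choices (Suc n)" shows "pl_sphere n (\<Union>(cell ` away c))"
proof -
  obtain d :: "nat \<Rightarrow> 'b" where d: "inj_on d {..n+1}" "\<not> affine_dependent (d ` {..n+1})" by (rule model_simplex)
  define q where "q v = (case v of Apex \<Rightarrow> 0 | A i k \<Rightarrow>
      if k = lo c i then d (Suc i) else (1 / real (Suc i)) *\<^sub>R (\<Sum>m\<le>i. d m))" for v
  define X where "X i = A i (lo c i)" for i
  define Y where "Y i = A i (hi c i)" for i
  let ?V = "X ` {..n} \<union> Y ` {..n}"
  have injX: "inj_on X S" "inj_on Y S" for S by (auto simp: X_def Y_def inj_on_def)
  have disj: "X i \<noteq> Y j" if "i \<le> n" for i j using lo_hi(3)[OF c that] by (auto simp: X_def Y_def)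
  have qX: "q (X i) = d (Suc i)" for i by (simp add: q_def X_def)
  have qY: "q (Y i) = (1 / real (Suc i)) *\<^sub>R (\<Sum>m\<le>i. d m)" if "i \<le> n" for i
    using lo_hi(3)[OF c that] by (simp add: q_def Y_def)
  have one: "{v} \<in> \<Sigma>" if "v \<in> ?V" for v
  proof -
    from that obtain i k where "i \<le> n" "k \<in> {0,1,2}" "v = A i k"
      using lo_hi(1,2)[OF c] unfolding X_def Y_def by blast
    then show ?thesis unfolding Sigma_iff by auto
  qed
  then have VV: "?V \<subseteq> \<Union>\<Sigma>" by blast
  have sumV1: "(\<Sum>v\<in>?V. g v) = (\<Sum>i\<le>n. g (X i) + g (Y i))" for g :: "vertex \<Rightarrow> real"
    by (subst sum.union_disjoint) (use disj in \<open>auto simp: sum.reindex[OF injX(1)] sum.reindex[OF injX(2)] sum.distrib\<close>)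
  have sumV2: "(\<Sum>v\<in>?V. g v) = (\<Sum>i\<le>n. g (X i) + g (Y i))" for g :: "vertex \<Rightarrow> 'b"
    by (subst sum.union_disjoint) (use disj in \<open>auto simp: sum.reindex[OF injX(1)] sum.reindex[OF injX(2)] sum.distrib\<close>)
  \<comment> \<open>\<open>U w k\<close> is the barycentric coordinate of \<open>pt q w\<close> at \<open>d k\<close>.\<close>
  define a where "a w i = w (Y i) / real (Suc i)" for w :: "vertex \<Rightarrow> real" and i
  define R where "R w k = (\<Sum>i\<in>{k..n}. a w i)" for w k
  define U where "U w k = (case k of 0 \<Rightarrow> R w 0 | Suc k' \<Rightarrow> w (X k') + R w k)" for w k
  have U0: "U w 0 = R w 0" and US: "U w (Suc k) = w (X k) + R w (Suc k)" for w k by (simp_all add: U_def)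
  have Rn: "R w (Suc n) = 0" for w by (simp add: R_def)
  have RS: "R w i = a w i + R w (Suc i)" if "i \<le> n" for w i
    unfolding R_def using that by (rule sum.atLeast_Suc_atMost)
  have W: "(\<forall>v. 0 \<le> w v) \<and> (\<forall>v. v \<notin> ?V \<longrightarrow> w v = 0) \<and> (\<Sum>i\<le>n. w (X i) + w (Y i)) = 1 \<and>
      (\<forall>i\<le>n. w (X i) = 0 \<or> w (Y i) = 0)" if w: "w \<in> wts (away c)" for w
  proof -
    obtain s where s: "s \<in> away c" "\<And>v. v \<notin> s \<Longrightarrow> w v = 0" "sum w s = 1" "\<forall>v. 0 \<le> w v" using w unfolding wts_def by blast
    have sV: "s \<subseteq> ?V" using away_memD[OF c s(1)] unfolding X_def Y_def by blast
    have "sum w ?V = sum w s" by (rule sum.mono_neutral_right) (use sV s(2) in auto)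
    then have "(\<Sum>i\<le>n. w (X i) + w (Y i)) = 1" using s(3) sumV1[of w] by simp
    moreover have "w (X i) = 0 \<or> w (Y i) = 0" if "i \<le> n" for i
    proof -
      have "s \<in> \<Sigma>" using s(1) by (simp add: away_def)
      then have "\<not> (X i \<in> s \<and> Y i \<in> s)" using lo_hi(3)[OF c that] unfolding Sigma_iff X_def Y_def by blast
      then show ?thesis using s(2) by blast
    qed
    ultimately show ?thesis using s(2,4) sV by blast
  qed
  have ptU: "pt q w = (\<Sum>k\<le>n+1. U w k *\<^sub>R d k)" if w: "w \<in> wts (away c)" for w
  proof -
    have "pt q w = (\<Sum>v\<in>?V. w v *\<^sub>R q v)" by (rule pt_on[OF VV]) (use W[OF w] in blast)
    also have "\<dots> = (\<Sum>i\<le>n. w (X i) *\<^sub>R q (X i) + w (Y i) *\<^sub>R q (Y i))" by (rule sumV2)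
    also have "\<dots> = (\<Sum>i\<le>n. w (X i) *\<^sub>R d (Suc i) + a w i *\<^sub>R (\<Sum>m\<le>i. d m))"
      by (rule sum.cong[OF refl]) (simp add: qX qY a_def)
    also have "\<dots> = R w 0 *\<^sub>R d 0 + (\<Sum>k\<le>n. (w (X k) + R w (Suc k)) *\<^sub>R d (Suc k))"
      unfolding R_def by (rule shifted_sum)
    also have "\<dots> = U w 0 *\<^sub>R d 0 + (\<Sum>k\<le>n. U w (Suc k) *\<^sub>R d (Suc k))" by (simp only: U0 US)
    also have "\<dots> = (\<Sum>k\<le>Suc n. U w k *\<^sub>R d k)" by (rule sum.atMost_Suc_shift[symmetric])
    finally show ?thesis by simp
  qed
  have sumU: "(\<Sum>k\<le>n+1. U w k) = (\<Sum>i\<le>n. w (X i) + w (Y i))" for w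
  proof -
    have "(\<Sum>i\<le>n. w (X i) + w (Y i)) = (\<Sum>i\<le>n. w (X i) *\<^sub>R 1 + a w i *\<^sub>R (\<Sum>m\<le>i. 1))"
      by (rule sum.cong[OF refl]) (simp add: a_def)
    also have "\<dots> = R w 0 *\<^sub>R 1 + (\<Sum>k\<le>n. (w (X k) + R w (Suc k)) *\<^sub>R 1)"
      unfolding R_def by (rule shifted_sum[of _ "\<lambda>_. 1"])
    also have "\<dots> = U w 0 + (\<Sum>k\<le>n. U w (Suc k))" by (simp only: U0 US real_scaleR_def mult_1_right)
    also have "\<dots> = (\<Sum>k\<le>Suc n. U w k)" by (rule sum.atMost_Suc_shift[symmetric])
    finally show ?thesis by simp
  qed
  have min: "running_min (U w) i = R w i"
    if w: "\<forall>v. 0 \<le> w v" "\<forall>i\<le>n. w (X i) = 0 \<or> w (Y i) = 0" and i: "i \<le> Suc n" for w i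
    using i
  proof (induction i)
    case (Suc i)
    then have i: "i \<le> n" by simp
    have "a w i \<ge> 0" using w(1) by (simp add: a_def)
    moreover have "w (X i) \<ge> 0" using w(1) by simp
    moreover have "w (X i) = 0 \<or> a w i = 0" using w(2) i by (auto simp: a_def)
    ultimately have "min (a w i + R w (Suc i)) (w (X i) + R w (Suc i)) = R w (Suc i)" by (auto simp: min_def)
    then show ?case using Suc i RS[OF i, of w] US[of w i] by simp
  qed (simp add: U0)
  have Unn: "0 \<le> U w k" if "\<forall>v. 0 \<le> w v" for w k
  proof -
    have "0 \<le> R w j" for j unfolding R_def by (intro sum_nonneg) (use that in \<open>simp add: a_def\<close>)
    then show ?thesis using that by (cases k) (simp_all add: U0 US)
  qed
  show ?thesis
  proof (rule pl_sphereI[OF d subcx_away])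
    show "inj_on (pt q) (wts (away c))"
    proof (rule inj_onI)
      fix w u assume w: "w \<in> wts (away c)" and u: "u \<in> wts (away c)" and eq: "pt q w = pt q u"
      note Ww = W[OF w] and Wu = W[OF u]
      have Ueq: "U w k = U u k" if "k \<in> {..n+1}" for k
      proof (rule affine_independent_unique[OF finite_atMost d _ _ that])
        show "sum (U w) {..n+1} = sum (U u) {..n+1}" using sumU[of w] sumU[of u] Ww Wu by simp
        show "(\<Sum>k\<le>n+1. U w k *\<^sub>R d k) = (\<Sum>k\<le>n+1. U u k *\<^sub>R d k)" using ptU[OF w] ptU[OF u] eq by simp
      qed
      have Req: "R w i = R u i" if "i \<le> Suc n" for i
      proof -
        have "running_min (U w) i = running_min (U u) i" by (rule running_min_cong) (use Ueq that in simp)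
        then show ?thesis using min[of w i] min[of u i] Ww Wu that by simp
      qed
      have "w (X i) = u (X i)" if "i \<le> n" for i using Ueq[of "Suc i"] Req[of "Suc i"] US[of w i] US[of u i] that by simp
      moreover have "w (Y i) = u (Y i)" if "i \<le> n" for i
      proof -
        have "a w i = a u i" using RS[OF that, of w] RS[OF that, of u] Req[of i] Req[of "Suc i"] that by simp
        then show ?thesis by (simp add: a_def)
      qed
      ultimately have "w v = u v" if "v \<in> ?V" for v using that by blast
      moreover have "w v = u v" if "v \<notin> ?V" for v using Ww Wu that by metis
      ultimately show "w = u" by blast
    qed
    show "pt q ` wts (away c) = rel_frontier (convex hull (d ` {..n+1}))"
    proof (intro set_eqI iffI)
      fix x assume "x \<in> pt q ` wts (away c)"
      then obtain w where w: "w \<in> wts (away c)" "x = pt q w" by blast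
      note Ww = W[OF w(1)]
      have "running_min (U w) (Suc n) = 0" using min[of w "Suc n"] Ww Rn by simp
      then obtain k where "k \<le> Suc n" "U w k = 0" using running_min_attained[of "Suc n" "U w"] by auto
      then have "\<exists>k\<le>n+1. U w k = 0" by auto
      moreover have "\<forall>k. 0 \<le> U w k" using Unn Ww by blast
      moreover have "(\<Sum>k\<le>n+1. U w k) = 1" using sumU[of w] Ww by simp
      ultimately show "x \<in> rel_frontier (convex hull (d ` {..n+1}))"
        unfolding frontier_weights[OF d] using ptU[OF w(1)] w(2) by blast
    next
      fix x assume "x \<in> rel_frontier (convex hull (d ` {..n+1}))"
      then obtain u k where u: "\<forall>k. 0 \<le> u k" "(\<Sum>k\<le>n+1. u k) = 1" "k \<le> n+1" "u k = (0::real)" "x = (\<Sum>k\<le>n+1. u k *\<^sub>R d k)"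
        unfolding frontier_weights[OF d] by (elim exE conjE)
      \<comment> \<open>The inverse: the differences of the running minima are the normalized weights at the barycentres, the excess of \<open>u\<close> over the minimum is the weight at \<open>d (i+1)\<close>.\<close>
      let ?M = "running_min u"
      define s where "s i = u (Suc i) - ?M (Suc i)" for i
      define t where "t i = real (Suc i) * (?M i - ?M (Suc i))" for i
      have s0: "0 \<le> s i" for i using running_min_le[of "Suc i" "Suc i" u] by (simp add: s_def)
      have t0: "0 \<le> t i" for i by (simp add: t_def)
      have st: "s i = 0 \<or> t i = 0" for i by (auto simp: s_def t_def min_def)
      have Mn: "?M (Suc n) = 0"
      proof -
        have "?M (Suc n) \<le> 0" using running_min_le[of k "Suc n" u] u(3,4) by simp
        moreover obtain j where "?M (Suc n) = u j" using running_min_attained[of "Suc n" u] by blast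
        ultimately show ?thesis using u(1) by (metis order_antisym)
      qed
      define w where "w v = (case v of Apex \<Rightarrow> 0 | A i k \<Rightarrow> if i \<le> n then (if k = lo c i then s i else if k = hi c i then t i else 0) else 0)" for v
      have wX: "w (X i) = s i" if "i \<le> n" for i using that by (simp add: w_def X_def)
      have wY: "w (Y i) = t i" if "i \<le> n" for i using that lo_hi(3)[OF c that] by (simp add: w_def Y_def)
      have w0: "\<forall>v. 0 \<le> w v" unfolding w_def using s0 t0 by (simp split: vertex.split)
      have aM: "a w i = ?M i - ?M (Suc i)" if "i \<le> n" for i using wY[OF that] by (simp add: a_def t_def)
      have RM: "R w i = ?M i" if "i \<le> Suc n" for i
        using that
      proof (induction "Suc n - i" arbitrary: i)
        case 0
        then have "i = Suc n" by simp
        then show ?case using Rn Mn by simp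
      next
        case (Suc m)
        then have i: "i \<le> n" by simp
        have "R w (Suc i) = ?M (Suc i)" by (rule Suc.hyps) (use Suc i in auto)
        then show ?case using RS[OF i, of w] aM[OF i] by simp
      qed
      have UM: "U w j = u j" if "j \<le> n + 1" for j
        using that RM[of j] wX[of "j - 1"] by (cases j) (simp_all add: U0 US s_def)
      have sum1: "(\<Sum>i\<le>n. w (X i) + w (Y i)) = 1"
      proof -
        have "(\<Sum>k\<le>n+1. U w k) = (\<Sum>k\<le>n+1. u k)" by (rule sum.cong) (use UM in auto)
        then show ?thesis using sumU[of w] u(2) by simp
      qed
      \<comment> \<open>One of the two weights in position \<open>i\<close> vanishes, so the weights are supported on a simplex.\<close>
      define z where "z i = A i (if s i = 0 then hi c i else lo c i)" for i
      have zS: "z ` {..n} \<in> away c"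
      proof -
        have el: "z i = X i \<or> z i = Y i" for i by (simp add: z_def X_def Y_def)
        have "z ` {..n} \<in> \<Sigma>" unfolding Sigma_iff
        proof (intro conjI ballI allI impI)
          fix v assume "v \<in> z ` {..n}"
          then obtain i where i: "i \<le> n" "v = z i" by auto
          then show "v = Apex \<or> (\<exists>i\<le>n. \<exists>k\<in>{0,1,2}. v = A i k)"
            using lo_hi(1,2)[OF c i(1)] unfolding z_def by metis
        next
          fix i k k' assume "A i k \<in> z ` {..n}" "A i k' \<in> z ` {..n}"
          then show "k = k'" by (auto simp: z_def)
        next
          assume "Apex \<in> z ` {..n}" then show "\<exists>q\<le>n. \<forall>k. A q k \<notin> z ` {..n}" by (auto simp: z_def)
        qed
        moreover have "z i \<notin> insert Apex (tr c)" if "i \<le> n" for i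
          using lo_hi(4,5)[OF c that] by (simp add: z_def mem_tr)
        then have "z ` {..n} \<inter> insert Apex (tr c) = {}" by blast
        ultimately show ?thesis unfolding away_def by (intro CollectI conjI)
      qed
      have wz: "w v = 0" if v: "v \<notin> z ` {..n}" for v
      proof (cases v)
        case (A i k)
        have "w (A i k) = 0" if i: "i \<le> n"
        proof -
          have "z i \<noteq> v" using v i by blast
          then have "k \<noteq> (if s i = 0 then hi c i else lo c i)" using A by (auto simp: z_def)
          then show ?thesis using st[of i] i by (auto simp: w_def split: if_splits)
        qed
        then show ?thesis using A by (cases "i \<le> n") (simp_all add: w_def)
      qed (simp add: w_def)
      have "sum w (z ` {..n}) = 1"
      proof -
        have "sum w (z ` {..n}) = (\<Sum>i\<le>n. w (z i))"
          by (rule sum.reindex_cong[OF _ refl refl]) (auto simp: z_def inj_on_def)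
        also have "\<dots> = (\<Sum>i\<le>n. w (X i) + w (Y i))"
        proof (rule sum.cong[OF refl])
          fix i assume "i \<in> {..n}"
          then have i: "i \<le> n" by simp
          show "w (z i) = w (X i) + w (Y i)"
          proof (cases "s i = 0")
            case True
            then have "z i = Y i" by (simp add: z_def Y_def)
            then show ?thesis using wX[OF i] True by simp
          next
            case False
            then have "z i = X i" "t i = 0" using st[of i] by (simp_all add: z_def X_def)
            then show ?thesis using wY[OF i] by simp
          qed
        qed
        finally show ?thesis using sum1 by simp
      qed
      then have w: "w \<in> wts (away c)" unfolding wts_def using w0 zS wz by blast
      have "pt q w = x" unfolding ptU[OF w] u(5) by (rule sum.cong) (use UM in auto)
      then show "x \<in> pt q ` wts (away c)" using w by blast
    qed
  qed
qed

end

section \<open>Pairs of disjoint spheres\<close>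

text \<open>The value at \<open>Apex\<close> is a dummy; \<open>idx\<close> is only used for the other vertices.\<close>

definition idx :: "vertex \<Rightarrow> nat" where "idx v = (case v of A i k \<Rightarrow> i | Apex \<Rightarrow> 0)"

context realization begin

definition sph :: "vertex set set \<Rightarrow> bool" where
  "sph S \<longleftrightarrow> subcx S \<and> pl_sphere n (\<Union>(cell ` S))"

lemma sphD: assumes "sph S" shows "subcx S" "S \<subseteq> \<Sigma>" "s \<in> S \<Longrightarrow> t \<subseteq> s \<Longrightarrow> t \<in> S"
  using assms unfolding sph_def subcx_def by blast+

lemma sph_triangulation:
  assumes "sph S" obtains \<Delta> :: "'b set" where "sphere_triangulation (cell ` S) \<Delta> n"
proof -
  have S: "subcx S" "pl_sphere n (\<Union>(cell ` S))" using assms unfolding sph_def by (rule conjunct1, rule conjunct2)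
  show thesis by (rule pl_sphere_triangulation[OF subcx_complex[OF S(1)] S(2)]) (rule that)
qed

lemma card_eq_dim: "s \<in> \<Sigma> \<Longrightarrow> aff_dim (cell s) = int n \<longleftrightarrow> card s = Suc n"
  using aff_dim_cell by auto

lemma sph_pure:
  assumes "sph S" "s \<in> S" shows "\<exists>t\<in>S. s \<subseteq> t \<and> card t = Suc n"
proof -
  obtain \<Delta> :: "'b set" where st: "sphere_triangulation (cell ` S) \<Delta> n" using sph_triangulation[OF assms(1)] .
  obtain u where u: "u \<in> cell ` S" "cell s \<subseteq> u" "aff_dim u = int n"
    using sphere_triangulation.pure[OF st imageI[OF assms(2)]] .
  then obtain t where t: "t \<in> S" "u = cell t" by blast
  have "s \<in> \<Sigma>" "t \<in> \<Sigma>" using sphD(2)[OF assms(1)] assms(2) t(1) by auto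
  then show ?thesis using cell_subset card_eq_dim u t by auto
qed

lemma sph_top:
  assumes "sph S" shows "\<exists>t\<in>S. card t = Suc n"
proof -
  obtain \<Delta> :: "'b set" where st: "sphere_triangulation (cell ` S) \<Delta> n" using sph_triangulation[OF assms(1)] .
  obtain s where "s \<in> S" using sphere_triangulation.Union_ne[OF st] by blast
  then show ?thesis using sph_pure[OF assms] by blast
qed

text \<open>Crossing a facet of a sphere. Together with the few vertices that are available this determines the
spheres.\<close>

lemma sph_flip:
  assumes "sph S" "s \<in> S" "card s = Suc n" "v \<in> s"
  shows "\<exists>t\<in>S. t \<noteq> s \<and> card t = Suc n \<and> s - {v} \<subseteq> t"
proof -
  obtain \<Delta> :: "'b set" where st: "sphere_triangulation (cell ` S) \<Delta> n" using sph_triangulation[OF assms(1)] .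
  have sS: "s \<in> \<Sigma>" using sphD(2)[OF assms(1)] assms(2) by blast
  have f: "cell (s - {v}) facet_of cell s" unfolding facet_of_cell[OF sS] using n assms by auto
  have d: "aff_dim (cell s) = int n" using card_eq_dim[OF sS] assms(3) by simp
  obtain u where u: "u \<in> cell ` S" "u \<noteq> cell s" "aff_dim u = int n" "cell (s - {v}) facet_of u"
    using sphere_triangulation.second_cell[OF st imageI[OF assms(2)] d f] by blast
  then obtain t where t: "t \<in> S" "u = cell t" by blast
  have tS: "t \<in> \<Sigma>" using sphD(2)[OF assms(1)] t(1) by blast
  have "cell (s - {v}) \<subseteq> cell t" using facet_of_imp_subset[OF u(4)] unfolding t(2) .
  then have "s - {v} \<subseteq> t" by (rule iffD1[OF cell_subset[OF down[OF sS Diff_subset] tS]])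
  moreover have "card t = Suc n" using card_eq_dim[OF tS] u(3) unfolding t(2) by simp
  moreover have "t \<noteq> s" using t(2) u(2) by auto
  ultimately show ?thesis using t(1) by blast
qed

lemma top_eq: "s \<in> \<Sigma> \<Longrightarrow> t \<in> \<Sigma> \<Longrightarrow> s \<subseteq> t \<Longrightarrow> card s = Suc n \<Longrightarrow> card t = Suc n \<Longrightarrow> s = t"
  by (rule card_subset_eq[OF finite_simplex]) simp_all

lemma idx_inj: assumes "s \<in> \<Sigma>" shows "inj_on idx (s - {Apex})" "idx ` (s - {Apex}) \<subseteq> {..n}"
proof -
  have v: "\<exists>i\<le>n. \<exists>k. v = A i k" if "v \<in> s - {Apex}" for v using Sigma_vertex[OF assms, of v] that by blast
  show "inj_on idx (s - {Apex})"
  proof (rule inj_onI)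
    fix x y assume xy: "x \<in> s - {Apex}" "y \<in> s - {Apex}" "idx x = idx y"
    obtain i k where x: "x = A i k" using v[OF xy(1)] by blast
    obtain j m where y: "y = A j m" using v[OF xy(2)] by blast
    have "i = j" using xy(3) by (simp add: x y idx_def)
    then show "x = y" using Sigma_unique[OF assms, of i k m] xy x y by simp
  qed
  show "idx ` (s - {Apex}) \<subseteq> {..n}"
  proof
    fix j assume "j \<in> idx ` (s - {Apex})"
    then obtain x where x: "x \<in> s - {Apex}" "j = idx x" by blast
    obtain i k where "i \<le> n" "x = A i k" using v[OF x(1)] by blast
    then show "j \<in> {..n}" using x by (simp add: idx_def)
  qed
qed

lemma idx_mem: "i \<in> idx ` (s - {Apex}) \<Longrightarrow> \<exists>k. A i k \<in> s"
proof -
  assume "i \<in> idx ` (s - {Apex})"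
  then obtain v where "v \<in> s" "v \<noteq> Apex" "i = idx v" by blast
  then show "\<exists>k. A i k \<in> s" by (cases v) (auto simp: idx_def)
qed

lemma top_full:
  assumes "s \<in> \<Sigma>" "card s = Suc n" "Apex \<notin> s" "i \<le> n" shows "\<exists>k. A i k \<in> s"
proof -
  have "s - {Apex} = s" using assms(3) by blast
  then have "card (idx ` (s - {Apex})) = Suc n" using card_image[OF idx_inj(1)[OF assms(1)]] assms(2) by simp
  then have "idx ` (s - {Apex}) = {..n}" using card_subset_eq[OF _ idx_inj(2)[OF assms(1)]] by simp
  then show ?thesis using idx_mem assms(4) by blast
qed

lemma value_range: "sph S \<Longrightarrow> A i k \<in> \<Union>S \<Longrightarrow> i \<le> n \<and> k \<in> {0,1,2}"
proof -
  assume S: "sph S" and v: "A i k \<in> \<Union>S"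
  obtain s where s: "s \<in> S" "A i k \<in> s" using v by blast
  have "s \<in> \<Sigma>" using sphD(2)[OF S] s(1) by blast
  from Sigma_vertex[OF this s(2)] show "i \<le> n \<and> k \<in> {0,1,2}" by auto
qed

text \<open>A sphere without \<open>b\<close> consists of simplices of type I. Crossing the facet without the vertex in \<open>V\<^sup>i\<close>
replaces this vertex by another one.\<close>

lemma two_values:
  assumes S: "sph S" "Apex \<notin> \<Union>S" and i: "i \<le> n"
  obtains k k' where "k \<noteq> k'" "A i k \<in> \<Union>S" "A i k' \<in> \<Union>S"
proof -
  obtain s where s: "s \<in> S" "card s = Suc n" using sph_top[OF S(1)] by blast
  have sS: "s \<in> \<Sigma>" using sphD(2)[OF S(1)] s by blast
  obtain k where k: "A i k \<in> s" using top_full[OF sS s(2) _ i] S(2) s(1) by blast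
  obtain t where t: "t \<in> S" "t \<noteq> s" "card t = Suc n" "s - {A i k} \<subseteq> t" using sph_flip[OF S(1) s k] by blast
  have tS: "t \<in> \<Sigma>" using sphD(2)[OF S(1)] t by blast
  obtain k' where k': "A i k' \<in> t" using top_full[OF tS t(3) _ i] S(2) t(1) by blast
  have "k \<noteq> k'"
  proof
    assume "k = k'"
    then have "s \<subseteq> t" using t(4) k' by blast
    then show False using top_eq[OF sS tS _ s(2) t(3)] t(2) by blast
  qed
  then show thesis using that k k' s t by blast
qed

text \<open>Otherwise both spheres would have two of the three vertices of \<open>V\<^sup>0\<close>.\<close>

lemma apex_in_one:
  assumes "sph S" "sph T" "\<Union>S \<inter> \<Union>T = {}" shows "Apex \<in> \<Union>S \<or> Apex \<in> \<Union>T"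
proof (rule ccontr)
  assume "\<not> ?thesis"
  then have ap: "Apex \<notin> \<Union>S" "Apex \<notin> \<Union>T" by blast+
  obtain k k' where k: "k \<noteq> k'" "A 0 k \<in> \<Union>S" "A 0 k' \<in> \<Union>S" using two_values[OF assms(1) ap(1) le0] .
  obtain m m' where m: "m \<noteq> m'" "A 0 m \<in> \<Union>T" "A 0 m' \<in> \<Union>T" using two_values[OF assms(2) ap(2) le0] .
  have "k \<in> {0,1,2}" "k' \<in> {0,1,2}" "m \<in> {0,1,2}" "m' \<in> {0,1,2}"
    using value_range[OF assms(1)] value_range[OF assms(2)] k m by blast+
  moreover have "k \<noteq> m" "k \<noteq> m'" "k' \<noteq> m" "k' \<noteq> m'" using assms(3) k m by blast+
  ultimately show False using k(1) m(1) by auto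
qed

text \<open>The sphere \<open>T\<close> without \<open>b\<close> uses two vertices of each \<open>V\<^sup>i\<close>, so at most one, \<open>c i\<close>, is left for \<open>S\<close>. Then \<open>S\<close>
is part of the boundary of the simplex on \<open>b\<close> and these vertices; crossing its facets reaches all of
that boundary. In \<open>T\<close>, crossing the facet opposite to the vertex in \<open>V\<^sup>i\<close> exchanges the two
vertices other than \<open>c i\<close>, so all \<open>n\<close>-simplices that avoid \<open>S\<close> belong to \<open>T\<close>.\<close>

lemma disjoint_spheres:
  assumes S: "sph S" and T: "sph T" and disj: "\<Union>S \<inter> \<Union>T = {}" and ap: "Apex \<in> \<Union>S"
  obtains c where "c \<in> choices (Suc n)" "S = bd c" "T = away c"
proof -
  have apT: "Apex \<notin> \<Union>T" using disj ap by blast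
  have "\<exists>c\<in>{0,1,2}. \<forall>k. A i k \<in> \<Union>S \<longrightarrow> k = c" if i: "i \<le> n" for i
  proof -
    obtain k k' where k: "k \<noteq> k'" "A i k \<in> \<Union>T" "A i k' \<in> \<Union>T" using two_values[OF T apT i] .
    have kr: "k \<in> {0,1,2}" "k' \<in> {0,1,2}" using value_range[OF T] k by blast+
    have "m = 3 - k - k'" if m: "A i m \<in> \<Union>S" for m
    proof -
      have "m \<in> {0,1,2}" using value_range[OF S m] by blast
      moreover have "m \<noteq> k" "m \<noteq> k'" using disj m k by blast+
      ultimately show ?thesis using kr k(1) by auto
    qed
    moreover have "3 - k - k' \<in> {0,1,2}" using kr k(1) by auto
    ultimately show ?thesis by blast
  qed
  then obtain c0 where c0: "\<And>i. i \<le> n \<Longrightarrow> c0 i \<in> {0,1,2} \<and> (\<forall>k. A i k \<in> \<Union>S \<longrightarrow> k = c0 i)" by metis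
  define c where "c = restrict c0 {..<Suc n}"
  have ci: "c i = c0 i" if "i \<le> n" for i using that by (simp add: c_def)
  have c: "c \<in> choices (Suc n)" unfolding choices_def c_def using c0 by (intro restrict_PiE_iff[THEN iffD2]) auto
  have cS: "k = c i" if "A i k \<in> \<Union>S" for i k
  proof -
    have "i \<le> n" using value_range[OF S that] by blast
    then show ?thesis using c0 ci that by metis
  qed
  have trS: "tr c \<subseteq> t" if t: "t \<in> S" "card t = Suc n" "Apex \<notin> t" for t
  proof
    fix v assume "v \<in> tr c"
    then obtain i where i: "i \<le> n" "v = A i (c i)" using tr_cases by blast
    have "t \<in> \<Sigma>" using sphD(2)[OF S] t by blast
    then obtain k where k: "A i k \<in> t" using top_full[OF _ t(2,3) i(1)] by blast
    then have "k = c i" using cS t(1) by blast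
    then show "v \<in> t" using k i by simp
  qed
  have ctr: "card (tr c) = Suc n" by simp
  obtain s where s: "s \<in> S" "Apex \<in> s" "card s = Suc n"
  proof -
    from ap obtain s' where s': "s' \<in> S" "Apex \<in> s'" by blast
    obtain s where "s \<in> S" "s' \<subseteq> s" "card s = Suc n" using sph_pure[OF S s'(1)] by blast
    then show thesis using that s' by blast
  qed
  obtain t where t: "t \<in> S" "t \<noteq> s" "card t = Suc n" "s - {Apex} \<subseteq> t" using sph_flip[OF S s(1,3,2)] by blast
  have SS: "\<And>x. x \<in> S \<Longrightarrow> x \<in> \<Sigma>" using sphD(2)[OF S] by blast
  have TS: "\<And>x. x \<in> T \<Longrightarrow> x \<in> \<Sigma>" using sphD(2)[OF T] by blast
  have "Apex \<notin> t"
  proof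
    assume "Apex \<in> t"
    then have "s \<subseteq> t" using t(4) by blast
    then show False using top_eq[OF SS[OF s(1)] SS[OF t(1)] _ s(3) t(3)] t(2) by blast
  qed
  then have "tr c \<subseteq> t" using trS t by blast
  then have "tr c \<in> S" using sphD(3)[OF S t(1)] by blast
  have side: "insert Apex (tr c - {A i (c i)}) \<in> S" if i: "i \<le> n" for i
  proof -
    have "A i (c i) \<in> tr c" using i by (simp add: mem_tr)
    then obtain t where t: "t \<in> S" "t \<noteq> tr c" "card t = Suc n" "tr c - {A i (c i)} \<subseteq> t"
      using sph_flip[OF S \<open>tr c \<in> S\<close> ctr] by blast
    have "Apex \<in> t"
    proof (rule ccontr)
      assume "Apex \<notin> t"
      then have "tr c \<subseteq> t" using trS t by blast
      then show False using top_eq[OF SS[OF \<open>tr c \<in> S\<close>] SS[OF t(1)] _ ctr t(3)] t(2) by blast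
    qed
    then have "insert Apex (tr c - {A i (c i)}) \<subseteq> t" using t(4) by blast
    then show ?thesis using sphD(3)[OF S t(1)] by blast
  qed
  have Sbd: "S = bd c"
  proof
    show "S \<subseteq> bd c"
    proof
      fix s assume s: "s \<in> S"
      have "s \<subseteq> insert Apex (tr c)"
      proof
        fix v assume v: "v \<in> s"
        show "v \<in> insert Apex (tr c)"
        proof (cases v)
          case (A i k)
          then have "A i k \<in> \<Union>S" using v s by blast
          then have "k = c i" "i \<le> n" using cS value_range[OF S] by blast+
          then show ?thesis using A by (simp add: mem_tr)
        qed simp
      qed
      moreover have "s \<noteq> insert Apex (tr c)"
      proof
        assume eq: "s = insert Apex (tr c)"
        then obtain q where q: "q \<le> n" "\<forall>k. A q k \<notin> s" using Sigma_gap[OF SS[OF s]] by blast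
        then have "A q (c q) \<in> s" using eq by (simp add: mem_tr)
        then show False using q(2) by blast
      qed
      ultimately show "s \<in> bd c" unfolding bd_def by blast
    qed
    show "bd c \<subseteq> S"
    proof
      fix s assume "s \<in> bd c"
      then have ps: "s \<subset> insert Apex (tr c)" by (simp add: bd_def)
      then obtain x where x: "x \<in> insert Apex (tr c)" "x \<notin> s" by blast
      show "s \<in> S"
      proof (cases "x = Apex")
        case True
        then have "s \<subseteq> tr c" using ps x by blast
        then show ?thesis using sphD(3)[OF S \<open>tr c \<in> S\<close>] by blast
      next
        case False
        then have "x \<in> tr c" using x by blast
        then obtain i where i: "i \<le> n" "x = A i (c i)" using tr_cases by blast
        have "s \<subseteq> insert Apex (tr c - {A i (c i)})" using ps x(2) i(2) by blast
        then show ?thesis using sphD(3)[OF S side[OF i(1)]] by blast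
      qed
    qed
  qed
  have US: "insert Apex (tr c) \<subseteq> \<Union>S" using ap \<open>tr c \<in> S\<close> by blast
  have notc: "k \<noteq> c i" if "A i k \<in> \<Union>T" "i \<le> n" for i k
  proof
    assume "k = c i"
    then have "A i k \<in> \<Union>S" using US that(2) mem_tr[of i k c] by blast
    then show False using disj that by blast
  qed
  have Tc: "T = away c"
  proof
    show "T \<subseteq> away c" unfolding away_def using TS US disj by blast
    obtain s0 where s0: "s0 \<in> T" "card s0 = Suc n" using sph_top[OF T] by blast
    have "\<exists>k. A i k \<in> s0" if "i \<le> n" for i using top_full[OF TS[OF s0(1)] s0(2) _ that] apT s0(1) by blast
    then obtain g0 where g0: "\<And>i. i \<le> n \<Longrightarrow> A i (g0 i) \<in> s0" by metis
    have "tr g0 \<subseteq> s0"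
    proof
      fix v assume "v \<in> tr g0"
      then obtain i where "i \<le> n" "v = A i (g0 i)" using tr_cases by blast
      then show "v \<in> s0" using g0 by simp
    qed
    then have base: "tr g0 \<in> T" using sphD(3)[OF T s0(1)] by blast
    \<comment> \<open>Starting from one simplex \<open>g0\<close> of \<open>T\<close>, change its vertices to those of \<open>g\<close> one position after the other.\<close>
    have walk: "tr (\<lambda>i. if i < m then g i else g0 i) \<in> T"
      if g: "\<And>i. i \<le> n \<Longrightarrow> g i = lo c i \<or> g i = hi c i" and m: "m \<le> Suc n" for g m
      using m
    proof (induction m)
      case 0
      then show ?case using base by simp
    next
      case (Suc m)
      then have mn: "m \<le> n" by simp
      let ?f = "\<lambda>i. if i < m then g i else g0 i" and ?f' = "\<lambda>i. if i < Suc m then g i else g0 i"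
      have IH: "tr ?f \<in> T" using Suc by simp
      have fin: "A m (g0 m) \<in> tr ?f" using mn by (simp add: mem_tr)
      have cf: "card (tr ?f) = Suc n" by simp
      show ?case
      proof (cases "g m = g0 m")
        case True
        then have "?f' = ?f" by (auto simp: fun_eq_iff less_Suc_eq)
        then show ?thesis using IH by simp
      next
        case False
        obtain t where t: "t \<in> T" "t \<noteq> tr ?f" "card t = Suc n" "tr ?f - {A m (g0 m)} \<subseteq> t"
          using sph_flip[OF T IH cf fin] by blast
        obtain k where k: "A m k \<in> t" using top_full[OF TS[OF t(1)] t(3) _ mn] apT t(1) by blast
        have "k \<noteq> g0 m"
        proof
          assume "k = g0 m"
          then have "tr ?f \<subseteq> t" using t(4) k by blast
          then show False using top_eq[OF TS[OF IH] TS[OF t(1)] _ cf t(3)] t(2) by blast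
        qed
        moreover have "A m k \<in> \<Union>T" "A m (g0 m) \<in> \<Union>T" using k t(1) fin IH by blast+
        then have "k \<noteq> c m" "g0 m \<noteq> c m" "k \<in> {0,1,2}" "g0 m \<in> {0,1,2}"
          using notc mn value_range[OF T] by blast+
        ultimately have "k = g m" using lo_hi(6)[OF c mn] g[OF mn] False by metis
        have "tr ?f' \<subseteq> t"
        proof
          fix v assume "v \<in> tr ?f'"
          then obtain i where i: "i \<le> n" "v = A i (?f' i)" using tr_cases by blast
          show "v \<in> t"
          proof (cases "i = m")
            case True
            then show ?thesis using i k \<open>k = g m\<close> by simp
          next
            case False
            then have "v = A i (?f i)" using i by (auto simp: less_Suc_eq)
            then have "v \<in> tr ?f" "v \<noteq> A m (g0 m)" using i False by (auto simp: mem_tr)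
            then show ?thesis using t(4) by blast
          qed
        qed
        then show ?thesis using sphD(3)[OF T t(1)] by blast
      qed
    qed
    show "away c \<subseteq> T"
    proof
      fix s assume s: "s \<in> away c"
      then have sS: "s \<in> \<Sigma>" by (simp add: away_def)
      define g where "g i = (if \<exists>k. A i k \<in> s then SOME k. A i k \<in> s else lo c i)" for i
      have gs: "A i (g i) \<in> s" if ex: "\<exists>k. A i k \<in> s" for i
      proof -
        have "g i = (SOME k. A i k \<in> s)" unfolding g_def by (rule if_P[OF ex])
        then show ?thesis using someI_ex[OF ex] by simp
      qed
      have gr: "g i = lo c i \<or> g i = hi c i" if "i \<le> n" for i
      proof (cases "\<exists>k. A i k \<in> s")
        case True
        from away_memD[OF c s gs[OF True]] show ?thesis by auto
      qed (simp add: g_def)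
      have "s \<subseteq> tr g"
      proof
        fix v assume v: "v \<in> s"
        from away_memD[OF c s v] obtain i k where i: "i \<le> n" "v = A i k" by blast
        then have "A i (g i) \<in> s" using gs v by blast
        then have "k = g i" using Sigma_unique[OF sS] v i by blast
        then show "v \<in> tr g" using i by (simp add: mem_tr)
      qed
      moreover have "tr (\<lambda>i. if i < Suc n then g i else g0 i) = tr g" by (auto simp: part_def)
      ultimately show "s \<in> T" using walk[OF gr order_refl] sphD(3)[OF T] by metis
    qed
  qed
  show thesis by (rule that[OF c Sbd Tc])
qed

lemma sph_bd: "c \<in> choices (Suc n) \<Longrightarrow> sph (bd c)"
  unfolding sph_def using subcx_bd sphere_bd by blast

lemma sph_away: "c \<in> choices (Suc n) \<Longrightarrow> sph (away c)"
  unfolding sph_def using subcx_away sphere_away by blast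

lemma bd_away_disjoint: "\<Union>(bd c) \<inter> \<Union>(away c) = {}"
  unfolding bd_def away_def by blast

definition pair :: "(nat \<Rightarrow> nat) \<Rightarrow> 'b set set set" where
  "pair c = {cell ` bd c, cell ` away c}"

lemma sph_family:
  assumes "sph S"
  shows "cell ` S \<subseteq> K" "simplicial_complex (cell ` S)" "pl_sphere n (\<Union>(cell ` S))"
proof -
  show "cell ` S \<subseteq> K" unfolding K_cell by (rule image_mono[OF sphD(2)[OF assms]])
  show "simplicial_complex (cell ` S)" by (rule subcx_complex[OF sphD(1)[OF assms]])
  show "pl_sphere n (\<Union>(cell ` S))" using assms unfolding sph_def by (rule conjunct2)
qed

lemma Lambda_eq: "Lambda n K = pair ` choices (Suc n)"
proof
  show "Lambda n K \<subseteq> pair ` choices (Suc n)"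
  proof
    fix L assume "L \<in> Lambda n K"
    then obtain g1 g2 where g: "L = {g1, g2}" "g1 \<subseteq> K" "simplicial_complex g1" "pl_sphere n (\<Union>g1)"
      "g2 \<subseteq> K" "simplicial_complex g2" "pl_sphere n (\<Union>g2)" "\<Union>g1 \<inter> \<Union>g2 = {}"
      unfolding Lambda_def mem_Collect_eq by (elim exE conjE)
    obtain S where S: "subcx S" "g1 = cell ` S" using complex_subcx[OF g(2,3)] .
    obtain T where T: "subcx T" "g2 = cell ` T" using complex_subcx[OF g(5,6)] .
    have sp: "sph S" "sph T" unfolding sph_def using S T g(4,7) by simp_all
    have dj: "\<Union>S \<inter> \<Union>T = {}" using cells_disjoint[OF S(1) T(1)] g(8) S T by simp
    then have dj': "\<Union>T \<inter> \<Union>S = {}" by blast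
    show "L \<in> pair ` choices (Suc n)"
    proof (cases "Apex \<in> \<Union>S")
      case True
      obtain c where "c \<in> choices (Suc n)" "S = bd c" "T = away c" using disjoint_spheres[OF sp dj True] .
      then show ?thesis using g(1) S T unfolding pair_def by simp
    next
      case False
      then have ap: "Apex \<in> \<Union>T" using apex_in_one[OF sp dj] by blast
      obtain c where "c \<in> choices (Suc n)" "T = bd c" "S = away c" using disjoint_spheres[OF sp(2,1) dj' ap] .
      then show ?thesis using g(1) S T unfolding pair_def by (simp add: insert_commute)
    qed
  qed
  show "pair ` choices (Suc n) \<subseteq> Lambda n K"
  proof
    fix L assume "L \<in> pair ` choices (Suc n)"
    then obtain c where c: "c \<in> choices (Suc n)" "L = {cell ` bd c, cell ` away c}" unfolding pair_def by (rule imageE)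
    have "\<Union>(cell ` bd c) \<inter> \<Union>(cell ` away c) = {}"
      by (rule iffD2[OF cells_disjoint[OF subcx_bd[OF c(1)] subcx_away] bd_away_disjoint])
    then show "L \<in> Lambda n K" unfolding Lambda_def mem_Collect_eq c(2)
      using sph_family[OF sph_bd[OF c(1)]] sph_family[OF sph_away[OF c(1)]] by (intro exI[of _ "cell ` bd c"] exI[of _ "cell ` away c"] conjI refl)
  qed
qed

lemma Apex_bd: "{Apex} \<in> bd c"
  unfolding bd_def using mem_tr[of 0 "c 0" c] by auto

lemma vertex_bd: "i \<le> n \<Longrightarrow> {A i (c i)} \<in> bd c"
  unfolding bd_def using mem_tr[of i "c i" c] by auto

lemma inj_pair: "inj_on pair (choices (Suc n))"
proof (rule inj_onI)
  fix c c' assume c: "c \<in> choices (Suc n)" and c': "c' \<in> choices (Suc n)" and eq: "pair c = pair c'"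
  have sub: "\<And>x. x \<in> bd c \<Longrightarrow> x \<in> \<Sigma>" "\<And>x. x \<in> bd c' \<Longrightarrow> x \<in> \<Sigma>" "\<And>x. x \<in> away c' \<Longrightarrow> x \<in> \<Sigma>"
    using subcx_bd[OF c] subcx_bd[OF c'] subcx_away[of c'] unfolding subcx_def by blast+
  have "cell ` bd c \<noteq> cell ` away c'"
  proof
    assume "cell ` bd c = cell ` away c'"
    then have "cell {Apex} \<in> cell ` away c'" using Apex_bd[of c] by blast
    then obtain s where s: "s \<in> away c'" "cell {Apex} = cell s" by blast
    have "{Apex} = s" by (rule cell_inj[OF sub(1)[OF Apex_bd] sub(3)[OF s(1)] s(2)])
    then show False using s(1) unfolding away_def by blast
  qed
  then have eqb: "cell ` bd c = cell ` bd c'" using eq unfolding pair_def by (metis doubleton_eq_iff)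
  have "c i = c' i" if i: "i \<in> {..<Suc n}" for i
  proof -
    have i': "i \<le> n" using i by simp
    have "cell {A i (c i)} \<in> cell ` bd c'" using vertex_bd[OF i', of c] eqb by blast
    then obtain s where s: "s \<in> bd c'" "cell {A i (c i)} = cell s" by blast
    have "{A i (c i)} = s" by (rule cell_inj[OF sub(1)[OF vertex_bd[OF i']] sub(2)[OF s(1)] s(2)])
    then have "A i (c i) \<in> insert Apex (tr c')" using s(1) unfolding bd_def by blast
    then show ?thesis by (simp add: mem_tr)
  qed
  then show "c = c'" using c c' unfolding choices_def by (rule PiE_ext[rotated 2])
qed

lemma tops_bd:
  "{s \<in> bd c. card s = Suc n} = insert (tr c) ((\<lambda>q. insert Apex (tr c - {A q (c q)})) ` {..<Suc n})"
proof (intro set_eqI iffI)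
  fix s assume "s \<in> {s \<in> bd c. card s = Suc n}"
  then have s: "s \<subset> insert Apex (tr c)" "card s = Suc n" by (auto simp: bd_def)
  show "s \<in> insert (tr c) ((\<lambda>q. insert Apex (tr c - {A q (c q)})) ` {..<Suc n})"
  proof (cases "Apex \<in> s")
    case False
    then have "s \<subseteq> tr c" using s by blast
    then have "s = tr c" by (rule card_subset_eq[OF finite_part]) (simp add: s(2))
    then show ?thesis by blast
  next
    case True
    then obtain x where "x \<in> tr c" "x \<notin> s" using s by blast
    then obtain q where q: "q \<le> n" "A q (c q) \<notin> s" using tr_cases by blast
    have "s \<subseteq> insert Apex (tr c - {A q (c q)})" using s(1) q(2) by blast
    moreover have "card (insert Apex (tr c - {A q (c q)})) = Suc n"
      using q(1) Apex_notin_tr by (simp add: mem_tr)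
    ultimately have "s = insert Apex (tr c - {A q (c q)})" by (intro card_subset_eq) (simp_all add: s(2))
    then show ?thesis using q(1) by auto
  qed
next
  fix s assume "s \<in> insert (tr c) ((\<lambda>q. insert Apex (tr c - {A q (c q)})) ` {..<Suc n})"
  then show "s \<in> {s \<in> bd c. card s = Suc n}"
  proof (rule insertE)
    assume "s = tr c"
    then show ?thesis using Apex_notin_tr[of c] by (auto simp: bd_def)
  next
    assume "s \<in> (\<lambda>q. insert Apex (tr c - {A q (c q)})) ` {..<Suc n}"
    then obtain q where q: "s = insert Apex (tr c - {A q (c q)})" "q \<in> {..<Suc n}" by (rule imageE)
    then have "A q (c q) \<in> tr c" by (simp add: mem_tr)
    moreover from this have "s \<subset> insert Apex (tr c)" unfolding q(1) by blast
    moreover have "card s = Suc n" unfolding q(1) using Apex_notin_tr[of c] \<open>A q (c q) \<in> tr c\<close> by simp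
    ultimately show ?thesis by (simp add: bd_def)
  qed
qed

lemma sum_tops_bd:
  fixes G :: "vertex set \<Rightarrow> nat"
  shows "(\<Sum>s\<in>{s \<in> bd c. card s = Suc n}. G s) = G (tr c) + (\<Sum>q<Suc n. G (insert Apex (tr c - {A q (c q)})))"
proof -
  have "inj_on (\<lambda>q. insert Apex (tr c - {A q (c q)})) {..<Suc n}"
  proof (rule inj_onI)
    fix q q' assume q: "q \<in> {..<Suc n}" "q' \<in> {..<Suc n}" "insert Apex (tr c - {A q (c q)}) = insert Apex (tr c - {A q' (c q')})"
    have "A q (c q) \<notin> insert Apex (tr c - {A q' (c q')})" using q(3) by blast
    then show "q = q'" using q(1) by (auto simp: mem_tr)
  qed
  moreover have "tr c \<notin> (\<lambda>q. insert Apex (tr c - {A q (c q)})) ` {..<Suc n}" using Apex_notin_tr[of c] by blast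
  ultimately show ?thesis unfolding tops_bd by (simp add: sum.reindex del: lessThan_Suc)
qed

lemma tops_away:
  assumes c: "c \<in> choices (Suc n)"
  shows "{s \<in> away c. card s = Suc n} = tr ` {t. (c, t) \<in> opposite (Suc n)}"
proof (intro set_eqI iffI)
  fix s assume "s \<in> {s \<in> away c. card s = Suc n}"
  then have s: "s \<in> \<Sigma>" "s \<inter> insert Apex (tr c) = {}" "card s = Suc n" "s \<in> away c" by (auto simp: away_def)
  have "\<exists>k. A i k \<in> s" if "i \<le> n" for i using top_full[OF s(1,3) _ that] s(2) by blast
  then obtain g where g: "\<And>i. i \<le> n \<Longrightarrow> A i (g i) \<in> s" by metis
  define t where "t = restrict g {..<Suc n}"
  have ti: "t i = g i" if "i \<le> n" for i using that by (simp add: t_def)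
  have sub: "tr t \<subseteq> s"
  proof
    fix v assume "v \<in> tr t"
    then obtain i where "i \<le> n" "v = A i (t i)" using tr_cases by blast
    then show "v \<in> s" using g ti by simp
  qed
  have "tr t = s" by (rule card_subset_eq[OF finite_simplex[OF s(1)] sub]) (simp add: s(3))
  moreover have "(c, t) \<in> opposite (Suc n)"
  proof -
    have gr: "g i \<in> {0,1,2} \<and> c i \<noteq> g i" if "i \<le> n" for i
    proof -
      have "A i (g i) \<notin> tr c" using g[OF that] s(2) by blast
      then have "c i \<noteq> g i" using that by (simp add: mem_tr)
      moreover have "g i \<in> {0,1,2}" using Sigma_vertex[OF s(1) g[OF that]] by auto
      ultimately show ?thesis by blast
    qed
    then have "t \<in> choices (Suc n)" unfolding choices_def t_def by (intro restrict_PiE_iff[THEN iffD2]) auto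
    then show ?thesis unfolding opposite_def using c gr ti by auto
  qed
  ultimately show "s \<in> tr ` {t. (c, t) \<in> opposite (Suc n)}" by blast
next
  fix s assume "s \<in> tr ` {t. (c, t) \<in> opposite (Suc n)}"
  then obtain t where t: "s = tr t" "t \<in> choices (Suc n)" "\<And>j. j < Suc n \<Longrightarrow> c j \<noteq> t j" unfolding opposite_def by blast
  have "tr t \<subset> insert Apex (tr t)" using Apex_notin_tr by blast
  then have "tr t \<in> \<Sigma>" using subcx_bd[OF t(2)] unfolding subcx_def bd_def by blast
  moreover have "tr t \<inter> insert Apex (tr c) = {}"
  proof (rule ccontr)
    assume "\<not> ?thesis"
    then obtain v where v: "v \<in> tr t" "v \<in> tr c" using Apex_notin_tr by blast
    then obtain i where i: "i \<le> n" "v = A i (t i)" using tr_cases by blast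
    then have "t i = c i" using v(2) by (simp add: mem_tr)
    then show False using t(3)[of i] i(1) by simp
  qed
  ultimately show "s \<in> {s \<in> away c. card s = Suc n}" using t(1) by (simp add: away_def)
qed

lemma sum_tops_away:
  fixes G :: "vertex set \<Rightarrow> nat"
  assumes c: "c \<in> choices (Suc n)"
  shows "(\<Sum>s\<in>{s \<in> away c. card s = Suc n}. G s) = (\<Sum>t\<in>{t. (c, t) \<in> opposite (Suc n)}. G (tr t))"
  unfolding tops_away[OF c]
proof (rule sum.reindex_cong[OF _ refl refl])
  show "inj_on tr {t. (c, t) \<in> opposite (Suc n)}"
  proof (rule inj_onI)
    fix t u assume t: "t \<in> {t. (c, t) \<in> opposite (Suc n)}" and u: "u \<in> {t. (c, t) \<in> opposite (Suc n)}" and eq: "tr t = tr u"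
    have "t i = u i" if "i \<in> {..<Suc n}" for i
    proof -
      have "A i (t i) \<in> tr u" using that eq[symmetric] by (simp add: mem_tr)
      then show ?thesis by (simp add: mem_tr)
    qed
    moreover have "t \<in> choices (Suc n)" "u \<in> choices (Suc n)" using t u by (auto simp: opposite_def)
    ultimately show "t = u" unfolding choices_def by (metis PiE_ext)
  qed
qed

end

section \<open>The sum of the linking numbers\<close>

text \<open>The situation of the theorem, with the embedding \<open>f\<close> affine on the simplices of a subdivision \<open>T\<close>.\<close>

locale embedded_realization = realization n K p + emb: refined_embedding T f K
  for n :: nat and K :: "'b::euclidean_space set set" and p :: "vertex \<Rightarrow> 'b"
    and T :: "'b set set" and f :: "'b \<Rightarrow> 'a::euclidean_space" +
  assumes dim: "DIM('a) = 2 * n + 1"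
begin

abbreviation im :: "vertex set set \<Rightarrow> 'a set" where "im S \<equiv> f ` \<Union>(cell ` S)"

lemma cell_K: "s \<in> \<Sigma> \<Longrightarrow> cell s \<in> K" unfolding K_cell by (rule imageI)

lemma cell_T: "s \<in> \<Sigma> \<Longrightarrow> cell s \<subseteq> \<Union>T"
  using emb.refine[OF cell_K] by blast

lemma cells_T: "S \<subseteq> \<Sigma> \<Longrightarrow> \<Union>(cell ` S) \<subseteq> \<Union>T"
  by (rule UN_least, rule cell_T) (rule subsetD)

lemma image_cell_Int:
  assumes "s \<in> \<Sigma>" "t \<in> \<Sigma>" shows "f ` cell s \<inter> f ` cell t = f ` cell (s \<inter> t)"
  using inj_on_image_Int[OF emb.inj cell_T[OF assms(1)] cell_T[OF assms(2)]] cell_Int[OF assms] by simp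

lemma im_disjoint:
  assumes "sph S" "sph S'" "\<Union>S \<inter> \<Union>S' = {}" shows "im S \<inter> im S' = {}"
proof -
  have "\<Union>(cell ` S) \<inter> \<Union>(cell ` S') = {}"
    by (rule iffD2[OF cells_disjoint[OF sphD(1)[OF assms(1)] sphD(1)[OF assms(2)]] assms(3)])
  then show ?thesis
    using inj_on_image_Int[OF emb.inj cells_T[OF sphD(2)[OF assms(1)]] cells_T[OF sphD(2)[OF assms(2)]]] by simp
qed

text \<open>Any triangulation of the image is a triangulation of a topological sphere.\<close>

lemma im_cycle: assumes S: "sph S" shows "cycle_set n (im S)"
  unfolding cycle_set_def
proof (intro conjI allI impI)
  define W where "W = {t \<in> T. \<exists>s\<in>S. t \<subseteq> cell s}"
  have WT: "W \<subseteq> T" by (auto simp: W_def)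
  have "simplicial_complex W" unfolding simplicial_complex_def
  proof (intro conjI allI impI ballI)
    show "finite W" by (rule finite_subset[OF WT simplicial_complexD(1)[OF emb.T]])
    show "\<exists>n. n simplex x" if "x \<in> W" for x using that WT simplicial_complexD(2)[OF emb.T] by blast
    show "F \<in> W" if XF: "X \<in> W \<and> F face_of X" for F X
    proof -
      obtain s where s: "X \<in> T" "s \<in> S" "X \<subseteq> cell s" using XF by (auto simp: W_def)
      have "F \<in> T" by (rule simplicial_complexD(3)[OF emb.T s(1) conjunct2[OF XF]])
      moreover have "F \<subseteq> cell s" using face_of_imp_subset[OF conjunct2[OF XF]] s(3) by (rule order_trans)
      ultimately show ?thesis unfolding W_def using s(2) by blast
    qed
    show "X \<inter> Y face_of X" if XY: "X \<in> W \<and> Y \<in> W" for X Y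
      using complex_Int(2)[OF emb.T] XY WT by blast
  qed
  then have "simplicial_complex ((`) f ` W)" by (rule emb.complex_image[OF WT])
  moreover have "\<Union>((`) f ` W) = im S"
  proof -
    have "\<Union>W = \<Union>(cell ` S)"
    proof
      show "\<Union>W \<subseteq> \<Union>(cell ` S)" unfolding W_def by blast
      show "\<Union>(cell ` S) \<subseteq> \<Union>W"
      proof (rule UN_least)
        fix s assume s: "s \<in> S"
        have "cell s = \<Union>{t \<in> T. t \<subseteq> cell s}"
          using emb.refine[OF cell_K[OF subsetD[OF sphD(2)[OF S] s]]] by simp
        also have "\<dots> \<subseteq> \<Union>W" unfolding W_def using s by blast
        finally show "cell s \<subseteq> \<Union>W" .
      qed
    qed
    then show ?thesis by (metis image_Union)
  qed
  ultimately show "\<exists>T. simplicial_complex T \<and> \<Union>T = im S" by blast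
next
  obtain \<Delta> :: "'b set" where st: "sphere_triangulation (cell ` S) \<Delta> n" using sph_triangulation[OF S] .
  have cpt: "compact (\<Union>(cell ` S))" by (rule compact_complex[OF subcx_complex[OF sphD(1)[OF S]]])
  have "pl_map_on (\<Union>T) f" unfolding pl_map_on_def using emb.T emb.aff by blast
  then have cont: "continuous_on (\<Union>(cell ` S)) f"
    by (rule continuous_on_subset[OF pl_map_continuous cells_T[OF sphD(2)[OF S]]])
  have "\<Union>(cell ` S) homeomorphic im S"
    by (rule homeomorphic_compact[OF cpt cont refl inj_on_subset[OF emb.inj cells_T[OF sphD(2)[OF S]]]])
  then have hom: "im S homeomorphic rel_frontier \<Delta>"
    using homeomorphic_trans homeomorphic_sym sphere_triangulation.hom[OF st] by blast
  fix T' :: "'a set set" assume T': "simplicial_complex T'" "\<Union>T' = im S"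
  have st': "sphere_triangulation T' \<Delta> n"
    by (rule sphere_triangulation.intro[OF T'(1) hom[folded T'(2)] sphere_triangulation.\<Delta>[OF st]])
  show "\<forall>t\<in>T'. aff_dim t \<le> int n" by (rule ballI) (rule sphere_triangulation.dim_le[OF st'])
  show "bdry (top_cells n T') = {}" by (rule sphere_triangulation.bdry_empty[OF st'])
qed

lemma im_ne: assumes "sph S" shows "im S \<noteq> {}"
proof -
  obtain \<Delta> :: "'b set" where "sphere_triangulation (cell ` S) \<Delta> n" using sph_triangulation[OF assms] .
  from sphere_triangulation.Union_ne[OF this] show ?thesis by simp
qed

text \<open>The symmetry of \<open>lk2\<close> makes the value independent of the order of the components.\<close>

lemma lk2_link_crossings:
  assumes S: "sph S" "sph S'" "\<Union>S \<inter> \<Union>S' = {}"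
  obtains \<R> where "finite \<R>" "\<And>Q. Q \<in> \<R> \<Longrightarrow> admissible Q"
    "\<And>l. generic l \<R> \<Longrightarrow> lk2_link n {im S, im S'} = over l (2 * n) (im S) (im S') mod 2"
proof -
  note disj = im_disjoint[OF S]
  have disj': "im S' \<inter> im S = {}" using disj by (simp only: Int_commute)
  obtain \<R> where R: "finite \<R>" "\<And>Q. Q \<in> \<R> \<Longrightarrow> admissible Q"
      "\<And>l. generic l \<R> \<Longrightarrow> lk2 n (im S) (im S') = over l (2 * n) (im S) (im S') mod 2"
      "\<And>l. generic l \<R> \<Longrightarrow> even (over l (2 * n) (im S) (im S') + over l (2 * n) (im S') (im S))"
    using lk2_crossings[OF dim n im_cycle[OF S(1)] im_cycle[OF S(2)] disj] by metis
  obtain \<R>' where R': "finite \<R>'" "\<And>Q. Q \<in> \<R>' \<Longrightarrow> admissible Q"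
      "\<And>l. generic l \<R>' \<Longrightarrow> lk2 n (im S') (im S) = over l (2 * n) (im S') (im S) mod 2"
    using lk2_crossings[OF dim n im_cycle[OF S(2)] im_cycle[OF S(1)] disj'] by metis
  obtain l where l: "generic l (\<R> \<union> \<R>')"
    by (rule generic_exists[of "\<R> \<union> \<R>'"]) (use R(1,2) R'(1,2) in auto)
  then have l': "generic l \<R>" "generic l \<R>'" by (simp_all add: generic_Un)
  have sym: "lk2 n (im S') (im S) = lk2 n (im S) (im S')"
    unfolding R(3)[OF l'(1)] R'(3)[OF l'(2)] by (rule iffD1[OF even_add_mod2 R(4)[OF l'(1)], symmetric])
  have ne: "im S \<noteq> im S'" using disj im_ne[OF S(1)] by auto
  have "lk2_link n {im S, im S'} = lk2 n (im S) (im S')"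
    unfolding lk2_link_def
  proof (rule the_equality)
    show "\<exists>X Y. {im S, im S'} = {X, Y} \<and> X \<noteq> Y \<and> lk2 n (im S) (im S') = lk2 n X Y"
      using ne by (intro exI[of _ "im S"] exI[of _ "im S'"] conjI refl)
    fix r assume "\<exists>X Y. {im S, im S'} = {X, Y} \<and> X \<noteq> Y \<and> r = lk2 n X Y"
    then obtain X Y where XY: "{im S, im S'} = {X, Y}" "r = lk2 n X Y" by (elim exE conjE)
    from XY(1) have "im S = X \<and> im S' = Y \<or> im S = Y \<and> im S' = X" by (rule iffD1[OF doubleton_eq_iff])
    then show "r = lk2 n (im S) (im S')" using XY(2) sym by auto
  qed
  then have res: "lk2_link n {im S, im S'} = over l (2 * n) (im S) (im S') mod 2" if "generic l \<R>" for l
    unfolding R(3)[OF that, symmetric] .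
  show thesis by (rule that[OF R(1,2) res])
qed

lemma no_crossing_cells:
  assumes gen: "generic l emb.\<Q>" and st: "s \<in> \<Sigma>" "t \<in> \<Sigma>" "s \<inter> t = {}"
    and d: "card s + card t < k + 2" and k: "k \<le> 2 * n"
  shows "f ` cell s \<times> f ` cell t \<inter> fib l k = {}"
proof (rule emb.no_crossing[OF gen cell_K[OF st(1)] cell_K[OF st(2)]])
  show "cell s \<inter> cell t = {}" using cell_Int[OF st(1,2)] st(3) by simp
  show "aff_dim (cell s) + aff_dim (cell t) < int k" using aff_dim_cell st d by simp
  show "k \<le> DIM('a)" using k dim by simp
qed

text \<open>Crossings occur only in the interior of \<open>n\<close>-simplices, because \<open>f(s) \<times> f(t)\<close> misses the fibre if the total
dimension of \<open>s\<close> and \<open>t\<close> is smaller than \<open>2n\<close>.\<close>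

lemma over_spheres:
  assumes gen: "generic l emb.\<Q>" and S: "sph S" "sph S'" and disj: "\<Union>S \<inter> \<Union>S' = {}"
  shows "over l (2 * n) (im S) (im S') =
    (\<Sum>s\<in>{s \<in> S. card s = Suc n}. \<Sum>t\<in>{t \<in> S'. card t = Suc n}. over l (2 * n) (f ` cell s) (f ` cell t))"
proof -
  let ?A = "{s \<in> S. card s = Suc n}" and ?B = "{t \<in> S'. card t = Suc n}"
  let ?Z = "\<lambda>s t. {z \<in> f ` cell s \<times> f ` cell t \<inter> fib l (2 * n). 0 < ht l (2 * n) z}"
  have cover: "im R = (\<Union>s\<in>{s \<in> R. card s = Suc n}. f ` cell s)" if R: "sph R" for R
  proof
    show "im R \<subseteq> (\<Union>s\<in>{s \<in> R. card s = Suc n}. f ` cell s)"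
    proof
      fix y assume "y \<in> im R"
      then obtain s where s: "s \<in> R" "y \<in> f ` cell s" by blast
      obtain t where t: "t \<in> R" "s \<subseteq> t" "card t = Suc n" using sph_pure[OF R s(1)] by blast
      have "y \<in> f ` cell t" using s(2) image_mono[OF cell_mono[OF t(2)]] by (rule rev_subsetD)
      then show "y \<in> (\<Union>s\<in>{s \<in> R. card s = Suc n}. f ` cell s)" using t by blast
    qed
  qed blast
  have mem: "s \<in> \<Sigma>" "card s = Suc n" "s \<in> S" if "s \<in> ?A" for s using that sphD(2)[OF S(1)] by auto
  have mem': "s \<in> \<Sigma>" "card s = Suc n" "s \<in> S'" if "s \<in> ?B" for s using that sphD(2)[OF S(2)] by auto
  have "finite \<Sigma>" by (rule finite_subset[of _ "Pow (\<Union>\<Sigma>)"]) (use finite_VV in auto)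
  then have fin: "finite {s \<in> R. card s = Suc n}" if "sph R" for R
    by (rule rev_finite_subset) (use sphD(2)[OF that] in blast)
  have less: "card (s \<inter> s') < Suc n" if "s \<in> \<Sigma>" "s' \<in> \<Sigma>" "card s = Suc n" "card s' = Suc n" "s \<noteq> s'" for s s'
  proof -
    have "s \<inter> s' \<subset> s" using top_eq[OF that(1,2) _ that(3,4)] that(5) by blast
    then show ?thesis using psubset_card_mono[OF finite_simplex[OF that(1)]] that(3) by simp
  qed
  have dj: "s \<inter> t = {}" if "s \<in> S" "t \<in> S'" for s t using disj that by blast
  have apart: "?Z s t \<inter> ?Z s' t' = {}" if st: "s \<in> ?A" "t \<in> ?B" "s' \<in> ?A" "t' \<in> ?B" "(s, t) \<noteq> (s', t')" for s t s' t'
  proof (rule ccontr)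
    assume "\<not> ?thesis"
    then obtain z where z: "fst z \<in> f ` cell s" "fst z \<in> f ` cell s'" "snd z \<in> f ` cell t" "snd z \<in> f ` cell t'"
      "z \<in> fib l (2 * n)" by (auto simp: mem_Times_iff)
    have z1: "fst z \<in> f ` cell (s \<inter> s')" using image_cell_Int[OF mem(1)[OF st(1)] mem(1)[OF st(3)]] z by blast
    have z2: "snd z \<in> f ` cell (t \<inter> t')" using image_cell_Int[OF mem'(1)[OF st(2)] mem'(1)[OF st(4)]] z by blast
    consider "s \<noteq> s'" | "t \<noteq> t'" using st(5) by auto
    then show False
    proof cases
      case 1
      have "f ` cell (s \<inter> s') \<times> f ` cell t \<inter> fib l (2 * n) = {}"
      proof (rule no_crossing_cells[OF gen down[OF mem(1)[OF st(1)] Int_lower1] mem'(1)[OF st(2)]])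
        show "s \<inter> s' \<inter> t = {}" using dj[OF mem(3)[OF st(1)] mem'(3)[OF st(2)]] by blast
        show "card (s \<inter> s') + card t < 2 * n + 2"
          using less[OF mem(1)[OF st(1)] mem(1)[OF st(3)] mem(2)[OF st(1)] mem(2)[OF st(3)] 1] mem'(2)[OF st(2)] by simp
      qed simp
      moreover have "z \<in> f ` cell (s \<inter> s') \<times> f ` cell t \<inter> fib l (2 * n)" using z1 z(3,5) by (simp only: mem_Times_iff Int_iff simp_thms)
      ultimately show False by blast
    next
      case 2
      have "f ` cell s \<times> f ` cell (t \<inter> t') \<inter> fib l (2 * n) = {}"
      proof (rule no_crossing_cells[OF gen mem(1)[OF st(1)] down[OF mem'(1)[OF st(2)] Int_lower1]])
        show "s \<inter> (t \<inter> t') = {}" using dj[OF mem(3)[OF st(1)] mem'(3)[OF st(2)]] by blast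
        show "card s + card (t \<inter> t') < 2 * n + 2"
          using less[OF mem'(1)[OF st(2)] mem'(1)[OF st(4)] mem'(2)[OF st(2)] mem'(2)[OF st(4)] 2] mem(2)[OF st(1)] by simp
      qed simp
      moreover have "z \<in> f ` cell s \<times> f ` cell (t \<inter> t') \<inter> fib l (2 * n)" using z2 z(1,5) by (simp only: mem_Times_iff Int_iff simp_thms)
      ultimately show False by blast
    qed
  qed
  have finZ: "finite (?Z s t)" if "s \<in> ?A" "t \<in> ?B" for s t
  proof -
    have "finite (f ` cell s \<times> f ` cell t \<inter> fib l (2 * n))"
    proof (rule emb.img_counts(1)[OF gen cell_K[OF mem(1)[OF that(1)]] cell_K[OF mem'(1)[OF that(2)]]])
      show "cell s \<inter> cell t = {}"
        using cell_Int[OF mem(1)[OF that(1)] mem'(1)[OF that(2)]] dj[OF mem(3)[OF that(1)] mem'(3)[OF that(2)]] by simp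
      show "aff_dim (cell s) + aff_dim (cell t) = int (2 * n)"
        using aff_dim_cell[OF mem(1)[OF that(1)]] aff_dim_cell[OF mem'(1)[OF that(2)]] mem(2)[OF that(1)] mem'(2)[OF that(2)] by simp
    qed (simp add: dim)
    then show ?thesis by (rule rev_finite_subset) blast
  qed
  have "{z \<in> im S \<times> im S' \<inter> fib l (2 * n). 0 < ht l (2 * n) z} = (\<Union>x\<in>?A \<times> ?B. ?Z (fst x) (snd x))"
    unfolding cover[OF S(1)] cover[OF S(2)] by (auto simp: mem_Times_iff)
  then have "over l (2 * n) (im S) (im S') = card (\<Union>x\<in>?A \<times> ?B. ?Z (fst x) (snd x))" unfolding over_def by simp
  also have "\<dots> = (\<Sum>x\<in>?A \<times> ?B. card (?Z (fst x) (snd x)))"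
  proof (rule card_UN_disjoint)
    show "finite (?A \<times> ?B)" by (rule finite_cartesian_product[OF fin[OF S(1)] fin[OF S(2)]])
    show "\<forall>x\<in>?A \<times> ?B. finite (?Z (fst x) (snd x))" using finZ by (intro ballI) (simp only: mem_Times_iff)
    show "\<forall>x\<in>?A \<times> ?B. \<forall>y\<in>?A \<times> ?B. x \<noteq> y \<longrightarrow> ?Z (fst x) (snd x) \<inter> ?Z (fst y) (snd y) = {}"
    proof (intro ballI impI)
      fix x y assume xy: "x \<in> ?A \<times> ?B" "y \<in> ?A \<times> ?B" "x \<noteq> y"
      show "?Z (fst x) (snd x) \<inter> ?Z (fst y) (snd y) = {}"
      proof (rule apart)
        show "(fst x, snd x) \<noteq> (fst y, snd y)" using xy(3) by simp
      qed (use xy in \<open>simp_all only: mem_Times_iff\<close>)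
    qed
  qed
  also have "\<dots> = (\<Sum>s\<in>?A. \<Sum>t\<in>?B. over l (2 * n) (f ` cell s) (f ` cell t))"
    unfolding over_def sum.cartesian_product by (simp only: case_prod_unfold)
  finally show ?thesis .
qed

text \<open>The removal of the only vertex of a point gives the empty set, which is no facet; the assumption
\<open>G {} = 0\<close> makes its term vanish.\<close>

lemma sum_facets_cell:
  fixes G :: "'b set \<Rightarrow> nat"
  assumes s: "s \<in> \<Sigma>" "s \<noteq> {}" and G: "G {} = 0"
  shows "(\<Sum>r | r facet_of cell s. G r) = (\<Sum>v\<in>s. G (cell (s - {v})))"
proof (cases "2 \<le> card s")
  case True
  then have "{r. r facet_of cell s} = (\<lambda>v. cell (s - {v})) ` s" using facet_of_cell[OF s(1)] by auto
  moreover have "inj_on (\<lambda>v. cell (s - {v})) s"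
  proof (rule inj_onI)
    fix v w assume vw: "v \<in> s" "w \<in> s" "cell (s - {v}) = cell (s - {w})"
    have "s - {v} = s - {w}" by (rule cell_inj[OF down[OF s(1) Diff_subset] down[OF s(1) Diff_subset] vw(3)])
    then show "v = w" using vw(1,2) by blast
  qed
  ultimately show ?thesis by (simp add: sum.reindex)
next
  case False
  have "card s \<noteq> 0" using s(2) finite_simplex[OF s(1)] by simp
  then have "card s = 1" using False by simp
  then obtain v where "s = {v}" by (rule card_1_singletonE)
  moreover have "{r. r facet_of cell s} = {}" using facet_of_cell[OF s(1)] False by auto
  ultimately show ?thesis using G by simp
qed

lemma cochains:
  assumes gen: "generic l emb.\<Q>"
  shows "crossing_cochains n (\<lambda>k s t. over l k (f ` cell s) (f ` cell t)) (\<lambda>k s t. meet l k (f ` cell s) (f ` cell t))"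
proof
  fix v w
  have "cell {v} = {p v}" "cell {w} = {p w}" by (simp_all add: cell_def)
  moreover have "{z \<in> {f (p v)} \<times> {f (p w)} \<inter> fib l 0. True} = {(f (p v), f (p w))}" by auto
  ultimately show "odd (meet l 0 (f ` cell {v}) (f ` cell {w}))" unfolding meet_def by simp
next
  fix k s t
  assume st: "s \<in> \<Sigma>" "t \<in> \<Sigma>" "s \<inter> t = {}" "s \<noteq> {}" "t \<noteq> {}" and c: "card s + card t = k + 2" and k: "k \<le> 2 * n"
  have "over l k (f ` cell s) (f ` cell t) + over l k (f ` cell t) (f ` cell s) = meet l k (f ` cell s) (f ` cell t)"
  proof (rule emb.over_add_swap_cells[OF gen cell_K[OF st(1)] cell_K[OF st(2)]])
    show "cell s \<inter> cell t = {}" using cell_Int[OF st(1,2)] st(3) by simp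
    show "aff_dim (cell s) + aff_dim (cell t) = int k" using aff_dim_cell st(1,2) c by simp
    show "k < DIM('a)" using k dim by simp
  qed
  then show "even (over l k (f ` cell s) (f ` cell t) + over l k (f ` cell t) (f ` cell s) + meet l k (f ` cell s) (f ` cell t))"
    by simp
next
  fix k s t
  assume st: "s \<in> \<Sigma>" "t \<in> \<Sigma>" "s \<inter> t = {}" "s \<noteq> {}" "t \<noteq> {}" and c: "card s + card t = k + 3" and k: "k \<le> 2 * n"
  have s: "(\<Sum>r | r facet_of cell s. over l k (f ` r) (f ` cell t)) = (\<Sum>v\<in>s. over l k (f ` cell (s - {v})) (f ` cell t))"
    by (rule sum_facets_cell[OF st(1,4)]) (simp add: over_def)
  have t: "(\<Sum>r | r facet_of cell t. over l k (f ` cell s) (f ` r)) = (\<Sum>v\<in>t. over l k (f ` cell s) (f ` cell (t - {v})))"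
    by (rule sum_facets_cell[OF st(2,5)]) (simp add: over_def)
  show "even (meet l (Suc k) (f ` cell s) (f ` cell t) + ((\<Sum>v\<in>s. over l k (f ` cell (s - {v})) (f ` cell t)) +
      (\<Sum>v\<in>t. over l k (f ` cell s) (f ` cell (t - {v})))))"
    unfolding s[symmetric] t[symmetric]
  proof (rule emb.meet_boundary[OF gen cell_K[OF st(1)] cell_K[OF st(2)]])
    show "cell s \<inter> cell t = {}" using cell_Int[OF st(1,2)] st(3) by simp
    show "cell s \<noteq> {}" "cell t \<noteq> {}" using st(4,5) by (simp_all add: cell_eq_empty)
    show "aff_dim (cell s) + aff_dim (cell t) = int k + 1" using aff_dim_cell st(1,2) c by simp
    show "k < DIM('a)" using k dim by simp
  qed
qed

text \<open>For a family of forms that is generic for all pairs at once, each linking number is a sum of crossing numbers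
of simplices. The \<open>n\<close>-simplices of \<open>bd c\<close> are the simplex of type I given by \<open>c\<close> and the \<open>n+1\<close> simplices of
type II obtained from it by replacing one vertex with \<open>b\<close>; those of \<open>away c\<close> are the simplices of
type I disjoint from \<open>c\<close>.\<close>

theorem odd_linking: "odd (\<Sum>L\<in>Lambda n K. lk2_link n (image_link f L))"
proof -
  let ?C = "choices (Suc n)" and ?N = "2 * n"
  let ?lk = "\<lambda>c. lk2_link n {im (bd c), im (away c)}"
  have "\<exists>\<R>. finite \<R> \<and> (\<forall>Q\<in>\<R>. admissible Q) \<and>
      (\<forall>l. generic l \<R> \<longrightarrow> ?lk c = over l ?N (im (bd c)) (im (away c)) mod 2)" if "c \<in> ?C" for c
    using lk2_link_crossings[OF sph_bd[OF that] sph_away[OF that] bd_away_disjoint] by metis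
  then obtain R where R: "\<And>c. c \<in> ?C \<Longrightarrow> finite (R c)" "\<And>c Q. c \<in> ?C \<Longrightarrow> Q \<in> R c \<Longrightarrow> admissible Q"
      "\<And>c l. c \<in> ?C \<Longrightarrow> generic l (R c) \<Longrightarrow> ?lk c = over l ?N (im (bd c)) (im (away c)) mod 2"
    by metis
  obtain l where l: "generic l (emb.\<Q> \<union> (\<Union>c\<in>?C. R c))"
  proof (rule generic_exists)
    show "finite (emb.\<Q> \<union> (\<Union>c\<in>?C. R c))"
      using emb.finite_\<Q> finite_choices R(1) by (intro finite_UnI finite_UN_I)
    show "admissible Q" if "Q \<in> emb.\<Q> \<union> (\<Union>c\<in>?C. R c)" for Q
      using that emb.admissible_\<Q> R(2) by blast
  qed
  have gen: "generic l emb.\<Q>" using l by (simp add: generic_Un)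
  have genR: "generic l (R c)" if "c \<in> ?C" for c using l that unfolding generic_def by blast
  let ?o = "\<lambda>s t. over l ?N (f ` cell s) (f ` cell t)"
  let ?H = "\<lambda>c t. ?o (tr c) (tr t) + (\<Sum>q<Suc n. ?o (insert Apex (tr c - {A q (c q)})) (tr t))"
  let ?O = "\<lambda>c. {t. (c, t) \<in> opposite (Suc n)}"
  have count: "over l ?N (im (bd c)) (im (away c)) = (\<Sum>t\<in>?O c. ?H c t)" if c: "c \<in> ?C" for c
    unfolding over_spheres[OF gen sph_bd[OF c] sph_away[OF c] bd_away_disjoint] sum_tops_away[OF c] sum_tops_bd
      sum.distrib by (simp only: sum.swap[of _ _ "{..<Suc n}"])
  have "(\<Sum>L\<in>Lambda n K. lk2_link n (image_link f L)) = (\<Sum>c\<in>?C. ?lk c)"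
    unfolding Lambda_eq sum.reindex[OF inj_pair] by (simp add: image_link_def pair_def)
  also have "\<dots> = (\<Sum>c\<in>?C. (\<Sum>t\<in>?O c. ?H c t) mod 2)"
    by (rule sum.cong[OF refl]) (simp only: R(3)[OF _ genR] count)
  finally have "(\<Sum>L\<in>Lambda n K. lk2_link n (image_link f L)) mod 2 = (\<Sum>c\<in>?C. \<Sum>t\<in>?O c. ?H c t) mod 2"
    by (simp only: mod_sum_eq)
  also have "(\<Sum>c\<in>?C. \<Sum>t\<in>?O c. ?H c t) = (\<Sum>(c, t)\<in>(SIGMA c:?C. ?O c). ?H c t)"
  proof (rule sum.Sigma[OF finite_choices], rule ballI)
    fix c show "finite (?O c)"
      by (rule finite_subset[OF _ finite_choices[of "Suc n"]]) (auto simp: opposite_def)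
  qed
  also have "(SIGMA c:?C. ?O c) = opposite (Suc n)" by (auto simp: opposite_def)
  also have "(\<Sum>(c, t)\<in>opposite (Suc n). ?H c t) mod 2 = 1"
    using crossing_cochains.odd_total[OF cochains[OF gen]] by (simp only: odd_iff_mod_2_eq_one)
  finally show ?thesis by (simp only: odd_iff_mod_2_eq_one)
qed

end

theorem theorem1p3:
  fixes n :: nat
    and K :: "'b::euclidean_space set set"
    and f :: "'b \<Rightarrow> 'a::euclidean_space"
  assumes "n \<ge> 1"
    and "DIM('a) = 2 * n + 1"
    and "realizes K (K_complex n)"
    and "pl_embedding (\<Union>K) f"
  shows "[(\<Sum>l\<in>Lambda n K. lk2_link n (image_link f l)) = 1] (mod 2)"
proof -
  have K: "simplicial_complex K" using assms(3) unfolding realizes_def by (rule conjunct1)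
  obtain p where p: "inj_on p (\<Union>(K_complex n))" "\<forall>s\<in>K_complex n. \<not> affine_dependent (p ` s)"
      "K = (\<lambda>s. convex hull (p ` s)) ` K_complex n"
    using assms(3) unfolding realizes_def by (elim exE conjE)
  have f: "pl_map_on (\<Union>K) f" "inj_on f (\<Union>K)" using assms(4) unfolding pl_embedding_def by (rule conjunct1, rule conjunct2)
  obtain T where T: "simplicial_complex T" "\<Union>T = \<Union>K" "\<And>t. t \<in> T \<Longrightarrow> affine_map_on t f"
      "\<And>s. s \<in> K \<Longrightarrow> \<Union>{t \<in> T. t \<subseteq> s} = s"
    by (rule common_refinement[OF K f(1)]) (rule that)
  interpret embedded_realization n K p T f
  proof unfold_locales
    show "inj_on f (\<Union>T)" using f(2) T(2) by simp
    show "\<not> affine_dependent (p ` s)" if "s \<in> K_complex n" for s using p(2) that by blast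
  qed (fact assms K p T)+
  show ?thesis using odd_linking by (simp add: cong_def odd_iff_mod_2_eq_one)
qed

end
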